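(* Let $p>1$, $s\in(0,1)$, $N>p$, $m\in[0,p-1)$, $\lambda>0$, and, if $m>0$, let $\delta\in(0,m)$ and $\gamma\in\mathbb R$ with $\gamma<\frac12$. Let $g_0\in L^r(\Omega)$, with $r\ge2$, be a nonnegative function satisfying $g_0(x)\ge\lambda\underline g(x)$ for a.e. $x\in\Omega$, where $\underline g\in L^\infty(\Omega)$ is nonnegative and nontrivial. Suppose that $\underline u,\overline u\in W^{1,p}_0(\Omega)\cap L^{2(m+1)}(\Omega)$ are nonnegative functions that are, respectively, a weak sub-solution and a weak super-solution of problem $(S_\lambda)$ (see context). Then $\underline u\le\overline u$ a.e. in $\Omega$.
   Context: $\Omega\subset\mathbb R^N$ is a bounded domain with smooth boundary, $d(x)=\operatorname{dist}(x,\partial\Omega)$; $[a]^{p-1}:=|a|^{p-2}a$; $\Delta_p u=\operatorname{div}(|\nabla u|^{p-2}\nabla u)$, $(-\Delta)^s_pu(x)=2\,\mathrm{P.V.}\int_{\mathbb R^N}\frac{[u(x)-u(y)]^{p-1}}{|x-y|^{N+sp}}dy$. Functions in $W^{1,p}_0(\Omega)$ are extended by zero to $\mathbb R^N$. Let $\mathbf{WL}:=W^{1,p}_0(\Omega)\cap L^{2(m+1)}(\Omega)$. Problem $(S_\lambda)$: $u^{2m+1}-\lambda\Delta_pu+\lambda(-\Delta)^s_pu=g_0(x)u^m+\lambda m\,d(x)^{-\gamma}u^\delta$ in $\Omega$, $u>0$ in $\Omega$, $u=0$ in $\mathbb R^N\setminus\Omega$ (the term with factor $m$ is absent if $m=0$).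 A function $u\in\mathbf{WL}$, $u\ge0$, $u\not\equiv0$, is a weak sub-solution (resp. super-solution) of $(S_\lambda)$ if for all nonnegative $\varphi\in\mathbf{WL}$ $$\int_\Omega u^{2m+1}\varphi\,dx+\lambda\int_\Omega|\nabla u|^{p-2}\nabla u\cdot\nabla\varphi\,dx+\lambda\iint_{\mathbb R^{2N}}\frac{[u(x)-u(y)]^{p-1}(\varphi(x)-\varphi(y))}{|x-y|^{N+sp}}dxdy\ \le\ (\text{resp. }\ge)\ \int_\Omega\big(g_0u^m+\lambda m\,d(x)^{-\gamma}u^\delta\big)\varphi\,dx .$$ *)

theory Defs
  imports "HOL-Analysis.Analysis"
begin

section \<open>Smooth functions and smooth domains\<close>

primrec C_k :: "nat \<Rightarrow> ('a::euclidean_space \<Rightarrow> real) \<Rightarrow> bool" where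
  "C_k 0 f \<longleftrightarrow> continuous_on UNIV f"
| "C_k (Suc k) f \<longleftrightarrow> f differentiable_on UNIV \<and>
     (\<forall>i\<in>Basis. C_k k (\<lambda>x. frechet_derivative f (at x) i))"

definition smooth :: "('a::euclidean_space \<Rightarrow> real) \<Rightarrow> bool" where
  "smooth f \<longleftrightarrow> (\<forall>k. C_k k f)"

definition grad :: "('a::euclidean_space \<Rightarrow> real) \<Rightarrow> 'a \<Rightarrow> 'a" where
  "grad f x = (\<Sum>i\<in>Basis. frechet_derivative f (at x) i *\<^sub>R i)"

definition Cc_inf :: "'a::euclidean_space set \<Rightarrow> ('a \<Rightarrow> real) set" where
  "Cc_inf \<Omega> = {\<phi>. smooth \<phi> \<and> compact (closure {x. \<phi> x \<noteq> 0}) \<and> closure {x. \<phi> x \<noteq> 0} \<subseteq> \<Omega>}"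

text \<open>
  Near each boundary point the domain is, in suitably rotated coordinates, the region strictly
  above the graph of a smooth function of the other $N-1$ coordinates. The rotation is encoded by
  the direction \<open>\<nu>\<close> of the last axis, so that \<open>x - (x \<bullet> \<nu>) *\<^sub>R \<nu>\<close> collects the remaining
  coordinates; the values of \<open>h\<close> off the hyperplane orthogonal to \<open>\<nu>\<close> play no role.
\<close>

definition smooth_boundary :: "'a::euclidean_space set \<Rightarrow> bool" where
  "smooth_boundary \<Omega> \<longleftrightarrow>
     (\<forall>x0\<in>frontier \<Omega>. \<exists>r>0. \<exists>\<nu> h. norm \<nu> = 1 \<and> smooth h \<and>
        \<Omega> \<inter> ball x0 r = {x \<in> ball x0 r. x \<bullet> \<nu> > h (x - (x \<bullet> \<nu>) *\<^sub>R \<nu>)})"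

definition bounded_smooth_domain :: "'a::euclidean_space set \<Rightarrow> bool" where
  "bounded_smooth_domain \<Omega> \<longleftrightarrow>
     open \<Omega> \<and> connected \<Omega> \<and> \<Omega> \<noteq> {} \<and> bounded \<Omega> \<and> smooth_boundary \<Omega>"


section \<open>Lebesgue and Sobolev spaces\<close>

text \<open>The spaces consist of functions rather than classes modulo equality almost everywhere.\<close>

definition Lq :: "'a::euclidean_space set \<Rightarrow> real \<Rightarrow> ('a \<Rightarrow> 'b::euclidean_space) set" where
  "Lq \<Omega> q = {f. f \<in> borel_measurable (lebesgue_on \<Omega>) \<and>
                integrable (lebesgue_on \<Omega>) (\<lambda>x. norm (f x) powr q)}"

definition Linf :: "'a::euclidean_space set \<Rightarrow> ('a \<Rightarrow> real) set" where
  "Linf \<Omega> = {f. f \<in> borel_measurable (lebesgue_on \<Omega>) \<and>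
                (\<exists>C. AE x in lebesgue_on \<Omega>. \<bar>f x\<bar> \<le> C)}"

definition L1_loc :: "'a::euclidean_space set \<Rightarrow> ('a \<Rightarrow> 'b::euclidean_space) set" where
  "L1_loc \<Omega> = {f. \<forall>K. compact K \<and> K \<subseteq> \<Omega> \<longrightarrow> integrable (lebesgue_on K) f}"

definition has_weak_grad ::
  "'a::euclidean_space set \<Rightarrow> ('a \<Rightarrow> real) \<Rightarrow> ('a \<Rightarrow> 'a) \<Rightarrow> bool" where
  "has_weak_grad \<Omega> u G \<longleftrightarrow> u \<in> L1_loc \<Omega> \<and> G \<in> L1_loc \<Omega> \<and>
     (\<forall>\<phi>\<in>Cc_inf \<Omega>. \<forall>i\<in>Basis.
        (LINT x|lebesgue_on \<Omega>. u x * (grad \<phi> x \<bullet> i)) =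
        - (LINT x|lebesgue_on \<Omega>. (G x \<bullet> i) * \<phi> x))"

text \<open>The weak gradient is unique up to equality almost everywhere; one representative is chosen.\<close>

definition weak_grad :: "'a::euclidean_space set \<Rightarrow> ('a \<Rightarrow> real) \<Rightarrow> 'a \<Rightarrow> 'a" where
  "weak_grad \<Omega> u = (SOME G. has_weak_grad \<Omega> u G)"

definition W1p :: "'a::euclidean_space set \<Rightarrow> real \<Rightarrow> ('a \<Rightarrow> real) set" where
  "W1p \<Omega> p = {u. u \<in> Lq \<Omega> p \<and> (\<exists>G. has_weak_grad \<Omega> u G) \<and> weak_grad \<Omega> u \<in> Lq \<Omega> p}"

text \<open>
  The closure of \<open>Cc_inf \<Omega>\<close> in \<open>W1p \<Omega> p\<close>, where the members are already extended by zero to the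
  whole space.
\<close>

definition W1p_0 :: "'a::euclidean_space set \<Rightarrow> real \<Rightarrow> ('a \<Rightarrow> real) set" where
  "W1p_0 \<Omega> p = {u \<in> W1p \<Omega> p. (\<forall>x. x \<notin> \<Omega> \<longrightarrow> u x = 0) \<and>
     (\<exists>\<phi>. (\<forall>k::nat. \<phi> k \<in> Cc_inf \<Omega>) \<and>
        (\<lambda>k. LINT x|lebesgue_on \<Omega>. \<bar>u x - \<phi> k x\<bar> powr p) \<longlonglongrightarrow> 0 \<and>
        (\<lambda>k. LINT x|lebesgue_on \<Omega>. norm (weak_grad \<Omega> u x - grad (\<phi> k) x) powr p) \<longlonglongrightarrow> 0)}"

definition WL :: "'a::euclidean_space set \<Rightarrow> real \<Rightarrow> real \<Rightarrow> ('a \<Rightarrow> real) set" where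
  "WL \<Omega> p m = W1p_0 \<Omega> p \<inter> Lq \<Omega> (2 * (m + 1))"


section \<open>Weak sub- and super-solutions\<close>

text \<open>The library has \<open>0 powr 0 = 0\<close>, whereas $u^m$ has to be $1$ for $m = 0$, even where $u = 0$.\<close>

definition rpow :: "real \<Rightarrow> real \<Rightarrow> real" where
  "rpow x a = (if a = 0 then 1 else x powr a)"

text \<open>\<open>signed_pow a q\<close> is $[a]^q = |a|^{q-1} a$.\<close>

definition signed_pow :: "real \<Rightarrow> real \<Rightarrow> real" where
  "signed_pow a q = \<bar>a\<bar> powr (q - 1) * a"

text \<open>
  For \<open>u\<close>, \<open>\<phi>\<close> in \<open>WL\<close>, \<open>g0\<close> in $L^r$ with $r \ge 2$, $\delta < m$ and $\gamma < 1/2$ all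
  the integrands below are integrable, so the default value \<open>0\<close> of the Bochner integral does not
  interfere. The double integral is taken over $\mathbb{R}^{2N}$, that is, the type
  \<open>'a \<times> 'a\<close>.
\<close>

definition weak_lhs ::
  "'a::euclidean_space set \<Rightarrow> real \<Rightarrow> real \<Rightarrow> real \<Rightarrow> real \<Rightarrow> ('a \<Rightarrow> real) \<Rightarrow> ('a \<Rightarrow> real) \<Rightarrow> real" where
  "weak_lhs \<Omega> p s m lam u \<phi> =
     (LINT x|lebesgue_on \<Omega>. u x powr (2 * m + 1) * \<phi> x)
     + lam * (LINT x|lebesgue_on \<Omega>.
         (norm (weak_grad \<Omega> u x) powr (p - 2) *\<^sub>R weak_grad \<Omega> u x) \<bullet> weak_grad \<Omega> \<phi> x)
     + lam * (LINT z|(lebesgue :: ('a \<times> 'a) measure). (case z of (x, y) \<Rightarrow>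
         signed_pow (u x - u y) (p - 1) * (\<phi> x - \<phi> y)
           / norm (x - y) powr (real DIM('a) + s * p)))"

definition weak_rhs ::
  "'a::euclidean_space set \<Rightarrow> real \<Rightarrow> real \<Rightarrow> real \<Rightarrow> real \<Rightarrow> ('a \<Rightarrow> real) \<Rightarrow> ('a \<Rightarrow> real) \<Rightarrow>
     ('a \<Rightarrow> real) \<Rightarrow> real" where
  "weak_rhs \<Omega> m lam \<gamma> \<delta> g0 u \<phi> =
     (LINT x|lebesgue_on \<Omega>.
        (g0 x * rpow (u x) m
          + lam * m * infdist x (frontier \<Omega>) powr (- \<gamma>) * u x powr \<delta>) * \<phi> x)"

definition nonneg_ae :: "'a::euclidean_space set \<Rightarrow> ('a \<Rightarrow> real) \<Rightarrow> bool" where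
  "nonneg_ae \<Omega> u \<longleftrightarrow> (AE x in lebesgue_on \<Omega>. 0 \<le> u x)"

definition nontrivial :: "'a::euclidean_space set \<Rightarrow> ('a \<Rightarrow> real) \<Rightarrow> bool" where
  "nontrivial \<Omega> u \<longleftrightarrow> \<not> (AE x in lebesgue_on \<Omega>. u x = 0)"

definition weak_subsolution ::
  "'a::euclidean_space set \<Rightarrow> real \<Rightarrow> real \<Rightarrow> real \<Rightarrow> real \<Rightarrow> real \<Rightarrow> real \<Rightarrow> ('a \<Rightarrow> real) \<Rightarrow>
     ('a \<Rightarrow> real) \<Rightarrow> bool" where
  "weak_subsolution \<Omega> p s m lam \<gamma> \<delta> g0 u \<longleftrightarrow>
     u \<in> WL \<Omega> p m \<and> nonneg_ae \<Omega> u \<and> nontrivial \<Omega> u \<and>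
     (\<forall>\<phi>\<in>WL \<Omega> p m. nonneg_ae \<Omega> \<phi> \<longrightarrow>
        weak_lhs \<Omega> p s m lam u \<phi> \<le> weak_rhs \<Omega> m lam \<gamma> \<delta> g0 u \<phi>)"

definition weak_supersolution ::
  "'a::euclidean_space set \<Rightarrow> real \<Rightarrow> real \<Rightarrow> real \<Rightarrow> real \<Rightarrow> real \<Rightarrow> real \<Rightarrow> ('a \<Rightarrow> real) \<Rightarrow>
     ('a \<Rightarrow> real) \<Rightarrow> bool" where
  "weak_supersolution \<Omega> p s m lam \<gamma> \<delta> g0 u \<longleftrightarrow>
     u \<in> WL \<Omega> p m \<and> nonneg_ae \<Omega> u \<and> nontrivial \<Omega> u \<and>
     (\<forall>\<phi>\<in>WL \<Omega> p m. nonneg_ae \<Omega> \<phi> \<longrightarrow>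
        weak_lhs \<Omega> p s m lam u \<phi> \<ge> weak_rhs \<Omega> m lam \<gamma> \<delta> g0 u \<phi>)"

end

theory Submission
  imports Defs
begin

text \<open>
  Put $q = m + 1$. With $\varepsilon = 1/k$, $a = \min(u, k) + \varepsilon$ and $b = v + \varepsilon$, where $u$ is the
  sub-solution and $v$ the super-solution, test the inequality for $u$ with $(a^q - b^q)^+ / a^{q-1}$
  and the one for $v$ with $(a^q - b^q)^+ / b^{q-1}$, and subtract. Picone's inequality (local and
  discrete) makes the difference of the diffusion terms nonnegative, up to an error that is supported
  where $u > k$ and vanishes as $k \to \infty$. Truncating $u$ makes the test functions bounded, hence
  admissible, although nothing is known about the boundedness of $u$ and $v$.

  If $m > 0$, the reaction terms are under control only where $v > 0$. This positivity needs no maximum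
  principle: on $\{v = 0 < u\}$ the nonlocal term of the difference blows up as $\varepsilon \to 0$,
  whereas the remaining terms keep it bounded, so by Fatou's lemma this set is null. In the limit the
  reaction terms contribute at most $0$ and what remains is $\int ((u^q - v^q)^+)^2 \le 0$.

  Since the gradient in the definition of the Sobolev space is a choice among the weak gradients, every
  chain rule rests on the uniqueness of the weak gradient. The chain rule for $C^1$ functions comes from
  that for polynomials of test functions by Weierstrass approximation, the product rule for bounded
  functions from the chain rule for the square.
\<close>

section \<open>Smooth functions and the fundamental lemma\<close>

text \<open>The test functions come from a hidden convexity: for 1 <= q <= p the p-energy is convex
  as a function of w^q, and m < p - 1 puts q = m + 1 into this range. Division by the power q - 1 =
  m also suits the lower order terms. Where u and v are positive it turns the absorption u^(2m+1)
  into u^q, g0 u^m into g0, and u^\<delta> into u^(\<delta>-m), which decreases in u because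
  \<delta> < m, so the reaction difference has the favourable sign in the limit.

  The obstacle is the factor b^(-m), for which no bound uniform in the shift is at hand. Truncating
  u alone suffices because the tests vanish unless v < min(u, k).

  Integrability rests on pairings in L^2: the exponent 2(m + 1) is twice q, and a smooth boundary
  together with \<gamma> < 1/2 makes the weight d^(-\<gamma>) square integrable.\<close>

lemma C_k_SucI:
  assumes "\<And>x. (f has_derivative f' x) (at x)" and "\<And>i. i \<in> Basis \<Longrightarrow> C_k k (\<lambda>x. f' x i)"
  shows "C_k (Suc k) f"
proof -
  have "frechet_derivative f (at x) = f' x" for x
    using frechet_derivative_at[OF assms(1)] by simp
  then show ?thesis using assms by (auto simp: differentiable_on_def differentiable_def)
qed

lemma C_k_SucD:
  assumes "C_k (Suc k) f"
  shows "(f has_derivative frechet_derivative f (at x)) (at x)"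
    and "i \<in> Basis \<Longrightarrow> C_k k (\<lambda>x. frechet_derivative f (at x) i)"
  using assms by (auto simp: differentiable_on_def frechet_derivative_works)

lemma C_k_Suc_imp: "C_k (Suc k) f \<Longrightarrow> C_k k f"
proof (induction k arbitrary: f)
  case 0
  then show ?case by (simp add: differentiable_imp_continuous_on)
next
  case (Suc k)
  show ?case
    by (rule C_k_SucI[OF C_k_SucD(1)[OF Suc.prems]]) (rule Suc.IH[OF C_k_SucD(2)[OF Suc.prems]])
qed

lemma C_k_continuous: "C_k k f \<Longrightarrow> continuous_on UNIV f"
  by (cases k) (auto intro: differentiable_imp_continuous_on)

lemma C_k_const: "C_k k (\<lambda>x. c)"
proof (induction k arbitrary: c)
  case (Suc k)
  show ?case by (rule C_k_SucI[of _ "\<lambda>_ _. 0"]) (auto intro: Suc)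
qed simp

lemma C_k_add: "C_k k f \<Longrightarrow> C_k k g \<Longrightarrow> C_k k (\<lambda>x. f x + g x)"
proof (induction k arbitrary: f g)
  case (Suc k)
  show ?case
    by (rule C_k_SucI[OF has_derivative_add[OF C_k_SucD(1)[OF Suc.prems(1)] C_k_SucD(1)[OF Suc.prems(2)]]])
      (rule Suc.IH[OF C_k_SucD(2)[OF Suc.prems(1)] C_k_SucD(2)[OF Suc.prems(2)]])
qed (simp add: continuous_on_add)

lemma C_k_mult: "C_k k f \<Longrightarrow> C_k k g \<Longrightarrow> C_k k (\<lambda>x. f x * g x)"
proof (induction k arbitrary: f g)
  case (Suc k)
  show ?case
    by (rule C_k_SucI[OF has_derivative_mult[OF C_k_SucD(1)[OF Suc.prems(1)] C_k_SucD(1)[OF Suc.prems(2)]]])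
      (intro C_k_add Suc.IH C_k_Suc_imp[OF Suc.prems(1)] C_k_Suc_imp[OF Suc.prems(2)]
        C_k_SucD(2)[OF Suc.prems(1)] C_k_SucD(2)[OF Suc.prems(2)])
qed (simp add: continuous_on_mult)

lemma C_k_sum: "(\<And>i. i \<in> I \<Longrightarrow> C_k k (f i)) \<Longrightarrow> C_k k (\<lambda>x. \<Sum>i\<in>I. f i x)"
  by (induction I rule: infinite_finite_induct) (auto intro: C_k_const C_k_add)

lemma C_k_prod: "(\<And>i. i \<in> I \<Longrightarrow> C_k k (f i)) \<Longrightarrow> C_k k (\<lambda>x. \<Prod>i\<in>I. f i x)"
  by (induction I rule: infinite_finite_induct) (auto intro: C_k_const C_k_mult)

lemma C_k_power: "C_k k f \<Longrightarrow> C_k k (\<lambda>x. f x ^ n)"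
  by (induction n) (auto intro: C_k_const C_k_mult)

lemma C_k_linear: "bounded_linear f \<Longrightarrow> C_k k f"
proof (induction k)
  case 0 then show ?case by (simp add: linear_continuous_on)
next
  case (Suc k)
  show ?case
    by (rule C_k_SucI[OF bounded_linear_imp_has_derivative[OF Suc.prems]]) (rule C_k_const)
qed

lemma C_k_compose:
  fixes g :: "real \<Rightarrow> real"
  shows "C_k k g \<Longrightarrow> C_k k f \<Longrightarrow> C_k k (\<lambda>x. g (f x))"
proof (induction k arbitrary: f g)
  case 0
  then show ?case by (auto intro: continuous_on_compose2)
next
  case (Suc k)
  let ?g' = "\<lambda>t. frechet_derivative g (at t) 1"
  \<comment> \<open>A linear map on the reals is multiplication by its value at 1. This gives the
    chain rule the form of a product, to which \<open>C_k_mult\<close> and the induction hypothesis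
    apply.\<close>
  have lin: "frechet_derivative g (at t) s = s * ?g' t" for t s
  proof -
    have "linear (frechet_derivative g (at t))"
      using C_k_SucD(1)[OF Suc.prems(1), of t] has_derivative_linear by blast
    from linear_scale[OF this, of s 1] show ?thesis by simp
  qed
  have d: "((\<lambda>x. g (f x)) has_derivative (\<lambda>h. frechet_derivative f (at x) h * ?g' (f x))) (at x)" for x
  proof -
    have "((\<lambda>x. g (f x)) has_derivative (\<lambda>h. frechet_derivative g (at (f x)) (frechet_derivative f (at x) h))) (at x)"
      by (rule has_derivative_compose[OF C_k_SucD(1)[OF Suc.prems(2)] C_k_SucD(1)[OF Suc.prems(1)]])
    then show ?thesis by (subst (asm) lin)
  qed
  show ?case
    by (rule C_k_SucI[OF d])
      (rule C_k_mult[OF C_k_SucD(2)[OF Suc.prems(2)] Suc.IH[OF C_k_SucD(2)[OF Suc.prems(1)] C_k_Suc_imp[OF Suc.prems(2)]]], simp_all)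
qed

lemma smooth_borel_measurable: "smooth f \<Longrightarrow> f \<in> borel_measurable borel"
  by (meson C_k_continuous borel_measurable_continuous_onI smooth_def)

lemma smooth_C_k: "smooth f \<Longrightarrow> C_k k f" by (simp add: smooth_def)

section \<open>Smooth cutoff functions of boxes\<close>

definition flat_exp :: "nat \<Rightarrow> real \<Rightarrow> real" where
  "flat_exp n t = (if 0 < t then (1 / t) ^ n * exp (- (1 / t)) else 0)"

lemma flat_exp_tendsto_0: "(flat_exp n \<longlongrightarrow> 0) (at 0)"
proof (rule filterlim_split_at)
  show "(flat_exp n \<longlongrightarrow> 0) (at_left 0)"
    by (rule tendsto_eventually) (auto simp: flat_exp_def eventually_at_filter)
  have "((\<lambda>t. inverse t ^ n / exp (inverse t)) \<longlongrightarrow> (0::real)) (at_right 0)"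
    by (rule filterlim_compose[OF tendsto_power_div_exp_0 filterlim_inverse_at_top_right])
  moreover have "eventually (\<lambda>t::real. inverse t ^ n / exp (inverse t) = flat_exp n t) (at_right 0)"
    by (auto simp: eventually_at_filter flat_exp_def exp_minus field_simps)
  ultimately show "(flat_exp n \<longlongrightarrow> 0) (at_right 0)"
    by (simp add: tendsto_cong)
qed

text \<open>The factor (1/t)^n is carried along so that differentiation stays inside the family;
  smoothness is then an induction on the order for all n at once. At 0 the difference quotient is
  itself \<open>flat_exp (n + 1)\<close>, so flatness is \<open>flat_exp_tendsto_0\<close>.\<close>

lemma flat_exp_deriv: "(flat_exp n has_real_derivative flat_exp (n + 2) t - real n * flat_exp (n + 1) t) (at t)"
proof -
  consider "t < 0" | "t = 0" | "0 < t" by linarith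
  then show ?thesis
  proof cases
    case 1
    have "((\<lambda>_. 0) has_real_derivative 0) (at t)" by simp
    then have "(flat_exp n has_real_derivative 0) (at t)"
      by (rule has_field_derivative_transform_within_open[where S = "{..<0}"]) (use 1 in \<open>auto simp: flat_exp_def\<close>)
    then show ?thesis using 1 by (simp add: flat_exp_def)
  next
    case 2
    have "((\<lambda>h. (flat_exp n (0 + h) - flat_exp n 0) / h) \<longlongrightarrow> 0) (at 0)"
    proof (rule Lim_transform_eventually[OF flat_exp_tendsto_0[of "n + 1"]])
      show "\<forall>\<^sub>F h in at 0. flat_exp (n + 1) h = (flat_exp n (0 + h) - flat_exp n 0) / h"
        by (auto simp: eventually_at_filter flat_exp_def)
    qed
    then show ?thesis using 2 by (simp add: DERIV_def flat_exp_def)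
  next
    case 3
    have "((\<lambda>t. (1 / t) ^ n * exp (- (1 / t))) has_real_derivative flat_exp (n + 2) t - real n * flat_exp (n + 1) t) (at t)"
    proof -
      have i: "((\<lambda>t. 1 / t) has_real_derivative - ((1 / t) ^ 2)) (at t)"
        using 3 by (auto intro!: derivative_eq_intros simp: power2_eq_square)
      have "((\<lambda>t. (1 / t) ^ n * exp (- (1 / t))) has_real_derivative
        (real n * (1 / t) ^ (n - 1) * (- ((1 / t) ^ 2))) * exp (- (1 / t)) + (1 / t) ^ n * (exp (- (1 / t)) * (- (- ((1 / t) ^ 2))))) (at t)"
        using DERIV_mult[OF DERIV_power[OF i, of n] DERIV_fun_exp[OF DERIV_minus[OF i]]]
        by (simp add: algebra_simps)
      moreover have "real n * (1 / t) ^ (n - 1) * (- ((1 / t) ^ 2)) = - (real n * (1 / t) ^ (n + 1))"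
        by (cases n) (simp_all add: power2_eq_square)
      ultimately have "((\<lambda>t. (1 / t) ^ n * exp (- (1 / t))) has_real_derivative
        (- (real n * (1 / t) ^ (n + 1))) * exp (- (1 / t)) + (1 / t) ^ n * (exp (- (1 / t)) * (- (- ((1 / t) ^ 2))))) (at t)"
        by (simp only:)
      then show ?thesis using 3 by (simp add: flat_exp_def power_add power2_eq_square algebra_simps)
    qed
    then show ?thesis
      by (rule has_field_derivative_transform_within_open[where S = "{0<..}"]) (use 3 in \<open>auto simp: flat_exp_def\<close>)
  qed
qed

lemma C_k_real_SucI:
  fixes f :: "real \<Rightarrow> real"
  assumes "\<And>x. (f has_real_derivative f' x) (at x)" and "C_k k f'"
  shows "C_k (Suc k) f"
  by (rule C_k_SucI[OF assms(1)[unfolded has_field_derivative_def]]) (use assms(2) in simp)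

lemma C_k_flat_exp: "C_k k (flat_exp n)"
proof (induction k arbitrary: n)
  case 0
  have "isCont (flat_exp n) t" for t using flat_exp_deriv[of n t] DERIV_isCont by blast
  then show ?case by (simp add: continuous_at_imp_continuous_on)
next
  case (Suc k)
  have "C_k k (\<lambda>t. flat_exp (n + 2) t + (- real n) * flat_exp (n + 1) t)"
    by (intro C_k_add C_k_mult C_k_const Suc)
  then show ?case by (intro C_k_real_SucI[OF flat_exp_deriv]) simp
qed

lemma C_k_exp: "C_k k (exp :: real \<Rightarrow> real)"
proof (induction k)
  case 0 then show ?case by (auto intro: continuous_intros)
next
  case (Suc k) then show ?case by (intro C_k_real_SucI[OF DERIV_exp])
qed

text \<open>Positive exactly on the open box. Being a product over the coordinates, it inherits
  smoothness from \<open>flat_exp 0\<close>.\<close>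

definition box_bump :: "'a::euclidean_space \<Rightarrow> 'a \<Rightarrow> 'a \<Rightarrow> real" where
  "box_bump a b x = (\<Prod>i\<in>Basis. flat_exp 0 (x \<bullet> i - a \<bullet> i) * flat_exp 0 (b \<bullet> i - x \<bullet> i))"

lemma smooth_box_bump: "smooth (box_bump a b)"
  unfolding smooth_def box_bump_def[abs_def]
proof (intro allI C_k_prod C_k_mult)
  fix k and i :: 'a
  have "C_k k (\<lambda>x. x \<bullet> i + - (a \<bullet> i))" "C_k k (\<lambda>x. b \<bullet> i + (- 1) * (x \<bullet> i))"
    by (intro C_k_add C_k_mult C_k_const C_k_linear bounded_linear_inner_left)+
  then show "C_k k (\<lambda>x. flat_exp 0 (x \<bullet> i - a \<bullet> i))" "C_k k (\<lambda>x. flat_exp 0 (b \<bullet> i - x \<bullet> i))"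
    by (auto intro!: C_k_compose[OF C_k_flat_exp])
qed

lemma box_bump_pos: "x \<in> box a b \<Longrightarrow> 0 < box_bump a b x"
  by (auto simp: box_bump_def box_def flat_exp_def intro!: prod_pos)

lemma box_bump_zero: "x \<notin> box a b \<Longrightarrow> box_bump a b x = 0"
  by (auto simp: box_bump_def box_def flat_exp_def)

text \<open>For c = 0, 1, 2, ... these functions take values in [0, 1) and increase to the indicator
  of the open box, with support in the closed box. They serve as mollified indicators without any
  convolution.\<close>

lemma smooth_cutoff: "smooth (\<lambda>x. 1 - exp (- (c * box_bump a b x)))"
proof -
  have "C_k k (\<lambda>x. 1 + (- 1) * exp ((- c) * box_bump a b x))" for k
    by (intro C_k_add C_k_mult C_k_const C_k_compose[OF C_k_exp] smooth_C_k[OF smooth_box_bump])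
  then show ?thesis by (simp add: smooth_def)
qed

lemma cutoff_in_Cc_inf:
  assumes "cbox a b \<subseteq> \<Omega>"
  shows "(\<lambda>x. 1 - exp (- (c * box_bump a b x))) \<in> Cc_inf \<Omega>"
proof -
  let ?S = "{x. 1 - exp (- (c * box_bump a b x)) \<noteq> 0}"
  have "?S \<subseteq> cbox a b"
  proof
    fix x assume "x \<in> ?S"
    then have "x \<in> box a b" using box_bump_zero[of x a b] by (cases "x \<in> box a b") auto
    then show "x \<in> cbox a b" using box_subset_cbox by blast
  qed
  then have cl: "closure ?S \<subseteq> cbox a b"
    by (rule closure_minimal) (rule closed_cbox)
  moreover have "compact (closure ?S)"
    using cl bounded_subset[OF bounded_cbox] by (simp add: compact_eq_bounded_closed)
  ultimately show ?thesis using assms smooth_cutoff by (auto simp: Cc_inf_def)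
qed

text \<open>The positive and the negative part of f are densities of two measures that agree on open
  boxes. Boxes form an intersection-stable generator and exhaust the space with finite measure, so
  the measures coincide, and with them the two densities almost everywhere.\<close>

lemma AE_zero_if_box_integrals_zero:
  fixes f :: "'a::euclidean_space \<Rightarrow> real"
  assumes f: "integrable lborel f" and zero: "\<And>a b. (LINT x|lborel. indicator (box a b) x * f x) = 0"
  shows "AE x in lborel. f x = 0"
proof -
  have [measurable]: "f \<in> borel_measurable borel" using f by auto
  \<comment> \<open>\<open>ennreal\<close> sends negative numbers to 0, so these are the measures
    with densities f^+ and f^-.\<close>
  let ?M = "density lborel (\<lambda>x. ennreal (f x))" and ?N = "density lborel (\<lambda>x. ennreal (- f x))"
  let ?E = "range (\<lambda>(a, b). box a b::'a set)"
  have em: "emeasure (density lborel (\<lambda>x. ennreal (s * f x))) (box a b) =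
      ennreal (LINT x|lborel. indicator (box a b) x * max 0 (s * f x))" if "s = 1 \<or> s = -1" for s a b
  proof -
    have "integrable lborel (\<lambda>x. indicator (box a b) x * max 0 (s * f x))"
      using f by (intro integrable_real_mult_indicator[where A = "box a b", simplified mult.commute[of _ "indicator _ _"]] integrable_max) auto
    moreover have "emeasure (density lborel (\<lambda>x. ennreal (s * f x))) (box a b) =
      (\<integral>\<^sup>+x. ennreal (indicator (box a b) x * max 0 (s * f x)) \<partial>lborel)"
      by (subst emeasure_density) (auto intro!: nn_integral_cong simp: indicator_def max_def ennreal_neg)
    ultimately show ?thesis by (simp add: nn_integral_eq_integral)
  qed
  have "?M = ?N"
  proof (rule measure_eqI_generator_eq)
    show "Int_stable ?E" by (auto simp: Int_stable_def box_Int_box)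
    show "?E \<subseteq> Pow UNIV" "sets ?M = sigma_sets UNIV ?E" "sets ?N = sigma_sets UNIV ?E"
      by (simp_all add: borel_eq_box)
    let ?A = "\<lambda>n::nat. box (- (real n *\<^sub>R One)) (real n *\<^sub>R One) :: 'a set"
    show "range ?A \<subseteq> ?E" "(\<Union>i. ?A i) = UNIV" unfolding UN_box_eq_UNIV by auto
    show "emeasure ?M (?A i) \<noteq> \<infinity>" for i using em[of 1] by simp
    show "emeasure ?M X = emeasure ?N X" if X: "X \<in> ?E" for X
    proof -
      obtain a b where X: "X = box a b" using X by auto
      have i: "integrable lborel (\<lambda>x. indicator (box a b) x * max 0 (s * f x))" for s
        using f by (intro integrable_real_mult_indicator[where A = "box a b", simplified mult.commute[of _ "indicator _ _"]] integrable_max) auto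
      have "(LINT x|lborel. indicator (box a b) x * max 0 (1 * f x)) - (LINT x|lborel. indicator (box a b) x * max 0 ((-1) * f x))
         = (LINT x|lborel. indicator (box a b) x * f x)"
      proof -
        have "(\<lambda>x. indicator (box a b) x * f x) =
          (\<lambda>x. indicator (box a b) x * max 0 (1 * f x) - indicator (box a b) x * max 0 ((-1) * f x))"
          by (rule ext) (simp add: max_def algebra_simps)
        then show ?thesis using Bochner_Integration.integral_diff[OF i[of 1] i[of "-1"]] by presburger
      qed
      then show ?thesis using zero[of a b] em[of 1 a b] em[of "-1" a b] X by simp
    qed
  qed
  then have "AE x in lborel. ennreal (f x) = ennreal (- f x)"
    by (intro sigma_finite_measure.density_unique[OF sigma_finite_lborel]) auto
  then show ?thesis
  proof eventually_elim
    case (elim x)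
    then show ?case by (cases "0 \<le> f x") (auto simp: ennreal_neg ennreal_eq_0_iff dest!: sym[of 0])
  qed
qed

lemma integral_restrict_lebesgue:
  fixes f :: "'a::euclidean_space \<Rightarrow> real"
  assumes "S \<in> sets lebesgue"
  shows "(LINT x|lebesgue_on S. f x) = (LINT x|lebesgue. indicator S x * f x)"
  using assms by (subst integral_restrict_space) auto

lemma indicator_box_cbox:
  fixes y :: real
  shows "indicator (box a b) x * (indicator (cbox a b) x * y) = indicator (box a b) x * y"
  using subsetD[OF box_subset_cbox, of x a b] by (cases "x \<in> box a b") auto

text \<open>Testing with cutoffs that increase to the indicator of a box shows that f has integral 0
  over every open box whose closed box lies in \<Omega>. Cut down to one such box, f is integrable
  and \<open>AE_zero_if_box_integrals_zero\<close> applies; by Lindelof countably many of these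
  boxes cover \<Omega>.\<close>

lemma fundamental_lemma:
  fixes f :: "'a::euclidean_space \<Rightarrow> real"
  assumes \<Omega>: "open \<Omega>" and loc: "\<And>K. compact K \<Longrightarrow> K \<subseteq> \<Omega> \<Longrightarrow> integrable (lebesgue_on K) f"
    and zero: "\<And>\<phi>. \<phi> \<in> Cc_inf \<Omega> \<Longrightarrow> (LINT x|lebesgue_on \<Omega>. f x * \<phi> x) = 0"
  shows "AE x in lebesgue_on \<Omega>. f x = 0"
proof -
  have \<Omega>m: "\<Omega> \<in> sets lebesgue" using \<Omega> by (simp add: borel_open)
  have locint: "integrable lebesgue (\<lambda>x. indicator K x * f x)" if "compact K" "K \<subseteq> \<Omega>" for K
    using loc[OF that] that(1) by (subst (asm) integrable_restrict_space) (auto simp: borel_compact)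
  have box0: "(LINT x|lebesgue. indicator (box a b) x * f x) = 0" if ab: "cbox a b \<subseteq> \<Omega>" for a b
  proof -
    let ?\<phi> = "\<lambda>n x. 1 - exp (- (real n * box_bump a b x))"
    have "(\<lambda>n. LINT x|lebesgue. indicator (cbox a b) x * f x * ?\<phi> n x) \<longlonglongrightarrow> (LINT x|lebesgue. indicator (box a b) x * f x)"
    proof (rule integral_dominated_convergence)
      have m[measurable]: "(\<lambda>x. indicator (cbox a b) x * f x) \<in> borel_measurable lebesgue"
        using locint[OF compact_cbox ab] by auto
      have [measurable]: "?\<phi> n \<in> borel_measurable lebesgue" for n
        using smooth_borel_measurable[OF smooth_cutoff[of "real n" a b]]
        by (intro measurable_completion) simp
      show "(\<lambda>x. indicator (cbox a b) x * f x * ?\<phi> n x) \<in> borel_measurable lebesgue" for n by measurable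
      have "(\<lambda>x. indicator (box a b) x * (indicator (cbox a b) x * f x)) \<in> borel_measurable lebesgue"
        by (rule borel_measurable_times[OF _ m]) (simp add: borel_measurable_indicator)
      then show "(\<lambda>x. indicator (box a b) x * f x) \<in> borel_measurable lebesgue" by (simp only: indicator_box_cbox)
      show "integrable lebesgue (\<lambda>x. norm (indicator (cbox a b) x * f x))"
        using locint[OF compact_cbox ab] by (rule integrable_norm)
      show "AE x in lebesgue. (\<lambda>n. indicator (cbox a b) x * f x * ?\<phi> n x) \<longlonglongrightarrow> indicator (box a b) x * f x"
      proof (rule AE_I2)
        fix x :: 'a
        show "(\<lambda>n. indicator (cbox a b) x * f x * ?\<phi> n x) \<longlonglongrightarrow> indicator (box a b) x * f x"
        proof (cases "x \<in> box a b")
          case True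
          then have "(\<lambda>n. exp (- (real n * box_bump a b x))) \<longlonglongrightarrow> 0"
            using LIMSEQ_power_zero[of "exp (- box_bump a b x)"] box_bump_pos[OF True]
            by (simp add: exp_of_nat_mult[symmetric])
          then have "(\<lambda>n. indicator (cbox a b) x * f x * ?\<phi> n x) \<longlonglongrightarrow> indicator (cbox a b) x * f x * (1 - 0)"
            by (intro tendsto_intros)
          moreover have "x \<in> cbox a b" using True box_subset_cbox by blast
          ultimately show ?thesis using True by simp
        next
          case False then show ?thesis by (simp add: box_bump_zero)
        qed
      qed
      show "AE x in lebesgue. norm (indicator (cbox a b) x * f x * ?\<phi> n x) \<le> norm (indicator (cbox a b) x * f x)" for n
      proof (rule AE_I2)
        fix x :: 'a
        have "0 \<le> box_bump a b x" using box_bump_pos[of x a b] box_bump_zero[of x a b] by (cases "x \<in> box a b") auto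
        then have "\<bar>?\<phi> n x\<bar> \<le> 1" by simp
        then show "norm (indicator (cbox a b) x * f x * ?\<phi> n x) \<le> norm (indicator (cbox a b) x * f x)"
          by (simp add: abs_mult mult_left_le)
      qed
    qed
    moreover have "(LINT x|lebesgue. indicator (cbox a b) x * f x * ?\<phi> n x) = 0" for n
    proof -
      have "indicator (cbox a b) x * f x * ?\<phi> n x = indicator \<Omega> x * (f x * ?\<phi> n x)" for x
        using subsetD[OF ab, of x] box_bump_zero[of x a b] subsetD[OF box_subset_cbox, of x a b]
        by (cases "x \<in> box a b"; cases "x \<in> cbox a b"; cases "x \<in> \<Omega>") auto
      then have "(LINT x|lebesgue. indicator (cbox a b) x * f x * ?\<phi> n x) = (LINT x|lebesgue. indicator \<Omega> x * (f x * ?\<phi> n x))"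
        by (intro Bochner_Integration.integral_cong refl)
      also have "\<dots> = 0" using zero[OF cutoff_in_Cc_inf[OF ab]] \<Omega>m by (simp add: integral_restrict_lebesgue)
      finally show ?thesis .
    qed
    ultimately have "(\<lambda>n. 0) \<longlonglongrightarrow> (LINT x|lebesgue. indicator (box a b) x * f x)" by (simp only:)
    then show ?thesis by (simp only: LIMSEQ_const_iff)
  qed
  have cb: "AE x in lebesgue. x \<in> box c d \<longrightarrow> f x = 0" if cd: "cbox c d \<subseteq> \<Omega>" for c d
  proof -
    have "integrable lebesgue (\<lambda>x. indicator (box c d) x * (indicator (cbox c d) x * f x))"
      using integrable_real_mult_indicator[OF _ locint[OF compact_cbox cd], of "box c d"]
      by (simp add: mult.commute)
    then have int: "integrable lebesgue (\<lambda>x. indicator (box c d) x * f x)" by (simp only: indicator_box_cbox)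
    \<comment> \<open>The box argument concerns Borel measures, so f, which is only Lebesgue
      measurable, is replaced by a Borel function equal to it almost everywhere.\<close>
    then obtain F where F[measurable]: "F \<in> borel_measurable lborel" and FA: "AE x in lborel. indicator (box c d) x * f x = F x"
      using completion_ex_borel_measurable_real[OF borel_measurable_integrable[OF int]] by (elim bexE)
    have FA': "AE x in lebesgue. indicator (box c d) x * f x = F x" using FA by (rule AE_completion)
    have "integrable lebesgue F"
      using int by (subst integrable_cong_AE[symmetric, OF _ _ FA']) (auto intro: measurable_completion)
    then have Fi: "integrable lborel F" by (simp add: integrable_completion)
    have "AE x in lborel. F x = 0"
    proof (rule AE_zero_if_box_integrals_zero[OF Fi])
      fix a b
      have "(LINT x|lborel. indicator (box a b) x * F x) = (LINT x|lebesgue. indicator (box a b) x * F x)"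
        by (simp add: integral_completion)
      also have "\<dots> = (LINT x|lebesgue. indicator (box a b) x * (indicator (box c d) x * f x))"
      proof (rule integral_cong_AE)
        show "(\<lambda>x. indicator (box a b) x * F x) \<in> borel_measurable lebesgue"
          by (intro measurable_completion) simp
        show "(\<lambda>x. indicator (box a b) x * (indicator (box c d) x * f x)) \<in> borel_measurable lebesgue"
          by (rule borel_measurable_times[OF _ borel_measurable_integrable[OF int]])
            (simp add: borel_measurable_indicator)
        show "AE x in lebesgue. indicator (box a b) x * F x = indicator (box a b) x * (indicator (box c d) x * f x)"
          using FA' by eventually_elim simp
      qed
      also have "\<dots> = 0"
      proof -
        \<comment> \<open>The intersection of two open boxes is an open box, and its closed version
          still lies in \<open>cbox c d\<close>, hence in \<Omega>.\<close>
        define l u where "l = (\<Sum>i\<in>Basis. max (a \<bullet> i) (c \<bullet> i) *\<^sub>R i)" and "u = (\<Sum>i\<in>Basis. min (b \<bullet> i) (d \<bullet> i) *\<^sub>R i)"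
        have lu: "box a b \<inter> box c d = box l u" unfolding l_def u_def by (rule box_Int_box)
        have "(LINT x|lebesgue. indicator (box a b) x * (indicator (box c d) x * f x)) = (LINT x|lebesgue. indicator (box l u) x * f x)"
          unfolding lu[symmetric] indicator_inter_arith mult.assoc ..
        moreover have "cbox l u \<subseteq> \<Omega>" 
        proof
          fix x assume "x \<in> cbox l u"
          then have "x \<in> cbox c d" by (simp add: mem_box l_def u_def)
          then show "x \<in> \<Omega>" using cd by blast
        qed
        ultimately show ?thesis using box0 by simp
      qed
      finally show "(LINT x|lborel. indicator (box a b) x * F x) = 0" .
    qed
    then have "AE x in lebesgue. F x = 0" by (rule AE_completion)
    with FA' show ?thesis by eventually_elim (auto simp: indicator_def split: if_splits)
  qed
  obtain \<D> where D: "\<D> \<subseteq> {box c d |c d. cbox c d \<subseteq> \<Omega>}" "countable \<D>"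
    "\<Union>\<D> = \<Union>{box c d |c d. cbox c d \<subseteq> \<Omega>}"
  proof (rule Lindelof)
    show "open S" if "S \<in> {box c d |c d. cbox c d \<subseteq> \<Omega>}" for S using that by (auto simp: open_box)
  qed
  have cover: "\<Omega> \<subseteq> \<Union>\<D>"
  proof
    fix x assume "x \<in> \<Omega>"
    then obtain a b where "cbox a b \<subseteq> \<Omega>" "x \<in> box a b" using open_contains_cbox[OF \<Omega>] by metis
    then have "x \<in> \<Union>{box c d |c d. cbox c d \<subseteq> \<Omega>}" by (intro UnionI[of "box a b"]) auto
    then show "x \<in> \<Union>\<D>" by (simp only: D(3))
  qed
  have "AE x in lebesgue. \<forall>X\<in>\<D>. x \<in> X \<longrightarrow> f x = 0"
    unfolding AE_ball_countable[OF D(2)]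
  proof
    fix X assume "X \<in> \<D>"
    then obtain c d where "X = box c d" "cbox c d \<subseteq> \<Omega>" using D(1) by auto
    then show "AE x in lebesgue. x \<in> X \<longrightarrow> f x = 0" using cb by simp
  qed
  then have "AE x in lebesgue. x \<in> \<Omega> \<longrightarrow> f x = 0"
  proof eventually_elim
    case (elim x) then show ?case using cover by auto
  qed
  then show ?thesis using \<Omega>m by (simp add: AE_restrict_space_iff)
qed

section \<open>Gradients of compactly supported C^1 functions\<close>

lemma grad_inner_eq:
  assumes "f differentiable (at x)"
  shows "frechet_derivative f (at x) h = grad f x \<bullet> h"
proof -
  interpret linear "frechet_derivative f (at x)" using assms by (rule linear_frechet_derivative)
  have "frechet_derivative f (at x) h = frechet_derivative f (at x) (\<Sum>i\<in>Basis. (h \<bullet> i) *\<^sub>R i)"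
    by (simp add: euclidean_representation)
  also have "\<dots> = grad f x \<bullet> h"
    by (simp add: sum scale grad_def inner_sum_left inner_sum_right inner_commute mult.commute)
  finally show ?thesis .
qed

lemma grad_eqI:
  assumes "(f has_derivative (\<lambda>h. G \<bullet> h)) (at x)"
  shows "grad f x = G"
  by (simp add: grad_def frechet_derivative_at[OF assms, symmetric] euclidean_representation)

lemma C_k_grad:
  assumes "C_k (Suc k) f"
  shows "(f has_derivative (\<lambda>h. grad f x \<bullet> h)) (at x)"
    and "continuous_on UNIV (grad f)"
proof -
  have "f differentiable (at x)" using C_k_SucD(1)[OF assms] by (auto simp: differentiable_def)
  then have "frechet_derivative f (at x) = (\<lambda>h. grad f x \<bullet> h)"
    by (intro ext grad_inner_eq)
  then show "(f has_derivative (\<lambda>h. grad f x \<bullet> h)) (at x)"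
    using C_k_SucD(1)[OF assms, of x] by (simp only:)
  show "continuous_on UNIV (grad f)"
    unfolding grad_def[abs_def]
    using C_k_SucD(2)[OF assms] by (intro continuous_intros C_k_continuous) auto
qed

lemma grad_eq_0_outside_support:
  assumes "x \<notin> closure {x. f x \<noteq> 0}"
  shows "grad f x = 0"
proof (rule grad_eqI)
  have "((\<lambda>_. 0) has_derivative (\<lambda>h. 0 \<bullet> h)) (at x)" by simp
  then show "(f has_derivative (\<lambda>h. 0 \<bullet> h)) (at x)"
    by (rule has_derivative_transform_within_open[where s = "- closure {x. f x \<noteq> 0}"])
      (use assms closure_subset[of "{x. f x \<noteq> 0}"] in auto)
qed

lemma compactly_supported_C1_bounds:
  fixes f :: "'a::euclidean_space \<Rightarrow> real"
  assumes f: "C_k 1 f" and supp: "compact (closure {x. f x \<noteq> 0})"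
  obtains L R where "0 \<le> L" "0 \<le> R" "\<And>x. norm (grad f x) \<le> L" "\<And>x. \<bar>f x\<bar> \<le> L"
    "\<And>x y. \<bar>f x - f y\<bar> \<le> L * norm (x - y)" "\<And>x. R < norm x \<Longrightarrow> f x = 0 \<and> grad f x = 0"
proof -
  let ?K = "closure {x. f x \<noteq> 0}"
  have f1: "C_k (Suc 0) f" using f by simp
  have "bounded (grad f ` ?K)" "bounded (f ` ?K)" "bounded ?K"
    using supp C_k_grad(2)[OF f1] C_k_continuous[OF f]
    by (auto intro!: compact_imp_bounded compact_continuous_image intro: continuous_on_subset simp del: One_nat_def)
  then obtain B C R where B: "\<And>x. x \<in> ?K \<Longrightarrow> norm (grad f x) \<le> B" and C: "\<And>x. x \<in> ?K \<Longrightarrow> norm (f x) \<le> C"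
    and R: "\<And>x. x \<in> ?K \<Longrightarrow> norm x \<le> R"
    unfolding bounded_iff by (metis image_eqI)
  define L where "L = max 0 (max B C)"
  have out: "f x = 0 \<and> grad f x = 0" if "x \<notin> ?K" for x
    using that grad_eq_0_outside_support[OF that] closure_subset[of "{x. f x \<noteq> 0}"] by auto
  have g: "norm (grad f x) \<le> L" "\<bar>f x\<bar> \<le> L" for x
    using B[of x] C[of x] out[of x] by (cases "x \<in> ?K"; auto simp: L_def)+
  have "\<bar>f x - f y\<bar> \<le> L * norm (x - y)" for x y
  proof -
    have "norm (f x - f y) \<le> L * norm (x - y)"
    proof (rule differentiable_bound[of UNIV])
      show "(f has_derivative (\<lambda>h. grad f z \<bullet> h)) (at z within UNIV)" for z using C_k_grad(1)[OF f1] by simp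
      show "onorm (\<lambda>h. grad f z \<bullet> h) \<le> L" for z
      proof (rule onorm_bound)
        show "0 \<le> L" by (simp add: L_def)
        show "norm (grad f z \<bullet> h) \<le> L * norm h" for h
          using Cauchy_Schwarz_ineq2[of "grad f z" h] mult_right_mono[OF g(1)[of z] norm_ge_zero[of h]] by simp
      qed
    qed auto
    then show ?thesis by simp
  qed
  moreover have "f x = 0 \<and> grad f x = 0" if "max 0 R < norm x" for x
    using that R[of x] out[of x] by fastforce
  ultimately show thesis using g that[of L "max 0 R"] by (auto simp: L_def)
qed

lemma lborel_integrable_bounded_support:
  fixes f :: "'a::euclidean_space \<Rightarrow> 'b::euclidean_space"
  assumes "f \<in> borel_measurable borel" "\<And>x. norm (f x) \<le> C" "\<And>x. R < norm x \<Longrightarrow> f x = 0"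
  shows "integrable lborel f"
proof (rule Bochner_Integration.integrable_bound)
  show "integrable lborel (\<lambda>x::'a. C * indicator (cball 0 R) x)"
    by (intro integrable_mult_right integrable_real_indicator) (auto simp: emeasure_lborel_cball_finite[simplified infinity_ennreal_def])
  have "0 \<le> C" using assms(2) norm_ge_zero order_trans by blast
  then show "AE x in lborel. norm (f x) \<le> norm (C * indicator (cball 0 R) x)"
    using assms by (auto simp: indicator_def not_le)
qed (use assms in auto)

lemma integral_lborel_translate:
  fixes f :: "'a::euclidean_space \<Rightarrow> real"
  assumes "f \<in> borel_measurable borel"
  shows "(LINT x|lborel. f (x + c)) = (LINT x|lborel. f x)"
    and "integrable lborel f \<Longrightarrow> integrable lborel (\<lambda>x. f (x + c))"
proof -
  have d: "distr lborel borel ((+) c) = (lborel :: 'a measure)" by (rule lborel_distr_plus)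
  show "(LINT x|lborel. f (x + c)) = (LINT x|lborel. f x)"
    using integral_distr[of "(+) c" lborel borel f] assms unfolding d by (simp add: add.commute)
  show "integrable lborel (\<lambda>x. f (x + c))" if "integrable lborel f"
    using integrable_distr_eq[of "(+) c" lborel borel f] assms that unfolding d by (simp add: add.commute)
qed

lemma difference_quotient_tendsto:
  assumes "(f has_derivative (\<lambda>h. G \<bullet> h)) (at (x::'a::euclidean_space))"
  shows "(\<lambda>n. real (Suc n) * (f (x + (1 / real (Suc n)) *\<^sub>R e) - f x)) \<longlonglongrightarrow> G \<bullet> e"
proof -
  have "((\<lambda>t. f (x + t *\<^sub>R e)) has_derivative (\<lambda>t. G \<bullet> (t *\<^sub>R e))) (at 0)"
  proof -
    have "((\<lambda>t. x + t *\<^sub>R e) has_derivative (\<lambda>t. t *\<^sub>R e)) (at (0::real))"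
      by (auto intro!: derivative_eq_intros)
    from has_derivative_compose[OF this, of f "\<lambda>h. G \<bullet> h"] assms show ?thesis by simp
  qed
  moreover have "(\<lambda>t::real. G \<bullet> (t *\<^sub>R e)) = (*) (G \<bullet> e)" by (rule ext) simp
  ultimately have "((\<lambda>t. f (x + t *\<^sub>R e)) has_real_derivative (G \<bullet> e)) (at 0)"
    by (simp only: has_field_derivative_def)
  then have "((\<lambda>h. (f (x + h *\<^sub>R e) - f x) / h) \<longlongrightarrow> G \<bullet> e) (at 0)"
    by (simp add: DERIV_def)
  moreover have "filterlim (\<lambda>n. 1 / real (Suc n)) (at 0) sequentially"
  proof -
    have "(\<lambda>n. 1 / real (Suc n)) \<longlonglongrightarrow> 0" using LIMSEQ_inverse_real_of_nat by (simp add: divide_inverse)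
    then show ?thesis by (rule filterlim_atI) (simp del: of_nat_Suc)
  qed
  ultimately have "(\<lambda>n. (f (x + (1 / real (Suc n)) *\<^sub>R e) - f x) / (1 / real (Suc n))) \<longlonglongrightarrow> G \<bullet> e"
    by (rule filterlim_compose)
  moreover have "(f (x + (1 / real (Suc n)) *\<^sub>R e) - f x) / (1 / real (Suc n)) = real (Suc n) * (f (x + (1 / real (Suc n)) *\<^sub>R e) - f x)" for n
    by simp
  ultimately show ?thesis by (simp only:)
qed

text \<open>Each difference quotient has integral 0 because Lebesgue measure is translation
  invariant, and the quotients converge dominatedly to the derivative. Neither Fubini nor a
  one-dimensional fundamental theorem is involved.\<close>

lemma integral_directional_derivative_zero:
  fixes f :: "'a::euclidean_space \<Rightarrow> real"
  assumes f: "C_k 1 f" and supp: "compact (closure {x. f x \<noteq> 0})"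
  shows "(LINT x|lborel. grad f x \<bullet> e) = 0"
proof -
  obtain L R where L: "0 \<le> L" "0 \<le> R" "\<And>x. norm (grad f x) \<le> L" "\<And>x. \<bar>f x\<bar> \<le> L"
    "\<And>x y. \<bar>f x - f y\<bar> \<le> L * norm (x - y)" "\<And>x. R < norm x \<Longrightarrow> f x = 0 \<and> grad f x = 0"
    using compactly_supported_C1_bounds[OF f supp] by metis
  have [measurable]: "f \<in> borel_measurable borel" "grad f \<in> borel_measurable borel"
    using C_k_continuous[OF f] C_k_grad(2)[of 0 f] f by (auto intro: borel_measurable_continuous_onI)
  have fi: "integrable lborel f" using L by (intro lborel_integrable_bounded_support[of f L R]) auto
  let ?d = "\<lambda>n x. real (Suc n) * (f (x + (1 / real (Suc n)) *\<^sub>R e) - f x)"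
  have "(\<lambda>n. LINT x|lborel. ?d n x) \<longlonglongrightarrow> (LINT x|lborel. grad f x \<bullet> e)"
  \<comment> \<open>The Lipschitz bound gives the height. The support radius grows by
    \<open>norm e\<close> because no translation step is longer than that.\<close>
  proof (rule integral_dominated_convergence[where w = "\<lambda>x. L * norm e * indicator (cball 0 (R + norm e)) x"])
    show "integrable lborel (\<lambda>x::'a. L * norm e * indicator (cball 0 (R + norm e)) x)"
      by (intro integrable_mult_right integrable_real_indicator) (auto simp: emeasure_lborel_cball_finite[simplified infinity_ennreal_def])
    show "AE x in lborel. (\<lambda>n. ?d n x) \<longlonglongrightarrow> grad f x \<bullet> e"
      using C_k_grad(1)[of 0 f] f by (intro AE_I2 difference_quotient_tendsto) simp
    show "AE x in lborel. norm (?d n x) \<le> L * norm e * indicator (cball 0 (R + norm e)) x" for n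
    proof (rule AE_I2)
      fix x
      show "norm (?d n x) \<le> L * norm e * indicator (cball 0 (R + norm e)) x"
      proof (cases "x \<in> cball 0 (R + norm e)")
        case True
        have "\<bar>f (x + (1 / real (Suc n)) *\<^sub>R e) - f x\<bar> \<le> L * (1 / real (Suc n) * norm e)"
          using L(5)[of "x + (1 / real (Suc n)) *\<^sub>R e" x] by simp
        then have "real (Suc n) * \<bar>f (x + (1 / real (Suc n)) *\<^sub>R e) - f x\<bar> \<le> real (Suc n) * (L * (1 / real (Suc n) * norm e))"
          by (intro mult_left_mono) auto
        also have "\<dots> = L * norm e" by simp
        finally show ?thesis using True by (simp add: abs_mult)
      next
        case False
        then have x: "R + norm e < norm x" by simp
        have "norm ((1 / real (Suc n)) *\<^sub>R e) \<le> norm e" by (simp add: field_simps mult_le_cancel_left1)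
        then have "R < norm (x + (1 / real (Suc n)) *\<^sub>R e)" "R < norm x"
          using x norm_diff_ineq[of x "(1 / real (Suc n)) *\<^sub>R e"] norm_ge_zero[of e] by linarith+
        then show ?thesis using L(6) False by simp
      qed
    qed
  qed measurable
  moreover have "(LINT x|lborel. ?d n x) = 0" for n
    using integral_lborel_translate[of f] fi by simp
  ultimately show ?thesis by (simp add: LIMSEQ_const_iff)
qed

section \<open>Pointwise Picone and Diaz-Saa inequalities\<close>

text \<open>Convexity is invoked on the open half-line only. If one of x, y is 0, the claim reduces
  to t^q <= t on [0, 1].\<close>

lemma powr_convex_combination:
  fixes q x y s :: real
  assumes q: "1 \<le> q" and xy: "0 \<le> x" "0 \<le> y" and s: "0 \<le> s" "s \<le> 1"
  shows "(s * x + (1 - s) * y) powr q \<le> s * x powr q + (1 - s) * y powr q"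
proof -
  have key: "(t * z) powr q \<le> t * z powr q" if "0 \<le> t" "t \<le> 1" "0 \<le> z" for t z :: real
  proof -
    have "t powr q \<le> t" 
      using that q powr_mono'[of 1 q t] by (cases "t = 0") auto
    then show ?thesis using that by (simp add: powr_mult mult_right_mono)
  qed
  show ?thesis
  proof (cases "x = 0 \<or> y = 0")
    case True
    then show ?thesis using key[of s x] key[of "1 - s" y] xy s by auto
  next
    case False
    then have "x \<in> {0<..}" "y \<in> {0<..}" using xy by auto
    from convex_onD[OF powr_convex[OF q], of "1 - s" x y] this s
    show ?thesis by simp
  qed
qed

text \<open>Young's inequality with the exponents q/(q-1) and q, multiplied by q. For q = 1 the
  conjugate exponent degenerates, whence the case split.\<close>

lemma young_powr:
  fixes q A B :: real
  assumes q: "1 \<le> q" and AB: "0 \<le> A" "0 \<le> B"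
  shows "q * A powr (q - 1) * B \<le> (q - 1) * A powr q + B powr q"
proof (cases "q = 1")
  case True
  then show ?thesis using AB by (auto simp: powr_def)
next
  case False
  then have q1: "q > 1" using q by simp
  have "A powr (q - 1) * B \<le> (A powr (q - 1)) powr (q / (q - 1)) / (q / (q - 1)) + B powr q / q"
    using q1 AB by (intro Youngs_inequality) (auto simp: field_simps)
  also have "(A powr (q - 1)) powr (q / (q - 1)) = A powr q"
    using q1 by (simp add: powr_powr)
  finally show ?thesis using q1 by (simp add: field_simps)
qed

lemma powr_diff_le:
  fixes q a b :: real
  assumes q: "1 \<le> q" and ab: "0 < a" "0 \<le> b"
  shows "a powr q - b powr q \<le> q * a powr (q - 1) * (a - b)"
proof -
  have "a powr (q - 1) * a = a powr q" using ab by (simp add: powr_diff)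
  then show ?thesis using young_powr[OF q, of a b] ab by (simp add: algebra_simps)
qed

text \<open>The right side minus the left side is (A^q - B^q) (A^(p-q) - B^(p-q)), and the two
  factors have the same sign. This is how the two Picone inequalities, one for each solution, are
  added up.\<close>

lemma powr_cross_le:
  fixes p q A B :: real
  assumes q: "0 \<le> q" "q \<le> p" and AB: "0 \<le> A" "0 \<le> B"
  shows "B powr q * A powr (p - q) + A powr q * B powr (p - q) \<le> A powr p + B powr p"
proof -
  have split: "z powr p = z powr q * z powr (p - q)" if "0 \<le> z" for z :: real
    using that by (cases "z = 0") (auto simp: powr_add[symmetric])
  have "0 \<le> (A powr q - B powr q) * (A powr (p - q) - B powr (p - q))"
  proof (cases "A \<le> B")
    case True
    then have "A powr q \<le> B powr q" "A powr (p - q) \<le> B powr (p - q)"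
      using q AB by (auto intro!: powr_mono2)
    then show ?thesis by (simp add: mult_nonpos_nonpos)
  next
    case False
    then have "B powr q \<le> A powr q" "B powr (p - q) \<le> A powr (p - q)"
      using q AB by (auto intro!: powr_mono2)
    then show ?thesis by simp
  qed
  then show ?thesis using split[of A] split[of B] AB by (simp add: algebra_simps)
qed

lemma inner_powr_norm_le:
  fixes \<xi> \<zeta> :: "'a::real_inner"
  shows "(norm \<xi> powr (p - 2) *\<^sub>R \<xi>) \<bullet> \<zeta> \<le> norm \<xi> powr (p - 1) * norm \<zeta>"
    and "\<bar>(norm \<xi> powr (p - 2) *\<^sub>R \<xi>) \<bullet> \<zeta>\<bar> \<le> norm \<xi> powr (p - 1) * norm \<zeta>"
proof -
  have "norm \<xi> powr (p - 1) = norm \<xi> powr (p - 2) * norm \<xi>"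
    by (cases "\<xi> = 0") (auto simp: powr_mult_base[symmetric] mult.commute[of _ "norm \<xi>"] powr_mult_base)
  then show *: "\<bar>(norm \<xi> powr (p - 2) *\<^sub>R \<xi>) \<bullet> \<zeta>\<bar> \<le> norm \<xi> powr (p - 1) * norm \<zeta>"
    using Cauchy_Schwarz_ineq2[of \<xi> \<zeta>] 
    by (simp add: abs_mult mult.assoc mult_left_mono)
  then show "(norm \<xi> powr (p - 2) *\<^sub>R \<xi>) \<bullet> \<zeta> \<le> norm \<xi> powr (p - 1) * norm \<zeta>" by linarith
qed

lemma inner_powr_norm_self:
  fixes \<xi> :: "'a::real_inner"
  shows "(norm \<xi> powr (p - 2) *\<^sub>R \<xi>) \<bullet> \<xi> = norm \<xi> powr p"
proof (cases "\<xi> = 0")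
  case False
  then have "norm \<xi> powr (p - 2) * norm \<xi> ^ 2 = norm \<xi> powr p"
    by (simp add: powr_diff)
  then show ?thesis by (simp add: power2_norm_eq_inner)
qed simp

text \<open>With t = b/a, \<xi> the gradient of a and \<zeta> the gradient of b, the left side pairs
  the flux of a with the gradient of b^q / a^(q-1), so this is Picone's inequality. After
  Cauchy-Schwarz and splitting off the power p - q of \<open>norm \<xi>\<close>, it is
  \<open>young_powr\<close> for the numbers t |\<xi>| and |\<zeta>|.\<close>

lemma picone_pointwise:
  fixes \<xi> \<zeta> :: "'a::real_inner"
  assumes q: "1 \<le> q" "q \<le> p" and t: "0 < t"
  shows "q * t powr (q - 1) * ((norm \<xi> powr (p - 2) *\<^sub>R \<xi>) \<bullet> \<zeta>) - (q - 1) * t powr q * norm \<xi> powr p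
           \<le> norm \<xi> powr (p - q) * norm \<zeta> powr q"
proof (cases "\<xi> = 0")
  case False
  let ?X = "norm \<xi>" and ?Z = "norm \<zeta>"
  have X: "0 < ?X" using False by simp
  have "q * t powr (q - 1) * ((?X powr (p - 2) *\<^sub>R \<xi>) \<bullet> \<zeta>) \<le> q * t powr (q - 1) * (?X powr (p - 1) * ?Z)"
    using q by (intro mult_left_mono inner_powr_norm_le) auto
  also have "\<dots> = ?X powr (p - q) * (q * (t * ?X) powr (q - 1) * ?Z)"
    using X t by (simp add: powr_mult powr_add[symmetric])
  also have "\<dots> \<le> ?X powr (p - q) * ((q - 1) * (t * ?X) powr q + ?Z powr q)"
    using t by (intro mult_left_mono young_powr q) auto
  also have "\<dots> = (q - 1) * t powr q * ?X powr p + ?X powr (p - q) * ?Z powr q"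
    using X t by (simp add: powr_mult algebra_simps powr_add[symmetric])
  finally show ?thesis by simp
qed simp

text \<open>The two vectors paired with the fluxes are the gradients of a - b^q a^(1-q) and of a^q
  b^(1-q) - b. Their diagonal parts produce |\<xi>|^p + |\<zeta>|^p; Picone's inequality, once for
  each order of a and b, bounds the rest, and \<open>powr_cross_le\<close> closes the gap.\<close>

lemma diaz_saa_pointwise:
  fixes \<xi> \<zeta> :: "'a::real_inner"
  assumes q: "1 \<le> q" "q \<le> p" and ab: "0 < a" "0 < b"
  shows "0 \<le> (norm \<xi> powr (p - 2) *\<^sub>R \<xi>) \<bullet>
               ((1 + (q - 1) * (b / a) powr q) *\<^sub>R \<xi> - (q * (b / a) powr (q - 1)) *\<^sub>R \<zeta>)
           - (norm \<zeta> powr (p - 2) *\<^sub>R \<zeta>) \<bullet>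
               ((q * (a / b) powr (q - 1)) *\<^sub>R \<xi> - (1 + (q - 1) * (a / b) powr q) *\<^sub>R \<zeta>)"
proof -
  have 1: "(norm \<xi> powr (p - 2) *\<^sub>R \<xi>) \<bullet>
             ((1 + (q - 1) * (b / a) powr q) *\<^sub>R \<xi> - (q * (b / a) powr (q - 1)) *\<^sub>R \<zeta>)
      = (1 + (q - 1) * (b / a) powr q) * norm \<xi> powr p
         - q * (b / a) powr (q - 1) * ((norm \<xi> powr (p - 2) *\<^sub>R \<xi>) \<bullet> \<zeta>)"
    unfolding inner_diff_right inner_scaleR_right inner_powr_norm_self by simp
  have 2: "(norm \<zeta> powr (p - 2) *\<^sub>R \<zeta>) \<bullet>
             ((q * (a / b) powr (q - 1)) *\<^sub>R \<xi> - (1 + (q - 1) * (a / b) powr q) *\<^sub>R \<zeta>)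
      = q * (a / b) powr (q - 1) * ((norm \<zeta> powr (p - 2) *\<^sub>R \<zeta>) \<bullet> \<xi>)
         - (1 + (q - 1) * (a / b) powr q) * norm \<zeta> powr p"
    unfolding inner_diff_right inner_scaleR_right inner_powr_norm_self by simp
  have 3: "q * (b / a) powr (q - 1) * ((norm \<xi> powr (p - 2) *\<^sub>R \<xi>) \<bullet> \<zeta>) - (q - 1) * (b / a) powr q * norm \<xi> powr p
           \<le> norm \<xi> powr (p - q) * norm \<zeta> powr q"
    by (rule picone_pointwise) (use q ab in auto)
  have 4: "q * (a / b) powr (q - 1) * ((norm \<zeta> powr (p - 2) *\<^sub>R \<zeta>) \<bullet> \<xi>) - (q - 1) * (a / b) powr q * norm \<zeta> powr p
           \<le> norm \<zeta> powr (p - q) * norm \<xi> powr q"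
    by (rule picone_pointwise) (use q ab in auto)
  have 5: "norm \<zeta> powr q * norm \<xi> powr (p - q) + norm \<xi> powr q * norm \<zeta> powr (p - q) \<le> norm \<xi> powr p + norm \<zeta> powr p"
    by (rule powr_cross_le) (use q in auto)
  show ?thesis unfolding 1 2 using 3 4 5 by (simp add: algebra_simps)
qed

section \<open>Signed powers and the discrete Picone inequality\<close>

lemma signed_pow_nonneg: "0 \<le> x \<Longrightarrow> signed_pow x r = x powr r"
  by (cases "x = 0") (auto simp: signed_pow_def powr_diff)

lemma signed_pow_minus: "signed_pow (- x) r = - signed_pow x r"
  by (simp add: signed_pow_def)

lemma signed_pow_nonpos: "x \<le> 0 \<Longrightarrow> signed_pow x r = - ((- x) powr r)"
  using signed_pow_nonneg[of "- x" r] signed_pow_minus[of x r] by simp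

lemma abs_signed_pow: "\<bar>signed_pow x r\<bar> = \<bar>x\<bar> powr r"
  by (cases "0 \<le> x") (auto simp: signed_pow_nonneg signed_pow_nonpos)

lemma signed_pow_mult_self: "signed_pow x (p - 1) * x = \<bar>x\<bar> powr p"
proof (cases "x = 0")
  case False
  then have "\<bar>x\<bar> powr (p - 2) * \<bar>x\<bar> ^ 2 = \<bar>x\<bar> powr p" by (simp add: powr_diff)
  then show ?thesis by (simp add: signed_pow_def power2_eq_square mult.assoc)
qed (simp add: signed_pow_def)

text \<open>For c < a and e < b the number b/a is the convex combination of e/c and (b-e)/(a-c) with
  weights c/a and 1 - c/a. Convexity of t^q, multiplied by a, bounds the Picone difference by
  (b-e)^q (a-c)^(1-q). If b <= e that difference is nonpositive.\<close>

lemma discrete_picone: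
  fixes a b c e p q :: real
  assumes q: "1 \<le> q" "q \<le> p" and pos: "0 < a" "0 < c" "0 < b" "0 < e"
  shows "signed_pow (a - c) (p - 1) * (b powr q * a powr (1 - q) - e powr q * c powr (1 - q))
           \<le> \<bar>b - e\<bar> powr q * \<bar>a - c\<bar> powr (p - q)"
  using pos
proof (induction a c arbitrary: b e rule: linorder_wlog)
  case (sym a c)
  have "signed_pow (a - c) (p - 1) = - signed_pow (c - a) (p - 1)"
    using signed_pow_minus[of "c - a" "p - 1"] by simp
  then show ?case using sym(1)[of e b] sym(2-) 
    by (simp add: abs_minus_commute algebra_simps)
next
  case (le c a)
  \<comment> \<open>In this case of the reduction a and c appear with exchanged roles. The strict
    case is therefore proved for fresh variables and afterwards reflected by the oddness of
    \<open>signed_pow\<close>.\<close>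
  have *: "signed_pow (a - c) (p - 1) * (b powr q * a powr (1 - q) - e powr q * c powr (1 - q))
           \<le> \<bar>b - e\<bar> powr q * \<bar>a - c\<bar> powr (p - q)"
    if ca: "c < a" and pos: "0 < a" "0 < c" "0 < b" "0 < e" for a b c e
  proof -
  have split: "signed_pow (a - c) (p - 1) = (a - c) powr (p - q) * (a - c) powr (q - 1)"
    using ca by (simp add: signed_pow_nonneg powr_add[symmetric])
  have "(a - c) powr (q - 1) * (b powr q * a powr (1 - q) - e powr q * c powr (1 - q)) \<le> \<bar>b - e\<bar> powr q"
  proof (cases "b \<le> e")
    case True
    have "b powr q * a powr (1 - q) \<le> e powr q * c powr (1 - q)"
      using True ca pos q by (intro mult_mono powr_mono2 powr_mono2') auto
    then have "(a - c) powr (q - 1) * (b powr q * a powr (1 - q) - e powr q * c powr (1 - q)) \<le> 0"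
      by (simp add: mult_nonneg_nonpos)
    also have "0 \<le> \<bar>b - e\<bar> powr q" by simp
    finally show ?thesis .
  next
    case False
    \<comment> \<open>The weight for which s (e/c) + (1-s) (b-e)/(a-c) collapses to b/a.\<close>
    define s where "s = c / a"
    have s: "0 < s" "s < 1" using ca pos by (auto simp: s_def)
    have eq: "s * (e / c) + (1 - s) * ((b - e) / (a - c)) = b / a"
      using ca pos by (simp add: s_def divide_simps)
    have "(b / a) powr q \<le> s * (e / c) powr q + (1 - s) * ((b - e) / (a - c)) powr q"
      using powr_convex_combination[OF q(1), of "e / c" "(b - e) / (a - c)" s] eq False ca pos s by simp
    then have "a * (b / a) powr q \<le> a * (s * (e / c) powr q + (1 - s) * ((b - e) / (a - c)) powr q)"
      using pos by (intro mult_left_mono) auto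
    also have "\<dots> = c * (e / c) powr q + (a - c) * ((b - e) / (a - c)) powr q"
      using pos ca by (simp add: s_def divide_simps)
    finally have "a * (b / a) powr q \<le> c * (e / c) powr q + (a - c) * ((b - e) / (a - c)) powr q" .
    moreover have "z * (y / z) powr q = y powr q * z powr (1 - q)" if "0 < z" "0 < y" for y z :: real
      using that by (simp add: powr_divide powr_diff)
    ultimately have "b powr q * a powr (1 - q) \<le> e powr q * c powr (1 - q) + (b - e) powr q * (a - c) powr (1 - q)"
      using pos ca False by simp
    then have "(a - c) powr (q - 1) * (b powr q * a powr (1 - q) - e powr q * c powr (1 - q)) 
       \<le> (a - c) powr (q - 1) * ((b - e) powr q * (a - c) powr (1 - q))"
      by (intro mult_left_mono) auto
    also have "\<dots> = (b - e) powr q * ((a - c) powr (q - 1) * (a - c) powr (1 - q))" by simp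
    also have "(a - c) powr (q - 1) * (a - c) powr (1 - q) = 1" using ca by (simp add: powr_add[symmetric])
    finally show ?thesis using False by simp
  qed
  from mult_left_mono[OF this, of "(a - c) powr (p - q)"]
  show ?thesis unfolding split using ca by (simp add: mult.assoc mult.commute mult.left_commute)
  qed
  show ?case
  proof (cases "a = c")
    case True then show ?thesis by (simp add: signed_pow_def)
  next
    case False
    have "signed_pow (- (c - a)) (p - 1) * (e powr q * a powr (1 - q) - b powr q * c powr (1 - q))
           \<le> \<bar>b - e\<bar> powr q * \<bar>a - c\<bar> powr (p - q)"
      using *[of c a e b] le False by (simp add: abs_minus_commute)
    then show ?thesis unfolding signed_pow_minus by (simp add: algebra_simps abs_minus_commute)
  qed
qed

text \<open>For positive arguments this is (a^q - b^q)^+ / a^(q-1). The power of a is multiplied out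
  so that the test appears as a minus the Picone quotient b^q / a^(q-1); \<open>sup_test\<close> is
  treated in the same way.\<close>

definition sub_test :: "real \<Rightarrow> real \<Rightarrow> real \<Rightarrow> real" where
  "sub_test q a b = (if b < a then a - b powr q * a powr (1 - q) else 0)"

definition sup_test :: "real \<Rightarrow> real \<Rightarrow> real \<Rightarrow> real" where
  "sup_test q a b = (if b < a then a powr q * b powr (1 - q) - b else 0)"

lemma test_eq:
  assumes "0 < a" "0 < b" "0 < q"
  shows "sub_test q a b = max 0 (a powr q - b powr q) * a powr (1 - q)" 
    and "sup_test q a b = max 0 (a powr q - b powr q) * b powr (1 - q)"
proof -
  have *: "a powr q * a powr (1 - q) = a" "b powr q * b powr (1 - q) = b"
    using assms by (simp_all add: powr_add[symmetric])
  have **: "b < a \<longleftrightarrow> b powr q < a powr q"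
    using assms powr_less_mono2[of q] by (metis less_eq_real_def linorder_neqE_linordered_idom not_less_iff_gr_or_eq)
  show "sub_test q a b = max 0 (a powr q - b powr q) * a powr (1 - q)"
    "sup_test q a b = max 0 (a powr q - b powr q) * b powr (1 - q)"
    using * ** by (auto simp: sub_test_def sup_test_def max_def algebra_simps)
qed

lemma test_nonneg:
  assumes "0 < a" "0 < b" "0 < q"
  shows "0 \<le> sub_test q a b" "0 \<le> sup_test q a b"
  using test_eq[OF assms] by simp_all

text \<open>This handles a pair of points of which only the first is active. The tests at the second
  point vanish, the factor (a^q - b^q)^+ is common to both sides, and the coefficients below remain.
  Unless e < b, signs or plain monotonicity decide.\<close>

lemma one_active:
  fixes a b c e p q :: real
  assumes q: "1 \<le> q" "q < p" and pos: "0 < a" "0 < c" "0 < b" "0 < e" and act: "b < a" "c \<le> e"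
  shows "signed_pow (b - e) (p - 1) * b powr (1 - q) \<le> signed_pow (a - c) (p - 1) * a powr (1 - q)"
proof -
  consider "b \<le> e" "c \<le> a" | "b \<le> e" "a < c" | "e < b" using act by linarith
  then show ?thesis
  proof cases
    case 1
    then have "signed_pow (b - e) (p - 1) \<le> 0" "0 \<le> signed_pow (a - c) (p - 1)"
      by (simp_all add: signed_pow_nonneg signed_pow_nonpos)
    then show ?thesis by (meson mult_nonpos_nonneg mult_nonneg_nonneg order_trans powr_ge_zero)
  next
    case 2
    have "(c - a) powr (p - 1) * a powr (1 - q) \<le> (e - b) powr (p - 1) * b powr (1 - q)"
      using 2 act pos q by (intro mult_mono powr_mono2 powr_mono2') auto
    then show ?thesis using 2 by (simp add: signed_pow_nonpos)
  next
    case 3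
    have ca: "c < a" using 3 act by linarith
    \<comment> \<open>In this form the coefficient is increasing in z, as q < p, and decreasing in
      the ratio y/z. So b < a and c/a <= e/b settle the case.\<close>
    have split: "(z - y) powr (p - 1) * z powr (1 - q) = (1 - y / z) powr (p - 1) * z powr (p - q)"
      if "0 < y" "y < z" for y z :: real
    proof -
      have "(1 - y / z) powr (p - 1) = (z - y) powr (p - 1) / z powr (p - 1)"
        using that by (simp add: powr_divide[symmetric] diff_divide_distrib)
      moreover have "z powr (p - q) = z powr (p - 1) * z powr (1 - q)" by (simp add: powr_add[symmetric])
      ultimately show ?thesis using that by simp
    qed
    have "c / a \<le> e / b" using act pos by (intro frac_le) auto
    then have "(1 - e / b) powr (p - 1) * b powr (p - q) \<le> (1 - c / a) powr (p - 1) * a powr (p - q)"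
      using 3 act pos q by (intro mult_mono powr_mono2) auto
    then show ?thesis using split[of e b] split[of c a] 3 ca pos by (simp add: signed_pow_nonneg)
  qed
qed

text \<open>A point is active if the first solution exceeds the second there. With both points
  active this is two discrete Picone inequalities joined by \<open>powr_cross_le\<close>; with one
  active it is \<open>one_active\<close>, up to exchanging the points; with none active everything
  is 0.\<close>

lemma nonlocal_diaz_saa:
  fixes a b c e p q :: real
  assumes q: "1 \<le> q" "q < p" and pos: "0 < a" "0 < b" "0 < c" "0 < e"
  shows "0 \<le> signed_pow (a - c) (p - 1) * (sub_test q a b - sub_test q c e)
            - signed_pow (b - e) (p - 1) * (sup_test q a b - sup_test q c e)"
proof -
  have one: "0 \<le> signed_pow (a - c) (p - 1) * (sub_test q a b - sub_test q c e)
            - signed_pow (b - e) (p - 1) * (sup_test q a b - sup_test q c e)"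
    if "b < a" "c \<le> e" and pos: "0 < a" "0 < b" "0 < c" "0 < e" for a b c e
  proof -
    have 0: "sub_test q c e = 0" "sup_test q c e = 0" using that by (auto simp: sub_test_def sup_test_def)
    let ?m = "max 0 (a powr q - b powr q)"
    have "signed_pow (b - e) (p - 1) * b powr (1 - q) * ?m \<le> signed_pow (a - c) (p - 1) * a powr (1 - q) * ?m"
      using one_active[OF q, of a c b e] that by (intro mult_right_mono) auto
    then show ?thesis unfolding 0 using pos q by (simp add: test_eq algebra_simps)
  qed
  consider "b < a" "e < c" | "b < a" "c \<le> e" | "a \<le> b" "e < c" | "a \<le> b" "c \<le> e" by linarith
  then show ?thesis
  proof cases
    case 1
    have t: "sub_test q a b = a - b powr q * a powr (1 - q)" "sub_test q c e = c - e powr q * c powr (1 - q)"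
      "sup_test q a b = a powr q * b powr (1 - q) - b" "sup_test q c e = c powr q * e powr (1 - q) - e"
      using 1 by (auto simp: sub_test_def sup_test_def)
    have A: "signed_pow (a - c) (p - 1) * (b powr q * a powr (1 - q) - e powr q * c powr (1 - q))
           \<le> \<bar>b - e\<bar> powr q * \<bar>a - c\<bar> powr (p - q)"
      using q pos by (intro discrete_picone) auto
    have B: "signed_pow (b - e) (p - 1) * (a powr q * b powr (1 - q) - c powr q * e powr (1 - q))
           \<le> \<bar>a - c\<bar> powr q * \<bar>b - e\<bar> powr (p - q)"
      using q pos by (intro discrete_picone) auto
    have C: "\<bar>b - e\<bar> powr q * \<bar>a - c\<bar> powr (p - q) + \<bar>a - c\<bar> powr q * \<bar>b - e\<bar> powr (p - q) \<le> \<bar>a - c\<bar> powr p + \<bar>b - e\<bar> powr p"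
      by (rule powr_cross_le) (use q in auto)
    have "signed_pow (a - c) (p - 1) * (sub_test q a b - sub_test q c e)
            - signed_pow (b - e) (p - 1) * (sup_test q a b - sup_test q c e)
       = signed_pow (a - c) (p - 1) * (a - c) + signed_pow (b - e) (p - 1) * (b - e)
         - signed_pow (a - c) (p - 1) * (b powr q * a powr (1 - q) - e powr q * c powr (1 - q))
         - signed_pow (b - e) (p - 1) * (a powr q * b powr (1 - q) - c powr q * e powr (1 - q))"
      unfolding t by (simp add: algebra_simps)
    then show ?thesis using A B C unfolding signed_pow_mult_self by linarith
  next
    case 2 then show ?thesis using one pos by blast
  next
    case 3
    have "0 \<le> signed_pow (- (a - c)) (p - 1) * (sub_test q c e - sub_test q a b)
            - signed_pow (- (b - e)) (p - 1) * (sup_test q c e - sup_test q a b)"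
      using one[of e c a b] 3 pos by simp
    then show ?thesis unfolding signed_pow_minus by (simp add: algebra_simps)
  next
    case 4 then show ?thesis by (simp add: sub_test_def sup_test_def)
  qed
qed

text \<open>The profile t - b^q t^(1-q) has derivative 1 + (q-1) (b/t)^q, which lies between 1 and q
  for t >= b. The upper bound is obtained without calculus from Young's inequality applied to 1 and
  c/a.\<close>

lemma sub_profile_mono:
  fixes a b c q :: real
  assumes q: "1 \<le> q" and b: "0 < b" "b \<le> c" "c \<le> a"
  shows "c - b powr q * c powr (1 - q) \<le> a - b powr q * a powr (1 - q)"
    and "(a - b powr q * a powr (1 - q)) - (c - b powr q * c powr (1 - q)) \<le> q * (a - c)"
proof -
  have pos: "0 < c" "0 < a" using b by auto
  have le: "a powr (1 - q) \<le> c powr (1 - q)" using q b pos by (intro powr_mono2') auto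
  then have "b powr q * a powr (1 - q) \<le> b powr q * c powr (1 - q)" by (intro mult_left_mono) auto
  then show "c - b powr q * c powr (1 - q) \<le> a - b powr q * a powr (1 - q)" using b by linarith
  have y: "q * (c / a) \<le> (q - 1) + (c / a) powr q"
    using young_powr[OF q, of 1 "c / a"] pos by simp
  have "a * (c / a) powr q = c powr q * a powr (1 - q)"
    using pos by (simp add: powr_divide powr_diff)
  moreover have "a * (q * (c / a)) \<le> a * ((q - 1) + (c / a) powr q)" using y pos by (intro mult_left_mono) auto
  moreover have "a * (q * (c / a)) = q * c" using pos by simp
  ultimately have "q * c \<le> (q - 1) * a + c powr q * a powr (1 - q)" by (simp add: algebra_simps)
  moreover have "c powr q * c powr (1 - q) = c" using pos by (simp add: powr_add[symmetric])
  ultimately have "c powr q * (c powr (1 - q) - a powr (1 - q)) \<le> (q - 1) * (a - c)" by (simp add: algebra_simps)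
  moreover have "b powr q * (c powr (1 - q) - a powr (1 - q)) \<le> c powr q * (c powr (1 - q) - a powr (1 - q))"
    using le b q by (intro mult_right_mono powr_mono2) auto
  ultimately show "(a - b powr q * a powr (1 - q)) - (c - b powr q * c powr (1 - q)) \<le> q * (a - c)"
    by (simp add: algebra_simps)
qed

text \<open>The constant q does not depend on lower bounds for the arguments, so the estimates built
  on it are uniform in the shift and in the truncation height. One variable is moved at a time, and
  its interval is split at the diagonal a = b, where the test vanishes.\<close>

lemma sub_test_lipschitz:
  fixes a b c e q :: real
  assumes q: "1 \<le> q" and pos: "0 < a" "0 < b" "0 < c" "0 < e"
  shows "\<bar>sub_test q a b - sub_test q c e\<bar> \<le> q * (\<bar>a - c\<bar> + \<bar>b - e\<bar>)"
proof -
  have one: "b powr q * b powr (1 - q) = b" if "0 < b" for b :: real using that by (simp add: powr_add[symmetric])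
  have A: "\<bar>sub_test q a b - sub_test q c b\<bar> \<le> q * \<bar>a - c\<bar>" if "0 < b" "0 < c" "c \<le> a" for a b c
  proof -
    consider "b \<le> c" | "c < b" "b < a" | "a \<le> b" by linarith
    then show ?thesis
    proof cases
      case 1
      then have "sub_test q a b = a - b powr q * a powr (1 - q)" "sub_test q c b = c - b powr q * c powr (1 - q)"
        using one[OF that(1)] that 1 by (cases "a = b"; cases "c = b"; auto simp: sub_test_def)+
      then show ?thesis using sub_profile_mono[OF q, of b c a] 1 that by simp
    next
      case 2
      then have "sub_test q a b = a - b powr q * a powr (1 - q)" "sub_test q c b = b - b powr q * b powr (1 - q)"
        using one[OF that(1)] by (auto simp: sub_test_def)
      then have "\<bar>sub_test q a b - sub_test q c b\<bar> \<le> q * (a - b)" using sub_profile_mono[OF q, of b b a] 2 that by simp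
      also have "\<dots> \<le> q * \<bar>a - c\<bar>" using 2 q by (intro mult_left_mono) auto
      finally show ?thesis .
    next
      case 3 then show ?thesis using that q by (simp add: sub_test_def)
    qed
  qed
  have A': "\<bar>sub_test q a b - sub_test q c b\<bar> \<le> q * \<bar>a - c\<bar>" if "0 < b" "0 < c" "0 < a" for a b c
    using A[of b c a] A[of b a c] that by (cases "c \<le> a") (auto simp: abs_minus_commute)
  have B0: "\<bar>c powr (1 - q) * (b powr q - e powr q)\<bar> \<le> q * \<bar>b - e\<bar>" if "0 < e" "e \<le> b" "b \<le> c" for b c e
  proof -
    have "c powr (1 - q) * (b powr q - e powr q) \<le> c powr (1 - q) * (q * b powr (q - 1) * (b - e))"
      using that by (intro mult_left_mono powr_diff_le q) auto
    also have "\<dots> = (q * (b - e)) * (c powr (1 - q) * b powr (q - 1))" by simp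
    also have "c powr (1 - q) * b powr (q - 1) \<le> c powr (1 - q) * c powr (q - 1)"
      using that q by (intro mult_left_mono powr_mono2) auto
    also have "c powr (1 - q) * c powr (q - 1) = 1" using that by (simp add: powr_add[symmetric])
    finally have "c powr (1 - q) * (b powr q - e powr q) \<le> q * (b - e)" using that q by (simp add: mult_left_mono)
    moreover have "0 \<le> c powr (1 - q) * (b powr q - e powr q)"
      using that q by (simp add: powr_mono2)
    ultimately show ?thesis using that by simp
  qed
  have B: "\<bar>sub_test q c b - sub_test q c e\<bar> \<le> q * \<bar>b - e\<bar>" if "0 < c" "0 < e" "e \<le> b" for b c e
  proof -
    consider "b \<le> c" | "e < c" "c < b" | "c \<le> e" by linarith
    then show ?thesis
    proof cases
      case 1
      then have "sub_test q c b = c - b powr q * c powr (1 - q)" "sub_test q c e = c - e powr q * c powr (1 - q)"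
        using one[OF that(1)] that 1 by (cases "b = c"; cases "e = c"; auto simp: sub_test_def)+
      then have "sub_test q c b - sub_test q c e = - (c powr (1 - q) * (b powr q - e powr q))" by (simp add: algebra_simps)
      then show ?thesis using B0[of e b c] 1 that by simp
    next
      case 2
      then have "sub_test q c b = c - c powr q * c powr (1 - q)" "sub_test q c e = c - e powr q * c powr (1 - q)"
        using one[OF that(1)] that by (auto simp: sub_test_def)
      then have "sub_test q c b - sub_test q c e = - (c powr (1 - q) * (c powr q - e powr q))" by (simp add: algebra_simps)
      then have "\<bar>sub_test q c b - sub_test q c e\<bar> \<le> q * \<bar>c - e\<bar>" using B0[of e c c] 2 that by simp
      also have "\<dots> \<le> q * \<bar>b - e\<bar>" using 2 q by (intro mult_left_mono) auto
      finally show ?thesis .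
    next
      case 3 then show ?thesis using that q by (simp add: sub_test_def)
    qed
  qed
  have B': "\<bar>sub_test q c b - sub_test q c e\<bar> \<le> q * \<bar>b - e\<bar>" if "0 < c" "0 < e" "0 < b" for b c e
    using B[of c e b] B[of c b e] that by (cases "e \<le> b") (auto simp: abs_minus_commute)
  have "\<bar>sub_test q a b - sub_test q c e\<bar> \<le> \<bar>sub_test q a b - sub_test q c b\<bar> + \<bar>sub_test q c b - sub_test q c e\<bar>" by linarith
  also have "\<dots> \<le> q * \<bar>a - c\<bar> + q * \<bar>b - e\<bar>" using A'[of b c a] B'[of c e b] pos by linarith
  finally show ?thesis by (simp add: algebra_simps)
qed

lemma sub_test_le:
  assumes "1 \<le> q" "0 < a" "0 < b"
  shows "sub_test q a b \<le> q * \<bar>a - b\<bar>" and "sub_test q a b \<le> a"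
  using sub_test_lipschitz[OF assms(1), of a b b b] assms by (auto simp: sub_test_def)

text \<open>Cutting \<open>u\<close> off at height \<open>k\<close> costs only a term supported where \<open>u\<close> exceeds \<open>k\<close>,
  because the truncated difference has the same sign as, and is no larger than, the original one.\<close>

lemma truncated_nonlocal_diaz_saa:
  fixes u v u' v' k \<epsilon> p q :: real
  assumes q: "1 \<le> q" "q < p" and nn: "0 \<le> u" "0 \<le> v" "0 \<le> u'" "0 \<le> v'" and k: "0 < k" "0 < \<epsilon>"
  defines "a \<equiv> min u k + \<epsilon>" and "b \<equiv> v + \<epsilon>" and "c \<equiv> min u' k + \<epsilon>" and "e \<equiv> v' + \<epsilon>"
  shows "0 \<le> signed_pow (u - u') (p - 1) * (sub_test q a b - sub_test q c e)
            - signed_pow (v - v') (p - 1) * (sup_test q a b - sup_test q c e)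
            + q * \<bar>u - u'\<bar> powr (p - 1) * (\<bar>u - u'\<bar> + \<bar>v - v'\<bar>) * (if k < u \<or> k < u' then 1 else 0)"
proof -
  let ?S = "sub_test q a b - sub_test q c e"
  have pos: "0 < a" "0 < b" "0 < c" "0 < e" using nn k by (auto simp: a_def b_def c_def e_def)
  have base: "0 \<le> signed_pow (a - c) (p - 1) * ?S - signed_pow (v - v') (p - 1) * (sup_test q a b - sup_test q c e)"
    using nonlocal_diaz_saa[OF q pos] by (simp add: b_def e_def)
  show ?thesis
  proof (cases "k < u \<or> k < u'")
    case False
    then show ?thesis using base by (simp add: a_def c_def min_def split: if_splits)
  next
    case True
    have d1: "\<bar>signed_pow (u - u') (p - 1) - signed_pow (a - c) (p - 1)\<bar> \<le> \<bar>u - u'\<bar> powr (p - 1)"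
    proof (cases "u' \<le> u")
      case True
      then have "0 \<le> a - c" "a - c \<le> u - u'" by (auto simp: a_def c_def min_def)
      then have "(a - c) powr (p - 1) \<le> (u - u') powr (p - 1)" using q by (intro powr_mono2) auto
      then show ?thesis using \<open>0 \<le> a - c\<close> True by (simp add: signed_pow_nonneg)
    next
      case False
      then have "0 \<le> c - a" "c - a \<le> u' - u" by (auto simp: a_def c_def min_def)
      then have "(c - a) powr (p - 1) \<le> (u' - u) powr (p - 1)" using q by (intro powr_mono2) auto
      then show ?thesis using \<open>0 \<le> c - a\<close> False by (simp add: signed_pow_nonpos)
    qed
    have d2: "\<bar>?S\<bar> \<le> q * (\<bar>u - u'\<bar> + \<bar>v - v'\<bar>)"
    proof -
      have "\<bar>a - c\<bar> \<le> \<bar>u - u'\<bar>" by (auto simp: a_def c_def min_def)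
      moreover have "\<bar>b - e\<bar> = \<bar>v - v'\<bar>" by (simp add: b_def e_def)
      ultimately have "q * (\<bar>a - c\<bar> + \<bar>b - e\<bar>) \<le> q * (\<bar>u - u'\<bar> + \<bar>v - v'\<bar>)" using q by (intro mult_left_mono) auto
      then show ?thesis using sub_test_lipschitz[OF q(1) pos] by linarith
    qed
    have "\<bar>(signed_pow (u - u') (p - 1) - signed_pow (a - c) (p - 1)) * ?S\<bar>
       \<le> \<bar>u - u'\<bar> powr (p - 1) * (q * (\<bar>u - u'\<bar> + \<bar>v - v'\<bar>))"
      unfolding abs_mult using d1 d2 by (intro mult_mono) auto
    then have "0 \<le> (signed_pow (u - u') (p - 1) - signed_pow (a - c) (p - 1)) * ?S
       + q * \<bar>u - u'\<bar> powr (p - 1) * (\<bar>u - u'\<bar> + \<bar>v - v'\<bar>)"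
      unfolding abs_le_iff by (simp add: algebra_simps)
    then show ?thesis using base True by (simp add: algebra_simps)
  qed
qed

section \<open>Approximation by test functions in the Sobolev norm\<close>

lemma powr_add_le:
  fixes a b p :: real
  assumes "0 \<le> a" "0 \<le> b" "0 \<le> p"
  shows "(a + b) powr p \<le> 2 powr p * (a powr p + b powr p)"
proof -
  have "(a + b) powr p \<le> (2 * max a b) powr p" using assms by (intro powr_mono2) auto
  also have "\<dots> = 2 powr p * max a b powr p" using assms by (simp add: powr_mult)
  also have "\<dots> \<le> 2 powr p * (a powr p + b powr p)" by (intro mult_left_mono) (auto simp: max_def)
  finally show ?thesis .
qed

lemma Lq_add:
  fixes f g :: "'a::euclidean_space \<Rightarrow> 'b::euclidean_space"
  assumes "f \<in> Lq \<Omega> p" "g \<in> Lq \<Omega> p" "0 \<le> p"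
  shows "(\<lambda>x. f x + g x) \<in> Lq \<Omega> p"
proof -
  have [measurable]: "f \<in> borel_measurable (lebesgue_on \<Omega>)" "g \<in> borel_measurable (lebesgue_on \<Omega>)"
    and i: "integrable (lebesgue_on \<Omega>) (\<lambda>x. norm (f x) powr p)" "integrable (lebesgue_on \<Omega>) (\<lambda>x. norm (g x) powr p)"
    using assms by (auto simp: Lq_def)
  have "integrable (lebesgue_on \<Omega>) (\<lambda>x. norm (f x + g x) powr p)"
  proof (rule Bochner_Integration.integrable_bound)
    show "integrable (lebesgue_on \<Omega>) (\<lambda>x. 2 powr p * (norm (f x) powr p + norm (g x) powr p))" using i by simp
    have "norm (f x + g x) powr p \<le> 2 powr p * (norm (f x) powr p + norm (g x) powr p)" for x
      using powr_add_le[of "norm (f x)" "norm (g x)" p] assms(3) norm_triangle_ineq[of "f x" "g x"]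
      by (meson norm_ge_zero order_trans powr_mono2)
    then show "AE x in lebesgue_on \<Omega>. norm (norm (f x + g x) powr p) \<le> norm (2 powr p * (norm (f x) powr p + norm (g x) powr p))"
      by (auto intro!: AE_I2 order_trans[OF _ abs_ge_self])
  qed measurable
  then show ?thesis by (auto simp: Lq_def)
qed

lemma Lq_scale:
  fixes f :: "'a::euclidean_space \<Rightarrow> 'b::euclidean_space"
  assumes "f \<in> Lq \<Omega> p"
  shows "(\<lambda>x. c *\<^sub>R f x) \<in> Lq \<Omega> p"
  using assms by (auto simp: Lq_def powr_mult)

lemma Lq_diff:
  fixes f g :: "'a::euclidean_space \<Rightarrow> 'b::euclidean_space"
  assumes "f \<in> Lq \<Omega> p" "g \<in> Lq \<Omega> p" "0 \<le> p"
  shows "(\<lambda>x. f x - g x) \<in> Lq \<Omega> p"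
  using Lq_add[OF assms(1) Lq_scale[OF assms(2), of "-1"] assms(3)] by simp

lemma Lq_bound:
  fixes f :: "'a::euclidean_space \<Rightarrow> 'b::euclidean_space" and g :: "'a \<Rightarrow> 'c::euclidean_space"
  assumes "g \<in> Lq \<Omega> p" "f \<in> borel_measurable (lebesgue_on \<Omega>)" "0 \<le> p" "0 \<le> C"
    and "AE x in lebesgue_on \<Omega>. norm (f x) \<le> C * norm (g x)"
  shows "f \<in> Lq \<Omega> p"
proof -
  have [measurable]: "g \<in> borel_measurable (lebesgue_on \<Omega>)" 
    and i: "integrable (lebesgue_on \<Omega>) (\<lambda>x. norm (g x) powr p)" using assms(1) by (auto simp: Lq_def)
  have "integrable (lebesgue_on \<Omega>) (\<lambda>x. norm (f x) powr p)"
  proof (rule Bochner_Integration.integrable_bound)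
    show "integrable (lebesgue_on \<Omega>) (\<lambda>x. C powr p * norm (g x) powr p)" using i by simp
    show "AE x in lebesgue_on \<Omega>. norm (norm (f x) powr p) \<le> norm (C powr p * norm (g x) powr p)"
      using assms(5)
    proof eventually_elim
      case (elim x)
      then have "norm (f x) powr p \<le> (C * norm (g x)) powr p" using assms(3) by (intro powr_mono2) auto
      then show ?case using assms(4) by (simp add: powr_mult abs_mult)
    qed
  qed (use assms(2) in measurable)
  then show ?thesis using assms(2) by (simp add: Lq_def)
qed

lemma Lq_bounded:
  fixes f :: "'a::euclidean_space \<Rightarrow> 'b::euclidean_space"
  assumes "f \<in> borel_measurable (lebesgue_on \<Omega>)" "AE x in lebesgue_on \<Omega>. norm (f x) \<le> C"
    and "finite_measure (lebesgue_on \<Omega>)" "0 \<le> p"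
  shows "f \<in> Lq \<Omega> p"
proof -
  interpret finite_measure "lebesgue_on \<Omega>" by fact
  have "(\<lambda>x. 1::real) \<in> Lq \<Omega> p" by (simp add: Lq_def)
  then show ?thesis 
    by (rule Lq_bound[where C = "max 0 C"]) (use assms in \<open>auto elim!: eventually_mono\<close>)
qed

lemma Lq_cong_AE:
  assumes "f \<in> Lq \<Omega> p" "AE x in lebesgue_on \<Omega>. f x = g x" "g \<in> borel_measurable (lebesgue_on \<Omega>)" "0 \<le> p"
  shows "g \<in> Lq \<Omega> p"
  by (rule Lq_bound[OF assms(1,3,4), of 1]) (use assms(2) in auto)

lemma Lq_exponent_mono:
  fixes f :: "'a::euclidean_space \<Rightarrow> 'b::euclidean_space"
  assumes "f \<in> Lq \<Omega> q" "finite_measure (lebesgue_on \<Omega>)" "0 \<le> p" "p \<le> q"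
  shows "f \<in> Lq \<Omega> p"
proof -
  interpret finite_measure "lebesgue_on \<Omega>" by fact
  have [measurable]: "f \<in> borel_measurable (lebesgue_on \<Omega>)" using assms(1) by (simp add: Lq_def)
  have "integrable (lebesgue_on \<Omega>) (\<lambda>x. norm (f x) powr p)"
  proof (rule Bochner_Integration.integrable_bound)
    show "integrable (lebesgue_on \<Omega>) (\<lambda>x. 1 + norm (f x) powr q)" using assms(1) by (auto simp: Lq_def)
    have "t powr p \<le> 1 + t powr q" if "0 \<le> t" for t :: real
    proof (cases "t \<le> 1")
      case True
      then have "t powr p \<le> 1 powr p" using that assms by (intro powr_mono2) auto
      then have "t powr p \<le> 1" by simp
      then show ?thesis using powr_ge_zero[of t q] by linarith
    next
      case False
      then have "t powr p \<le> t powr q" using assms by (intro powr_mono) auto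
      then show ?thesis by simp
    qed
    then show "AE x in lebesgue_on \<Omega>. norm (norm (f x) powr p) \<le> norm (1 + norm (f x) powr q)" by simp
  qed measurable
  then show ?thesis by (auto simp: Lq_def)
qed

lemma Lp_dominated_convergence:
  fixes f :: "'a::euclidean_space \<Rightarrow> 'b::euclidean_space" and w :: "'a \<Rightarrow> 'c::euclidean_space"
  assumes "f \<in> borel_measurable (lebesgue_on \<Omega>)" "\<And>k::nat. F k \<in> borel_measurable (lebesgue_on \<Omega>)"
    and w: "w \<in> Lq \<Omega> p" and p: "0 < p" and C: "0 \<le> C"
    and lim: "AE x in lebesgue_on \<Omega>. (\<lambda>k. F k x) \<longlonglongrightarrow> f x"
    and bound: "\<And>k. AE x in lebesgue_on \<Omega>. norm (f x - F k x) \<le> C * norm (w x)"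
  shows "(\<lambda>k. LINT x|lebesgue_on \<Omega>. norm (f x - F k x) powr p) \<longlonglongrightarrow> 0"
proof -
  note [measurable] = assms(1,2)
  have "(\<lambda>k. LINT x|lebesgue_on \<Omega>. norm (f x - F k x) powr p) \<longlonglongrightarrow> (LINT x|lebesgue_on \<Omega>. 0)"
  proof (rule integral_dominated_convergence[where w = "\<lambda>x. C powr p * norm (w x) powr p"])
    show "integrable (lebesgue_on \<Omega>) (\<lambda>x. C powr p * norm (w x) powr p)" using w by (simp add: Lq_def)
    show "AE x in lebesgue_on \<Omega>. (\<lambda>k. norm (f x - F k x) powr p) \<longlonglongrightarrow> 0"
      using lim
    proof eventually_elim
      case (elim x)
      then have "(\<lambda>k. norm (f x - F k x)) \<longlonglongrightarrow> norm (f x - f x)" by (intro tendsto_intros)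
      then have "(\<lambda>k. norm (f x - F k x)) \<longlonglongrightarrow> 0" by simp
      then have "(\<lambda>k. norm (f x - F k x) powr p) \<longlonglongrightarrow> 0 powr p"
        by (rule tendsto_powr2) (use p in auto)
      then show ?case using p by simp
    qed
    show "AE x in lebesgue_on \<Omega>. norm (norm (f x - F k x) powr p) \<le> C powr p * norm (w x) powr p" for k
      using bound[of k]
    proof eventually_elim
      case (elim x)
      then have "norm (f x - F k x) powr p \<le> (C * norm (w x)) powr p" using p by (intro powr_mono2) auto
      then show ?case using C by (simp add: powr_mult)
    qed
  qed measurable
  then show ?thesis by simp
qed

text \<open>Describes \<^const>\<open>W1p_0\<close> together with the gradient, without reference to the \<open>SOME\<close> in
  \<^const>\<open>weak_grad\<close> and without prescribing values outside \<open>\<Omega>\<close>.\<close>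

definition W0 :: "'a::euclidean_space set \<Rightarrow> real \<Rightarrow> ('a \<Rightarrow> real) \<Rightarrow> ('a \<Rightarrow> 'a) \<Rightarrow> bool" where
  "W0 \<Omega> p u G \<longleftrightarrow> u \<in> Lq \<Omega> p \<and> G \<in> Lq \<Omega> p \<and>
     (\<forall>\<epsilon>>0. \<exists>\<phi>\<in>Cc_inf \<Omega>. (LINT x|lebesgue_on \<Omega>. norm (u x - \<phi> x) powr p) < \<epsilon> \<and>
                          (LINT x|lebesgue_on \<Omega>. norm (G x - grad \<phi> x) powr p) < \<epsilon>)"

section \<open>The relation \<open>W0\<close> on a bounded open set\<close>

locale bounded_open =
  fixes \<Omega> :: "'a::euclidean_space set" and p :: real
  assumes op: "open \<Omega>" and bd: "bounded \<Omega>" and p1: "1 < p"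
begin

lemma Om_sets [measurable, simp]: "\<Omega> \<in> sets lebesgue"
  using op by (simp add: borel_open)

lemma fin_meas: "finite_measure (lebesgue_on \<Omega>)"
proof
  have "emeasure (lebesgue_on \<Omega>) (space (lebesgue_on \<Omega>)) = emeasure lborel \<Omega>"
    using op by (simp add: emeasure_restrict_space borel_open)
  also have "\<dots> < \<infinity>" by (rule emeasure_bounded_finite[OF bd])
  finally show "emeasure (lebesgue_on \<Omega>) (space (lebesgue_on \<Omega>)) \<noteq> \<infinity>" by simp
qed

sublocale finite_measure "lebesgue_on \<Omega>" by (rule fin_meas)

lemma borel_imp_meas: "f \<in> borel_measurable borel \<Longrightarrow> f \<in> borel_measurable (lebesgue_on \<Omega>)"
  by (intro measurable_restrict_space1 measurable_completion) simp

lemma Cc_D: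
  assumes "\<phi> \<in> Cc_inf \<Omega>"
  shows "C_k k \<phi>" "compact (closure {x. \<phi> x \<noteq> 0})" "closure {x. \<phi> x \<noteq> 0} \<subseteq> \<Omega>" "x \<notin> \<Omega> \<Longrightarrow> \<phi> x = 0"
    "x \<notin> \<Omega> \<Longrightarrow> grad \<phi> x = 0" "\<phi> \<in> borel_measurable borel" "grad \<phi> \<in> borel_measurable borel"
    "(\<phi> has_derivative (\<lambda>h. grad \<phi> x \<bullet> h)) (at x)"
proof -
  show 1: "C_k k \<phi>" "compact (closure {x. \<phi> x \<noteq> 0})" "closure {x. \<phi> x \<noteq> 0} \<subseteq> \<Omega>" for k
    using assms by (auto simp: Cc_inf_def smooth_def)
  show "x \<notin> \<Omega> \<Longrightarrow> \<phi> x = 0" using 1(3) closure_subset[of "{x. \<phi> x \<noteq> 0}"] by auto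
  show "x \<notin> \<Omega> \<Longrightarrow> grad \<phi> x = 0" using 1(3) by (intro grad_eq_0_outside_support) auto
  show "\<phi> \<in> borel_measurable borel" "grad \<phi> \<in> borel_measurable borel"
    using C_k_continuous[OF 1(1)[of 0]] C_k_grad(2)[OF 1(1)[of "Suc 0"]] by (auto intro: borel_measurable_continuous_onI)
  show "(\<phi> has_derivative (\<lambda>h. grad \<phi> x \<bullet> h)) (at x)" by (rule C_k_grad(1)[OF 1(1)[of "Suc 0"]])
qed

lemma Cc_bounds:
  assumes "\<phi> \<in> Cc_inf \<Omega>"
  obtains L where "0 \<le> L" "\<And>x. \<bar>\<phi> x\<bar> \<le> L" "\<And>x. norm (grad \<phi> x) \<le> L"
  using compactly_supported_C1_bounds[OF Cc_D(1)[OF assms, of 1] Cc_D(2)[OF assms]] by metis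

lemma Cc_meas:
  assumes "\<phi> \<in> Cc_inf \<Omega>"
  shows "\<phi> \<in> borel_measurable (lebesgue_on \<Omega>)" "grad \<phi> \<in> borel_measurable (lebesgue_on \<Omega>)"
  using Cc_D(6,7)[OF assms] borel_imp_meas by auto

lemma Cc_Lq:
  assumes "\<phi> \<in> Cc_inf \<Omega>"
  shows "\<phi> \<in> Lq \<Omega> p" "grad \<phi> \<in> Lq \<Omega> p"
proof -
  obtain L where L: "0 \<le> L" "\<And>x. \<bar>\<phi> x\<bar> \<le> L" "\<And>x. norm (grad \<phi> x) \<le> L" using Cc_bounds[OF assms] by blast
  show "\<phi> \<in> Lq \<Omega> p" "grad \<phi> \<in> Lq \<Omega> p"
    using L p1 Cc_meas[OF assms] fin_meas by (auto intro!: Lq_bounded[where C = L])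
qed

lemma Cc_compose:
  fixes P :: "real \<Rightarrow> real"
  assumes \<phi>: "\<phi> \<in> Cc_inf \<Omega>" and P: "\<And>k. C_k k P" "P 0 = 0" and P': "\<And>t. (P has_real_derivative P' t) (at t)"
  shows "(\<lambda>x. P (\<phi> x)) \<in> Cc_inf \<Omega>" and "grad (\<lambda>x. P (\<phi> x)) x = P' (\<phi> x) *\<^sub>R grad \<phi> x"
proof -
  have sub: "closure {x. P (\<phi> x) \<noteq> 0} \<subseteq> closure {x. \<phi> x \<noteq> 0}"
    using P(2) by (intro closure_mono) auto
  then have "compact (closure {x. P (\<phi> x) \<noteq> 0})"
    using Cc_D(2)[OF \<phi>] bounded_subset[OF _ sub] by (simp add: compact_eq_bounded_closed)
  then show "(\<lambda>x. P (\<phi> x)) \<in> Cc_inf \<Omega>"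
    using sub Cc_D(3)[OF \<phi>] C_k_compose[OF P(1) Cc_D(1)[OF \<phi>]] by (auto simp: Cc_inf_def smooth_def)
  show "grad (\<lambda>x. P (\<phi> x)) x = P' (\<phi> x) *\<^sub>R grad \<phi> x"
  proof (rule grad_eqI)
    show "((\<lambda>x. P (\<phi> x)) has_derivative (\<bullet>) (P' (\<phi> x) *\<^sub>R grad \<phi> x)) (at x)"
      using has_derivative_compose[OF Cc_D(8)[OF \<phi>, of x] P'[of "\<phi> x", unfolded has_field_derivative_def]]
      by (simp add: inner_scaleR_left[abs_def])
  qed
qed

lemma Cc_lincomb:
  assumes "\<phi> \<in> Cc_inf \<Omega>" "\<psi> \<in> Cc_inf \<Omega>"
  shows "(\<lambda>x. \<phi> x + c * \<psi> x) \<in> Cc_inf \<Omega>" "grad (\<lambda>x. \<phi> x + c * \<psi> x) x = grad \<phi> x + c *\<^sub>R grad \<psi> x"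
proof -
  have sub: "closure {x. \<phi> x + c * \<psi> x \<noteq> 0} \<subseteq> closure {x. \<phi> x \<noteq> 0} \<union> closure {x. \<psi> x \<noteq> 0}"
    unfolding closure_Un[symmetric] by (intro closure_mono) auto
  have "compact (closure {x. \<phi> x \<noteq> 0} \<union> closure {x. \<psi> x \<noteq> 0})" using Cc_D(2) assms by (intro compact_Un) auto
  then have "compact (closure {x. \<phi> x + c * \<psi> x \<noteq> 0})"
    using sub by (meson bounded_subset closed_closure compact_eq_bounded_closed)
  then show "(\<lambda>x. \<phi> x + c * \<psi> x) \<in> Cc_inf \<Omega>"
    using sub Cc_D(3)[OF assms(1)] Cc_D(3)[OF assms(2)] C_k_add[OF Cc_D(1)[OF assms(1)] C_k_mult[OF C_k_const[of _ c] Cc_D(1)[OF assms(2)]]]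
    by (auto simp: Cc_inf_def smooth_def)
  show "grad (\<lambda>x. \<phi> x + c * \<psi> x) x = grad \<phi> x + c *\<^sub>R grad \<psi> x"
  proof (rule grad_eqI)
    show "((\<lambda>x. \<phi> x + c * \<psi> x) has_derivative (\<bullet>) (grad \<phi> x + c *\<^sub>R grad \<psi> x)) (at x)"
      using has_derivative_add[OF Cc_D(8)[OF assms(1), of x] has_derivative_mult_right[OF Cc_D(8)[OF assms(2), of x], of c]]
      by (simp add: inner_add_left[abs_def] inner_scaleR_left[abs_def])
  qed
qed

lemma W0_meas: "W0 \<Omega> p u G \<Longrightarrow> u \<in> borel_measurable (lebesgue_on \<Omega>)" "W0 \<Omega> p u G \<Longrightarrow> G \<in> borel_measurable (lebesgue_on \<Omega>)"
  by (auto simp: W0_def Lq_def)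

lemma W0_Lq: "W0 \<Omega> p u G \<Longrightarrow> u \<in> Lq \<Omega> p" "W0 \<Omega> p u G \<Longrightarrow> G \<in> Lq \<Omega> p"
  by (auto simp: W0_def)

text \<open>A triangle inequality for p-th powers of norms. The factor 2^p takes the place of
  Minkowski's inequality and is harmless, since only convergence to 0 is at stake.\<close>

lemma Lp_dist_le:
  fixes f g h :: "'a \<Rightarrow> 'b::euclidean_space"
  assumes "f \<in> Lq \<Omega> p" "g \<in> Lq \<Omega> p" "h \<in> Lq \<Omega> p"
  shows "(LINT x|lebesgue_on \<Omega>. norm (f x - h x) powr p) \<le>
    2 powr p * ((LINT x|lebesgue_on \<Omega>. norm (f x - g x) powr p) + (LINT x|lebesgue_on \<Omega>. norm (g x - h x) powr p))"
proof -
  have i: "integrable (lebesgue_on \<Omega>) (\<lambda>x. norm (f x - h x) powr p)" "integrable (lebesgue_on \<Omega>) (\<lambda>x. norm (f x - g x) powr p)"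
    "integrable (lebesgue_on \<Omega>) (\<lambda>x. norm (g x - h x) powr p)"
    using assms p1 Lq_diff[of _ \<Omega> p] by (auto simp: Lq_def)
  have "(LINT x|lebesgue_on \<Omega>. norm (f x - h x) powr p) \<le> (LINT x|lebesgue_on \<Omega>. 2 powr p * (norm (f x - g x) powr p + norm (g x - h x) powr p))"
  proof (rule integral_mono)
    fix x
    have "norm (f x - h x) powr p \<le> (norm (f x - g x) + norm (g x - h x)) powr p"
      using p1 norm_triangle_ineq[of "f x - g x" "g x - h x"] by (intro powr_mono2) auto
    also have "\<dots> \<le> 2 powr p * (norm (f x - g x) powr p + norm (g x - h x) powr p)"
      using p1 by (intro powr_add_le) auto
    finally show "norm (f x - h x) powr p \<le> 2 powr p * (norm (f x - g x) powr p + norm (g x - h x) powr p)" .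
  qed (use i in auto)
  also have "\<dots> = 2 powr p * ((LINT x|lebesgue_on \<Omega>. norm (f x - g x) powr p) + (LINT x|lebesgue_on \<Omega>. norm (g x - h x) powr p))"
    using i by simp
  finally show ?thesis .
qed

lemma W0_seq:
  assumes "W0 \<Omega> p u G"
  obtains \<phi> where "\<And>k::nat. \<phi> k \<in> Cc_inf \<Omega>"
    "(\<lambda>k. LINT x|lebesgue_on \<Omega>. norm (u x - \<phi> k x) powr p) \<longlonglongrightarrow> 0"
    "(\<lambda>k. LINT x|lebesgue_on \<Omega>. norm (G x - grad (\<phi> k) x) powr p) \<longlonglongrightarrow> 0"
proof -
  have "\<forall>k::nat. \<exists>\<phi>. \<phi> \<in> Cc_inf \<Omega> \<and> (LINT x|lebesgue_on \<Omega>. norm (u x - \<phi> x) powr p) < 1 / real (Suc k) \<and>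
                          (LINT x|lebesgue_on \<Omega>. norm (G x - grad \<phi> x) powr p) < 1 / real (Suc k)"
  proof
    fix k :: nat
    have "0 < 1 / real (Suc k)" by simp
    then show "\<exists>\<phi>. \<phi> \<in> Cc_inf \<Omega> \<and> (LINT x|lebesgue_on \<Omega>. norm (u x - \<phi> x) powr p) < 1 / real (Suc k) \<and>
                          (LINT x|lebesgue_on \<Omega>. norm (G x - grad \<phi> x) powr p) < 1 / real (Suc k)"
      using assms unfolding W0_def Bex_def by (elim conjE allE[of _ "1 / real (Suc k)"] impE)
  qed
  from choice[OF this] obtain \<phi> where \<phi>: "\<And>k::nat. \<phi> k \<in> Cc_inf \<Omega>" 
    "\<And>k. (LINT x|lebesgue_on \<Omega>. norm (u x - \<phi> k x) powr p) < 1 / real (Suc k)"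
    "\<And>k. (LINT x|lebesgue_on \<Omega>. norm (G x - grad (\<phi> k) x) powr p) < 1 / real (Suc k)"
    by blast
  have z: "(\<lambda>k. 1 / real (Suc k)) \<longlonglongrightarrow> 0" using LIMSEQ_inverse_real_of_nat by (simp add: divide_inverse)
  show thesis
    by (rule that[OF \<phi>(1)]; rule tendsto_sandwich[OF _ _ tendsto_const z])
      (use \<phi>(2,3) in \<open>auto intro!: always_eventually less_imp_le\<close>)
qed

text \<open>A test function close to some \<open>w k\<close> is close to the limit by
  \<open>Lp_dist_le\<close>. The calculus rules below are obtained by exhibiting suitable
  approximants and applying this closedness.\<close>

lemma W0_limit:
  assumes W: "\<And>k::nat. W0 \<Omega> p (w k) (H k)" and uG: "u \<in> Lq \<Omega> p" "G \<in> Lq \<Omega> p"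
    and lim: "(\<lambda>k. LINT x|lebesgue_on \<Omega>. norm (u x - w k x) powr p) \<longlonglongrightarrow> 0"
      "(\<lambda>k. LINT x|lebesgue_on \<Omega>. norm (G x - H k x) powr p) \<longlonglongrightarrow> 0"
  shows "W0 \<Omega> p u G"
  unfolding W0_def
proof (intro conjI uG allI impI)
  fix \<epsilon> :: real assume "0 < \<epsilon>"
  \<comment> \<open>Two errors of size \<eta>, amplified by the factor 2^p of
    \<open>Lp_dist_le\<close>, add up to \<epsilon>/2.\<close>
  define \<eta> where "\<eta> = \<epsilon> / (4 * 2 powr p)"
  have \<eta>: "0 < \<eta>" "2 powr p * (\<eta> + \<eta>) < \<epsilon>" using \<open>0 < \<epsilon>\<close> by (auto simp: \<eta>_def)
  have "eventually (\<lambda>k. (LINT x|lebesgue_on \<Omega>. norm (u x - w k x) powr p) < \<eta> \<and> (LINT x|lebesgue_on \<Omega>. norm (G x - H k x) powr p) < \<eta>) sequentially"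
    using order_tendstoD(2)[OF lim(1) \<eta>(1)] order_tendstoD(2)[OF lim(2) \<eta>(1)] by eventually_elim simp
  then obtain k where k: "(LINT x|lebesgue_on \<Omega>. norm (u x - w k x) powr p) < \<eta>" "(LINT x|lebesgue_on \<Omega>. norm (G x - H k x) powr p) < \<eta>"
    using eventually_happens' sequentially_bot by blast
  obtain \<phi> where \<phi>: "\<phi> \<in> Cc_inf \<Omega>" "(LINT x|lebesgue_on \<Omega>. norm (w k x - \<phi> x) powr p) < \<eta>" "(LINT x|lebesgue_on \<Omega>. norm (H k x - grad \<phi> x) powr p) < \<eta>"
    using W[of k] \<eta>(1) unfolding W0_def by blast
  have b: "2 powr p * (s + t) < \<epsilon>" if "s < \<eta>" "t < \<eta>" for s t
  proof -
    have "2 powr p * (s + t) < 2 powr p * (\<eta> + \<eta>)" using that by (intro mult_strict_left_mono) auto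
    then show ?thesis using \<eta>(2) by linarith
  qed
  show "\<exists>\<phi>\<in>Cc_inf \<Omega>. (LINT x|lebesgue_on \<Omega>. norm (u x - \<phi> x) powr p) < \<epsilon> \<and> (LINT x|lebesgue_on \<Omega>. norm (G x - grad \<phi> x) powr p) < \<epsilon>"
  proof (intro bexI[OF _ \<phi>(1)] conjI)
    show "(LINT x|lebesgue_on \<Omega>. norm (u x - \<phi> x) powr p) < \<epsilon>"
      by (rule le_less_trans[OF Lp_dist_le[OF uG(1) W0_Lq(1)[OF W[of k]] Cc_Lq(1)[OF \<phi>(1)]] b[OF k(1) \<phi>(2)]])
    show "(LINT x|lebesgue_on \<Omega>. norm (G x - grad \<phi> x) powr p) < \<epsilon>"
      by (rule le_less_trans[OF Lp_dist_le[OF uG(2) W0_Lq(2)[OF W[of k]] Cc_Lq(2)[OF \<phi>(1)]] b[OF k(2) \<phi>(3)]])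
  qed
qed

lemma W0_Cc: "\<phi> \<in> Cc_inf \<Omega> \<Longrightarrow> W0 \<Omega> p \<phi> (grad \<phi>)"
  unfolding W0_def using Cc_Lq by (auto intro!: bexI[of _ \<phi>])

lemma W0_cong_AE:
  assumes W: "W0 \<Omega> p u G" and ae: "AE x in lebesgue_on \<Omega>. u x = u' x" "AE x in lebesgue_on \<Omega>. G x = G' x"
    and m: "u' \<in> borel_measurable (lebesgue_on \<Omega>)" "G' \<in> borel_measurable (lebesgue_on \<Omega>)"
  shows "W0 \<Omega> p u' G'"
proof (rule W0_limit[of "\<lambda>_. u" "\<lambda>_. G"])
  show "u' \<in> Lq \<Omega> p" "G' \<in> Lq \<Omega> p" using Lq_cong_AE[OF W0_Lq(1)[OF W] ae(1) m(1)] Lq_cong_AE[OF W0_Lq(2)[OF W] ae(2) m(2)] p1 by simp_all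
  have "(LINT x|lebesgue_on \<Omega>. norm (u' x - u x) powr p) = 0" "(LINT x|lebesgue_on \<Omega>. norm (G' x - G x) powr p) = 0"
    using ae(1) ae(2) by (intro integral_eq_zero_AE; elim eventually_mono; simp)+
  then show "(\<lambda>k. LINT x|lebesgue_on \<Omega>. norm (u' x - u x) powr p) \<longlonglongrightarrow> 0" "(\<lambda>k. LINT x|lebesgue_on \<Omega>. norm (G' x - G x) powr p) \<longlonglongrightarrow> 0"
    by auto
qed (rule W)

lemma Lp_lincomb_tendsto:
  fixes f g :: "'a \<Rightarrow> 'b::euclidean_space"
  assumes "f \<in> Lq \<Omega> p" "g \<in> Lq \<Omega> p" "\<And>k::nat. F k \<in> Lq \<Omega> p" "\<And>k. H k \<in> Lq \<Omega> p"
    and "(\<lambda>k. LINT x|lebesgue_on \<Omega>. norm (f x - F k x) powr p) \<longlonglongrightarrow> 0"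
      "(\<lambda>k. LINT x|lebesgue_on \<Omega>. norm (g x - H k x) powr p) \<longlonglongrightarrow> 0"
  shows "(\<lambda>k. LINT x|lebesgue_on \<Omega>. norm ((f x + c *\<^sub>R g x) - (F k x + c *\<^sub>R H k x)) powr p) \<longlonglongrightarrow> 0"
proof (rule tendsto_sandwich[OF _ _ tendsto_const])
  let ?I = "\<lambda>k. LINT x|lebesgue_on \<Omega>. norm (f x - F k x) powr p" and ?J = "\<lambda>k. LINT x|lebesgue_on \<Omega>. norm (g x - H k x) powr p"
  have "(\<lambda>k. 2 powr p * (?I k + \<bar>c\<bar> powr p * ?J k)) \<longlonglongrightarrow> 2 powr p * (0 + \<bar>c\<bar> powr p * 0)"
    by (intro tendsto_intros assms)
  then show "(\<lambda>k. 2 powr p * (?I k + \<bar>c\<bar> powr p * ?J k)) \<longlonglongrightarrow> 0" by simp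
  show "\<forall>\<^sub>F k in sequentially. 0 \<le> (LINT x|lebesgue_on \<Omega>. norm ((f x + c *\<^sub>R g x) - (F k x + c *\<^sub>R H k x)) powr p)" by simp
  show "\<forall>\<^sub>F k in sequentially. (LINT x|lebesgue_on \<Omega>. norm ((f x + c *\<^sub>R g x) - (F k x + c *\<^sub>R H k x)) powr p) \<le> 2 powr p * (?I k + \<bar>c\<bar> powr p * ?J k)"
  proof (rule always_eventually, rule allI)
    fix k
    have p0: "0 \<le> p" using p1 by simp
    have L: "(\<lambda>x. f x + c *\<^sub>R g x) \<in> Lq \<Omega> p" "(\<lambda>x. F k x + c *\<^sub>R g x) \<in> Lq \<Omega> p" "(\<lambda>x. F k x + c *\<^sub>R H k x) \<in> Lq \<Omega> p"
      by (rule Lq_add[OF assms(1) Lq_scale[OF assms(2)] p0] Lq_add[OF assms(3) Lq_scale[OF assms(2)] p0]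
          Lq_add[OF assms(3) Lq_scale[OF assms(4)] p0])+
    have "norm ((F k x + c *\<^sub>R g x) - (F k x + c *\<^sub>R H k x)) powr p = \<bar>c\<bar> powr p * norm (g x - H k x) powr p" for x
    proof -
      have "(F k x + c *\<^sub>R g x) - (F k x + c *\<^sub>R H k x) = c *\<^sub>R (g x - H k x)" by (simp add: scaleR_diff_right)
      then show ?thesis by (simp only: norm_scaleR powr_mult abs_ge_zero norm_ge_zero)
    qed
    then show "(LINT x|lebesgue_on \<Omega>. norm ((f x + c *\<^sub>R g x) - (F k x + c *\<^sub>R H k x)) powr p) \<le> 2 powr p * (?I k + \<bar>c\<bar> powr p * ?J k)"
      using Lp_dist_le[OF L] by simp
  qed
qed

lemma W0_lincomb:
  assumes "W0 \<Omega> p u G" "W0 \<Omega> p v H"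
  shows "W0 \<Omega> p (\<lambda>x. u x + c * v x) (\<lambda>x. G x + c *\<^sub>R H x)"
proof -
  obtain \<phi> where \<phi>: "\<And>k::nat. \<phi> k \<in> Cc_inf \<Omega>" 
    "(\<lambda>k. LINT x|lebesgue_on \<Omega>. norm (u x - \<phi> k x) powr p) \<longlonglongrightarrow> 0"
    "(\<lambda>k. LINT x|lebesgue_on \<Omega>. norm (G x - grad (\<phi> k) x) powr p) \<longlonglongrightarrow> 0" by (rule W0_seq[OF assms(1)]) (rule that)
  obtain \<psi> where \<psi>: "\<And>k::nat. \<psi> k \<in> Cc_inf \<Omega>" 
    "(\<lambda>k. LINT x|lebesgue_on \<Omega>. norm (v x - \<psi> k x) powr p) \<longlonglongrightarrow> 0"
    "(\<lambda>k. LINT x|lebesgue_on \<Omega>. norm (H x - grad (\<psi> k) x) powr p) \<longlonglongrightarrow> 0" by (rule W0_seq[OF assms(2)]) (rule that)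
  have p0: "0 \<le> p" using p1 by simp
  show ?thesis
  proof (rule W0_limit[OF W0_Cc[OF Cc_lincomb(1)[OF \<phi>(1) \<psi>(1)]]])
    show "(\<lambda>x. u x + c * v x) \<in> Lq \<Omega> p" 
      using Lq_add[OF W0_Lq(1)[OF assms(1)] Lq_scale[OF W0_Lq(1)[OF assms(2)], of c] p0] by simp
    show "(\<lambda>x. G x + c *\<^sub>R H x) \<in> Lq \<Omega> p"
      using Lq_add[OF W0_Lq(2)[OF assms(1)] Lq_scale[OF W0_Lq(2)[OF assms(2)], of c] p0] by simp
    show "(\<lambda>k. LINT x|lebesgue_on \<Omega>. norm (u x + c * v x - (\<phi> k x + c * \<psi> k x)) powr p) \<longlonglongrightarrow> 0"
      using Lp_lincomb_tendsto[OF W0_Lq(1)[OF assms(1)] W0_Lq(1)[OF assms(2)] Cc_Lq(1)[OF \<phi>(1)] Cc_Lq(1)[OF \<psi>(1)] \<phi>(2) \<psi>(2), of c] by simp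
    show "(\<lambda>k. LINT x|lebesgue_on \<Omega>. norm (G x + c *\<^sub>R H x - grad (\<lambda>x. \<phi> k x + c * \<psi> k x) x) powr p) \<longlonglongrightarrow> 0"
      unfolding Cc_lincomb(2)[OF \<phi>(1) \<psi>(1)]
      by (rule Lp_lincomb_tendsto[OF W0_Lq(2)[OF assms(1)] W0_Lq(2)[OF assms(2)] Cc_Lq(2)[OF \<phi>(1)] Cc_Lq(2)[OF \<psi>(1)] \<phi>(3) \<psi>(3)])
  qed
qed

lemma W0_zero: "W0 \<Omega> p (\<lambda>x. 0) (\<lambda>x. 0)"
proof -
  have "(\<lambda>x::'a. 0) \<in> Cc_inf \<Omega>" by (simp add: Cc_inf_def smooth_def C_k_const)
  moreover have "grad (\<lambda>x::'a. 0) = (\<lambda>x. 0)"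
    by (rule ext, rule grad_eqI) simp
  ultimately show ?thesis using W0_Cc[of "\<lambda>x. 0"] by simp
qed

lemma W0_scale: "W0 \<Omega> p u G \<Longrightarrow> W0 \<Omega> p (\<lambda>x. c * u x) (\<lambda>x. c *\<^sub>R G x)"
  using W0_lincomb[OF W0_zero, of u G c] by simp

text \<open>The p-th powers of the errors tend to 0 in L^1, so a subsequence tends to 0 almost
  everywhere. Pointwise convergence of the functions, though not of their gradients, is what a
  continuous derivative in a chain rule and Fatou's lemma need.\<close>

lemma W0_AE_subseq:
  assumes "W0 \<Omega> p u G"
  obtains \<phi> where "\<And>k::nat. \<phi> k \<in> Cc_inf \<Omega>"
    "(\<lambda>k. LINT x|lebesgue_on \<Omega>. norm (u x - \<phi> k x) powr p) \<longlonglongrightarrow> 0"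
    "(\<lambda>k. LINT x|lebesgue_on \<Omega>. norm (G x - grad (\<phi> k) x) powr p) \<longlonglongrightarrow> 0"
    "AE x in lebesgue_on \<Omega>. (\<lambda>k. \<phi> k x) \<longlonglongrightarrow> u x"
proof -
  obtain \<phi> where \<phi>: "\<And>k::nat. \<phi> k \<in> Cc_inf \<Omega>" 
    "(\<lambda>k. LINT x|lebesgue_on \<Omega>. norm (u x - \<phi> k x) powr p) \<longlonglongrightarrow> 0"
    "(\<lambda>k. LINT x|lebesgue_on \<Omega>. norm (G x - grad (\<phi> k) x) powr p) \<longlonglongrightarrow> 0" by (rule W0_seq[OF assms(1)]) (rule that)
  have "integrable (lebesgue_on \<Omega>) (\<lambda>x. norm (u x - \<phi> k x) powr p)" for k
    using Lq_diff[OF W0_Lq(1)[OF assms] Cc_Lq(1)[OF \<phi>(1)]] p1 by (simp add: Lq_def)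
  then obtain r :: "nat \<Rightarrow> nat" where r: "strict_mono r" and ae: "AE x in lebesgue_on \<Omega>. (\<lambda>n. norm (u x - \<phi> (r n) x) powr p) \<longlonglongrightarrow> 0"
    using tendsto_L1_AE_subseq[of "lebesgue_on \<Omega>" "\<lambda>k x. norm (u x - \<phi> k x) powr p"] \<phi>(2) by auto
  show thesis
  proof (rule that[of "\<lambda>k. \<phi> (r k)"])
    show "\<phi> (r k) \<in> Cc_inf \<Omega>" for k by (rule \<phi>)
    show "(\<lambda>k. LINT x|lebesgue_on \<Omega>. norm (u x - \<phi> (r k) x) powr p) \<longlonglongrightarrow> 0" 
      "(\<lambda>k. LINT x|lebesgue_on \<Omega>. norm (G x - grad (\<phi> (r k)) x) powr p) \<longlonglongrightarrow> 0"
      using LIMSEQ_subseq_LIMSEQ[OF \<phi>(2) r] LIMSEQ_subseq_LIMSEQ[OF \<phi>(3) r] by (simp_all add: o_def)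
    show "AE x in lebesgue_on \<Omega>. (\<lambda>k. \<phi> (r k) x) \<longlonglongrightarrow> u x"
      using ae
    proof eventually_elim
      case (elim x)
      have "(\<lambda>n. (norm (u x - \<phi> (r n) x) powr p) powr (1 / p)) \<longlonglongrightarrow> 0 powr (1 / p)"
        by (rule tendsto_powr2[OF elim tendsto_const]) (use p1 in auto)
      then have "(\<lambda>n. norm (u x - \<phi> (r n) x)) \<longlonglongrightarrow> 0" using p1 by (simp add: powr_powr)
      then have "(\<lambda>n. u x - \<phi> (r n) x) \<longlonglongrightarrow> 0" by (rule tendsto_norm_zero_cancel)
      from tendsto_diff[OF tendsto_const[of "u x"] this] show ?case by simp
    qed
  qed
qed

end

section \<open>Weak gradients\<close>

context bounded_open begin

lemma Lq_integrable:
  fixes u :: "'a \<Rightarrow> 'b::euclidean_space"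
  assumes "u \<in> Lq \<Omega> p"
  shows "integrable (lebesgue_on \<Omega>) u"
proof -
  have "u \<in> Lq \<Omega> 1" using Lq_exponent_mono[OF assms fin_meas, of 1] p1 by simp
  then have "integrable (lebesgue_on \<Omega>) (\<lambda>x. norm (u x))" "u \<in> borel_measurable (lebesgue_on \<Omega>)"
    by (auto simp: Lq_def)
  then show ?thesis by (simp add: integrable_norm_iff)
qed

lemma Lq_L1_loc:
  fixes u :: "'a \<Rightarrow> 'b::euclidean_space"
  assumes "u \<in> Lq \<Omega> p"
  shows "u \<in> L1_loc \<Omega>"
  unfolding L1_loc_def
proof (intro CollectI allI impI, elim conjE)
  fix K assume K: "compact K" "K \<subseteq> \<Omega>"
  have Ks: "K \<in> sets lebesgue" using K by (simp add: borel_compact)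
  have "integrable lebesgue (\<lambda>x. indicator \<Omega> x *\<^sub>R u x)"
    using Lq_integrable[OF assms] by (subst (asm) integrable_restrict_space) auto
  then have "integrable lebesgue (\<lambda>x. indicator K x *\<^sub>R (indicator \<Omega> x *\<^sub>R u x))"
    using Ks by (rule integrable_mult_indicator[rotated])
  moreover have "indicator K x *\<^sub>R (indicator \<Omega> x *\<^sub>R u x) = indicator K x *\<^sub>R u x" for x
    using K(2) by (cases "x \<in> K") auto
  ultimately have "integrable lebesgue (\<lambda>x. indicator K x *\<^sub>R u x)" by (simp only:)
  then show "integrable (lebesgue_on K) u" using Ks by (subst integrable_restrict_space) auto
qed

text \<open>In place of Hoelder's inequality: t <= \<delta> + \<delta>^(1-p) t^p for every \<delta>
  > 0, integrated over a set of finite measure.\<close>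

lemma Lp_tendsto_L1:
  fixes F :: "nat \<Rightarrow> 'a \<Rightarrow> real"
  assumes F: "\<And>k. F k \<in> Lq \<Omega> p" and lim: "(\<lambda>k. LINT x|lebesgue_on \<Omega>. norm (F k x) powr p) \<longlonglongrightarrow> 0"
  shows "(\<lambda>k. LINT x|lebesgue_on \<Omega>. norm (F k x)) \<longlonglongrightarrow> 0"
proof (rule order_tendstoI)
  fix a :: real assume "a < 0"
  then show "\<forall>\<^sub>F k in sequentially. a < (LINT x|lebesgue_on \<Omega>. norm (F k x))"
    by (intro always_eventually allI less_le_trans[OF \<open>a < 0\<close>]) simp
next
  fix \<epsilon> :: real assume \<epsilon>: "0 < \<epsilon>"
  define \<mu> where "\<mu> = measure (lebesgue_on \<Omega>) (space (lebesgue_on \<Omega>))"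
  \<comment> \<open>The summand 1 in the denominator admits \<mu> = 0; in every case \<delta> \<mu>
    < \<epsilon>.\<close>
  define \<delta> where "\<delta> = \<epsilon> / (2 * (\<mu> + 1))"
  have \<mu>: "0 \<le> \<mu>" by (simp add: \<mu>_def)
  have \<delta>: "0 < \<delta>" "\<delta> * \<mu> < \<epsilon>" using \<epsilon> \<mu> mult_nonneg_nonneg[of \<epsilon> \<mu>] by (auto simp: \<delta>_def field_simps intro: add_nonneg_pos)
  have pt: "t \<le> \<delta> + \<delta> powr (1 - p) * t powr p" if "0 \<le> t" for t
  proof (cases "t \<le> \<delta>")
    case True
    have "0 \<le> \<delta> powr (1 - p) * t powr p" by simp
    then show ?thesis using True by linarith
  next
    case False
    have "t = t powr (1 - p) * t powr p" using False \<delta> by (simp add: powr_add[symmetric])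
    also have "\<dots> \<le> \<delta> powr (1 - p) * t powr p"
      using False \<delta> p1 by (intro mult_right_mono powr_mono2') auto
    finally show ?thesis using \<delta> by linarith
  qed
  have le: "(LINT x|lebesgue_on \<Omega>. norm (F k x)) \<le> \<delta> * \<mu> + \<delta> powr (1 - p) * (LINT x|lebesgue_on \<Omega>. norm (F k x) powr p)" for k
  proof -
    have i: "integrable (lebesgue_on \<Omega>) (\<lambda>x. norm (F k x) powr p)" using F[of k] by (simp add: Lq_def)
    have "(LINT x|lebesgue_on \<Omega>. norm (F k x)) \<le> (LINT x|lebesgue_on \<Omega>. \<delta> + \<delta> powr (1 - p) * norm (F k x) powr p)"
      using i by (intro integral_mono integrable_norm Lq_integrable[OF F] pt) auto
    also have "\<dots> = \<delta> * \<mu> + \<delta> powr (1 - p) * (LINT x|lebesgue_on \<Omega>. norm (F k x) powr p)"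
      using i by (simp add: \<mu>_def)
    finally show ?thesis .
  qed
  have "(\<lambda>k. \<delta> * \<mu> + \<delta> powr (1 - p) * (LINT x|lebesgue_on \<Omega>. norm (F k x) powr p)) \<longlonglongrightarrow> \<delta> * \<mu> + \<delta> powr (1 - p) * 0"
    by (intro tendsto_intros lim)
  then have "\<forall>\<^sub>F k in sequentially. \<delta> * \<mu> + \<delta> powr (1 - p) * (LINT x|lebesgue_on \<Omega>. norm (F k x) powr p) < \<epsilon>"
    using \<delta>(2) by (intro order_tendstoD(2)) auto
  then show "\<forall>\<^sub>F k in sequentially. (LINT x|lebesgue_on \<Omega>. norm (F k x)) < \<epsilon>"
    by eventually_elim (rule le_less_trans[OF le])
qed

lemma integrable_mult_bounded:
  fixes f b :: "'a \<Rightarrow> real"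
  assumes "integrable (lebesgue_on \<Omega>) f" "b \<in> borel_measurable (lebesgue_on \<Omega>)" "\<And>x. \<bar>b x\<bar> \<le> B"
  shows "integrable (lebesgue_on \<Omega>) (\<lambda>x. f x * b x)"
proof (rule Bochner_Integration.integrable_bound)
  show "integrable (lebesgue_on \<Omega>) (\<lambda>x. B * norm (f x))" using assms(1) by simp
  have "norm (f x * b x) \<le> norm (B * norm (f x))" for x
    using mult_left_mono[OF order_trans[OF assms(3)[of x] abs_ge_self[of B]], of "\<bar>f x\<bar>"] by (simp add: abs_mult mult.commute)
  then show "AE x in lebesgue_on \<Omega>. norm (f x * b x) \<le> norm (B * norm (f x))" by simp
qed (use assms in auto)

lemma Lp_tendsto_integral_mult:
  fixes f b :: "'a \<Rightarrow> real"
  assumes f: "f \<in> Lq \<Omega> p" "\<And>k. F k \<in> Lq \<Omega> p" 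
    and lim: "(\<lambda>k. LINT x|lebesgue_on \<Omega>. norm (f x - F k x) powr p) \<longlonglongrightarrow> 0"
    and b: "b \<in> borel_measurable (lebesgue_on \<Omega>)" "\<And>x. \<bar>b x\<bar> \<le> B"
  shows "(\<lambda>k. LINT x|lebesgue_on \<Omega>. F k x * b x) \<longlonglongrightarrow> (LINT x|lebesgue_on \<Omega>. f x * b x)"
proof -
  have p0: "0 \<le> p" using p1 by simp
  have d: "(\<lambda>x. f x - F k x) \<in> Lq \<Omega> p" for k by (rule Lq_diff[OF f p0])
  have "(\<lambda>k. \<bar>B\<bar> * (LINT x|lebesgue_on \<Omega>. norm (f x - F k x))) \<longlonglongrightarrow> \<bar>B\<bar> * 0"
    by (intro tendsto_intros Lp_tendsto_L1[OF d lim])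
  then have z: "(\<lambda>k. \<bar>B\<bar> * (LINT x|lebesgue_on \<Omega>. norm (f x - F k x))) \<longlonglongrightarrow> 0" by simp
  have "norm ((LINT x|lebesgue_on \<Omega>. F k x * b x) - (LINT x|lebesgue_on \<Omega>. f x * b x)) \<le> \<bar>B\<bar> * (LINT x|lebesgue_on \<Omega>. norm (f x - F k x))" for k
  proof -
    have i: "integrable (lebesgue_on \<Omega>) (\<lambda>x. F k x * b x)" "integrable (lebesgue_on \<Omega>) (\<lambda>x. f x * b x)"
      by (rule integrable_mult_bounded[OF Lq_integrable b]; rule f)+
    have "norm ((LINT x|lebesgue_on \<Omega>. F k x * b x) - (LINT x|lebesgue_on \<Omega>. f x * b x)) = norm (LINT x|lebesgue_on \<Omega>. F k x * b x - f x * b x)"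
      using i by simp
    also have "\<dots> \<le> (LINT x|lebesgue_on \<Omega>. norm (F k x * b x - f x * b x))" by (rule integral_norm_bound)
    also have "\<dots> \<le> (LINT x|lebesgue_on \<Omega>. \<bar>B\<bar> * norm (f x - F k x))"
    proof (rule integral_mono)
      fix x
      have "norm (F k x * b x - f x * b x) = \<bar>b x\<bar> * norm (f x - F k x)"
      proof -
        have "F k x * b x - f x * b x = b x * (F k x - f x)" by (simp add: algebra_simps)
        then show ?thesis by (simp add: abs_mult abs_minus_commute)
      qed
      also have "\<dots> \<le> \<bar>B\<bar> * norm (f x - F k x)" using order_trans[OF b(2)[of x] abs_ge_self[of B]] by (intro mult_right_mono) auto
      finally show "norm (F k x * b x - f x * b x) \<le> \<bar>B\<bar> * norm (f x - F k x)" .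
    qed (use i integrable_norm[OF Lq_integrable[OF d[of k]]] in auto)
    also have "\<dots> = \<bar>B\<bar> * (LINT x|lebesgue_on \<Omega>. norm (f x - F k x))" by simp
    finally show ?thesis .
  qed
  then have "(\<lambda>k. (LINT x|lebesgue_on \<Omega>. F k x * b x) - (LINT x|lebesgue_on \<Omega>. f x * b x)) \<longlonglongrightarrow> 0"
    by (intro Lim_null_comparison[OF always_eventually z]) auto
  from tendsto_add[OF this tendsto_const[of "LINT x|lebesgue_on \<Omega>. f x * b x"]] show ?thesis by simp
qed

lemma integral_Cc_eq_lborel:
  fixes f :: "'a \<Rightarrow> real"
  assumes "f \<in> borel_measurable borel" "\<And>x. x \<notin> \<Omega> \<Longrightarrow> f x = 0"
  shows "(LINT x|lebesgue_on \<Omega>. f x) = (LINT x|lborel. f x)"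
proof -
  have "(LINT x|lebesgue_on \<Omega>. f x) = (LINT x|lebesgue. indicator \<Omega> x * f x)" by (rule integral_restrict_lebesgue) simp
  also have "(\<lambda>x. indicator \<Omega> x * f x) = f" proof
    fix x show "indicator \<Omega> x * f x = f x" using assms(2)[of x] by (cases "x \<in> \<Omega>") auto
  qed
  finally show ?thesis using assms(1) by (simp add: integral_completion)
qed

text \<open>The product of two test functions is C^1 with compact support, so its directional
  derivative has integral 0.\<close>

lemma Cc_integration_by_parts:
  assumes \<phi>: "\<phi> \<in> Cc_inf \<Omega>" and \<eta>: "\<eta> \<in> Cc_inf \<Omega>"
  shows "(LINT x|lebesgue_on \<Omega>. \<phi> x * (grad \<eta> x \<bullet> e)) = - (LINT x|lebesgue_on \<Omega>. (grad \<phi> x \<bullet> e) * \<eta> x)"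
proof -
  have g: "grad (\<lambda>x. \<phi> x * \<eta> x) x = \<phi> x *\<^sub>R grad \<eta> x + \<eta> x *\<^sub>R grad \<phi> x" for x
  proof (rule grad_eqI)
    show "((\<lambda>x. \<phi> x * \<eta> x) has_derivative (\<bullet>) (\<phi> x *\<^sub>R grad \<eta> x + \<eta> x *\<^sub>R grad \<phi> x)) (at x)"
      using has_derivative_mult[OF Cc_D(8)[OF \<phi>, of x] Cc_D(8)[OF \<eta>, of x]]
      by (simp add: inner_add_left[abs_def] inner_scaleR_left[abs_def] mult.commute)
  qed
  have sub: "closure {x. \<phi> x * \<eta> x \<noteq> 0} \<subseteq> closure {x. \<phi> x \<noteq> 0}" by (intro closure_mono) auto
  have "compact (closure {x. \<phi> x * \<eta> x \<noteq> 0})"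
    using Cc_D(2)[OF \<phi>] bounded_subset[OF _ sub] by (simp add: compact_eq_bounded_closed)
  then have z: "(LINT x|lborel. grad (\<lambda>x. \<phi> x * \<eta> x) x \<bullet> e) = 0"
    by (intro integral_directional_derivative_zero C_k_mult Cc_D(1) \<phi> \<eta>)
  obtain L where L: "0 \<le> L" "\<And>x. \<bar>\<phi> x\<bar> \<le> L" "\<And>x. norm (grad \<phi> x) \<le> L" using Cc_bounds[OF \<phi>] by blast
  obtain M where M: "0 \<le> M" "\<And>x. \<bar>\<eta> x\<bar> \<le> M" "\<And>x. norm (grad \<eta> x) \<le> M" using Cc_bounds[OF \<eta>] by blast
  note [measurable] = Cc_meas[OF \<phi>] Cc_meas[OF \<eta>]
  have b: "\<bar>grad \<eta> x \<bullet> e\<bar> \<le> M * norm e" for x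
    using Cauchy_Schwarz_ineq2[of "grad \<eta> x" e] mult_right_mono[OF M(3)[of x] norm_ge_zero[of e]] by linarith
  have i: "integrable (lebesgue_on \<Omega>) (\<lambda>x. \<phi> x * (grad \<eta> x \<bullet> e))" "integrable (lebesgue_on \<Omega>) (\<lambda>x. (grad \<phi> x \<bullet> e) * \<eta> x)"
    by (rule integrable_mult_bounded[OF Lq_integrable[OF Cc_Lq(1)[OF \<phi>]] _ b], measurable)
      (rule integrable_mult_bounded[OF integrable_inner_left[OF Lq_integrable[OF Cc_Lq(2)[OF \<phi>]]] _ M(2)], measurable)
  have "0 = (LINT x|lborel. \<phi> x * (grad \<eta> x \<bullet> e) + (grad \<phi> x \<bullet> e) * \<eta> x)"
    using z unfolding g by (simp add: inner_add_left mult.commute)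
  also have "\<dots> = (LINT x|lebesgue_on \<Omega>. \<phi> x * (grad \<eta> x \<bullet> e) + (grad \<phi> x \<bullet> e) * \<eta> x)"
  proof (rule integral_Cc_eq_lborel[symmetric])
    note [measurable] = Cc_D(6,7)[OF \<phi>] Cc_D(6,7)[OF \<eta>]
    show "(\<lambda>x. \<phi> x * (grad \<eta> x \<bullet> e) + (grad \<phi> x \<bullet> e) * \<eta> x) \<in> borel_measurable borel" by measurable
  qed (use Cc_D(4)[OF \<phi>] Cc_D(4)[OF \<eta>] in auto)
  also have "\<dots> = (LINT x|lebesgue_on \<Omega>. \<phi> x * (grad \<eta> x \<bullet> e)) + (LINT x|lebesgue_on \<Omega>. (grad \<phi> x \<bullet> e) * \<eta> x)"
    using i by simp
  finally show ?thesis by linarith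
qed

lemma W0_has_weak_grad:
  assumes "W0 \<Omega> p u G"
  shows "has_weak_grad \<Omega> u G"
  unfolding has_weak_grad_def
proof (intro conjI ballI)
  show "u \<in> L1_loc \<Omega>" "G \<in> L1_loc \<Omega>" using W0_Lq[OF assms] Lq_L1_loc by auto
  fix \<eta> and i :: 'a assume \<eta>: "\<eta> \<in> Cc_inf \<Omega>" and i: "i \<in> Basis"
  obtain \<phi> where \<phi>: "\<And>k::nat. \<phi> k \<in> Cc_inf \<Omega>" 
    "(\<lambda>k. LINT x|lebesgue_on \<Omega>. norm (u x - \<phi> k x) powr p) \<longlonglongrightarrow> 0"
    "(\<lambda>k. LINT x|lebesgue_on \<Omega>. norm (G x - grad (\<phi> k) x) powr p) \<longlonglongrightarrow> 0" by (rule W0_seq[OF assms]) (rule that)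
  obtain M where M: "0 \<le> M" "\<And>x. \<bar>\<eta> x\<bar> \<le> M" "\<And>x. norm (grad \<eta> x) \<le> M" using Cc_bounds[OF \<eta>] by blast
  note [measurable] = Cc_meas[OF \<eta>]
  have p0: "0 \<le> p" using p1 by simp
  have b: "\<bar>grad \<eta> x \<bullet> i\<bar> \<le> M" for x using Basis_le_norm[OF i, of "grad \<eta> x"] M(3)[of x] by linarith
  have comp: "(\<lambda>x. H x \<bullet> i) \<in> Lq \<Omega> p" if "H \<in> Lq \<Omega> p" for H :: "'a \<Rightarrow> 'a"
    by (rule Lq_bound[OF that, of _ 1]) (use that p0 Basis_le_norm[OF i] in \<open>auto simp: Lq_def\<close>)
  have l1: "(\<lambda>k. LINT x|lebesgue_on \<Omega>. \<phi> k x * (grad \<eta> x \<bullet> i)) \<longlonglongrightarrow> (LINT x|lebesgue_on \<Omega>. u x * (grad \<eta> x \<bullet> i))"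
    by (rule Lp_tendsto_integral_mult[OF W0_Lq(1)[OF assms] Cc_Lq(1)[OF \<phi>(1)] \<phi>(2) _ b]) measurable
  have "(\<lambda>k. LINT x|lebesgue_on \<Omega>. norm (G x \<bullet> i - grad (\<phi> k) x \<bullet> i) powr p) \<longlonglongrightarrow> 0"
  proof (rule tendsto_sandwich[OF _ _ tendsto_const \<phi>(3)]; rule always_eventually, rule allI)
    fix k
    show "0 \<le> (LINT x|lebesgue_on \<Omega>. norm (G x \<bullet> i - grad (\<phi> k) x \<bullet> i) powr p)" by simp
    show "(LINT x|lebesgue_on \<Omega>. norm (G x \<bullet> i - grad (\<phi> k) x \<bullet> i) powr p) \<le> (LINT x|lebesgue_on \<Omega>. norm (G x - grad (\<phi> k) x) powr p)"
    proof (rule integral_mono)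
      show "integrable (lebesgue_on \<Omega>) (\<lambda>x. norm (G x \<bullet> i - grad (\<phi> k) x \<bullet> i) powr p)"
        using Lq_diff[OF comp[OF W0_Lq(2)[OF assms]] comp[OF Cc_Lq(2)[OF \<phi>(1)]] p0] by (simp add: Lq_def)
      show "integrable (lebesgue_on \<Omega>) (\<lambda>x. norm (G x - grad (\<phi> k) x) powr p)"
        using Lq_diff[OF W0_Lq(2)[OF assms] Cc_Lq(2)[OF \<phi>(1)] p0] by (simp add: Lq_def)
      show "norm (G x \<bullet> i - grad (\<phi> k) x \<bullet> i) powr p \<le> norm (G x - grad (\<phi> k) x) powr p" for x
        using Basis_le_norm[OF i, of "G x - grad (\<phi> k) x"] p0 by (intro powr_mono2) (auto simp: inner_diff_left)
    qed
  qed
  then have l2: "(\<lambda>k. LINT x|lebesgue_on \<Omega>. (grad (\<phi> k) x \<bullet> i) * \<eta> x) \<longlonglongrightarrow> (LINT x|lebesgue_on \<Omega>. (G x \<bullet> i) * \<eta> x)"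
    by (rule Lp_tendsto_integral_mult[OF comp[OF W0_Lq(2)[OF assms]] comp[OF Cc_Lq(2)[OF \<phi>(1)]] _ _ M(2)]) measurable
  have "(\<lambda>k. LINT x|lebesgue_on \<Omega>. \<phi> k x * (grad \<eta> x \<bullet> i)) \<longlonglongrightarrow> - (LINT x|lebesgue_on \<Omega>. (G x \<bullet> i) * \<eta> x)"
    unfolding Cc_integration_by_parts[OF \<phi>(1) \<eta>] by (rule tendsto_minus[OF l2])
  from LIMSEQ_unique[OF l1 this]
  show "(LINT x|lebesgue_on \<Omega>. u x * (grad \<eta> x \<bullet> i)) = - (LINT x|lebesgue_on \<Omega>. (G x \<bullet> i) * \<eta> x)" .
qed

lemma L1_loc_mult_Cc_integrable:
  assumes G: "G \<in> L1_loc \<Omega>" and \<phi>: "\<phi> \<in> Cc_inf \<Omega>"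
  shows "integrable (lebesgue_on \<Omega>) (\<lambda>x. (G x \<bullet> (i::'a)) * \<phi> x)"
proof -
  let ?K = "closure {x. \<phi> x \<noteq> 0}"
  have K: "compact ?K" "?K \<subseteq> \<Omega>" using Cc_D(2,3)[OF \<phi>] by simp_all
  have Ks: "?K \<in> sets lebesgue" using K by (simp add: borel_compact)
  have "integrable (lebesgue_on ?K) (\<lambda>x. G x \<bullet> i)" using G K unfolding L1_loc_def by (intro integrable_inner_left) simp
  then have i: "integrable lebesgue (\<lambda>x. indicator ?K x * (G x \<bullet> i))"
    using Ks by (subst (asm) integrable_restrict_space) simp_all
  obtain M where M: "0 \<le> M" "\<And>x. \<bar>\<phi> x\<bar> \<le> M" by (rule Cc_bounds[OF \<phi>]) (rule that)
  have [measurable]: "\<phi> \<in> borel_measurable lebesgue" using Cc_D(6)[OF \<phi>] by (intro measurable_completion) simp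
  have "integrable lebesgue (\<lambda>x. (indicator ?K x * (G x \<bullet> i)) * \<phi> x)"
  proof (rule Bochner_Integration.integrable_bound)
    show "integrable lebesgue (\<lambda>x. M * norm (indicator ?K x * (G x \<bullet> i)))" using i by (intro integrable_mult_right integrable_norm)
    show "(\<lambda>x. (indicator ?K x * (G x \<bullet> i)) * \<phi> x) \<in> borel_measurable lebesgue"
      by (rule borel_measurable_times[OF borel_measurable_integrable[OF i]]) measurable
    have "norm ((indicator ?K x * (G x \<bullet> i)) * \<phi> x) \<le> norm (M * norm (indicator ?K x * (G x \<bullet> i)))" for x
    proof -
      have "norm (y * \<phi> x) \<le> norm (M * norm y)" for y :: real
        using mult_left_mono[OF M(2)[of x], of "\<bar>y\<bar>"] M(1) by (simp add: abs_mult mult.commute)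
      then show ?thesis .
    qed
    then show "AE x in lebesgue. norm ((indicator ?K x * (G x \<bullet> i)) * \<phi> x) \<le> norm (M * norm (indicator ?K x * (G x \<bullet> i)))" by simp
  qed
  moreover have "(indicator ?K x * (G x \<bullet> i)) * \<phi> x = indicator \<Omega> x *\<^sub>R ((G x \<bullet> i) * \<phi> x)" for x
  proof (cases "\<phi> x = 0")
    case False
    then have "x \<in> ?K" using subsetD[OF closure_subset, of x "{x. \<phi> x \<noteq> 0}"] by simp
    moreover from this have "x \<in> \<Omega>" by (rule subsetD[OF K(2)])
    ultimately show ?thesis by (simp only: indicator_simps(1) mult_1 scaleR_one)
  qed (simp only: mult_zero_right scaleR_zero_right)
  ultimately have "integrable lebesgue (\<lambda>x. indicator \<Omega> x *\<^sub>R ((G x \<bullet> i) * \<phi> x))" by (simp only:)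
  then show ?thesis by (subst integrable_restrict_space) auto
qed

lemma weak_grad_unique:
  assumes "has_weak_grad \<Omega> u G" "has_weak_grad \<Omega> u H"
  shows "AE x in lebesgue_on \<Omega>. G x = H x"
proof -
  have "AE x in lebesgue_on \<Omega>. (G x - H x) \<bullet> i = 0" if i: "i \<in> Basis" for i
  proof (rule fundamental_lemma[OF op])
    show "integrable (lebesgue_on K) (\<lambda>x. (G x - H x) \<bullet> i)" if "compact K" "K \<subseteq> \<Omega>" for K
      using assms that unfolding has_weak_grad_def L1_loc_def by (auto intro: integrable_inner_left)
    fix \<phi> assume \<phi>: "\<phi> \<in> Cc_inf \<Omega>"
    have "(LINT x|lebesgue_on \<Omega>. (G x - H x) \<bullet> i * \<phi> x) = (LINT x|lebesgue_on \<Omega>. (G x \<bullet> i) * \<phi> x) - (LINT x|lebesgue_on \<Omega>. (H x \<bullet> i) * \<phi> x)"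
      using assms \<phi> unfolding has_weak_grad_def
      by (subst Bochner_Integration.integral_diff[symmetric]) (auto intro: L1_loc_mult_Cc_integrable simp: inner_diff_left left_diff_distrib)
    also have "\<dots> = 0" using assms \<phi> i unfolding has_weak_grad_def by auto
    finally show "(LINT x|lebesgue_on \<Omega>. (G x - H x) \<bullet> i * \<phi> x) = 0" .
  qed
  then have "AE x in lebesgue_on \<Omega>. \<forall>i\<in>Basis. (G x - H x) \<bullet> i = 0"
    by (subst AE_ball_countable) (auto intro: countable_finite)
  then show ?thesis
  proof eventually_elim
    case (elim x)
    then have "G x - H x = 0" by (intro euclidean_eqI[of "G x - H x" 0]) simp
    then show ?case by simp
  qed
qed

text \<open>The representative picked by \<open>SOME\<close> equals G almost everywhere by
  uniqueness, and it is measurable because Lebesgue measure is complete. So it can replace any other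
  gradient inside \<open>W0\<close>.\<close>

lemma weak_grad_AE:
  assumes "W0 \<Omega> p u G"
  shows "AE x in lebesgue_on \<Omega>. weak_grad \<Omega> u x = G x" and "W0 \<Omega> p u (weak_grad \<Omega> u)"
proof -
  have "has_weak_grad \<Omega> u (weak_grad \<Omega> u)"
    unfolding weak_grad_def using someI[of "has_weak_grad \<Omega> u", OF W0_has_weak_grad[OF assms]] .
  then show ae: "AE x in lebesgue_on \<Omega>. weak_grad \<Omega> u x = G x"
    using W0_has_weak_grad[OF assms] by (rule weak_grad_unique)
  have "(\<lambda>x. indicator \<Omega> x *\<^sub>R G x) \<in> borel_measurable lebesgue"
    using W0_meas(2)[OF assms] by (subst (asm) borel_measurable_restrict_space_iff) auto
  moreover have "AE x in lebesgue. indicator \<Omega> x *\<^sub>R G x = indicator \<Omega> x *\<^sub>R weak_grad \<Omega> u x"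
    using ae by (simp add: AE_restrict_space_iff indicator_def) (auto elim: eventually_mono)
  ultimately have "(\<lambda>x. indicator \<Omega> x *\<^sub>R weak_grad \<Omega> u x) \<in> borel_measurable lebesgue" by (rule borel_measurable_AE)
  then have "weak_grad \<Omega> u \<in> borel_measurable (lebesgue_on \<Omega>)" by (subst borel_measurable_restrict_space_iff) auto
  then show "W0 \<Omega> p u (weak_grad \<Omega> u)"
    using ae W0_meas[OF assms] by (intro W0_cong_AE[OF assms]) (auto elim: eventually_mono)
qed

text \<open>With the gradient quantified existentially, membership of the test functions can be read
  off from the calculus of \<open>W0\<close>.\<close>

lemma W1p_0_iff:
  "u \<in> W1p_0 \<Omega> p \<longleftrightarrow> (\<exists>G. W0 \<Omega> p u G) \<and> (\<forall>x. x \<notin> \<Omega> \<longrightarrow> u x = 0)"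
proof
  assume u: "u \<in> W1p_0 \<Omega> p"
  then obtain \<phi> where \<phi>: "\<And>k::nat. \<phi> k \<in> Cc_inf \<Omega>" 
    "(\<lambda>k. LINT x|lebesgue_on \<Omega>. norm (u x - \<phi> k x) powr p) \<longlonglongrightarrow> 0"
    "(\<lambda>k. LINT x|lebesgue_on \<Omega>. norm (weak_grad \<Omega> u x - grad (\<phi> k) x) powr p) \<longlonglongrightarrow> 0"
    unfolding W1p_0_def by auto
  have "W0 \<Omega> p u (weak_grad \<Omega> u)"
    by (rule W0_limit[OF W0_Cc[OF \<phi>(1)] _ _ \<phi>(2,3)]) (use u in \<open>auto simp: W1p_0_def W1p_def\<close>)
  then show "(\<exists>G. W0 \<Omega> p u G) \<and> (\<forall>x. x \<notin> \<Omega> \<longrightarrow> u x = 0)" using u by (auto simp: W1p_0_def)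
next
  assume *: "(\<exists>G. W0 \<Omega> p u G) \<and> (\<forall>x. x \<notin> \<Omega> \<longrightarrow> u x = 0)"
  then obtain G where G: "W0 \<Omega> p u G" by blast
  note W = weak_grad_AE(2)[OF G]
  obtain \<phi> where \<phi>: "\<And>k::nat. \<phi> k \<in> Cc_inf \<Omega>" 
    "(\<lambda>k. LINT x|lebesgue_on \<Omega>. norm (u x - \<phi> k x) powr p) \<longlonglongrightarrow> 0"
    "(\<lambda>k. LINT x|lebesgue_on \<Omega>. norm (weak_grad \<Omega> u x - grad (\<phi> k) x) powr p) \<longlonglongrightarrow> 0" by (rule W0_seq[OF W]) (rule that)
  then show "u \<in> W1p_0 \<Omega> p"
    using * W0_Lq[OF W] W0_has_weak_grad[OF W] unfolding W1p_0_def W1p_def by auto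
qed

end

section \<open>Chain rules\<close>

text \<open>Weierstrass approximation is applied to the derivative and the polynomial is then
  integrated. This way both P' and, through the common value at 0, the function itself are
  close.\<close>

lemma polynomial_C1_approx:
  fixes h :: "real \<Rightarrow> real"
  assumes h: "continuous_on {-M..M} h" and \<epsilon>: "0 < \<epsilon>"
  obtains P P' where "\<And>k. C_k k P" "P 0 = 0" "\<And>t. (P has_real_derivative P' t) (at t)"
    "\<And>t. \<bar>t\<bar> \<le> M \<Longrightarrow> \<bar>h t - P' t\<bar> < \<epsilon>"
proof -
  obtain Q where Q: "real_polynomial_function Q" "\<And>x. x \<in> {-M..M} \<Longrightarrow> \<bar>h x - Q x\<bar> < \<epsilon>"
    using Stone_Weierstrass_real_polynomial_function[OF compact_Icc h \<epsilon>] by blast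
  obtain a n where Qs: "Q = (\<lambda>x. \<Sum>i\<le>(n::nat). a i * x ^ i)"
    using Q(1) unfolding real_polynomial_function_iff_sum by blast
  \<comment> \<open>The antiderivative without constant term: vanishing at 0 keeps \<open>P\<close>
    composed with a test function compactly supported.\<close>
  define P where "P t = (\<Sum>i\<le>n. (a i / real (Suc i)) * t ^ Suc i)" for t
  show thesis
  proof (rule that[of P Q])
    show "C_k k P" for k
      unfolding P_def[abs_def] by (intro C_k_sum C_k_mult C_k_const C_k_power C_k_linear bounded_linear_ident)
    show "P 0 = 0" by (simp add: P_def)
    show "(P has_real_derivative Q t) (at t)" for t
    proof -
      have "((\<lambda>t. (a i / real (Suc i)) * t ^ Suc i) has_real_derivative a i * t ^ i) (at t)" for i
        using DERIV_cmult[OF DERIV_pow[of "Suc i" t UNIV], of "a i / real (Suc i)"] by (simp del: of_nat_Suc power_Suc)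
      then show ?thesis unfolding P_def[abs_def] Qs by (intro DERIV_sum)
    qed
    show "\<bar>h t - Q t\<bar> < \<epsilon>" if "\<bar>t\<bar> \<le> M" for t
      by (rule Q(2)) (use that in auto)
  qed
qed

text \<open>Powers of t + \<epsilon> are C^1 with bounded derivative only on an interval. Replacing
  them outside it by a globally C^1 function with bounded derivative brings them under the chain
  rule \<open>W0_comp_C1\<close>.\<close>

lemma C1_extension:
  fixes g g' :: "real \<Rightarrow> real"
  assumes AB: "A \<le> 0" "0 \<le> B" and g: "\<And>t. A \<le> t \<Longrightarrow> t \<le> B \<Longrightarrow> (g has_real_derivative g' t) (at t within {A..B})"
    and g': "continuous_on {A..B} g'"
  obtains H h C where "\<And>t. (H has_real_derivative h t) (at t)" "continuous_on UNIV h" "\<And>t. \<bar>h t\<bar> \<le> C" "H 0 = 0"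
    "\<And>t. A \<le> t \<Longrightarrow> t \<le> B \<Longrightarrow> H t = g t - g 0" "\<And>t. A \<le> t \<Longrightarrow> t \<le> B \<Longrightarrow> h t = g' t"
proof -
  \<comment> \<open>The derivative is extended by its end values, which keeps it continuous and
    bounded; \<open>H\<close> is then an antiderivative.\<close>
  define h where "h t = g' (max A (min B t))" for t
  have cl: "max A (min B t) \<in> {A..B}" for t using AB by auto
  have hc: "continuous_on UNIV h"
    unfolding h_def[abs_def]
    by (rule continuous_on_compose2[OF g', where f = "\<lambda>t. max A (min B t)"]) (use cl in \<open>auto intro!: continuous_intros\<close>)
  have "\<exists>F. \<forall>x. -\<infinity> < ereal x \<longrightarrow> ereal x < \<infinity> \<longrightarrow> (F has_vector_derivative h x) (at x)"
    by (rule einterval_antiderivative) (use hc in \<open>auto simp: continuous_on_eq_continuous_at\<close>)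
  then obtain F where F: "\<And>x. (F has_real_derivative h x) (at x)"
    by (auto simp: has_real_derivative_iff_has_vector_derivative)
  have "bounded (g' ` {A..B})" by (intro compact_imp_bounded compact_continuous_image g') auto
  then obtain C where "\<forall>y\<in>g' ` {A..B}. norm y \<le> C" unfolding bounded_iff by blast
  then have C: "\<And>t. t \<in> {A..B} \<Longrightarrow> \<bar>g' t\<bar> \<le> C" by simp
  have "\<exists>c. \<forall>t\<in>{A..B}. F t - g t = c"
  proof (rule has_field_derivative_zero_constant)
    fix t assume t: "t \<in> {A..B}"
    then have "h t = g' t" by (auto simp: h_def)
    then show "((\<lambda>t. F t - g t) has_real_derivative 0) (at t within {A..B})"
      using DERIV_diff[OF has_field_derivative_at_within[OF F[of t], of "{A..B}"] g[of t]] t by simp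
  qed simp
  then obtain c where c: "\<And>t. t \<in> {A..B} \<Longrightarrow> F t - g t = c" by blast
  show thesis
  proof (rule that[of "\<lambda>t. F t - F 0" h C])
    show "((\<lambda>t. F t - F 0) has_real_derivative h t) (at t)" for t
      using DERIV_diff[OF F[of t] DERIV_const] by simp
    show "\<bar>h t\<bar> \<le> C" for t using C[OF cl] by (simp add: h_def)
    show "F t - F 0 = g t - g 0" if "A \<le> t" "t \<le> B" for t using c[of t] c[of 0] that AB by simp
    show "h t = g' t" if "A \<le> t" "t \<le> B" for t using that by (simp add: h_def)
  qed (use hc in auto)
qed

text \<open>C^1 approximations of the positive part and their derivatives. Squaring t^+ instead of t
  makes them vanish for t <= 0, so the derivatives converge to the indicator of t > 0 at every
  point, including 0.\<close>

lemma tendsto_smooth_pos: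
  fixes t :: real
  shows "(\<lambda>j. sqrt ((max 0 t)\<^sup>2 + (1 / real (Suc j))\<^sup>2) - 1 / real (Suc j)) \<longlonglongrightarrow> max 0 t"
    and "(\<lambda>j. max 0 t / sqrt ((max 0 t)\<^sup>2 + (1 / real (Suc j))\<^sup>2)) \<longlonglongrightarrow> (if 0 < t then 1 else 0)"
proof -
  have z: "(\<lambda>j. 1 / real (Suc j)) \<longlonglongrightarrow> 0" using LIMSEQ_inverse_real_of_nat by (simp add: divide_inverse)
  have "(\<lambda>j. sqrt ((max 0 t)\<^sup>2 + (1 / real (Suc j))\<^sup>2)) \<longlonglongrightarrow> sqrt ((max 0 t)\<^sup>2 + 0\<^sup>2)"
    by (intro tendsto_intros z)
  then have s: "(\<lambda>j. sqrt ((max 0 t)\<^sup>2 + (1 / real (Suc j))\<^sup>2)) \<longlonglongrightarrow> max 0 t" by simp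
  from tendsto_diff[OF s z]
  show "(\<lambda>j. sqrt ((max 0 t)\<^sup>2 + (1 / real (Suc j))\<^sup>2) - 1 / real (Suc j)) \<longlonglongrightarrow> max 0 t" by simp
  show "(\<lambda>j. max 0 t / sqrt ((max 0 t)\<^sup>2 + (1 / real (Suc j))\<^sup>2)) \<longlonglongrightarrow> (if 0 < t then 1 else 0)"
  proof (cases "0 < t")
    case True
    have "(\<lambda>j. max 0 t / sqrt ((max 0 t)\<^sup>2 + (1 / real (Suc j))\<^sup>2)) \<longlonglongrightarrow> max 0 t / max 0 t"
      by (rule tendsto_divide[OF tendsto_const s]) (use True in simp)
    then show ?thesis using True by simp
  qed simp
qed

lemma DERIV_max_square: "((\<lambda>t::real. (max 0 t)\<^sup>2) has_real_derivative 2 * max 0 t) (at t)"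
proof -
  consider "t < 0" | "t = 0" | "0 < t" by linarith
  then show ?thesis
  proof cases
    case 1
    have "((\<lambda>_. 0) has_real_derivative 2 * max 0 t) (at t)" using 1 by simp
    then show ?thesis
      by (rule has_field_derivative_transform_within_open[where S = "{..<0}"]) (use 1 in auto)
  next
    case 3
    have "((\<lambda>t. t\<^sup>2) has_real_derivative 2 * max 0 t) (at t)" using 3 by (auto intro!: derivative_eq_intros)
    then show ?thesis
      by (rule has_field_derivative_transform_within_open[where S = "{0<..}"]) (use 3 in auto)
  next
    case 2
    have "((\<lambda>h::real. (max 0 h)\<^sup>2 / h) \<longlongrightarrow> 0) (at 0)"
    proof (rule Lim_null_comparison)
      show "\<forall>\<^sub>F h::real in at 0. norm ((max 0 h)\<^sup>2 / h) \<le> \<bar>h\<bar>"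
        by (rule always_eventually) (auto simp: max_def power2_eq_square)
      show "((\<lambda>h::real. \<bar>h\<bar>) \<longlongrightarrow> 0) (at 0)" by (auto intro!: tendsto_eq_intros)
    qed
    then show ?thesis using 2 by (simp add: DERIV_def)
  qed
qed

context bounded_open begin

lemma W0_comp_Cc:
  fixes g g' :: "real \<Rightarrow> real"
  assumes \<phi>: "\<phi> \<in> Cc_inf \<Omega>" and g: "\<And>t. (g has_real_derivative g' t) (at t)" "continuous_on UNIV g'" "g 0 = 0"
  shows "W0 \<Omega> p (\<lambda>x. g (\<phi> x)) (\<lambda>x. g' (\<phi> x) *\<^sub>R grad \<phi> x)"
proof -
  obtain L where L: "0 \<le> L" "\<And>x. \<bar>\<phi> x\<bar> \<le> L" "\<And>x. norm (grad \<phi> x) \<le> L" by (rule Cc_bounds[OF \<phi>]) (rule that)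
  note [measurable] = Cc_meas[OF \<phi>]
  have gi: "isCont g t" for t by (rule DERIV_isCont[OF g(1)])
  have gcont: "continuous_on UNIV g" by (simp add: continuous_at_imp_continuous_on gi)
  have [measurable]: "g \<in> borel_measurable borel" "g' \<in> borel_measurable borel"
    by (rule borel_measurable_continuous_onI[OF gcont], rule borel_measurable_continuous_onI[OF g(2)])
  have "\<forall>n. \<exists>Q. (\<forall>k. C_k k (fst Q)) \<and> fst Q 0 = 0 \<and> (\<forall>t. (fst Q has_real_derivative snd Q t) (at t)) \<and>
    (\<forall>t. \<bar>t\<bar> \<le> L \<longrightarrow> \<bar>g' t - snd Q t\<bar> < 1 / real (Suc n))"
  proof
    fix n
    have gc: "continuous_on {-L..L} g'" using continuous_on_subset[OF g(2)] by simp
    have n0: "0 < 1 / real (Suc n)" by simp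
    obtain P P' where "\<And>k. C_k k P" "P 0 = 0" "\<And>t. (P has_real_derivative P' t) (at t)"
      "\<And>t. \<bar>t\<bar> \<le> L \<Longrightarrow> \<bar>g' t - P' t\<bar> < 1 / real (Suc n)"
      by (rule polynomial_C1_approx[OF gc n0]) (rule that)
    then show "\<exists>Q. (\<forall>k. C_k k (fst Q)) \<and> fst Q 0 = 0 \<and> (\<forall>t. (fst Q has_real_derivative snd Q t) (at t)) \<and>
      (\<forall>t. \<bar>t\<bar> \<le> L \<longrightarrow> \<bar>g' t - snd Q t\<bar> < 1 / real (Suc n))"
      by (intro exI[of _ "(P, P')"]) simp
  qed
  from choice[OF this] obtain Q where Q: "\<forall>n. (\<forall>k. C_k k (fst (Q n))) \<and> fst (Q n) 0 = 0 \<and> (\<forall>t. (fst (Q n) has_real_derivative snd (Q n) t) (at t)) \<and>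
    (\<forall>t. \<bar>t\<bar> \<le> L \<longrightarrow> \<bar>g' t - snd (Q n) t\<bar> < 1 / real (Suc n))" ..
  define P P' where "P n = fst (Q n)" and "P' n = snd (Q n)" for n
  have P: "\<And>n k. C_k k (P n)" "\<And>n. P n 0 = 0" "\<And>n t. (P n has_real_derivative P' n t) (at t)"
    "\<And>n t. \<bar>t\<bar> \<le> L \<Longrightarrow> \<bar>g' t - P' n t\<bar> < 1 / real (Suc n)" using Q by (simp_all add: P_def P'_def)
  \<comment> \<open>Closeness of the derivatives together with equal values at 0, by the mean value
    inequality on the range [-L, L] of \<phi>.\<close>
  have gP: "\<bar>g t - P n t\<bar> \<le> 1 / real (Suc n) * L" if "\<bar>t\<bar> \<le> L" for n t
  proof -
    have "norm ((g t - P n t) - (g 0 - P n 0)) \<le> 1 / real (Suc n) * norm (t - 0)"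
    proof (rule field_differentiable_bound[of "{-L..L}" "\<lambda>t. g t - P n t" "\<lambda>t. g' t - P' n t"])
      show "((\<lambda>t. g t - P n t) has_real_derivative g' z - P' n z) (at z within {-L..L})" for z
        by (rule has_field_derivative_at_within[OF DERIV_diff[OF g(1) P(3)]])
      show "norm (g' z - P' n z) \<le> 1 / real (Suc n)" if "z \<in> {-L..L}" for z
      proof -
        have "\<bar>z\<bar> \<le> L" using that by auto
        from P(4)[OF this, of n] show ?thesis by simp
      qed
    qed (use that L in auto)
    also have "\<dots> \<le> 1 / real (Suc n) * L" using that by (intro mult_left_mono) auto
    finally show ?thesis using P(2) g(3) by simp
  qed
  have z: "(\<lambda>j. 1 / real (Suc j)) \<longlonglongrightarrow> 0" using LIMSEQ_inverse_real_of_nat by (simp add: divide_inverse)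
  have one: "(\<lambda>x::'a. 1::real) \<in> Lq \<Omega> p" using p1 by (intro Lq_bounded[where C = 1] fin_meas) auto
  have bd: "(\<lambda>x. g (\<phi> x)) \<in> Lq \<Omega> p" "(\<lambda>x. g' (\<phi> x) *\<^sub>R grad \<phi> x) \<in> Lq \<Omega> p"
  proof -
    have "bounded (g ` {-L..L})" "bounded (g' ` {-L..L})"
      using continuous_on_subset[OF g(2)] continuous_on_subset[OF gcont]
      by (simp_all add: compact_imp_bounded compact_continuous_image)
    then obtain B C where bc: "\<forall>y\<in>g ` {-L..L}. norm y \<le> B" "\<forall>y\<in>g' ` {-L..L}. norm y \<le> C"
      unfolding bounded_iff by blast
    have B: "norm (g t) \<le> B" and C: "norm (g' t) \<le> C" if "t \<in> {-L..L}" for t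
      using bspec[OF bc(1) imageI[OF that]] bspec[OF bc(2) imageI[OF that]] .
    have in': "\<phi> x \<in> {-L..L}" for x using L(2)[of x] by auto
    show "(\<lambda>x. g (\<phi> x)) \<in> Lq \<Omega> p"
      using p1 B[OF in'] by (intro Lq_bounded[where C = B] fin_meas) auto
    have "norm (g' (\<phi> x) *\<^sub>R grad \<phi> x) \<le> C * L" for x
      using mult_mono[OF C[OF in'[of x]] L(3)[of x]] order_trans[OF norm_ge_zero C[OF in'[of x]]] by simp
    then show "(\<lambda>x. g' (\<phi> x) *\<^sub>R grad \<phi> x) \<in> Lq \<Omega> p"
      using p1 by (intro Lq_bounded[where C = "C * L"] fin_meas) auto
  qed
  have conv: "F \<longlonglongrightarrow> l" if "\<And>n. norm (l - F n) \<le> 1 / real (Suc n) * L" for F and l :: "'c::real_normed_vector"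
  proof -
    have "(\<lambda>n. 1 / real (Suc n) * L) \<longlonglongrightarrow> 0 * L" by (intro tendsto_intros z)
    then have "(\<lambda>n. 1 / real (Suc n) * L) \<longlonglongrightarrow> 0" by simp
    then have "(\<lambda>n. l - F n) \<longlonglongrightarrow> 0" by (rule Lim_null_comparison[rotated]) (use that in auto)
    from tendsto_diff[OF tendsto_const[of l] this] show ?thesis by simp
  qed
  have le1: "1 / real (Suc n) * L \<le> L" for n using mult_right_mono[of "1 / real (Suc n)" 1 L] L(1) by simp
  have d1: "norm (g (\<phi> x) - P n (\<phi> x)) \<le> 1 / real (Suc n) * L" for n x using gP[OF L(2)] by simp
  have d2: "norm (g' (\<phi> x) *\<^sub>R grad \<phi> x - grad (\<lambda>x. P n (\<phi> x)) x) \<le> 1 / real (Suc n) * L" for n x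
  proof -
    have "norm (g' (\<phi> x) *\<^sub>R grad \<phi> x - grad (\<lambda>x. P n (\<phi> x)) x) = \<bar>g' (\<phi> x) - P' n (\<phi> x)\<bar> * norm (grad \<phi> x)"
      unfolding Cc_compose(2)[OF \<phi> P(1-3)] by (simp add: scaleR_diff_left[symmetric])
    also have "\<dots> \<le> 1 / real (Suc n) * L" using P(4)[OF L(2), of x n] L by (intro mult_mono) auto
    finally show ?thesis .
  qed
  have W: "W0 \<Omega> p (\<lambda>x. P n (\<phi> x)) (grad (\<lambda>x. P n (\<phi> x)))" for n
    by (rule W0_Cc[OF Cc_compose(1)[OF \<phi> P(1-3)]])
  show ?thesis
  proof (rule W0_limit[OF W bd])
    show "(\<lambda>k. LINT x|lebesgue_on \<Omega>. norm (g (\<phi> x) - P k (\<phi> x)) powr p) \<longlonglongrightarrow> 0"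
    proof (rule Lp_dominated_convergence[OF _ W0_meas(1)[OF W] one _ L(1)])
      show "AE x in lebesgue_on \<Omega>. (\<lambda>k. P k (\<phi> x)) \<longlonglongrightarrow> g (\<phi> x)" by (intro AE_I2 conv d1)
      show "AE x in lebesgue_on \<Omega>. norm (g (\<phi> x) - P k (\<phi> x)) \<le> L * norm (1::real)" for k
        using order_trans[OF d1 le1] by simp
    qed (use p1 in auto)
    show "(\<lambda>k. LINT x|lebesgue_on \<Omega>. norm (g' (\<phi> x) *\<^sub>R grad \<phi> x - grad (\<lambda>x. P k (\<phi> x)) x) powr p) \<longlonglongrightarrow> 0"
    proof (rule Lp_dominated_convergence[OF _ W0_meas(2)[OF W] one _ L(1)])
      show "AE x in lebesgue_on \<Omega>. (\<lambda>k. grad (\<lambda>x. P k (\<phi> x)) x) \<longlonglongrightarrow> g' (\<phi> x) *\<^sub>R grad \<phi> x" by (intro AE_I2 conv d2)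
      show "AE x in lebesgue_on \<Omega>. norm (g' (\<phi> x) *\<^sub>R grad \<phi> x - grad (\<lambda>x. P k (\<phi> x)) x) \<le> L * norm (1::real)" for k
        using order_trans[OF d2 le1] by simp
    qed (use p1 in auto)
  qed
qed

text \<open>The functions converge because g is Lipschitz. The gradient error splits into (g'(u) -
  g'(\<phi>_k)) G, which tends to 0 by dominated convergence along an almost everywhere convergent
  sequence, and g'(\<phi>_k) (G - grad \<phi>_k), which is bounded by C times the approximation
  error.\<close>

lemma W0_comp_C1:
  fixes g g' :: "real \<Rightarrow> real"
  assumes W: "W0 \<Omega> p u G" and g: "\<And>t. (g has_real_derivative g' t) (at t)" "continuous_on UNIV g'" "g 0 = 0"
    and C: "\<And>t. \<bar>g' t\<bar> \<le> C"
  shows "W0 \<Omega> p (\<lambda>x. g (u x)) (\<lambda>x. g' (u x) *\<^sub>R G x)"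
proof -
  have p0: "0 \<le> p" using p1 by simp
  have C0: "0 \<le> C" using order_trans[OF abs_ge_zero C[of 0]] .
  obtain \<phi> where \<phi>: "\<And>k::nat. \<phi> k \<in> Cc_inf \<Omega>" 
    "(\<lambda>k. LINT x|lebesgue_on \<Omega>. norm (u x - \<phi> k x) powr p) \<longlonglongrightarrow> 0"
    "(\<lambda>k. LINT x|lebesgue_on \<Omega>. norm (G x - grad (\<phi> k) x) powr p) \<longlonglongrightarrow> 0" 
    "AE x in lebesgue_on \<Omega>. (\<lambda>k. \<phi> k x) \<longlonglongrightarrow> u x" by (rule W0_AE_subseq[OF W]) (rule that)
  have gi: "isCont g t" for t by (rule DERIV_isCont[OF g(1)])
  have gcont: "continuous_on UNIV g" by (simp add: continuous_at_imp_continuous_on gi)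
  have [measurable]: "g \<in> borel_measurable borel" "g' \<in> borel_measurable borel"
    by (rule borel_measurable_continuous_onI[OF gcont], rule borel_measurable_continuous_onI[OF g(2)])
  note [measurable] = W0_meas[OF W] Cc_meas[OF \<phi>(1)]
  have lip: "\<bar>g a - g b\<bar> \<le> C * \<bar>a - b\<bar>" for a b
    using field_differentiable_bound[of UNIV g g' C a b] g(1) C by simp
  have gu: "(\<lambda>x. g (u x)) \<in> Lq \<Omega> p"
    by (rule Lq_bound[OF W0_Lq(1)[OF W] _ p0 C0]) (use lip[of _ 0] g(3) in auto)
  have gG: "(\<lambda>x. g' (u x) *\<^sub>R G x) \<in> Lq \<Omega> p"
    by (rule Lq_bound[OF W0_Lq(2)[OF W] _ p0 C0]) (use C in \<open>auto intro!: AE_I2 mult_right_mono\<close>)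
  have gpG: "(\<lambda>x. g' (\<phi> k x) *\<^sub>R G x) \<in> Lq \<Omega> p" for k
    by (rule Lq_bound[OF W0_Lq(2)[OF W] _ p0 C0]) (use C in \<open>auto intro!: AE_I2 mult_right_mono\<close>)
  show ?thesis
  proof (rule W0_limit[OF W0_comp_Cc[OF \<phi>(1) g] gu gG])
    have b: "norm (LINT x|lebesgue_on \<Omega>. norm (g (u x) - g (\<phi> k x)) powr p) \<le> C powr p * (LINT x|lebesgue_on \<Omega>. norm (u x - \<phi> k x) powr p)" for k
    proof -
      have i: "integrable (lebesgue_on \<Omega>) (\<lambda>x. norm (u x - \<phi> k x) powr p)"
        using Lq_diff[OF W0_Lq(1)[OF W] Cc_Lq(1)[OF \<phi>(1)] p0] by (simp add: Lq_def)
      have "(LINT x|lebesgue_on \<Omega>. norm (g (u x) - g (\<phi> k x)) powr p) \<le> (LINT x|lebesgue_on \<Omega>. C powr p * norm (u x - \<phi> k x) powr p)"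
      proof (rule integral_mono)
        show "integrable (lebesgue_on \<Omega>) (\<lambda>x. norm (g (u x) - g (\<phi> k x)) powr p)"
          using Lq_diff[OF gu W0_Lq(1)[OF W0_comp_Cc[OF \<phi>(1) g]] p0] by (simp add: Lq_def)
        show "norm (g (u x) - g (\<phi> k x)) powr p \<le> C powr p * norm (u x - \<phi> k x) powr p" for x
          using powr_mono2[OF p0 _ lip[of "u x" "\<phi> k x"]] C0 by (simp add: powr_mult)
      qed (use i in auto)
      then show ?thesis using i by simp
    qed
    have "(\<lambda>k. C powr p * (LINT x|lebesgue_on \<Omega>. norm (u x - \<phi> k x) powr p)) \<longlonglongrightarrow> C powr p * 0" by (intro tendsto_intros \<phi>(2))
    then have "(\<lambda>k. C powr p * (LINT x|lebesgue_on \<Omega>. norm (u x - \<phi> k x) powr p)) \<longlonglongrightarrow> 0" by simp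
    then show "(\<lambda>k. LINT x|lebesgue_on \<Omega>. norm (g (u x) - g (\<phi> k x)) powr p) \<longlonglongrightarrow> 0"
      by (rule Lim_null_comparison[OF always_eventually[OF allI[OF b]]])
    let ?I = "\<lambda>k. LINT x|lebesgue_on \<Omega>. norm (g' (u x) *\<^sub>R G x - g' (\<phi> k x) *\<^sub>R G x) powr p"
    let ?J = "\<lambda>k. LINT x|lebesgue_on \<Omega>. norm (G x - grad (\<phi> k) x) powr p"
    have I: "?I \<longlonglongrightarrow> 0"
    proof (rule Lp_dominated_convergence[OF _ _ W0_Lq(2)[OF W], of _ _ "2 * C"])
      show "AE x in lebesgue_on \<Omega>. (\<lambda>k. g' (\<phi> k x) *\<^sub>R G x) \<longlonglongrightarrow> g' (u x) *\<^sub>R G x"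
        using \<phi>(4)
      proof eventually_elim
        case (elim x)
        have "isCont g' (u x)" using g(2) by (simp add: continuous_on_eq_continuous_at)
        then show ?case by (intro tendsto_intros isCont_tendsto_compose[OF _ elim])
      qed
      show "AE x in lebesgue_on \<Omega>. norm (g' (u x) *\<^sub>R G x - g' (\<phi> k x) *\<^sub>R G x) \<le> 2 * C * norm (G x)" for k
      proof (rule AE_I2)
        fix x
        have "\<bar>g' (u x) - g' (\<phi> k x)\<bar> \<le> 2 * C" using C[of "u x"] C[of "\<phi> k x"] by linarith
        then show "norm (g' (u x) *\<^sub>R G x - g' (\<phi> k x) *\<^sub>R G x) \<le> 2 * C * norm (G x)"
          unfolding scaleR_diff_left[symmetric] norm_scaleR by (intro mult_right_mono) auto
      qed
    qed (use p1 C0 in auto)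
    have J: "norm (LINT x|lebesgue_on \<Omega>. norm (g' (u x) *\<^sub>R G x - g' (\<phi> k x) *\<^sub>R grad (\<phi> k) x) powr p)
        \<le> 2 powr p * (?I k + C powr p * ?J k)" for k
    proof -
      have i: "integrable (lebesgue_on \<Omega>) (\<lambda>x. norm (G x - grad (\<phi> k) x) powr p)"
        using Lq_diff[OF W0_Lq(2)[OF W] Cc_Lq(2)[OF \<phi>(1)] p0] by (simp add: Lq_def)
      have "(LINT x|lebesgue_on \<Omega>. norm (g' (\<phi> k x) *\<^sub>R G x - g' (\<phi> k x) *\<^sub>R grad (\<phi> k) x) powr p) \<le> (LINT x|lebesgue_on \<Omega>. C powr p * norm (G x - grad (\<phi> k) x) powr p)"
      proof (rule integral_mono)
        show "integrable (lebesgue_on \<Omega>) (\<lambda>x. norm (g' (\<phi> k x) *\<^sub>R G x - g' (\<phi> k x) *\<^sub>R grad (\<phi> k) x) powr p)"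
          using Lq_diff[OF gpG[of k] W0_Lq(2)[OF W0_comp_Cc[OF \<phi>(1) g]] p0] by (simp add: Lq_def)
        show "norm (g' (\<phi> k x) *\<^sub>R G x - g' (\<phi> k x) *\<^sub>R grad (\<phi> k) x) powr p \<le> C powr p * norm (G x - grad (\<phi> k) x) powr p" for x
        proof -
          have "norm (g' (\<phi> k x) *\<^sub>R G x - g' (\<phi> k x) *\<^sub>R grad (\<phi> k) x) \<le> C * norm (G x - grad (\<phi> k) x)"
            unfolding scaleR_diff_right[symmetric] norm_scaleR using C by (intro mult_right_mono) auto
          from powr_mono2[OF p0 _ this] show ?thesis using C0 by (simp add: powr_mult)
        qed
      qed (use i in auto)
      then have "2 powr p * (?I k + (LINT x|lebesgue_on \<Omega>. norm (g' (\<phi> k x) *\<^sub>R G x - g' (\<phi> k x) *\<^sub>R grad (\<phi> k) x) powr p)) \<le> 2 powr p * (?I k + C powr p * ?J k)"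
        using i by (intro mult_left_mono add_left_mono) auto
      from order_trans[OF Lp_dist_le[OF gG gpG[of k] W0_Lq(2)[OF W0_comp_Cc[OF \<phi>(1) g]]] this]
      show ?thesis by simp
    qed
    have "(\<lambda>k. 2 powr p * (?I k + C powr p * ?J k)) \<longlonglongrightarrow> 2 powr p * (0 + C powr p * 0)" by (intro tendsto_intros I \<phi>(3))
    then have "(\<lambda>k. 2 powr p * (?I k + C powr p * ?J k)) \<longlonglongrightarrow> 0" by simp
    then show "(\<lambda>k. LINT x|lebesgue_on \<Omega>. norm (g' (u x) *\<^sub>R G x - g' (\<phi> k x) *\<^sub>R grad (\<phi> k) x) powr p) \<longlonglongrightarrow> 0"
      by (rule Lim_null_comparison[OF always_eventually[OF allI[OF J]]])
  qed
qed

text \<open>Limit of the smooth approximations of \<open>tendsto_smooth_pos\<close>, shifted by k.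
  The condition 0 <= k makes them vanish at 0, and u and G dominate functions and gradients.\<close>

lemma W0_pos_part:
  assumes W: "W0 \<Omega> p u G" and k: "0 \<le> k"
  shows "W0 \<Omega> p (\<lambda>x. max 0 (u x - k)) (\<lambda>x. (if k < u x then 1 else 0) *\<^sub>R G x)"
proof -
  let ?g = "\<lambda>j t. sqrt ((max 0 (t - k))\<^sup>2 + (1 / real (Suc j))\<^sup>2) - 1 / real (Suc j)"
  let ?h = "\<lambda>j t. max 0 (t - k) / sqrt ((max 0 (t - k))\<^sup>2 + (1 / real (Suc j))\<^sup>2)"
  note [measurable] = W0_meas[OF W]
  have pos: "0 < (max 0 t)\<^sup>2 + (1 / real (Suc j))\<^sup>2" for j t by (intro add_nonneg_pos) auto
  have d: "(?g j has_real_derivative ?h j t) (at t)" for j t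
  proof -
    define c where "c = 1 / real (Suc j)"
    have c: "0 < (max 0 (t - k))\<^sup>2 + c\<^sup>2" unfolding c_def by (rule pos)
    have "((\<lambda>t. (max 0 (t + - k))\<^sup>2) has_real_derivative 2 * max 0 (t + - k)) (at t)"
      unfolding DERIV_shift[of "\<lambda>t. (max 0 t)\<^sup>2" _ t "- k", symmetric] by (rule DERIV_max_square)
    then have 1: "((\<lambda>t. (max 0 (t - k))\<^sup>2) has_real_derivative 2 * max 0 (t - k) * 1) (at t)"
      by (simp only: diff_conv_add_uminus mult_1_right)
    have 2: "((\<lambda>t. (max 0 (t - k))\<^sup>2 + c\<^sup>2) has_real_derivative 2 * max 0 (t - k) * 1 + 0) (at t)"
      by (rule DERIV_add[OF 1 DERIV_const])
    have 3: "((\<lambda>t. sqrt ((max 0 (t - k))\<^sup>2 + c\<^sup>2)) has_real_derivative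
        (inverse (sqrt ((max 0 (t - k))\<^sup>2 + c\<^sup>2)) / 2) * (2 * max 0 (t - k) * 1 + 0)) (at t)"
      by (rule DERIV_chain2[where f = sqrt, OF DERIV_real_sqrt[OF c] 2])
    have 4: "((\<lambda>t. sqrt ((max 0 (t - k))\<^sup>2 + c\<^sup>2) - c) has_real_derivative
        (inverse (sqrt ((max 0 (t - k))\<^sup>2 + c\<^sup>2)) / 2) * (2 * max 0 (t - k) * 1 + 0) - 0) (at t)"
      by (rule DERIV_diff[OF 3 DERIV_const])
    have "(inverse r / 2) * (2 * m * 1 + 0) - 0 = m / r" for r m :: real by (cases "r = 0") (simp_all add: field_simps)
    then show ?thesis using 4 unfolding c_def by (simp only:)
  qed
  have h1: "\<bar>?h j t\<bar> \<le> 1" for j t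
  proof -
    have "max 0 (t - k) \<le> sqrt ((max 0 (t - k))\<^sup>2 + (1 / real (Suc j))\<^sup>2)" by (rule real_le_rsqrt) simp
    then show ?thesis using pos[where t = "t - k" and j = j] by (simp add: divide_le_eq_1)
  qed
  have hc: "continuous_on UNIV (?h j)" for j
    using pos by (intro continuous_intros) (metis less_irrefl real_sqrt_eq_zero_cancel_iff)
  have g0: "?g j 0 = 0" for j using k by simp
  have gb: "\<bar>?g j t\<bar> \<le> max 0 (t - k)" for j t
  proof -
    have "sqrt ((max 0 (t - k))\<^sup>2 + (1 / real (Suc j))\<^sup>2) \<le> max 0 (t - k) + 1 / real (Suc j)"
      using sqrt_sum_squares_le_sum[of "max 0 (t - k)" "1 / real (Suc j)"] by simp
    moreover have "1 / real (Suc j) \<le> sqrt ((max 0 (t - k))\<^sup>2 + (1 / real (Suc j))\<^sup>2)" by (rule real_le_rsqrt) simp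
    ultimately show ?thesis by linarith
  qed
  have gb': "\<bar>?g j t\<bar> \<le> \<bar>t\<bar>" for j t using gb[where j = j and t = t] k by linarith
  have WW: "W0 \<Omega> p (\<lambda>x. ?g j (u x)) (\<lambda>x. ?h j (u x) *\<^sub>R G x)" for j
    by (rule W0_comp_C1[OF W d hc g0 h1])
  have p0: "0 \<le> p" using p1 by simp
  show ?thesis
  proof (rule W0_limit[OF WW])
    show "(\<lambda>x. max 0 (u x - k)) \<in> Lq \<Omega> p"
      by (rule Lq_bound[OF W0_Lq(1)[OF W] _ p0, of _ 1]) (use k in auto)
    show "(\<lambda>x. (if k < u x then 1 else 0) *\<^sub>R G x) \<in> Lq \<Omega> p"
      by (rule Lq_bound[OF W0_Lq(2)[OF W] _ p0, of _ 1]) auto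
    show "(\<lambda>j. LINT x|lebesgue_on \<Omega>. norm (max 0 (u x - k) - ?g j (u x)) powr p) \<longlonglongrightarrow> 0"
    proof (rule Lp_dominated_convergence[OF _ W0_meas(1)[OF WW] W0_Lq(1)[OF W], of _ 2])
      show "AE x in lebesgue_on \<Omega>. (\<lambda>j. ?g j (u x)) \<longlonglongrightarrow> max 0 (u x - k)" by (intro AE_I2 tendsto_smooth_pos(1))
      show "AE x in lebesgue_on \<Omega>. norm (max 0 (u x - k) - ?g j (u x)) \<le> 2 * norm (u x)" for j
      proof (rule AE_I2)
        fix x
        have "\<bar>max 0 (u x - k)\<bar> \<le> \<bar>u x\<bar>" using k by auto
        then show "norm (max 0 (u x - k) - ?g j (u x)) \<le> 2 * norm (u x)" 
          using gb'[where j = j and t = "u x"] abs_triangle_ineq4[of "max 0 (u x - k)" "?g j (u x)"] unfolding real_norm_def by linarith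
      qed
    qed (use p1 in auto)
    show "(\<lambda>j. LINT x|lebesgue_on \<Omega>. norm ((if k < u x then 1 else 0) *\<^sub>R G x - ?h j (u x) *\<^sub>R G x) powr p) \<longlonglongrightarrow> 0"
    proof (rule Lp_dominated_convergence[OF _ W0_meas(2)[OF WW] W0_Lq(2)[OF W], of _ 2])
      show "AE x in lebesgue_on \<Omega>. (\<lambda>j. ?h j (u x) *\<^sub>R G x) \<longlonglongrightarrow> (if k < u x then 1 else 0) *\<^sub>R G x"
      proof (rule AE_I2)
        fix x
        show "(\<lambda>j. ?h j (u x) *\<^sub>R G x) \<longlonglongrightarrow> (if k < u x then 1 else 0) *\<^sub>R G x"
          using tendsto_scaleR[OF tendsto_smooth_pos(2)[of "u x - k"] tendsto_const[of "G x"]] by (simp only: diff_gt_0_iff_gt)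
      qed
      show "AE x in lebesgue_on \<Omega>. norm ((if k < u x then 1 else 0) *\<^sub>R G x - ?h j (u x) *\<^sub>R G x) \<le> 2 * norm (G x)" for j
      proof (rule AE_I2)
        fix x
        have "\<bar>c - y\<bar> \<le> 2" if "\<bar>y\<bar> \<le> 1" "c = 0 \<or> c = 1" for c y :: real using that by auto
        from this[OF h1[where j = j and t = "u x"], of "if k < u x then 1 else 0"]
        have "\<bar>(if k < u x then 1 else 0) - ?h j (u x)\<bar> \<le> 2" by presburger
        then show "norm ((if k < u x then 1 else 0) *\<^sub>R G x - ?h j (u x) *\<^sub>R G x) \<le> 2 * norm (G x)"
          unfolding scaleR_diff_left[symmetric] norm_scaleR by (intro mult_right_mono) auto
      qed
    qed (use p1 in auto)
  qed
qed

lemma W0_min: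
  assumes W: "W0 \<Omega> p u G" and k: "0 \<le> k"
  shows "W0 \<Omega> p (\<lambda>x. min (u x) k) (\<lambda>x. (if u x \<le> k then 1 else 0) *\<^sub>R G x)"
proof -
  have eq: "(\<lambda>x. u x + (- 1) * max 0 (u x - k)) = (\<lambda>x. min (u x) k)" 
    "(\<lambda>x. G x + (- 1) *\<^sub>R ((if k < u x then 1 else 0) *\<^sub>R G x)) = (\<lambda>x. (if u x \<le> k then 1 else 0) *\<^sub>R G x)"
    by (auto simp: fun_eq_iff)
  from W0_lincomb[OF W W0_pos_part[OF W k], of "-1"] show ?thesis unfolding eq .
qed

text \<open>The range condition lets an extension of g replace g almost everywhere. As nothing is
  known about g outside the interval, measurability of the compositions is assumed
  separately.\<close>

lemma W0_comp_interval:
  assumes W: "W0 \<Omega> p u G" and AB: "A \<le> 0" "0 \<le> B" "AE x in lebesgue_on \<Omega>. A \<le> u x \<and> u x \<le> B"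
    and g: "\<And>t. A \<le> t \<Longrightarrow> t \<le> B \<Longrightarrow> (g has_real_derivative g' t) (at t within {A..B})" "continuous_on {A..B} g'"
    and m: "(\<lambda>x. g (u x)) \<in> borel_measurable (lebesgue_on \<Omega>)" "(\<lambda>x. g' (u x)) \<in> borel_measurable (lebesgue_on \<Omega>)"
  shows "W0 \<Omega> p (\<lambda>x. g (u x) - g 0) (\<lambda>x. g' (u x) *\<^sub>R G x)"
proof -
  obtain H h C where H: "\<And>t. (H has_real_derivative h t) (at t)" "continuous_on UNIV h" "\<And>t. \<bar>h t\<bar> \<le> C" "H 0 = 0"
    "\<And>t. A \<le> t \<Longrightarrow> t \<le> B \<Longrightarrow> H t = g t - g 0" "\<And>t. A \<le> t \<Longrightarrow> t \<le> B \<Longrightarrow> h t = g' t"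
    by (rule C1_extension[OF AB(1,2) g]) (assumption | rule that)+
  note [measurable] = m W0_meas[OF W]
  show ?thesis
  proof (rule W0_cong_AE[OF W0_comp_C1[OF W H(1,2,4,3)]])
    show "AE x in lebesgue_on \<Omega>. H (u x) = g (u x) - g 0" using AB(3) by eventually_elim (simp add: H(5))
    show "AE x in lebesgue_on \<Omega>. h (u x) *\<^sub>R G x = g' (u x) *\<^sub>R G x" using AB(3) by eventually_elim (simp add: H(6))
  qed measurable
qed

lemma W0_mult:
  assumes W: "W0 \<Omega> p u G" "W0 \<Omega> p v H" and b: "AE x in lebesgue_on \<Omega>. \<bar>u x\<bar> \<le> M" "AE x in lebesgue_on \<Omega>. \<bar>v x\<bar> \<le> M"
  shows "W0 \<Omega> p (\<lambda>x. u x * v x) (\<lambda>x. u x *\<^sub>R H x + v x *\<^sub>R G x)"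
proof -
  note [measurable] = W0_meas[OF W(1)] W0_meas[OF W(2)]
  \<comment> \<open>The bound 2 |M| covers u + v as well as u and v, the three functions whose
    squares enter the polarization identity.\<close>
  have sq: "W0 \<Omega> p (\<lambda>x. (w x)\<^sup>2) (\<lambda>x. (2 * w x) *\<^sub>R K x)" if WK: "W0 \<Omega> p w K" and bw: "AE x in lebesgue_on \<Omega>. \<bar>w x\<bar> \<le> 2 * \<bar>M\<bar>" for w K
  proof -
    note [measurable] = W0_meas[OF WK]
    have "W0 \<Omega> p (\<lambda>x. (w x)\<^sup>2 - 0\<^sup>2) (\<lambda>x. (2 * w x) *\<^sub>R K x)"
    proof (rule W0_comp_interval[OF WK, of "- 2 * \<bar>M\<bar>" "2 * \<bar>M\<bar>"])
      show "AE x in lebesgue_on \<Omega>. - 2 * \<bar>M\<bar> \<le> w x \<and> w x \<le> 2 * \<bar>M\<bar>" using bw by eventually_elim linarith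
      show "((\<lambda>t::real. t\<^sup>2) has_real_derivative 2 * t) (at t within S)" for t S by (auto intro!: derivative_eq_intros)
      show "continuous_on {- 2 * \<bar>M\<bar>..2 * \<bar>M\<bar>} (\<lambda>t::real. 2 * t)" by (intro continuous_intros)
    qed auto
    then show ?thesis by simp
  qed
  have s: "W0 \<Omega> p (\<lambda>x. u x + 1 * v x) (\<lambda>x. G x + 1 *\<^sub>R H x)" by (rule W0_lincomb[OF W])
  have "W0 \<Omega> p (\<lambda>x. (u x + 1 * v x)\<^sup>2 + (-1) * (u x)\<^sup>2) (\<lambda>x. (2 * (u x + 1 * v x)) *\<^sub>R (G x + 1 *\<^sub>R H x) + (-1) *\<^sub>R ((2 * u x) *\<^sub>R G x))"
    by (intro W0_lincomb sq s W) (use b in \<open>eventually_elim, linarith\<close>)+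
  then have "W0 \<Omega> p (\<lambda>x. ((u x + 1 * v x)\<^sup>2 + (-1) * (u x)\<^sup>2) + (-1) * (v x)\<^sup>2) 
    (\<lambda>x. ((2 * (u x + 1 * v x)) *\<^sub>R (G x + 1 *\<^sub>R H x) + (-1) *\<^sub>R ((2 * u x) *\<^sub>R G x)) + (-1) *\<^sub>R ((2 * v x) *\<^sub>R H x))"
    by (rule W0_lincomb[OF _ sq[OF W(2)]]) (use b in \<open>eventually_elim, linarith\<close>)
  from W0_scale[OF this, of "1/2"]
  have "W0 \<Omega> p (\<lambda>x. 1/2 * (((u x + 1 * v x)\<^sup>2 + (-1) * (u x)\<^sup>2) + (-1) * (v x)\<^sup>2)) 
    (\<lambda>x. (1/2) *\<^sub>R (((2 * (u x + 1 * v x)) *\<^sub>R (G x + 1 *\<^sub>R H x) + (-1) *\<^sub>R ((2 * u x) *\<^sub>R G x)) + (-1) *\<^sub>R ((2 * v x) *\<^sub>R H x)))" .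
  moreover have "1/2 * (((u x + 1 * v x)\<^sup>2 + (-1) * (u x)\<^sup>2) + (-1) * (v x)\<^sup>2) = u x * v x" for x
    by (simp add: power2_eq_square algebra_simps)
  moreover have "(1/2) *\<^sub>R (((2 * (u x + 1 * v x)) *\<^sub>R (G x + 1 *\<^sub>R H x) + (-1) *\<^sub>R ((2 * u x) *\<^sub>R G x)) + (-1) *\<^sub>R ((2 * v x) *\<^sub>R H x))
     = u x *\<^sub>R H x + v x *\<^sub>R G x" for x
    by (simp add: algebra_simps)
  ultimately show ?thesis by (simp only:)
qed

text \<open>Where u is 0 the power of u + \<epsilon> equals the power of \<epsilon>. Subtracting
  this constant restores zero boundary values.\<close>

lemma W0_shifted_powr:
  assumes W: "W0 \<Omega> p u G" and u: "AE x in lebesgue_on \<Omega>. 0 \<le> u x \<and> u x \<le> k" and k: "0 \<le> k" "0 < \<epsilon>"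
  shows "W0 \<Omega> p (\<lambda>x. (u x + \<epsilon>) powr r - \<epsilon> powr r) (\<lambda>x. (r * (u x + \<epsilon>) powr (r - 1)) *\<^sub>R G x)"
proof -
  note [measurable] = W0_meas[OF W]
  have "W0 \<Omega> p (\<lambda>x. (u x + \<epsilon>) powr r - (0 + \<epsilon>) powr r) (\<lambda>x. (r * (u x + \<epsilon>) powr (r - 1)) *\<^sub>R G x)"
  proof (rule W0_comp_interval[OF W _ k(1) u, where g = "\<lambda>t. (t + \<epsilon>) powr r" and g' = "\<lambda>t. r * (t + \<epsilon>) powr (r - 1)"])
    show "((\<lambda>t. (t + \<epsilon>) powr r) has_real_derivative r * (t + \<epsilon>) powr (r - 1)) (at t within {0..k})" if "0 \<le> t" for t
    proof -
      have "((\<lambda>t. (t + \<epsilon>) powr r) has_real_derivative r * (t + \<epsilon>) powr (r - 1)) (at t)"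
        using that k by (auto intro!: derivative_eq_intros)
      then show ?thesis by (rule has_field_derivative_at_within)
    qed
    show "continuous_on {0..k} (\<lambda>t. r * (t + \<epsilon>) powr (r - 1))"
      using k by (intro continuous_intros) auto
  qed auto
  then show ?thesis by simp
qed

text \<open>The product is expanded as (f + \<epsilon>^q) (h + \<epsilon>^(1-q)) with f and h from
  \<open>W0_shifted_powr\<close>. The product of the two constants is \<epsilon>, which cancels
  against the shift in -(v + \<epsilon>), so zero boundary values survive.\<close>

lemma W0_profile:
  assumes W: "W0 \<Omega> p u G" "W0 \<Omega> p v H" and u: "AE x in lebesgue_on \<Omega>. 0 \<le> u x \<and> u x \<le> k" 
    and v: "AE x in lebesgue_on \<Omega>. 0 \<le> v x \<and> v x \<le> k" and k: "0 \<le> k" "0 < \<epsilon>" and q: "1 \<le> q"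
  shows "W0 \<Omega> p (\<lambda>x. (u x + \<epsilon>) powr q * (v x + \<epsilon>) powr (1 - q) - (v x + \<epsilon>))
    (\<lambda>x. (q * ((u x + \<epsilon>) / (v x + \<epsilon>)) powr (q - 1)) *\<^sub>R G x - (1 + (q - 1) * ((u x + \<epsilon>) / (v x + \<epsilon>)) powr q) *\<^sub>R H x)"
proof -
  note [measurable] = W0_meas[OF W(1)] W0_meas[OF W(2)]
  let ?a = "\<lambda>x. u x + \<epsilon>" and ?b = "\<lambda>x. v x + \<epsilon>"
  let ?f = "\<lambda>x. ?a x powr q - \<epsilon> powr q" and ?h = "\<lambda>x. ?b x powr (1 - q) - \<epsilon> powr (1 - q)"
  have f: "W0 \<Omega> p ?f (\<lambda>x. (q * ?a x powr (q - 1)) *\<^sub>R G x)"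
    by (rule W0_shifted_powr[OF W(1) u k])
  have h: "W0 \<Omega> p ?h (\<lambda>x. ((1 - q) * ?b x powr (1 - q - 1)) *\<^sub>R H x)"
    by (rule W0_shifted_powr[OF W(2) v k])
  define M where "M = (k + \<epsilon>) powr q + \<epsilon> powr q + \<epsilon> powr (1 - q)"
  have bf: "AE x in lebesgue_on \<Omega>. \<bar>?f x\<bar> \<le> M" using u
  proof eventually_elim
    case (elim x)
    have "?a x powr q \<le> (k + \<epsilon>) powr q" using elim k q by (intro powr_mono2) auto
    moreover have "0 \<le> ?a x powr q" "0 \<le> \<epsilon> powr q" "0 \<le> \<epsilon> powr (1 - q)" by simp_all
    ultimately show ?case unfolding M_def by linarith
  qed
  have bh: "AE x in lebesgue_on \<Omega>. \<bar>?h x\<bar> \<le> M" using v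
  proof eventually_elim
    case (elim x)
    have "?b x powr (1 - q) \<le> \<epsilon> powr (1 - q)" using elim k q by (intro powr_mono2') auto
    moreover have "0 \<le> ?b x powr (1 - q)" "0 \<le> \<epsilon> powr q" "0 \<le> (k + \<epsilon>) powr q" by simp_all
    ultimately show ?case unfolding M_def by linarith
  qed
  have w: "W0 \<Omega> p (\<lambda>x. ((?f x * ?h x + \<epsilon> powr (1 - q) * ?f x) + \<epsilon> powr q * ?h x) + (-1) * v x)
    (\<lambda>x. (((?f x *\<^sub>R (((1 - q) * ?b x powr (1 - q - 1)) *\<^sub>R H x) + ?h x *\<^sub>R ((q * ?a x powr (q - 1)) *\<^sub>R G x))
      + \<epsilon> powr (1 - q) *\<^sub>R ((q * ?a x powr (q - 1)) *\<^sub>R G x)) + \<epsilon> powr q *\<^sub>R (((1 - q) * ?b x powr (1 - q - 1)) *\<^sub>R H x)) + (-1) *\<^sub>R H x)"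
    by (rule W0_lincomb[OF W0_lincomb[OF W0_lincomb[OF W0_mult[OF f h bf bh] f] h] W(2)])
  have one: "\<epsilon> powr q * \<epsilon> powr (1 - q) = \<epsilon>" using k by (simp add: powr_add[symmetric])
  show ?thesis
  proof (rule W0_cong_AE[OF w])
    show "AE x in lebesgue_on \<Omega>. ((?f x * ?h x + \<epsilon> powr (1 - q) * ?f x) + \<epsilon> powr q * ?h x) + (-1) * v x = ?a x powr q * ?b x powr (1 - q) - ?b x"
      using one by (intro AE_I2) (simp add: algebra_simps)
    show "AE x in lebesgue_on \<Omega>. (((?f x *\<^sub>R (((1 - q) * ?b x powr (1 - q - 1)) *\<^sub>R H x) + ?h x *\<^sub>R ((q * ?a x powr (q - 1)) *\<^sub>R G x))
      + \<epsilon> powr (1 - q) *\<^sub>R ((q * ?a x powr (q - 1)) *\<^sub>R G x)) + \<epsilon> powr q *\<^sub>R (((1 - q) * ?b x powr (1 - q - 1)) *\<^sub>R H x)) + (-1) *\<^sub>R H x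
      = (q * (?a x / ?b x) powr (q - 1)) *\<^sub>R G x - (1 + (q - 1) * (?a x / ?b x) powr q) *\<^sub>R H x"
      using u v
    proof eventually_elim
      case (elim x)
      have pos: "0 < ?a x" "0 < ?b x" using elim k by auto
      have 1: "(?a x / ?b x) powr (q - 1) = ?a x powr (q - 1) * ?b x powr (1 - q)"
        using pos by (simp add: powr_divide powr_diff)
      have 2: "(?a x / ?b x) powr q = ?a x powr q * ?b x powr (1 - q - 1)"
        using pos by (simp add: powr_divide powr_minus_divide)
      show ?case unfolding 1 2 by (simp add: algebra_simps)
    qed
  qed measurable
qed

lemma profile_sign:
  fixes a b q :: real
  assumes "0 < a" "0 < b" "1 \<le> q"
  shows "0 < a powr q * b powr (1 - q) - b \<longleftrightarrow> b < a" 
    and "0 < a - b powr q * a powr (1 - q) \<longleftrightarrow> b < a"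
proof -
  have 1: "a powr q * a powr (1 - q) = a" "b powr q * b powr (1 - q) = b"
    using assms by (simp_all add: powr_add[symmetric])
  have 2: "b powr q < a powr q \<longleftrightarrow> b < a"
    using assms powr_less_mono2[of q b a] powr_mono2[of q a b] by (cases "b < a") (auto simp: not_less)
  have "a powr q * b powr (1 - q) - b = (a powr q - b powr q) * b powr (1 - q)"
    "a - b powr q * a powr (1 - q) = (a powr q - b powr q) * a powr (1 - q)" using 1 by (simp_all add: algebra_simps)
  then show "0 < a powr q * b powr (1 - q) - b \<longleftrightarrow> b < a" "0 < a - b powr q * a powr (1 - q) \<longleftrightarrow> b < a"
    using 2 assms by (simp_all add: zero_less_mult_iff)
qed

text \<open>\<open>W0_profile\<close> needs both functions bounded, while v is not truncated in the
  tests. But a test is nonzero only where v < min(u, k), so v may be replaced by min(v, k) without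
  changing it. The tests are positive parts of profiles, whose sign is given by
  \<open>profile_sign\<close>.\<close>

lemma W0_tests:
  assumes W: "W0 \<Omega> p u G" "W0 \<Omega> p v H" and uv: "AE x in lebesgue_on \<Omega>. 0 \<le> u x" "AE x in lebesgue_on \<Omega>. 0 \<le> v x"
    and k: "0 < k" "0 < \<epsilon>" and q: "1 \<le> q"
  defines "a \<equiv> \<lambda>x. min (u x) k + \<epsilon>" and "b \<equiv> \<lambda>x. v x + \<epsilon>"
    and "G' \<equiv> \<lambda>x. (if u x \<le> k then 1 else 0) *\<^sub>R G x"
  shows "W0 \<Omega> p (\<lambda>x. sub_test q (a x) (b x))
      (\<lambda>x. if b x < a x then (1 + (q - 1) * (b x / a x) powr q) *\<^sub>R G' x - (q * (b x / a x) powr (q - 1)) *\<^sub>R H x else 0)"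
    and "W0 \<Omega> p (\<lambda>x. sup_test q (a x) (b x))
      (\<lambda>x. if b x < a x then (q * (a x / b x) powr (q - 1)) *\<^sub>R G' x - (1 + (q - 1) * (a x / b x) powr q) *\<^sub>R H x else 0)"
proof -
  let ?H' = "\<lambda>x. (if v x \<le> k then 1 else 0) *\<^sub>R H x" and ?b = "\<lambda>x. min (v x) k + \<epsilon>"
  note [measurable] = W0_meas[OF W(1)] W0_meas[OF W(2)]
  have mu: "W0 \<Omega> p (\<lambda>x. min (u x) k) G'" and mv: "W0 \<Omega> p (\<lambda>x. min (v x) k) ?H'"
    unfolding G'_def using k by (intro W0_min W; simp)+
  have u': "AE x in lebesgue_on \<Omega>. 0 \<le> min (u x) k \<and> min (u x) k \<le> k" and v': "AE x in lebesgue_on \<Omega>. 0 \<le> min (v x) k \<and> min (v x) k \<le> k"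
    using uv k by (auto elim!: eventually_mono)
  have k0: "0 \<le> k" using k by simp
  have mG[measurable]: "G' \<in> borel_measurable (lebesgue_on \<Omega>)" by (rule W0_meas(2)[OF mu])
  have ma[measurable]: "a \<in> borel_measurable (lebesgue_on \<Omega>)" "b \<in> borel_measurable (lebesgue_on \<Omega>)"
    unfolding a_def b_def by measurable
  have key: "(?b x < a x \<longleftrightarrow> b x < a x) \<and> (b x < a x \<longrightarrow> ?b x = b x \<and> ?H' x = H x) \<and> 0 < a x \<and> 0 < b x \<and> 0 < ?b x" 
    if "0 \<le> u x" "0 \<le> v x" for x
    using that k by (auto simp: a_def b_def)
  have P1: "W0 \<Omega> p (\<lambda>x. max 0 ((a x powr q * ?b x powr (1 - q) - ?b x) - 0))
    (\<lambda>x. (if 0 < a x powr q * ?b x powr (1 - q) - ?b x then 1 else 0) *\<^sub>R ((q * (a x / ?b x) powr (q - 1)) *\<^sub>R G' x - (1 + (q - 1) * (a x / ?b x) powr q) *\<^sub>R ?H' x))"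
    unfolding a_def by (rule W0_pos_part[OF W0_profile[OF mu mv u' v' k0 k(2) q]]) simp
  \<comment> \<open>\<open>sub_test\<close> is the positive part of the negative of the profile with
    the two functions exchanged.\<close>
  have P2: "W0 \<Omega> p (\<lambda>x. max 0 ((-1) * (?b x powr q * a x powr (1 - q) - a x) - 0))
    (\<lambda>x. (if 0 < (-1) * (?b x powr q * a x powr (1 - q) - a x) then 1 else 0) *\<^sub>R 
      ((-1) *\<^sub>R ((q * (?b x / a x) powr (q - 1)) *\<^sub>R ?H' x - (1 + (q - 1) * (?b x / a x) powr q) *\<^sub>R G' x)))"
    unfolding a_def by (rule W0_pos_part[OF W0_scale[OF W0_profile[OF mv mu v' u' k0 k(2) q]]]) simp
  show "W0 \<Omega> p (\<lambda>x. sup_test q (a x) (b x))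
      (\<lambda>x. if b x < a x then (q * (a x / b x) powr (q - 1)) *\<^sub>R G' x - (1 + (q - 1) * (a x / b x) powr q) *\<^sub>R H x else 0)"
  proof (rule W0_cong_AE[OF P1])
    show "AE x in lebesgue_on \<Omega>. max 0 ((a x powr q * ?b x powr (1 - q) - ?b x) - 0) = sup_test q (a x) (b x)"
      using uv
    proof eventually_elim
      case (elim x)
      show ?case using key[OF elim] profile_sign(1)[of "a x" "?b x" q] q by (auto simp: sup_test_def max_def not_less)
    qed
    show "AE x in lebesgue_on \<Omega>. (if 0 < a x powr q * ?b x powr (1 - q) - ?b x then 1 else 0) *\<^sub>R ((q * (a x / ?b x) powr (q - 1)) *\<^sub>R G' x - (1 + (q - 1) * (a x / ?b x) powr q) *\<^sub>R ?H' x)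
       = (if b x < a x then (q * (a x / b x) powr (q - 1)) *\<^sub>R G' x - (1 + (q - 1) * (a x / b x) powr q) *\<^sub>R H x else 0)"
      using uv
    proof eventually_elim
      case (elim x)
      have s: "0 < a x powr q * ?b x powr (1 - q) - ?b x \<longleftrightarrow> b x < a x" using key[OF elim] profile_sign(1)[of "a x" "?b x" q] q by simp
      show ?case
      proof (cases "b x < a x")
        case True
        then have e: "?b x = b x" "?H' x = H x" using key[OF elim] by blast+
        show ?thesis unfolding s using True by (simp only: e if_True scaleR_one)
      qed (simp only: s if_False scaleR_zero_left)
    qed
    show "(\<lambda>x. sup_test q (a x) (b x)) \<in> borel_measurable (lebesgue_on \<Omega>)" unfolding sup_test_def by measurable
  qed measurable
  show "W0 \<Omega> p (\<lambda>x. sub_test q (a x) (b x))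
      (\<lambda>x. if b x < a x then (1 + (q - 1) * (b x / a x) powr q) *\<^sub>R G' x - (q * (b x / a x) powr (q - 1)) *\<^sub>R H x else 0)"
  proof (rule W0_cong_AE[OF P2])
    show "AE x in lebesgue_on \<Omega>. max 0 ((-1) * (?b x powr q * a x powr (1 - q) - a x) - 0) = sub_test q (a x) (b x)"
      using uv
    proof eventually_elim
      case (elim x)
      show ?case using key[OF elim] profile_sign(2)[of "a x" "?b x" q] q by (auto simp: sub_test_def max_def not_less)
    qed
    show "AE x in lebesgue_on \<Omega>. (if 0 < (-1) * (?b x powr q * a x powr (1 - q) - a x) then 1 else 0) *\<^sub>R 
      ((-1) *\<^sub>R ((q * (?b x / a x) powr (q - 1)) *\<^sub>R ?H' x - (1 + (q - 1) * (?b x / a x) powr q) *\<^sub>R G' x))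
       = (if b x < a x then (1 + (q - 1) * (b x / a x) powr q) *\<^sub>R G' x - (q * (b x / a x) powr (q - 1)) *\<^sub>R H x else 0)"
      using uv
    proof eventually_elim
      case (elim x)
      have s: "0 < (-1) * (?b x powr q * a x powr (1 - q) - a x) \<longleftrightarrow> b x < a x" using key[OF elim] profile_sign(2)[of "a x" "?b x" q] q by simp
      show ?case
      proof (cases "b x < a x")
        case True
        then have e: "?b x = b x" "?H' x = H x" using key[OF elim] by blast+
        show ?thesis unfolding s using True by (simp only: e if_True scaleR_one scaleR_minus1_left minus_diff_eq)
      qed (simp only: s if_False scaleR_zero_left)
    qed
    show "(\<lambda>x. sub_test q (a x) (b x)) \<in> borel_measurable (lebesgue_on \<Omega>)" unfolding sub_test_def by measurable
  qed measurable
qed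

end

section \<open>Integrability of powers of the distance to the boundary\<close>

text \<open>Dyadic layers: f^(-\<alpha>) is at most 1 plus the sum of 2^(\<alpha>(n+1)) over those n
  with f <= 2^(-n). Integration gives a geometric series with ratio 2^(\<alpha>-1). It is applied to
  the distance from the boundary and to a power of the norm.\<close>

lemma (in finite_measure) integrable_powr_of_layer_bound:
  fixes f :: "'a \<Rightarrow> real"
  assumes f[measurable]: "f \<in> borel_measurable M" and nn: "\<And>x. x \<in> space M \<Longrightarrow> 0 \<le> f x" 
    and \<alpha>: "0 < \<alpha>" "\<alpha> < 1"
    and layer: "\<And>\<eta>. 0 < \<eta> \<Longrightarrow> measure M {x \<in> space M. f x \<le> \<eta>} \<le> C * \<eta>"
  shows "integrable M (\<lambda>x. f x powr (- \<alpha>))"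
proof (rule integrableI_nonneg)
  let ?L = "\<lambda>n. {x \<in> space M. f x \<le> (1/2) ^ n}"
  let ?c = "\<lambda>n. 2 powr (\<alpha> * real (Suc n))"
  have C0: "0 \<le> C" using layer[of 1] measure_nonneg[of M "{x \<in> space M. f x \<le> 1}"] by linarith
  have pw: "ennreal (f x powr (- \<alpha>)) \<le> 1 + (\<Sum>n. ennreal (?c n) * indicator (?L n) x)" if x: "x \<in> space M" for x
  proof -
    consider "f x = 0" | "1 \<le> f x" | "0 < f x" "f x < 1" using nn[OF x] by linarith
    then show ?thesis
    proof cases
      case 2
      then have "f x powr (- \<alpha>) \<le> f x powr 0" using \<alpha> by (intro powr_mono) auto
      then have "ennreal (f x powr (- \<alpha>)) \<le> 1" using 2 by (simp add: ennreal_le_1)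
      then show ?thesis by (rule order_trans) simp
    next
      case 3
      \<comment> \<open>The layer with 2^(-(n+1)) <= f x <= 2^(-n).\<close>
      define n where "n = nat \<lfloor>log 2 (1 / f x)\<rfloor>"
      have l0: "0 \<le> log 2 (1 / f x)" using 3 by (simp add: log_def)
      then have n: "real n \<le> log 2 (1 / f x)" "log 2 (1 / f x) < real (Suc n)" unfolding n_def by linarith+
      have "2 powr real n \<le> 1 / f x" "1 / f x \<le> 2 powr real (Suc n)"
        using n 3 by (simp_all add: le_log_iff log_less_iff less_imp_le)
      then have b: "f x \<le> (1/2) ^ n" "1 / f x \<le> 2 powr real (Suc n)"
        using 3 by (simp_all add: powr_realpow power_divide field_simps)
      have "f x powr (- \<alpha>) = (1 / f x) powr \<alpha>" using 3 by (simp add: powr_minus_divide powr_divide)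
      also have "\<dots> \<le> (2 powr real (Suc n)) powr \<alpha>" using b(2) 3 \<alpha> by (intro powr_mono2) auto
      also have "\<dots> = ?c n" by (simp add: powr_powr mult.commute)
      finally have le: "f x powr (- \<alpha>) \<le> ?c n" .
      define F where "F i = ennreal (?c i) * indicator (?L i) x" for i
      have "ennreal (f x powr (- \<alpha>)) \<le> F n" using le b(1) x by (simp add: F_def)
      also have "\<dots> \<le> (\<Sum>n. F n)" using sum_le_suminf[of F "{n}"] by simp
      also have "\<dots> \<le> 1 + (\<Sum>n. F n)" by simp
      finally show ?thesis unfolding F_def .
    qed simp
  qed
  have "(\<integral>\<^sup>+x. ennreal (f x powr (- \<alpha>)) \<partial>M) \<le> (\<integral>\<^sup>+x. 1 + (\<Sum>n. ennreal (?c n) * indicator (?L n) x) \<partial>M)"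
    by (rule nn_integral_mono) (rule pw)
  also have "\<dots> = emeasure M (space M) + (\<Sum>n. ennreal (?c n) * emeasure M (?L n))"
    by (simp add: nn_integral_add nn_integral_suminf nn_integral_cmult)
  also have "\<dots> \<le> emeasure M (space M) + (\<Sum>n. ennreal (C * 2 powr \<alpha> * (2 powr (\<alpha> - 1)) ^ n))"
  proof (intro add_left_mono suminf_le)
    fix n
    have "ennreal (?c n) * emeasure M (?L n) = ennreal (?c n * measure M (?L n))"
      by (simp add: emeasure_eq_measure ennreal_mult)
    also have "\<dots> \<le> ennreal (?c n * (C * (1/2) ^ n))" by (intro ennreal_leI mult_left_mono layer) auto
    also have "?c n * (C * (1/2) ^ n) = C * 2 powr \<alpha> * (2 powr (\<alpha> - 1)) ^ n"
    proof -
      have "?c n = 2 powr \<alpha> * (2 powr \<alpha>) ^ n" by (simp add: powr_add[symmetric] powr_realpow[symmetric] powr_powr algebra_simps)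
      moreover have "(2 powr (\<alpha> - 1)) ^ n = (2 powr \<alpha>) ^ n * (1/2) ^ n" by (simp add: powr_diff power_divide)
      ultimately show ?thesis by simp
    qed
    finally show "ennreal (?c n) * emeasure M (?L n) \<le> ennreal (C * 2 powr \<alpha> * (2 powr (\<alpha> - 1)) ^ n)" .
  qed auto
  also have "\<dots> < \<infinity>"
  proof -
    have "2 powr (\<alpha> - 1) < (2::real) powr 0" using \<alpha> by (intro powr_less_mono) auto
    then have "summable (\<lambda>n. C * 2 powr \<alpha> * (2 powr (\<alpha> - 1)) ^ n)" by (intro summable_mult summable_geometric) auto
    then have "(\<Sum>n. ennreal (C * 2 powr \<alpha> * (2 powr (\<alpha> - 1)) ^ n)) = ennreal (\<Sum>n. C * 2 powr \<alpha> * (2 powr (\<alpha> - 1)) ^ n)"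
      using C0 by (intro suminf_ennreal2) auto
    then show ?thesis by (simp add: emeasure_eq_measure less_top[symmetric])
  qed
  finally show "(\<integral>\<^sup>+x. ennreal (f x powr (- \<alpha>)) \<partial>M) < \<infinity>" .
qed auto

text \<open>Translating the layer by multiples of \<open>\<tau> *\<^sub>R \<nu>\<close> gives disjoint copies of it, and about \<open>1 / \<tau>\<close> of them
  fit into a bounded set.\<close>

lemma measure_graph_layer_le:
  fixes h :: "'a::euclidean_space \<Rightarrow> real"
  assumes h: "continuous_on UNIV h" and \<nu>: "norm \<nu> = 1" and \<tau>: "0 < \<tau>"
  shows "measure lebesgue {x \<in> ball x0 r. 0 < x \<bullet> \<nu> - h (x - (x \<bullet> \<nu>) *\<^sub>R \<nu>) \<and> x \<bullet> \<nu> - h (x - (x \<bullet> \<nu>) *\<^sub>R \<nu>) \<le> \<tau>}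
    \<le> 2 * measure lebesgue (ball x0 (r + 1)) * \<tau>"
proof -
  define t where "t x = x \<bullet> \<nu> - h (x - (x \<bullet> \<nu>) *\<^sub>R \<nu>)" for x
  define S where "S = {x \<in> ball x0 r. 0 < t x \<and> t x \<le> \<tau>}"
  define m where "m = measure lebesgue (ball x0 (r + 1))"
  have tc: "continuous_on UNIV t" unfolding t_def by (intro continuous_intros continuous_on_compose2[OF h]) auto
  have [measurable]: "t \<in> borel_measurable borel" by (rule borel_measurable_continuous_onI[OF tc])
  have "S = ball x0 r \<inter> {x \<in> space borel. 0 < t x \<and> t x \<le> \<tau>}" by (auto simp: S_def)
  also have "\<dots> \<in> sets borel" by measurable
  finally have "S \<in> sets borel" .
  then have S: "S \<in> sets lebesgue" by simp
  have Sl: "S \<in> lmeasurable"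
    by (rule bounded_set_imp_lmeasurable[OF _ S]) (auto simp: S_def intro: bounded_subset[OF bounded_ball])
  \<comment> \<open>The projection off \<nu> does not see translations along \<nu>, so only the
    height changes.\<close>
  have shift: "t (c *\<^sub>R \<nu> + x) = t x + c" for c x
  proof -
    have "\<nu> \<bullet> \<nu> = 1" using \<nu> by (simp add: dot_square_norm)
    then show ?thesis by (simp add: t_def inner_add_left algebra_simps)
  qed
  have m0: "0 \<le> m" by (simp add: m_def)
  have ball: "ball x0 r \<subseteq> ball x0 (r + 1)" by auto
  have "measure lebesgue S \<le> 2 * m * \<tau>"
  proof (cases "\<tau> \<le> 1")
    case False
    have "measure lebesgue S \<le> m" unfolding m_def
      by (rule measure_mono_fmeasurable) (use S ball in \<open>auto simp: S_def\<close>)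
    also have "m \<le> 2 * m * \<tau>" using False m0 mult_left_mono[of 1 "2 * \<tau>" m] by simp
    finally show ?thesis .
  next
    case True
    \<comment> \<open>With this n all shifts have length at most 1, whence the ball of radius r + 1,
      while n >= 1/(2 \<tau>), whence the factor 2.\<close>
    define n where "n = nat \<lfloor>1 / \<tau>\<rfloor>"
    have "1 \<le> 1 / \<tau>" using True \<tau> by simp
    moreover from this have "1 \<le> \<lfloor>1 / \<tau>\<rfloor>" by (simp add: le_floor_iff)
    ultimately have n: "real n \<le> 1 / \<tau>" "1 / \<tau> < real n + 1" "1 \<le> real n" unfolding n_def by linarith+
    let ?T = "\<lambda>j. (+) ((real j * \<tau>) *\<^sub>R \<nu>) ` S"
    have T: "?T j \<in> lmeasurable" for j using Sl by (rule measurable_translation)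
    have Tt: "real j * \<tau> < t y \<and> t y \<le> real j * \<tau> + \<tau>" if y: "y \<in> ?T j" for j y
      using y by (auto simp: S_def shift)
    have Tb: "?T j \<subseteq> ball x0 (r + 1)" if "j < n" for j
    proof
      fix y assume "y \<in> ?T j"
      then obtain x where x: "x \<in> S" "y = (real j * \<tau>) *\<^sub>R \<nu> + x" by auto
      have "real j * \<tau> \<le> real n * \<tau>" using that \<tau> by simp
      also have "\<dots> \<le> 1" using n(1) \<tau> by (simp add: field_simps)
      finally have "norm ((real j * \<tau>) *\<^sub>R \<nu>) \<le> 1" using \<nu> \<tau> by simp
      then have "dist x y \<le> 1" by (simp add: x dist_norm)
      moreover have "dist x0 x < r" using x by (simp add: S_def)
      ultimately show "y \<in> ball x0 (r + 1)" using dist_triangle[of x0 y x] by simp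
    qed
    have disj: "disjoint_family_on ?T {..<n}"
      unfolding disjoint_family_on_def
    proof (intro ballI impI)
      fix i j assume "i \<in> {..<n}" "j \<in> {..<n}" "i \<noteq> j"
      have *: False if "y \<in> ?T i" "y \<in> ?T j" "i < j" for y i j
      proof -
        have "real i * \<tau> + \<tau> \<le> real j * \<tau>" using mult_right_mono[of "real i + 1" "real j" \<tau>] that(3) \<tau> by (simp add: algebra_simps)
        then show False using Tt[OF that(1)] Tt[OF that(2)] by linarith
      qed
      show "?T i \<inter> ?T j = {}" using *[of _ i j] *[of _ j i] \<open>i \<noteq> j\<close> by (metis disjoint_iff linorder_neqE_nat)
    qed
    have "real n * measure lebesgue S = (\<Sum>j<n. measure lebesgue (?T j))" by (simp add: measure_translation)
    also have "\<dots> = measure lebesgue (\<Union>j<n. ?T j)"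
      by (rule measure_finite_Union[symmetric, OF finite_lessThan _ disj])
        (use fmeasurableD[OF T] in blast, unfold infinity_ennreal_def, rule fmeasurableD2[OF T])
    also have "\<dots> \<le> m" unfolding m_def
      using Tb T by (intro measure_mono_fmeasurable) (auto intro!: sets.finite_UN fmeasurableD)
    finally have le: "real n * measure lebesgue S \<le> m" .
    have "1 \<le> 2 * real n * \<tau>"
    proof -
      have "1 / \<tau> \<le> 2 * real n" using n by linarith
      then show ?thesis using \<tau> by (simp add: field_simps)
    qed
    then have "measure lebesgue S \<le> (2 * real n * \<tau>) * measure lebesgue S" using mult_right_mono[of 1 "2 * real n * \<tau>" "measure lebesgue S"] by simp
    also have "\<dots> = 2 * \<tau> * (real n * measure lebesgue S)" by simp
    also have "\<dots> \<le> 2 * \<tau> * m" using le \<tau> by (intro mult_left_mono) auto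
    finally show ?thesis by (simp add: algebra_simps)
  qed
  then show ?thesis by (simp add: S_def t_def m_def)
qed

text \<open>The height t above the graph is positive at points x of \<Omega> and nonpositive at a
  nearest boundary point y. As t is Lipschitz near x0, t(x) is at most K times the distance, so the
  boundary layer lies in a graph layer, to which \<open>measure_graph_layer_le\<close>
  applies.\<close>

lemma boundary_layer_local:
  fixes \<Omega> :: "'a::euclidean_space set"
  assumes op: "open \<Omega>" and x0: "x0 \<in> frontier \<Omega>" and sb: "smooth_boundary \<Omega>"
  obtains \<rho> C where "0 < \<rho>" "0 \<le> C" 
    "\<And>\<eta>. 0 < \<eta> \<Longrightarrow> \<eta> \<le> \<rho> \<Longrightarrow> measure lebesgue {x \<in> \<Omega> \<inter> ball x0 (2 * \<rho>). infdist x (frontier \<Omega>) \<le> \<eta>} \<le> C * \<eta>"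
proof -
  obtain r \<nu> h where r: "0 < r" and \<nu>: "norm \<nu> = 1" and h: "smooth h"
    and eq: "\<Omega> \<inter> ball x0 r = {x \<in> ball x0 r. x \<bullet> \<nu> > h (x - (x \<bullet> \<nu>) *\<^sub>R \<nu>)}"
    using sb x0 unfolding smooth_boundary_def by blast
  let ?P = "\<lambda>x. x - (x \<bullet> \<nu>) *\<^sub>R \<nu>"
  have P: "norm (?P x - ?P y) \<le> 2 * norm (x - y)" for x y
  proof -
    have "norm (?P x - ?P y) = norm ((x - y) - ((x - y) \<bullet> \<nu>) *\<^sub>R \<nu>)" by (simp add: inner_diff_left algebra_simps)
    also have "\<dots> \<le> norm (x - y) + \<bar>(x - y) \<bullet> \<nu>\<bar> * norm \<nu>" using norm_triangle_ineq4[of "x - y" "((x - y) \<bullet> \<nu>) *\<^sub>R \<nu>"] by simp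
    also have "\<bar>(x - y) \<bullet> \<nu>\<bar> * norm \<nu> \<le> norm (x - y)" using Cauchy_Schwarz_ineq2[of "x - y" \<nu>] \<nu> by simp
    finally show ?thesis by simp
  qed
  \<comment> \<open>The projection is 2-Lipschitz by the bound above, so it maps the ball of radius
    r around x0 into this ball. There the gradient of h is bounded by compactness.\<close>
  let ?B = "cball (?P x0) (2 * r)"
  note h1 = C_k_grad[OF smooth_C_k[OF h, of "Suc 0"]]
  have "bounded (grad h ` ?B)" by (intro compact_imp_bounded compact_continuous_image continuous_on_subset[OF h1(2)]) auto
  then obtain L0 where L0': "\<forall>y\<in>grad h ` ?B. norm y \<le> L0" unfolding bounded_iff by blast
  then have L0: "norm (grad h z) \<le> max 0 L0" if "z \<in> ?B" for z
    using bspec[OF L0' imageI[OF that, of "grad h"]] by (simp add: le_max_iff_disj)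
  define L where "L = max 0 L0"
  have L: "0 \<le> L" by (simp add: L_def)
  have hl: "\<bar>h z - h w\<bar> \<le> L * norm (z - w)" if "z \<in> ?B" "w \<in> ?B" for z w
  proof -
    have "norm (h z - h w) \<le> L * norm (z - w)"
    proof (rule differentiable_bound[of ?B])
      show "(h has_derivative (\<lambda>v. grad h x \<bullet> v)) (at x within ?B)" for x by (rule has_derivative_at_withinI[OF h1(1)])
      show "onorm (\<lambda>v. grad h x \<bullet> v) \<le> L" if "x \<in> ?B" for x
      proof (rule onorm_bound[OF L])
        show "norm (grad h x \<bullet> v) \<le> L * norm v" for v
          using Cauchy_Schwarz_ineq2[of "grad h x" v] mult_right_mono[OF L0[OF that] norm_ge_zero[of v]] by (simp add: L_def)
      qed
    qed (use that in auto)
    then show ?thesis by simp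
  qed
  define K where "K = 1 + 2 * L"
  let ?t = "\<lambda>x. x \<bullet> \<nu> - h (?P x)"
  have sub: "{x \<in> \<Omega> \<inter> ball x0 (2 * (r / 3)). infdist x (frontier \<Omega>) \<le> \<eta>}
     \<subseteq> {x \<in> ball x0 r. 0 < ?t x \<and> ?t x \<le> K * \<eta>}" if \<eta>: "\<eta> \<le> r / 3" for \<eta>
  proof
    fix x assume x: "x \<in> {x \<in> \<Omega> \<inter> ball x0 (2 * (r / 3)). infdist x (frontier \<Omega>) \<le> \<eta>}"
    obtain y where y: "y \<in> frontier \<Omega>" "infdist x (frontier \<Omega>) = dist x y"
      using infdist_attains_inf[of "frontier \<Omega>" x] x0 by auto
    have "dist x0 y < r" using x y \<eta> dist_triangle[of x0 y x] by auto
    then have xy: "x \<in> \<Omega>" "y \<in> frontier \<Omega>" "y \<in> ball x0 r" "x \<in> ball x0 r" "dist x y \<le> \<eta>" using r x y by auto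
    have "y \<notin> \<Omega>" using xy(2) op by (simp add: frontier_def interior_open)
    then have "y \<notin> {x \<in> ball x0 r. x \<bullet> \<nu> > h (?P x)}" unfolding eq[symmetric] by simp
    then have ty: "?t y \<le> 0" using xy(3) by simp
    have "x \<in> {x \<in> ball x0 r. x \<bullet> \<nu> > h (?P x)}" unfolding eq[symmetric] using xy(1,4) by simp
    then have tx: "0 < ?t x" by simp
    have inB: "?P z \<in> ?B" if "z \<in> ball x0 r" for z
      using P[of x0 z] that by (auto simp: dist_norm)
    have "?t x \<le> ?t x - ?t y" using ty by simp
    also have "\<dots> = (x - y) \<bullet> \<nu> - (h (?P x) - h (?P y))" by (simp add: inner_diff_left)
    also have "\<dots> \<le> norm (x - y) + L * (2 * norm (x - y))"
    proof -
      have "(x - y) \<bullet> \<nu> \<le> norm (x - y)" using Cauchy_Schwarz_ineq2[of "x - y" \<nu>] \<nu> by simp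
      moreover have "\<bar>h (?P x) - h (?P y)\<bar> \<le> L * (2 * norm (x - y))"
        using hl[OF inB[OF xy(4)] inB[OF xy(3)]] mult_left_mono[OF P[of x y] L] by linarith
      ultimately show ?thesis by linarith
    qed
    also have "\<dots> = K * dist x y" by (simp add: K_def dist_norm algebra_simps)
    also have "\<dots> \<le> K * \<eta>" using xy(5) L by (intro mult_left_mono) (auto simp: K_def)
    finally show "x \<in> {x \<in> ball x0 r. 0 < ?t x \<and> ?t x \<le> K * \<eta>}" using tx xy by simp
  qed
  have K: "0 < K" using L by (simp add: K_def)
  show thesis
  \<comment> \<open>A point within 2r/3 of x0 whose nearest boundary point is at distance at most
    r/3 has that boundary point inside the chart of radius r.\<close>
  proof (rule that[of "r / 3" "2 * measure lebesgue (ball x0 (r + 1)) * K"])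
    fix \<eta> :: real assume \<eta>: "0 < \<eta>" "\<eta> \<le> r / 3"
    let ?A = "{x \<in> \<Omega> \<inter> ball x0 (2 * (r / 3)). infdist x (frontier \<Omega>) \<le> \<eta>}"
    have hc: "continuous_on UNIV h" by (rule C_k_continuous[OF smooth_C_k[OF h, of 0]])
    have tc: "continuous_on UNIV ?t" by (intro continuous_intros continuous_on_compose2[OF hc]) auto
    have [measurable]: "?t \<in> borel_measurable borel" by (rule borel_measurable_continuous_onI[OF tc])
    have "{x \<in> ball x0 r. 0 < ?t x \<and> ?t x \<le> K * \<eta>} = ball x0 r \<inter> {x \<in> space borel. 0 < ?t x \<and> ?t x \<le> K * \<eta>}" by auto
    also have "\<dots> \<in> sets borel" by measurable
    finally have Sm: "{x \<in> ball x0 r. 0 < ?t x \<and> ?t x \<le> K * \<eta>} \<in> lmeasurable"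
      by (intro bounded_set_imp_lmeasurable) (auto intro: bounded_subset[OF bounded_ball[of x0 r]])
    have "measure lebesgue ?A \<le> measure lebesgue {x \<in> ball x0 r. 0 < ?t x \<and> ?t x \<le> K * \<eta>}"
    \<comment> \<open>A set that is not measurable has measure 0 by convention, so no measurability
      proof is needed here.\<close>
    proof (cases "?A \<in> sets lebesgue")
      case True
      then show ?thesis by (rule measure_mono_fmeasurable[OF sub[OF \<eta>(2)] _ Sm])
    qed (simp add: measure_notin_sets)
    also have "\<dots> \<le> 2 * measure lebesgue (ball x0 (r + 1)) * (K * \<eta>)"
      by (rule measure_graph_layer_le[OF hc \<nu>]) (use K \<eta> in simp)
    finally show "measure lebesgue ?A \<le> 2 * measure lebesgue (ball x0 (r + 1)) * K * \<eta>" by (simp add: mult.assoc)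
  qed (use r K in auto)
qed

text \<open>Finitely many chart balls cover the compact frontier. If \<eta> is below all their
  radii, the doubled balls cover the layer, which explains the factor 2 in
  \<open>boundary_layer_local\<close>. For larger \<eta> the measure of \<Omega> is itself at most a
  constant times \<eta>.\<close>

lemma boundary_layer:
  fixes \<Omega> :: "'a::euclidean_space set"
  assumes \<Omega>: "bounded_smooth_domain \<Omega>" and ne: "frontier \<Omega> \<noteq> {}"
  obtains C where "\<And>\<eta>. 0 < \<eta> \<Longrightarrow> measure lebesgue {x \<in> \<Omega>. infdist x (frontier \<Omega>) \<le> \<eta>} \<le> C * \<eta>"
proof -
  let ?F = "frontier \<Omega>"
  let ?A = "\<lambda>\<eta>. {x \<in> \<Omega>. infdist x ?F \<le> \<eta>}"
  have op: "open \<Omega>" and bd: "bounded \<Omega>" and sb: "smooth_boundary \<Omega>" using \<Omega> by (auto simp: bounded_smooth_domain_def)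
  have \<Omega>l: "\<Omega> \<in> lmeasurable" using op bd by (intro bounded_set_imp_lmeasurable) (auto simp: borel_open)
  have cl: "closed {x. infdist x ?F \<le> \<eta>}" for \<eta>
    by (intro closed_Collect_le continuous_intros)
  have sets: "?A \<eta> \<in> sets lebesgue" for \<eta>
  proof -
    have "?A \<eta> = \<Omega> \<inter> {x. infdist x ?F \<le> \<eta>}" by auto
    also have "\<dots> \<in> sets borel" using op cl by (intro sets.Int borel_open borel_closed)
    finally show ?thesis by simp
  qed
  have "\<forall>c\<in>?F. \<exists>\<rho>C. 0 < fst \<rho>C \<and> 0 \<le> snd \<rho>C \<and> (\<forall>\<eta>. 0 < \<eta> \<longrightarrow> \<eta> \<le> fst \<rho>C \<longrightarrow>
    measure lebesgue {x \<in> \<Omega> \<inter> ball c (2 * fst \<rho>C). infdist x ?F \<le> \<eta>} \<le> snd \<rho>C * \<eta>)"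
  proof
    fix c assume c: "c \<in> ?F"
    obtain \<rho> C where "0 < \<rho>" "0 \<le> C" 
      "\<And>\<eta>. 0 < \<eta> \<Longrightarrow> \<eta> \<le> \<rho> \<Longrightarrow> measure lebesgue {x \<in> \<Omega> \<inter> ball c (2 * \<rho>). infdist x ?F \<le> \<eta>} \<le> C * \<eta>"
      by (rule boundary_layer_local[OF op c sb]) (rule that)
    then show "\<exists>\<rho>C. 0 < fst \<rho>C \<and> 0 \<le> snd \<rho>C \<and> (\<forall>\<eta>. 0 < \<eta> \<longrightarrow> \<eta> \<le> fst \<rho>C \<longrightarrow>
      measure lebesgue {x \<in> \<Omega> \<inter> ball c (2 * fst \<rho>C). infdist x ?F \<le> \<eta>} \<le> snd \<rho>C * \<eta>)"
      by (intro exI[of _ "(\<rho>, C)"]) simp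
  qed
  from bchoice[OF this] obtain f where f: "\<forall>c\<in>?F. 0 < fst (f c) \<and> 0 \<le> snd (f c) \<and> (\<forall>\<eta>. 0 < \<eta> \<longrightarrow> \<eta> \<le> fst (f c) \<longrightarrow>
    measure lebesgue {x \<in> \<Omega> \<inter> ball c (2 * fst (f c)). infdist x ?F \<le> \<eta>} \<le> snd (f c) * \<eta>)" ..
  have cF: "compact ?F" using bd by (rule compact_frontier_bounded)
  have "?F \<subseteq> (\<Union>c\<in>?F. ball c (fst (f c)))" using f by (auto intro!: centre_in_ball[THEN iffD2])
  from compactE_image[OF cF _ this] obtain T where T: "T \<subseteq> ?F" "finite T" "?F \<subseteq> (\<Union>c\<in>T. ball c (fst (f c)))" by auto
  have T0: "T \<noteq> {}" using T(3) ne by auto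
  define \<rho> where "\<rho> = Min ((\<lambda>c. fst (f c)) ` T)"
  have \<rho>: "0 < \<rho>" "\<And>c. c \<in> T \<Longrightarrow> \<rho> \<le> fst (f c)" unfolding \<rho>_def using T T0 f by (auto simp: subset_iff)
  define C where "C = (\<Sum>c\<in>T. snd (f c)) + measure lebesgue \<Omega> / \<rho>"
  have C0: "0 \<le> (\<Sum>c\<in>T. snd (f c))" using T f by (intro sum_nonneg) auto
  show thesis
  proof (rule that[of C])
    fix \<eta> :: real assume \<eta>: "0 < \<eta>"
    show "measure lebesgue (?A \<eta>) \<le> C * \<eta>"
    proof (cases "\<eta> \<le> \<rho>")
      case False
      have "measure lebesgue (?A \<eta>) \<le> measure lebesgue \<Omega>"
        by (rule measure_mono_fmeasurable[OF _ sets \<Omega>l]) auto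
      also have "\<dots> = measure lebesgue \<Omega> / \<rho> * \<rho>" using \<rho> by simp
      also have "\<dots> \<le> measure lebesgue \<Omega> / \<rho> * \<eta>" using False \<rho> by (intro mult_left_mono) auto
      also have "\<dots> \<le> C * \<eta>" unfolding C_def using C0 \<eta> by (intro mult_right_mono) auto
      finally show ?thesis .
    next
      case True
      let ?B = "\<lambda>c. {x \<in> \<Omega> \<inter> ball c (2 * fst (f c)). infdist x ?F \<le> \<eta>}"
      have Bs: "?B c \<in> lmeasurable" for c
      proof -
        have "?B c = ball c (2 * fst (f c)) \<inter> ?A \<eta>" by auto
        then show ?thesis using fmeasurable_Int_fmeasurable[OF lmeasurable_ball sets] by simp
      qed
      have "?A \<eta> \<subseteq> (\<Union>c\<in>T. ?B c)"
      proof
        fix x assume x: "x \<in> ?A \<eta>"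
        obtain y where y: "y \<in> ?F" "infdist x ?F = dist x y" using infdist_attains_inf[of ?F x] ne by auto
        then obtain c where c: "c \<in> T" "y \<in> ball c (fst (f c))" using T(3) by auto
        have "dist c x < 2 * fst (f c)"
          using x y c \<rho>(2)[OF c(1)] True dist_triangle[of c x y] by (auto simp: dist_commute)
        then show "x \<in> (\<Union>c\<in>T. ?B c)" using x c(1) by auto
      qed
      then have "measure lebesgue (?A \<eta>) \<le> measure lebesgue (\<Union>c\<in>T. ?B c)"
        by (rule measure_mono_fmeasurable[OF _ sets]) (use T(2) Bs in \<open>auto intro!: fmeasurable.finite_UN\<close>)
      also have "\<dots> \<le> (\<Sum>c\<in>T. measure lebesgue (?B c))"
        by (rule measure_UNION_le[OF T(2)]) (use Bs in auto)
      also have "\<dots> \<le> (\<Sum>c\<in>T. snd (f c) * \<eta>)"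
      proof (rule sum_mono)
        fix c assume c: "c \<in> T"
        then have "c \<in> ?F" "\<eta> \<le> fst (f c)" using T(1) True \<rho>(2)[OF c] by auto
        then show "measure lebesgue (?B c) \<le> snd (f c) * \<eta>" using f \<eta> by blast
      qed
      also have "\<dots> = (\<Sum>c\<in>T. snd (f c)) * \<eta>" by (simp add: sum_distrib_right)
      also have "\<dots> \<le> C * \<eta>" unfolding C_def using \<eta> \<rho> by (intro mult_right_mono) auto
      finally show ?thesis .
    qed
  qed
qed

text \<open>For 0 < \<alpha> < 1 this is the layer bound fed into
  \<open>integrable_powr_of_layer_bound\<close>. For \<alpha> <= 0 the power is bounded because
  \<Omega> is; for an empty frontier \<open>infdist\<close> is 0 by convention.\<close>

lemma integrable_dist_boundary_powr:
  fixes \<Omega> :: "'a::euclidean_space set"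
  assumes \<Omega>: "bounded_smooth_domain \<Omega>" and \<alpha>: "\<alpha> < 1"
  shows "integrable (lebesgue_on \<Omega>) (\<lambda>x. infdist x (frontier \<Omega>) powr (- \<alpha>))"
proof -
  have op: "open \<Omega>" and bd: "bounded \<Omega>" using \<Omega> by (auto simp: bounded_smooth_domain_def)
  interpret bounded_open \<Omega> 2 using op bd by unfold_locales auto
  let ?d = "\<lambda>x. infdist x (frontier \<Omega>)"
  have [measurable]: "?d \<in> borel_measurable (lebesgue_on \<Omega>)"
    by (intro borel_imp_meas borel_measurable_continuous_onI continuous_intros)
  show ?thesis
  proof (cases "frontier \<Omega> = {} \<or> \<alpha> \<le> 0")
    case True
    obtain R where R: "\<And>x. x \<in> \<Omega> \<Longrightarrow> norm x \<le> R" using bd unfolding bounded_iff by blast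
    obtain z where z: "frontier \<Omega> = {} \<or> z \<in> frontier \<Omega>" by auto
    have b: "norm (?d x powr (- \<alpha>)) \<le> (R + norm z) powr (- \<alpha>)" if x: "x \<in> \<Omega>" for x
    proof (cases "frontier \<Omega> = {}")
      case False
      then have "?d x \<le> dist x z" using z by (intro infdist_le) auto
      also have "\<dots> \<le> R + norm z" using R[OF x] norm_triangle_ineq4[of x z] by (simp add: dist_norm)
      finally have "?d x powr (- \<alpha>) \<le> (R + norm z) powr (- \<alpha>)" using True False by (intro powr_mono2) (auto simp: infdist_nonneg)
      then show ?thesis by simp
    qed (simp add: infdist_def)
    show ?thesis
      by (rule integrable_const_bound[where B = "(R + norm z) powr (- \<alpha>)"]) (use b in \<open>auto intro!: AE_I2\<close>)
  next
    case False
    obtain C where C: "\<And>\<eta>. 0 < \<eta> \<Longrightarrow> measure lebesgue {x \<in> \<Omega>. ?d x \<le> \<eta>} \<le> C * \<eta>"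
      by (rule boundary_layer[OF \<Omega>]) (use False in simp, rule that)
    show ?thesis
    proof (rule integrable_powr_of_layer_bound)
      fix \<eta> :: real assume \<eta>: "0 < \<eta>"
      have "measure (lebesgue_on \<Omega>) {x \<in> space (lebesgue_on \<Omega>). ?d x \<le> \<eta>} = measure lebesgue {x \<in> \<Omega>. ?d x \<le> \<eta>}"
        by (subst measure_restrict_space) auto
      then show "measure (lebesgue_on \<Omega>) {x \<in> space (lebesgue_on \<Omega>). ?d x \<le> \<eta>} \<le> C * \<eta>" using C[OF \<eta>] by simp
    qed (use False \<alpha> in \<open>auto simp: infdist_nonneg\<close>)
  qed
qed

section \<open>Finiteness of the Gagliardo seminorm\<close>

text \<open>Jensen's inequality for n equal weights, from the tangent of t^p at the mean A: summed
  over j, the linear terms cancel.\<close>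

lemma powr_sum_le:
  fixes d :: "nat \<Rightarrow> real"
  assumes p: "1 \<le> p" and n: "0 < n"
  shows "\<bar>\<Sum>j<n. d j\<bar> powr p \<le> real n powr (p - 1) * (\<Sum>j<n. \<bar>d j\<bar> powr p)"
proof -
  define A where "A = (\<Sum>j<n. \<bar>d j\<bar>) / real n"
  have A0: "0 \<le> A" unfolding A_def by (intro divide_nonneg_nonneg sum_nonneg) auto
  have sA: "(\<Sum>j<n. \<bar>d j\<bar>) = real n * A" using n by (simp add: A_def)
  have "real n * A powr p \<le> (\<Sum>j<n. \<bar>d j\<bar> powr p)"
  proof (cases "A = 0")
    case True
    then show ?thesis by (auto intro!: sum_nonneg)
  next
    case False
    then have A: "0 < A" using A0 by simp
    have "(\<Sum>j<n. A powr p - \<bar>d j\<bar> powr p) \<le> (\<Sum>j<n. p * A powr (p - 1) * (A - \<bar>d j\<bar>))"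
      by (intro sum_mono powr_diff_le[OF p A]) auto
    also have "\<dots> = p * A powr (p - 1) * (real n * A - (\<Sum>j<n. \<bar>d j\<bar>))"
      by (simp add: sum_distrib_left[symmetric] sum_subtractf)
    also have "\<dots> = 0" using sA by simp
    finally show ?thesis by (simp add: sum_subtractf)
  qed
  then have "real n powr (p - 1) * (real n * A powr p) \<le> real n powr (p - 1) * (\<Sum>j<n. \<bar>d j\<bar> powr p)"
    by (intro mult_left_mono) auto
  moreover have "real n powr (p - 1) * (real n * A powr p) = (real n * A) powr p"
    using n A0 by (simp add: powr_mult powr_diff)
  moreover have "\<bar>\<Sum>j<n. d j\<bar> powr p \<le> (real n * A) powr p"
    using sum_abs[of d "{..<n}"] p unfolding sA by (intro powr_mono2) auto
  ultimately show ?thesis by linarith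
qed

lemma nn_integral_lborel_translate:
  fixes f :: "'a::euclidean_space \<Rightarrow> ennreal"
  assumes "f \<in> borel_measurable borel"
  shows "(\<integral>\<^sup>+x. f (x + c) \<partial>lborel) = (\<integral>\<^sup>+x. f x \<partial>lborel)"
proof -
  have d: "distr lborel borel ((+) c) = (lborel :: 'a measure)" by (rule lborel_distr_plus)
  show ?thesis
    using nn_integral_distr[of "(+) c" lborel borel f] assms unfolding d by (simp add: add.commute)
qed

text \<open>Splitting the translation by \<open>h\<close> into \<open>n\<close> equal steps shows that the left-hand side does not decrease
  when the difference is replaced by \<open>n\<close> times the difference over one step; then \<open>n\<close> tends to infinity.\<close>

lemma translation_difference_bound:
  fixes f :: "'a::euclidean_space \<Rightarrow> real"
  assumes f: "C_k 1 f" and supp: "compact (closure {x. f x \<noteq> 0})" and p: "1 < p"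
  shows "(LINT x|lborel. \<bar>f (x + h) - f x\<bar> powr p) \<le> norm h powr p * (LINT x|lborel. norm (grad f x) powr p)"
    and "integrable lborel (\<lambda>x. \<bar>f (x + h) - f x\<bar> powr p)"
proof -
  obtain L R where L: "0 \<le> L" "0 \<le> R" "\<And>x. norm (grad f x) \<le> L" "\<And>x. \<bar>f x\<bar> \<le> L"
    "\<And>x y. \<bar>f x - f y\<bar> \<le> L * norm (x - y)" "\<And>x. R < norm x \<Longrightarrow> f x = 0 \<and> grad f x = 0"
    by (rule compactly_supported_C1_bounds[OF f supp]) (rule that)
  have f1: "C_k (Suc 0) f" using f by simp
  have [measurable]: "f \<in> borel_measurable borel" "grad f \<in> borel_measurable borel"
    by (rule borel_measurable_continuous_onI[OF C_k_continuous[OF f]], rule borel_measurable_continuous_onI[OF C_k_grad(2)[OF f1]])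
  have int: "integrable lborel (\<lambda>x. \<bar>f (x + v) - f x\<bar> powr p)" for v
  proof (rule lborel_integrable_bounded_support[where C = "(L * norm v) powr p" and R = "R + norm v"])
    show "norm (\<bar>f (x + v) - f x\<bar> powr p) \<le> (L * norm v) powr p" for x
      using L(5)[of "x + v" x] p by (simp add: powr_mono2)
    fix x :: 'a assume "R + norm v < norm x"
    then have "R < norm (x + v)" "R < norm x" using norm_diff_ineq[of x v] norm_ge_zero[of v] by linarith+
    then show "\<bar>f (x + v) - f x\<bar> powr p = 0" using L(6) by simp
  qed measurable
  show "integrable lborel (\<lambda>x. \<bar>f (x + h) - f x\<bar> powr p)" by (rule int)
  let ?d = "\<lambda>n x. real (Suc n) * (f (x + (1 / real (Suc n)) *\<^sub>R h) - f x)"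
  have le: "(LINT x|lborel. \<bar>f (x + h) - f x\<bar> powr p) \<le> (LINT x|lborel. \<bar>?d n x\<bar> powr p)" for n
  proof -
    let ?v = "(1 / real (Suc n)) *\<^sub>R h"
    let ?D = "\<lambda>j x. f (x + real (Suc j) *\<^sub>R ?v) - f (x + real j *\<^sub>R ?v)"
    have tele: "f (x + h) - f x = (\<Sum>j<Suc n. ?D j x)" for x
    proof -
      have "(\<Sum>j<Suc n. ?D j x) = f (x + real (Suc n) *\<^sub>R ?v) - f (x + real 0 *\<^sub>R ?v)"
        by (rule sum_lessThan_telescope)
      then show ?thesis by simp
    qed
    have D: "?D j x = f ((x + real j *\<^sub>R ?v) + ?v) - f (x + real j *\<^sub>R ?v)" for j x
    proof -
      have "x + real (Suc j) *\<^sub>R ?v = (x + real j *\<^sub>R ?v) + ?v" by (simp only: of_nat_Suc scaleR_add_left scaleR_one add_ac)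
      then show ?thesis by (simp only:)
    qed
    have Di: "integrable lborel (\<lambda>x. \<bar>?D j x\<bar> powr p)" "(LINT x|lborel. \<bar>?D j x\<bar> powr p) = (LINT x|lborel. \<bar>f (x + ?v) - f x\<bar> powr p)" for j
      unfolding D using integral_lborel_translate[of "\<lambda>x. \<bar>f (x + ?v) - f x\<bar> powr p" "real j *\<^sub>R ?v"] int[of ?v] by measurable
    have "(LINT x|lborel. \<bar>f (x + h) - f x\<bar> powr p) \<le> (LINT x|lborel. real (Suc n) powr (p - 1) * (\<Sum>j<Suc n. \<bar>?D j x\<bar> powr p))"
    proof (rule integral_mono[OF int])
      show "integrable lborel (\<lambda>x. real (Suc n) powr (p - 1) * (\<Sum>j<Suc n. \<bar>?D j x\<bar> powr p))"
        by (intro integrable_mult_right Bochner_Integration.integrable_sum Di)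
      show "\<bar>f (x + h) - f x\<bar> powr p \<le> real (Suc n) powr (p - 1) * (\<Sum>j<Suc n. \<bar>?D j x\<bar> powr p)" for x
        unfolding tele by (rule powr_sum_le) (use p in auto)
    qed
    also have "\<dots> = real (Suc n) powr (p - 1) * (\<Sum>j<Suc n. (LINT x|lborel. \<bar>?D j x\<bar> powr p))"
      using Di(1) by (simp only: integral_mult_right_zero Bochner_Integration.integral_sum)
    also have "\<dots> = real (Suc n) powr (p - 1) * (real (Suc n) * (LINT x|lborel. \<bar>f (x + ?v) - f x\<bar> powr p))"
      by (simp only: Di(2) sum_constant card_lessThan)
    \<comment> \<open>The convexity factor with exponent p - 1 and the number of equal integrals
      combine to exponent p, which turns the one-step difference into a difference quotient.\<close>
    also have "\<dots> = real (Suc n) powr p * (LINT x|lborel. \<bar>f (x + ?v) - f x\<bar> powr p)"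
      by (simp add: powr_diff)
    also have "\<dots> = (LINT x|lborel. \<bar>?d n x\<bar> powr p)"
      by (simp only: abs_mult powr_mult abs_ge_zero integral_mult_right_zero abs_of_nat)
    finally show ?thesis .
  qed
  have "(\<lambda>n. LINT x|lborel. \<bar>?d n x\<bar> powr p) \<longlonglongrightarrow> (LINT x|lborel. \<bar>grad f x \<bullet> h\<bar> powr p)"
  proof (rule integral_dominated_convergence[where w = "\<lambda>x. (L * norm h) powr p * indicator (cball 0 (R + norm h)) x"])
    show "integrable lborel (\<lambda>x::'a. (L * norm h) powr p * indicator (cball 0 (R + norm h)) x)"
      by (intro integrable_mult_right integrable_real_indicator) (auto simp: emeasure_lborel_cball_finite[simplified infinity_ennreal_def])
    show "AE x in lborel. (\<lambda>n. \<bar>?d n x\<bar> powr p) \<longlonglongrightarrow> \<bar>grad f x \<bullet> h\<bar> powr p"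
      by (intro AE_I2 tendsto_powr2 tendsto_rabs difference_quotient_tendsto C_k_grad(1)[OF f1] tendsto_const) (use p in auto)
    show "AE x in lborel. norm (\<bar>?d n x\<bar> powr p) \<le> (L * norm h) powr p * indicator (cball 0 (R + norm h)) x" for n
    proof (rule AE_I2)
      fix x
      show "norm (\<bar>?d n x\<bar> powr p) \<le> (L * norm h) powr p * indicator (cball 0 (R + norm h)) x"
      proof (cases "x \<in> cball 0 (R + norm h)")
        case True
        have "\<bar>f (x + (1 / real (Suc n)) *\<^sub>R h) - f x\<bar> \<le> L * (1 / real (Suc n) * norm h)"
          using L(5)[of "x + (1 / real (Suc n)) *\<^sub>R h" x] by simp
        then have "real (Suc n) * \<bar>f (x + (1 / real (Suc n)) *\<^sub>R h) - f x\<bar> \<le> real (Suc n) * (L * (1 / real (Suc n) * norm h))"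
          by (intro mult_left_mono) auto
        also have "\<dots> = L * norm h" by simp
        finally have "\<bar>?d n x\<bar> \<le> L * norm h" by (simp add: abs_mult)
        then show ?thesis using True p by (simp add: powr_mono2)
      next
        case False
        then have x: "R + norm h < norm x" by simp
        have "norm ((1 / real (Suc n)) *\<^sub>R h) \<le> norm h" by (simp add: field_simps mult_le_cancel_left1)
        then have "R < norm (x + (1 / real (Suc n)) *\<^sub>R h)" "R < norm x"
          using x norm_diff_ineq[of x "(1 / real (Suc n)) *\<^sub>R h"] norm_ge_zero[of h] by linarith+
        then show ?thesis using L(6) False by simp
      qed
    qed
  qed measurable
  then have "(LINT x|lborel. \<bar>f (x + h) - f x\<bar> powr p) \<le> (LINT x|lborel. \<bar>grad f x \<bullet> h\<bar> powr p)"
    by (rule LIMSEQ_le_const) (use le in auto)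
  also have "\<dots> \<le> (LINT x|lborel. norm h powr p * norm (grad f x) powr p)"
  proof (rule integral_mono)
    have gi: "integrable lborel (\<lambda>x. norm (grad f x) powr p)"
      by (rule lborel_integrable_bounded_support[where C = "L powr p" and R = R]) (use L p in \<open>auto intro!: powr_mono2\<close>)
    then show "integrable lborel (\<lambda>x. norm h powr p * norm (grad f x) powr p)" by simp
    have b: "\<bar>grad f x \<bullet> h\<bar> powr p \<le> norm h powr p * norm (grad f x) powr p" for x
    proof -
      have "\<bar>grad f x \<bullet> h\<bar> powr p \<le> (norm h * norm (grad f x)) powr p"
        using Cauchy_Schwarz_ineq2[of "grad f x" h] p by (intro powr_mono2) (auto simp: mult.commute)
      then show ?thesis by (simp add: powr_mult)
    qed
    then show "\<bar>grad f x \<bullet> h\<bar> powr p \<le> norm h powr p * norm (grad f x) powr p" for x .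
    show "integrable lborel (\<lambda>x. \<bar>grad f x \<bullet> h\<bar> powr p)"
      by (rule Bochner_Integration.integrable_bound[OF integrable_mult_right[OF gi, of "norm h powr p"]]) (use b in auto)
  qed
  finally show "(LINT x|lborel. \<bar>f (x + h) - f x\<bar> powr p) \<le> norm h powr p * (LINT x|lborel. norm (grad f x) powr p)" by simp
qed

text \<open>Taking f = |h|^N in \<open>integrable_powr_of_layer_bound\<close>, N the dimension, the
  sublevel sets are balls of volume proportional to \<eta>, and the exponent becomes \<beta>/N <
  1.\<close>

lemma kernel_near_zero:
  fixes \<beta> :: real
  assumes \<beta>: "\<beta> < real DIM('a::euclidean_space)"
  shows "(\<integral>\<^sup>+(h::'a). ennreal (norm h powr (- \<beta>)) * indicator (ball 0 1) h \<partial>lborel) < \<infinity>"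
proof -
  let ?N = "real DIM('a)" and ?B = "ball (0::'a) 1"
  let ?M = "restrict_space lborel ?B"
  \<comment> \<open>The layer lemma needs a positive exponent, but \<beta> may be negative. Raising
    \<beta> to at least N/2 only enlarges the integrand inside the unit ball.\<close>
  define \<beta>' where "\<beta>' = max \<beta> (?N / 2)"
  have N: "0 < ?N" by simp
  have \<beta>': "\<beta> \<le> \<beta>'" "0 < \<beta>'" "\<beta>' < ?N" using \<beta> N by (auto simp: \<beta>'_def less_max_iff_disj)
  interpret finite_measure ?M
    by (rule finite_measureI) (simp add: emeasure_restrict_space emeasure_lborel_ball_finite[simplified infinity_ennreal_def, THEN less_imp_neq])
  have "integrable ?M (\<lambda>h. (norm h powr ?N) powr (- (\<beta>' / ?N)))"
  proof (rule integrable_powr_of_layer_bound[where C = "unit_ball_vol ?N"])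
    show "(\<lambda>h. norm h powr ?N) \<in> borel_measurable ?M" by (rule measurable_restrict_space1) measurable
    show "0 < \<beta>' / ?N" "\<beta>' / ?N < 1" using \<beta>' N by auto
    fix \<eta> :: real assume \<eta>: "0 < \<eta>"
    have "measure ?M {h \<in> space ?M. norm h powr ?N \<le> \<eta>} = measure lborel {h \<in> ?B. norm h powr ?N \<le> \<eta>}"
      by (subst measure_restrict_space) (auto simp: space_restrict_space)
    also have "\<dots> \<le> measure lborel (cball (0::'a) (\<eta> powr (1 / ?N)))"
    proof (rule measure_mono_fmeasurable)
      show "{h \<in> ?B. norm h powr ?N \<le> \<eta>} \<subseteq> cball 0 (\<eta> powr (1 / ?N))"
      proof
        fix h assume h: "h \<in> {h \<in> ?B. norm h powr ?N \<le> \<eta>}"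
        then have "(norm h powr ?N) powr (1 / ?N) \<le> \<eta> powr (1 / ?N)" by (intro powr_mono2) auto
        then show "h \<in> cball 0 (\<eta> powr (1 / ?N))" using N by (simp add: powr_powr)
      qed
      have "{h \<in> ?B. norm h powr ?N \<le> \<eta>} = ?B \<inter> {h \<in> space borel. norm h powr ?N \<le> \<eta>}" by auto
      also have "\<dots> \<in> sets borel" by measurable
      finally show "{h \<in> ?B. norm h powr ?N \<le> \<eta>} \<in> sets lborel" by simp
      show "cball (0::'a) (\<eta> powr (1 / ?N)) \<in> fmeasurable lborel"
        by (simp add: fmeasurable_def emeasure_lborel_cball_finite[simplified infinity_ennreal_def])
    qed
    also have "\<dots> = unit_ball_vol ?N * (\<eta> powr (1 / ?N)) ^ DIM('a)"
      by (simp add: measure_def emeasure_cball)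
    also have "(\<eta> powr (1 / ?N)) ^ DIM('a) = (\<eta> powr (1 / ?N)) powr ?N" using \<eta> by (simp add: powr_realpow)
    also have "\<dots> = \<eta>" using \<eta> DIM_positive[where 'a = 'a] by (simp only: powr_powr) (simp del: DIM_positive)
    finally show "measure ?M {h \<in> space ?M. norm h powr ?N \<le> \<eta>} \<le> unit_ball_vol ?N * \<eta>" .
  qed auto
  then have fin: "(\<integral>\<^sup>+h. ennreal ((norm h powr ?N) powr (- (\<beta>' / ?N))) \<partial>?M) < \<infinity>"
    by (subst (asm) integrable_iff_bounded) simp
  have "(\<integral>\<^sup>+(h::'a). ennreal (norm h powr (- \<beta>)) * indicator ?B h \<partial>lborel) = (\<integral>\<^sup>+h. ennreal (norm h powr (- \<beta>)) \<partial>?M)"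
    by (subst nn_integral_restrict_space) auto
  also have "\<dots> \<le> (\<integral>\<^sup>+h. ennreal ((norm h powr ?N) powr (- (\<beta>' / ?N))) \<partial>?M)"
  proof (rule nn_integral_mono)
    fix h assume "h \<in> space ?M"
    then have h: "norm h < 1" by (simp add: space_restrict_space)
    have "norm h powr (- \<beta>) \<le> norm h powr (- \<beta>')"
      using h \<beta>' powr_mono'[of "- \<beta>'" "- \<beta>" "norm h"] by (cases "h = 0") auto
    also have "\<dots> = (norm h powr ?N) powr (- (\<beta>' / ?N))" using N by (simp add: powr_powr)
    finally show "ennreal (norm h powr (- \<beta>)) \<le> ennreal ((norm h powr ?N) powr (- (\<beta>' / ?N)))" by (rule ennreal_leI)
  qed
  also note fin
  finally show ?thesis .
qed

text \<open>Dyadic shells: on the shell from 2^n to 2^(n+1) the kernel is at most 2^(-\<beta> n),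
  and the volumes turn the sum into a geometric series with ratio 2^(N-\<beta>).\<close>

lemma kernel_at_infinity:
  fixes \<beta> :: real
  assumes \<beta>: "real DIM('a::euclidean_space) < \<beta>"
  shows "(\<integral>\<^sup>+(h::'a). ennreal (norm h powr (- \<beta>)) * indicator (- ball 0 1) h \<partial>lborel) < \<infinity>"
proof -
  let ?N = "real DIM('a)"
  let ?c = "\<lambda>n. (2::real) powr (- \<beta> * real n)" and ?C = "\<lambda>n. cball (0::'a) (2 ^ Suc n)"
  have pw: "ennreal (norm h powr (- \<beta>)) * indicator (- ball 0 1) h \<le> (\<Sum>n. ennreal (?c n) * indicator (?C n) h)" for h :: 'a
  proof (cases "norm h < 1")
    case False
    define n where "n = nat \<lfloor>log 2 (norm h)\<rfloor>"
    have h: "1 \<le> norm h" using False by simp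
    then have l0: "0 \<le> log 2 (norm h)" by (simp add: log_def)
    then have n: "real n \<le> log 2 (norm h)" "log 2 (norm h) < real (Suc n)" unfolding n_def by linarith+
    have h0: "0 < norm h" using h by linarith
    have b: "2 powr real n \<le> norm h" "norm h \<le> 2 powr real (Suc n)"
      using n le_log_iff[of 2 "norm h" "real n"] log_less_iff[of 2 "norm h" "real (Suc n)"] h0 by auto
    have "norm h powr (- \<beta>) \<le> (2 powr real n) powr (- \<beta>)"
      using b(1) \<beta> by (intro powr_mono2') auto
    then have le: "norm h powr (- \<beta>) \<le> ?c n" by (simp add: powr_powr mult.commute)
    define F where "F i = ennreal (?c i) * indicator (?C i) h" for i
    have "norm h \<le> 2 ^ Suc n" using b(2) powr_realpow[of 2 "Suc n"] by simp
    then have "ennreal (norm h powr (- \<beta>)) * indicator (- ball 0 1) h \<le> F n" 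
      using le by (simp add: F_def indicator_def del: power_Suc)
    also have "\<dots> \<le> (\<Sum>n. F n)" using sum_le_suminf[of F "{n}"] by simp
    finally show ?thesis unfolding F_def .
  qed simp
  have "(\<integral>\<^sup>+(h::'a). ennreal (norm h powr (- \<beta>)) * indicator (- ball 0 1) h \<partial>lborel) \<le> (\<integral>\<^sup>+h. (\<Sum>n. ennreal (?c n) * indicator (?C n) h) \<partial>lborel)"
    by (rule nn_integral_mono) (rule pw)
  also have "\<dots> = (\<Sum>n. ennreal (?c n) * emeasure lborel (?C n))"
  proof -
    have "(\<integral>\<^sup>+h. (\<Sum>n. ennreal (?c n) * indicator (?C n) h) \<partial>lborel) = (\<Sum>n. \<integral>\<^sup>+h. ennreal (?c n) * indicator (?C n) h \<partial>lborel)"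
      by (rule nn_integral_suminf) (rule borel_measurable_times_ennreal[OF _ borel_measurable_indicator]; simp)
    also have "\<dots> = (\<Sum>n. ennreal (?c n) * emeasure lborel (?C n))"
      by (rule arg_cong[of _ _ suminf], rule ext, rule nn_integral_cmult_indicator) simp
    finally show ?thesis .
  qed
  also have "\<dots> = (\<Sum>n. ennreal (unit_ball_vol ?N * 2 powr ?N * (2 powr (?N - \<beta>)) ^ n))"
  proof (rule arg_cong[of _ _ suminf], rule ext)
    fix n
    have "ennreal (?c n) * emeasure lborel (?C n) = ennreal (?c n * (unit_ball_vol ?N * (2 ^ Suc n) ^ DIM('a)))"
      by (simp add: emeasure_cball ennreal_mult)
    also have "(2 ^ Suc n) ^ DIM('a) = (2::real) powr (?N * real (Suc n))"
    proof -
      have "(2::real) powr (?N * real (Suc n)) = 2 powr real (Suc n * DIM('a))" by (simp only: of_nat_mult mult.commute)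
      also have "\<dots> = 2 ^ (Suc n * DIM('a))" by (rule powr_realpow) simp
      also have "\<dots> = (2 ^ Suc n) ^ DIM('a)" by (rule power_mult)
      finally show ?thesis by (rule sym)
    qed
    also have "?c n * (unit_ball_vol ?N * (2::real) powr (?N * real (Suc n))) = unit_ball_vol ?N * 2 powr ?N * (2 powr (?N - \<beta>)) ^ n"
    proof -
      have "?c n * (2::real) powr (?N * real (Suc n)) = 2 powr ?N * (2 powr (?N - \<beta>)) ^ n"
      proof -
        have "(2 powr (?N - \<beta>)) ^ n = (2 powr (?N - \<beta>)) powr real n" by (rule powr_realpow[symmetric]) simp
        then have 1: "(2 powr (?N - \<beta>)) ^ n = (2::real) powr ((?N - \<beta>) * real n)" by (simp only: powr_powr)
        have 2: "- \<beta> * real n + ?N * real (Suc n) = ?N + (?N - \<beta>) * real n" by (simp add: algebra_simps)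
        show ?thesis unfolding 1 powr_add[symmetric] 2 ..
      qed
      then show ?thesis by (simp only: mult.left_commute mult.assoc)
    qed
    finally show "ennreal (?c n) * emeasure lborel (?C n) = ennreal (unit_ball_vol ?N * 2 powr ?N * (2 powr (?N - \<beta>)) ^ n)" .
  qed
  also have "\<dots> < \<infinity>"
  proof -
    have "2 powr (?N - \<beta>) < (2::real) powr 0" using \<beta> by (intro powr_less_mono) auto
    then have "summable (\<lambda>n. unit_ball_vol ?N * 2 powr ?N * (2 powr (?N - \<beta>)) ^ n)" by (intro summable_mult summable_geometric) auto
    then have "(\<Sum>n. ennreal (unit_ball_vol ?N * 2 powr ?N * (2 powr (?N - \<beta>)) ^ n)) = ennreal (\<Sum>n. unit_ball_vol ?N * 2 powr ?N * (2 powr (?N - \<beta>)) ^ n)"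
      by (intro suminf_ennreal2) auto
    then show ?thesis by simp
  qed
  finally show ?thesis .
qed

text \<open>The density of the p-th power of the Gagliardo seminorm. On the diagonal the quotient
  0/0 has the value 0.\<close>

definition gagliardo :: "real \<Rightarrow> real \<Rightarrow> ('a::euclidean_space \<Rightarrow> real) \<Rightarrow> 'a \<times> 'a \<Rightarrow> real" where
  "gagliardo s p u = (\<lambda>(x, y). \<bar>u x - u y\<bar> powr p / norm (x - y) powr (real DIM('a) + s * p))"

lemma gagliardo_measurable [measurable]:
  assumes [measurable]: "u \<in> borel_measurable borel"
  shows "gagliardo s p u \<in> borel_measurable (borel \<Otimes>\<^sub>M borel)"
  unfolding gagliardo_def case_prod_beta by measurable

context bounded_open begin

text \<open>After substituting y = x + h, the differences are integrated in x first. For |h| < 1 the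
  translation estimate gains |h|^p and leaves a kernel integrable at 0 as s < 1; for |h| >= 1 the
  differences are bounded by twice the p-th power integral of \<phi>, up to 2^p, and the kernel is
  integrable at infinity as 0 < s. So K is the same for all test functions.\<close>

lemma gagliardo_Cc_bound:
  assumes s: "0 < s" "s < 1"
  obtains K where "0 \<le> K" "\<And>\<phi>. \<phi> \<in> Cc_inf \<Omega> \<Longrightarrow> (\<integral>\<^sup>+x. \<integral>\<^sup>+y. ennreal (gagliardo s p \<phi> (x, y)) \<partial>lborel \<partial>lborel) \<le>
     ennreal (K * ((LINT x|lborel. norm (grad \<phi> x) powr p) + (LINT x|lborel. norm (\<phi> x) powr p)))"
proof -
  let ?\<beta> = "real DIM('a) + s * p"
  define K1 where "K1 = (\<integral>\<^sup>+(h::'a). ennreal (norm h powr (- (?\<beta> - p))) * indicator (ball 0 1) h \<partial>lborel)"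
  define K2 where "K2 = (\<integral>\<^sup>+(h::'a). ennreal (norm h powr (- ?\<beta>)) * indicator (- ball 0 1) h \<partial>lborel)"
  have "s * p < p" using s p1 by simp
  then have K1: "K1 < \<infinity>" unfolding K1_def by (intro kernel_near_zero) simp
  have K2: "K2 < \<infinity>" unfolding K2_def using s p1 by (intro kernel_at_infinity) simp
  define k where "k = enn2real K1 + 2 * 2 powr p * enn2real K2"
  have k0: "0 \<le> k" by (simp add: k_def)
  show thesis
  proof (rule that[OF k0])
    fix \<phi> assume \<phi>: "\<phi> \<in> Cc_inf \<Omega>"
    note [measurable] = Cc_D(6,7)[OF \<phi>]
    define A where "A = (LINT x|lborel. norm (grad \<phi> x) powr p)"
    define B where "B = (LINT x|lborel. norm (\<phi> x) powr p)"
    have A0: "0 \<le> A" and B0: "0 \<le> B" by (simp_all add: A_def B_def)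
    note tr = translation_difference_bound[OF Cc_D(1)[OF \<phi>] Cc_D(2)[OF \<phi>] p1]
    obtain L R where L: "0 \<le> L" "0 \<le> R" "\<And>x. norm (grad \<phi> x) \<le> L" "\<And>x. \<bar>\<phi> x\<bar> \<le> L"
      "\<And>x y. \<bar>\<phi> x - \<phi> y\<bar> \<le> L * norm (x - y)" "\<And>x. R < norm x \<Longrightarrow> \<phi> x = 0 \<and> grad \<phi> x = 0"
      by (rule compactly_supported_C1_bounds[OF Cc_D(1)[OF \<phi>, of 1] Cc_D(2)[OF \<phi>]]) (rule that)
    have Bi: "integrable lborel (\<lambda>x. norm (\<phi> x) powr p)"
      by (rule lborel_integrable_bounded_support[where C = "L powr p" and R = R]) (use L p1 in \<open>auto intro!: powr_mono2\<close>)
    have Bt: "integrable lborel (\<lambda>x. norm (\<phi> (x + h)) powr p)" "(LINT x|lborel. norm (\<phi> (x + h)) powr p) = B" for h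
      using integral_lborel_translate[of "\<lambda>x. norm (\<phi> x) powr p" h] Bi unfolding B_def by measurable
    have far: "(LINT x|lborel. \<bar>\<phi> (x + h) - \<phi> x\<bar> powr p) \<le> 2 powr p * (2 * B)" for h
    proof -
      have "(LINT x|lborel. \<bar>\<phi> (x + h) - \<phi> x\<bar> powr p) \<le> (LINT x|lborel. 2 powr p * (norm (\<phi> (x + h)) powr p + norm (\<phi> x) powr p))"
      proof (rule integral_mono[OF tr(2)])
        show "integrable lborel (\<lambda>x. 2 powr p * (norm (\<phi> (x + h)) powr p + norm (\<phi> x) powr p))"
          by (intro integrable_mult_right Bochner_Integration.integrable_add Bt(1) Bi)
        show "\<bar>\<phi> (x + h) - \<phi> x\<bar> powr p \<le> 2 powr p * (norm (\<phi> (x + h)) powr p + norm (\<phi> x) powr p)" for x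
        proof -
          have "\<bar>\<phi> (x + h) - \<phi> x\<bar> powr p \<le> (norm (\<phi> (x + h)) + norm (\<phi> x)) powr p"
            using p1 by (intro powr_mono2) auto
          also have "\<dots> \<le> 2 powr p * (norm (\<phi> (x + h)) powr p + norm (\<phi> x) powr p)"
            using p1 by (intro powr_add_le) auto
          finally show ?thesis .
        qed
      qed
      also have "\<dots> = 2 powr p * (B + B)" using Bt[of h] Bi by (simp add: B_def)
      finally show ?thesis by simp
    qed
    have inner: "(\<integral>\<^sup>+x. ennreal (gagliardo s p \<phi> (x, x + h)) \<partial>lborel) \<le>
       ennreal A * (ennreal (norm h powr (- (?\<beta> - p))) * indicator (ball 0 1) h) +
       ennreal (2 powr p * (2 * B)) * (ennreal (norm h powr (- ?\<beta>)) * indicator (- ball 0 1) h)" for h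
    proof -
      have "(\<integral>\<^sup>+x. ennreal (gagliardo s p \<phi> (x, x + h)) \<partial>lborel) = (\<integral>\<^sup>+x. ennreal (norm h powr (- ?\<beta>)) * ennreal (\<bar>\<phi> (x + h) - \<phi> x\<bar> powr p) \<partial>lborel)"
      proof (rule nn_integral_cong)
        fix x
        have "gagliardo s p \<phi> (x, x + h) = norm h powr (- ?\<beta>) * \<bar>\<phi> (x + h) - \<phi> x\<bar> powr p"
          unfolding gagliardo_def prod.case powr_minus_divide by (simp add: abs_minus_commute)
        then show "ennreal (gagliardo s p \<phi> (x, x + h)) = ennreal (norm h powr (- ?\<beta>)) * ennreal (\<bar>\<phi> (x + h) - \<phi> x\<bar> powr p)"
          by (simp only: ennreal_mult[symmetric] powr_ge_zero)
      qed
      also have "\<dots> = ennreal (norm h powr (- ?\<beta>)) * (\<integral>\<^sup>+x. ennreal (\<bar>\<phi> (x + h) - \<phi> x\<bar> powr p) \<partial>lborel)"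
        by (rule nn_integral_cmult) measurable
      also have "(\<integral>\<^sup>+x. ennreal (\<bar>\<phi> (x + h) - \<phi> x\<bar> powr p) \<partial>lborel) = ennreal (LINT x|lborel. \<bar>\<phi> (x + h) - \<phi> x\<bar> powr p)"
        by (rule nn_integral_eq_integral[OF tr(2)]) simp
      finally have eq: "(\<integral>\<^sup>+x. ennreal (gagliardo s p \<phi> (x, x + h)) \<partial>lborel) = ennreal (norm h powr (- ?\<beta>) * (LINT x|lborel. \<bar>\<phi> (x + h) - \<phi> x\<bar> powr p))"
        by (simp add: ennreal_mult)
      show ?thesis
      proof (cases "norm h < 1")
        case True
        have "norm h powr (- ?\<beta>) * (LINT x|lborel. \<bar>\<phi> (x + h) - \<phi> x\<bar> powr p) \<le> norm h powr (- ?\<beta>) * (norm h powr p * A)"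
          unfolding A_def by (intro mult_left_mono tr(1)) auto
        also have "\<dots> = A * norm h powr (- (?\<beta> - p))"
        proof -
          have "norm h powr (- ?\<beta>) * norm h powr p = norm h powr (- (?\<beta> - p))" by (simp add: powr_add[symmetric] algebra_simps)
          then show ?thesis by (simp add: mult.commute mult.left_commute)
        qed
        finally show ?thesis unfolding eq using True A0 by (simp add: ennreal_mult[symmetric] ennreal_leI)
      next
        case False
        have "norm h powr (- ?\<beta>) * (LINT x|lborel. \<bar>\<phi> (x + h) - \<phi> x\<bar> powr p) \<le> norm h powr (- ?\<beta>) * (2 powr p * (2 * B))"
          by (intro mult_left_mono far) auto
        then show ?thesis unfolding eq using False B0 by (simp add: ennreal_mult[symmetric] ennreal_leI mult.commute)
      qed
    qed
    have "(\<integral>\<^sup>+x. \<integral>\<^sup>+y. ennreal (gagliardo s p \<phi> (x, y)) \<partial>lborel \<partial>lborel) = (\<integral>\<^sup>+x. \<integral>\<^sup>+h. ennreal (gagliardo s p \<phi> (x, x + h)) \<partial>lborel \<partial>lborel)"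
    proof (rule nn_integral_cong)
      fix x
      show "(\<integral>\<^sup>+y. ennreal (gagliardo s p \<phi> (x, y)) \<partial>lborel) = (\<integral>\<^sup>+h. ennreal (gagliardo s p \<phi> (x, x + h)) \<partial>lborel)"
        using nn_integral_lborel_translate[of "\<lambda>y. ennreal (gagliardo s p \<phi> (x, y))" x] by (simp add: add.commute)
    qed
    also have "\<dots> = (\<integral>\<^sup>+h. \<integral>\<^sup>+x. ennreal (gagliardo s p \<phi> (x, x + h)) \<partial>lborel \<partial>lborel)"
      by (rule lborel_pair.Fubini') measurable
    also have "\<dots> \<le> (\<integral>\<^sup>+(h::'a). ennreal A * (ennreal (norm h powr (- (?\<beta> - p))) * indicator (ball 0 1) h) +
       ennreal (2 powr p * (2 * B)) * (ennreal (norm h powr (- ?\<beta>)) * indicator (- ball 0 1) h) \<partial>lborel)"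
      by (rule nn_integral_mono) (rule inner)
    also have "\<dots> = ennreal A * K1 + ennreal (2 powr p * (2 * B)) * K2"
    proof -
      have m: "(\<lambda>h::'a. ennreal (norm h powr (- (?\<beta> - p))) * indicator (ball 0 1) h) \<in> borel_measurable lborel"
        "(\<lambda>h::'a. ennreal (norm h powr (- ?\<beta>)) * indicator (- ball 0 1) h) \<in> borel_measurable lborel"
        by - (rule borel_measurable_times_ennreal[OF _ borel_measurable_indicator]; simp)+
      show ?thesis unfolding K1_def K2_def nn_integral_cmult[OF m(1), symmetric] nn_integral_cmult[OF m(2), symmetric]
        by (rule nn_integral_add) (use m in measurable)
    qed
    also have "\<dots> = ennreal (A * enn2real K1 + 2 powr p * (2 * B) * enn2real K2)"
    proof -
      have e: "K1 = ennreal (enn2real K1)" "K2 = ennreal (enn2real K2)" using K1 K2 by simp_all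
      show ?thesis using A0 B0 by (subst e(1), subst e(2)) (simp add: ennreal_mult)
    qed
    also have "\<dots> \<le> ennreal (k * (A + B))"
    proof (rule ennreal_leI)
      have "0 \<le> B * enn2real K1" "0 \<le> A * (2 * 2 powr p * enn2real K2)" using A0 B0 by simp_all
      then show "A * enn2real K1 + 2 powr p * (2 * B) * enn2real K2 \<le> k * (A + B)" unfolding k_def by (simp add: algebra_simps)
    qed
    finally show "(\<integral>\<^sup>+x. \<integral>\<^sup>+y. ennreal (gagliardo s p \<phi> (x, y)) \<partial>lborel \<partial>lborel) \<le>
       ennreal (k * ((LINT x|lborel. norm (grad \<phi> x) powr p) + (LINT x|lborel. norm (\<phi> x) powr p)))"
      unfolding A_def B_def .
  qed
qed

text \<open>Lower semicontinuity: the approximating test functions have bounded seminorms by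
  \<open>gagliardo_Cc_bound\<close>, and they converge almost everywhere on the whole space because
  all functions vanish outside \<Omega>.\<close>

lemma gagliardo_finite:
  assumes s: "0 < s" "s < 1" and W: "W0 \<Omega> p u G" and u[measurable]: "u \<in> borel_measurable borel" and out: "\<And>x. x \<notin> \<Omega> \<Longrightarrow> u x = 0"
  shows "integrable (lborel \<Otimes>\<^sub>M lborel) (gagliardo s p u)"
proof -
  obtain K where K: "0 \<le> K" "\<And>\<phi>. \<phi> \<in> Cc_inf \<Omega> \<Longrightarrow> (\<integral>\<^sup>+x. \<integral>\<^sup>+y. ennreal (gagliardo s p \<phi> (x, y)) \<partial>lborel \<partial>lborel) \<le>
     ennreal (K * ((LINT x|lborel. norm (grad \<phi> x) powr p) + (LINT x|lborel. norm (\<phi> x) powr p)))"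
    by (rule gagliardo_Cc_bound[OF s]) (rule that)
  obtain \<phi> where \<phi>: "\<And>k::nat. \<phi> k \<in> Cc_inf \<Omega>" 
    "(\<lambda>k. LINT x|lebesgue_on \<Omega>. norm (u x - \<phi> k x) powr p) \<longlonglongrightarrow> 0"
    "(\<lambda>k. LINT x|lebesgue_on \<Omega>. norm (G x - grad (\<phi> k) x) powr p) \<longlonglongrightarrow> 0" 
    "AE x in lebesgue_on \<Omega>. (\<lambda>k. \<phi> k x) \<longlonglongrightarrow> u x" by (rule W0_AE_subseq[OF W]) (rule that)
  note [measurable] = Cc_D(6,7)[OF \<phi>(1)]
  define I where "I k = (LINT x|lebesgue_on \<Omega>. norm (grad (\<phi> k) x) powr p) + (LINT x|lebesgue_on \<Omega>. norm (\<phi> k x) powr p)" for k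
  have Ieq: "(LINT x|lborel. norm (grad (\<phi> k) x) powr p) + (LINT x|lborel. norm (\<phi> k x) powr p) = I k" for k
    unfolding I_def using Cc_D(4,5)[OF \<phi>(1)[of k]] by (subst (1 2) integral_Cc_eq_lborel) auto
  define C where "C = 2 powr p * ((1 + (LINT x|lebesgue_on \<Omega>. norm (G x) powr p)) + (1 + (LINT x|lebesgue_on \<Omega>. norm (u x) powr p)))"
  have "eventually (\<lambda>k. (LINT x|lebesgue_on \<Omega>. norm (u x - \<phi> k x) powr p) < 1 \<and> (LINT x|lebesgue_on \<Omega>. norm (G x - grad (\<phi> k) x) powr p) < 1) sequentially"
    using order_tendstoD(2)[OF \<phi>(2), of 1] order_tendstoD(2)[OF \<phi>(3), of 1] by (simp add: eventually_conj)
  then have Ib: "eventually (\<lambda>k. I k \<le> C) sequentially"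
  proof eventually_elim
    case (elim k)
    have z: "(\<lambda>x::'a. 0::real) \<in> Lq \<Omega> p" "(\<lambda>x::'a. 0::'a) \<in> Lq \<Omega> p" by (simp_all add: Lq_def)
    have "(LINT x|lebesgue_on \<Omega>. norm (0 - grad (\<phi> k) x) powr p) \<le> 2 powr p * ((LINT x|lebesgue_on \<Omega>. norm (0 - G x) powr p) + (LINT x|lebesgue_on \<Omega>. norm (G x - grad (\<phi> k) x) powr p))"
      by (rule Lp_dist_le[OF z(2) W0_Lq(2)[OF W] Cc_Lq(2)[OF \<phi>(1)]])
    also have "\<dots> \<le> 2 powr p * ((LINT x|lebesgue_on \<Omega>. norm (0 - G x) powr p) + 1)"
      using elim by (intro mult_left_mono add_left_mono) auto
    finally have 1: "(LINT x|lebesgue_on \<Omega>. norm (grad (\<phi> k) x) powr p) \<le> 2 powr p * (1 + (LINT x|lebesgue_on \<Omega>. norm (G x) powr p))" by (simp add: add.commute)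
    have "(LINT x|lebesgue_on \<Omega>. norm (0 - \<phi> k x) powr p) \<le> 2 powr p * ((LINT x|lebesgue_on \<Omega>. norm (0 - u x) powr p) + (LINT x|lebesgue_on \<Omega>. norm (u x - \<phi> k x) powr p))"
      by (rule Lp_dist_le[OF z(1) W0_Lq(1)[OF W] Cc_Lq(1)[OF \<phi>(1)]])
    also have "\<dots> \<le> 2 powr p * ((LINT x|lebesgue_on \<Omega>. norm (0 - u x) powr p) + 1)"
      using elim by (intro mult_left_mono add_left_mono) auto
    finally have 2: "(LINT x|lebesgue_on \<Omega>. norm (\<phi> k x) powr p) \<le> 2 powr p * (1 + (LINT x|lebesgue_on \<Omega>. norm (u x) powr p))" by (simp add: add.commute)
    show ?case unfolding I_def C_def distrib_left using 1 2 by (simp add: distrib_left)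
  qed
  have "AE x in lebesgue. x \<in> \<Omega> \<longrightarrow> (\<lambda>k. \<phi> k x) \<longlonglongrightarrow> u x" using \<phi>(4) by (simp add: AE_restrict_space_iff)
  then have "AE x in lebesgue. (\<lambda>k. \<phi> k x) \<longlonglongrightarrow> u x"
  proof eventually_elim
    case (elim x)
    show ?case
    proof (cases "x \<in> \<Omega>")
      case False
      then show ?thesis using Cc_D(4)[OF \<phi>(1)] out by simp
    qed (use elim in simp)
  qed
  then have ae: "AE x in lborel. (\<lambda>k. \<phi> k x) \<longlonglongrightarrow> u x" by (simp add: AE_completion_iff)
  have pt: "(\<lambda>k. ennreal (gagliardo s p (\<phi> k) (x, y))) \<longlonglongrightarrow> ennreal (gagliardo s p u (x, y))" 
    if "(\<lambda>k. \<phi> k x) \<longlonglongrightarrow> u x" "(\<lambda>k. \<phi> k y) \<longlonglongrightarrow> u y" for x y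
    unfolding gagliardo_def prod.case divide_inverse
    by (intro tendsto_ennrealI tendsto_mult tendsto_powr2 tendsto_rabs tendsto_diff that tendsto_const) (use p1 in auto)
  have "(\<integral>\<^sup>+x. \<integral>\<^sup>+y. ennreal (gagliardo s p u (x, y)) \<partial>lborel \<partial>lborel) \<le> (\<integral>\<^sup>+x. liminf (\<lambda>k. \<integral>\<^sup>+y. ennreal (gagliardo s p (\<phi> k) (x, y)) \<partial>lborel) \<partial>lborel)"
  \<comment> \<open>Fatou's lemma is applied to the inner and to the outer integral in turn, so
    convergence for almost every x and almost every y suffices and no null set of the product has to
    be handled.\<close>
  proof (rule nn_integral_mono_AE)
    show "AE x in lborel. (\<integral>\<^sup>+y. ennreal (gagliardo s p u (x, y)) \<partial>lborel) \<le> liminf (\<lambda>k. \<integral>\<^sup>+y. ennreal (gagliardo s p (\<phi> k) (x, y)) \<partial>lborel)"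
      using ae
    proof eventually_elim
      case (elim x)
      have "(\<integral>\<^sup>+y. ennreal (gagliardo s p u (x, y)) \<partial>lborel) \<le> (\<integral>\<^sup>+y. liminf (\<lambda>k. ennreal (gagliardo s p (\<phi> k) (x, y))) \<partial>lborel)"
      proof (rule nn_integral_mono_AE)
        show "AE y in lborel. ennreal (gagliardo s p u (x, y)) \<le> liminf (\<lambda>k. ennreal (gagliardo s p (\<phi> k) (x, y)))"
          using ae
        proof eventually_elim
          case (elim y)
          show ?case using lim_imp_Liminf[OF _ pt[OF \<open>(\<lambda>k. \<phi> k x) \<longlonglongrightarrow> u x\<close> elim]] by simp
        qed
      qed
      also have "\<dots> \<le> liminf (\<lambda>k. \<integral>\<^sup>+y. ennreal (gagliardo s p (\<phi> k) (x, y)) \<partial>lborel)"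
        by (rule nn_integral_liminf) measurable
      finally show ?case .
    qed
  qed
  also have "\<dots> \<le> liminf (\<lambda>k. \<integral>\<^sup>+x. \<integral>\<^sup>+y. ennreal (gagliardo s p (\<phi> k) (x, y)) \<partial>lborel \<partial>lborel)"
    by (rule nn_integral_liminf) measurable
  also have "\<dots> \<le> liminf (\<lambda>k::nat. ennreal (K * C))"
  proof (rule Liminf_mono)
    show "\<forall>\<^sub>F k in sequentially. (\<integral>\<^sup>+x. \<integral>\<^sup>+y. ennreal (gagliardo s p (\<phi> k) (x, y)) \<partial>lborel \<partial>lborel) \<le> ennreal (K * C)"
      using Ib
    proof eventually_elim
      case (elim k)
      have "ennreal (K * I k) \<le> ennreal (K * C)" using elim K(1) by (intro ennreal_leI mult_left_mono)
      then show ?case using K(2)[OF \<phi>(1)[of k]] unfolding Ieq by (rule order_trans[rotated])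
    qed
  qed
  also have "\<dots> < \<infinity>" by (simp add: Liminf_const)
  finally have fin: "(\<integral>\<^sup>+x. \<integral>\<^sup>+y. ennreal (gagliardo s p u (x, y)) \<partial>lborel \<partial>lborel) < \<infinity>" .
  have m: "gagliardo s p u \<in> borel_measurable (lborel \<Otimes>\<^sub>M lborel)"
    using gagliardo_measurable[OF u, of s p] by (simp cong: measurable_cong_sets)
  show ?thesis
  proof (rule integrableI_nonneg[OF m])
    show "AE z in lborel \<Otimes>\<^sub>M lborel. 0 \<le> gagliardo s p u z" by (auto simp: gagliardo_def)
    have "(\<integral>\<^sup>+z. ennreal (gagliardo s p u z) \<partial>(lborel \<Otimes>\<^sub>M lborel)) = (\<integral>\<^sup>+x. \<integral>\<^sup>+y. ennreal (gagliardo s p u (x, y)) \<partial>lborel \<partial>lborel)"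
      using m by (intro lborel.nn_integral_fst[symmetric]) measurable
    then show "(\<integral>\<^sup>+z. ennreal (gagliardo s p u z) \<partial>(lborel \<Otimes>\<^sub>M lborel)) < \<infinity>" using fin by simp
  qed
qed

end

section \<open>Subtracting the two inequalities\<close>

text \<open>\<open>powr_cross_le\<close> for the exponent 1 with one summand dropped. It makes each
  flux-times-gradient integrand integrable; the constant is of no concern.\<close>

lemma powr_young_le:
  fixes A B p :: real
  assumes "1 \<le> p" "0 \<le> A" "0 \<le> B"
  shows "A powr (p - 1) * B \<le> A powr p + B powr p"
proof -
  have "B powr 1 * A powr (p - 1) + A powr 1 * B powr (p - 1) \<le> A powr p + B powr p"
    by (rule powr_cross_le) (use assms in auto)
  moreover have "0 \<le> A powr 1 * B powr (p - 1)" by simp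
  ultimately have "B powr 1 * A powr (p - 1) \<le> A powr p + B powr p" by linarith
  then show ?thesis using assms by (simp add: mult.commute)
qed

lemma Lq2_mult_integrable:
  fixes f g :: "'a::euclidean_space \<Rightarrow> real"
  assumes "f \<in> Lq \<Omega> 2" "g \<in> Lq \<Omega> 2"
  shows "integrable (lebesgue_on \<Omega>) (\<lambda>x. f x * g x)"
proof (rule Bochner_Integration.integrable_bound)
  show "integrable (lebesgue_on \<Omega>) (\<lambda>x. norm (f x) powr 2 + norm (g x) powr 2)" using assms by (auto simp: Lq_def)
  show "(\<lambda>x. f x * g x) \<in> borel_measurable (lebesgue_on \<Omega>)" using assms by (auto simp: Lq_def)
  have "\<bar>a * b\<bar> \<le> \<bar>a\<bar> powr 2 + \<bar>b\<bar> powr 2" for a b :: real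
    using powr_young_le[of 2 "\<bar>a\<bar>" "\<bar>b\<bar>"] by (simp add: abs_mult)
  then have "norm (f x * g x) \<le> norm (norm (f x) powr 2 + norm (g x) powr 2)" for x
    by (metis abs_ge_self order_trans real_norm_def)
  then show "AE x in lebesgue_on \<Omega>. norm (f x * g x) \<le> norm (norm (f x) powr 2 + norm (g x) powr 2)" by simp
qed

definition nonlocal_integrand ::
  "real \<Rightarrow> real \<Rightarrow> ('a::euclidean_space \<Rightarrow> real) \<Rightarrow> ('a \<Rightarrow> real) \<Rightarrow> 'a \<times> 'a \<Rightarrow> real" where
  "nonlocal_integrand s p w \<phi> = (\<lambda>(x, y).
     signed_pow (w x - w y) (p - 1) * (\<phi> x - \<phi> y) / norm (x - y) powr (real DIM('a) + s * p))"

text \<open>The form of \<open>weak_lhs\<close> with explicit gradients and with the nonlocal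
  integral over a product of Borel measures, so that Borel representatives, arbitrary gradients from
  \<open>W0\<close> and Fubini can be used.\<close>

definition energy :: "'a::euclidean_space set \<Rightarrow> real \<Rightarrow> real \<Rightarrow> real \<Rightarrow> real \<Rightarrow> ('a \<Rightarrow> real) \<Rightarrow> ('a \<Rightarrow> 'a) \<Rightarrow>
    ('a \<Rightarrow> real) \<Rightarrow> ('a \<Rightarrow> 'a) \<Rightarrow> real" where
  "energy \<Omega> p s m lam w G \<phi> H =
     (LINT x|lebesgue_on \<Omega>. w x powr (2 * m + 1) * \<phi> x)
     + lam * (LINT x|lebesgue_on \<Omega>. (norm (G x) powr (p - 2) *\<^sub>R G x) \<bullet> H x)
     + lam * (LINT z|(lborel \<Otimes>\<^sub>M lborel). nonlocal_integrand s p w \<phi> z)"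

definition reaction :: "'a::euclidean_space set \<Rightarrow> real \<Rightarrow> real \<Rightarrow> real \<Rightarrow> real \<Rightarrow> ('a \<Rightarrow> real) \<Rightarrow> ('a \<Rightarrow> real) \<Rightarrow> 'a \<Rightarrow> real" where
  "reaction \<Omega> m lam \<gamma> \<delta> g0 w x =
     g0 x * rpow (w x) m + lam * m * infdist x (frontier \<Omega>) powr (- \<gamma>) * w x powr \<delta>"

lemma nonlocal_integrand_measurable [measurable]:
  assumes [measurable]: "w \<in> borel_measurable borel" "\<phi> \<in> borel_measurable borel"
  shows "nonlocal_integrand s p w \<phi> \<in> borel_measurable (borel \<Otimes>\<^sub>M borel)"
  unfolding nonlocal_integrand_def signed_pow_def case_prod_beta by measurable

lemma rpow_measurable:
  assumes [measurable]: "f \<in> borel_measurable M"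
  shows "(\<lambda>x. rpow (f x) m) \<in> borel_measurable M"
  unfolding rpow_def by (cases "m = 0") simp_all

context bounded_open begin

lemma Lq_powr:
  fixes w :: "'a \<Rightarrow> real"
  assumes w: "w \<in> Lq \<Omega> t" and e: "0 \<le> e" "0 < r" "e * r \<le> t"
  shows "(\<lambda>x. \<bar>w x\<bar> powr e) \<in> Lq \<Omega> r"
proof -
  have [measurable]: "w \<in> borel_measurable (lebesgue_on \<Omega>)" using w by (simp add: Lq_def)
  have "w \<in> Lq \<Omega> (e * r)" by (rule Lq_exponent_mono[OF w fin_meas]) (use e in auto)
  then have "integrable (lebesgue_on \<Omega>) (\<lambda>x. \<bar>w x\<bar> powr (e * r))" by (simp add: Lq_def)
  moreover have "(\<lambda>x. \<bar>w x\<bar> powr e) \<in> borel_measurable (lebesgue_on \<Omega>)" by measurable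
  ultimately show ?thesis by (simp add: Lq_def powr_powr)
qed

lemma local_integrand_integrable:
  fixes G H :: "'a \<Rightarrow> 'a"
  assumes G: "G \<in> Lq \<Omega> p" and H: "H \<in> Lq \<Omega> p"
  shows "integrable (lebesgue_on \<Omega>) (\<lambda>x. norm (G x) powr (p - 1) * norm (H x))"
    and "integrable (lebesgue_on \<Omega>) (\<lambda>x. (norm (G x) powr (p - 2) *\<^sub>R G x) \<bullet> H x)"
proof -
  have [measurable]: "G \<in> borel_measurable (lebesgue_on \<Omega>)" "H \<in> borel_measurable (lebesgue_on \<Omega>)"
    using G H by (auto simp: Lq_def)
  have i: "integrable (lebesgue_on \<Omega>) (\<lambda>x. norm (G x) powr p + norm (H x) powr p)" using G H by (simp add: Lq_def)
  have b: "norm (G x) powr (p - 1) * norm (H x) \<le> norm (G x) powr p + norm (H x) powr p" for x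
    by (rule powr_young_le) (use p1 in auto)
  show "integrable (lebesgue_on \<Omega>) (\<lambda>x. norm (G x) powr (p - 1) * norm (H x))"
    by (rule Bochner_Integration.integrable_bound[OF i]) (use b in \<open>auto intro!: AE_I2\<close>)
  have b2: "norm ((norm (G x) powr (p - 2) *\<^sub>R G x) \<bullet> H x) \<le> norm (norm (G x) powr p + norm (H x) powr p)" for x
    using order_trans[OF inner_powr_norm_le(2)[of "G x" p "H x"] b[of x]] unfolding real_norm_def by linarith
  show "integrable (lebesgue_on \<Omega>) (\<lambda>x. (norm (G x) powr (p - 2) *\<^sub>R G x) \<bullet> H x)"
    by (rule Bochner_Integration.integrable_bound[OF i]) (use b2 in \<open>auto intro!: AE_I2\<close>)
qed

lemma nonlocal_bound:
  fixes w \<phi> :: "'a \<Rightarrow> real"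
  shows "\<bar>w x - w y\<bar> powr (p - 1) * \<bar>\<phi> x - \<phi> y\<bar> / norm (x - y) powr (real DIM('a) + s * p) \<le>
    gagliardo s p w (x, y) + gagliardo s p \<phi> (x, y)"
  unfolding gagliardo_def prod.case add_divide_distrib[symmetric]
  by (intro divide_right_mono powr_young_le) (use p1 in auto)

lemma abs_nonlocal_integrand:
  "\<bar>nonlocal_integrand s p w \<phi> (x, y)\<bar> = \<bar>w x - w y\<bar> powr (p - 1) * \<bar>\<phi> x - \<phi> y\<bar> / norm (x - y) powr (real DIM('a) + s * p)"
  for w \<phi> :: "'a \<Rightarrow> real"
  unfolding nonlocal_integrand_def prod.case by (simp add: abs_mult abs_signed_pow)

lemma nonlocal_integrable:
  fixes w \<phi> :: "'a \<Rightarrow> real"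
  assumes [measurable]: "w \<in> borel_measurable borel" "\<phi> \<in> borel_measurable borel"
    and g: "integrable (lborel \<Otimes>\<^sub>M lborel) (gagliardo s p w)" "integrable (lborel \<Otimes>\<^sub>M lborel) (gagliardo s p \<phi>)"
  shows "integrable (lborel \<Otimes>\<^sub>M lborel) (nonlocal_integrand s p w \<phi>)"
proof (rule Bochner_Integration.integrable_bound)
  show "integrable (lborel \<Otimes>\<^sub>M lborel) (\<lambda>z. gagliardo s p w z + gagliardo s p \<phi> z)" using g by simp
  show "nonlocal_integrand s p w \<phi> \<in> borel_measurable (lborel \<Otimes>\<^sub>M lborel)"
    using nonlocal_integrand_measurable[of w \<phi> s p] by (simp cong: measurable_cong_sets)
  show "AE z in lborel \<Otimes>\<^sub>M lborel. norm (nonlocal_integrand s p w \<phi> z) \<le> norm (gagliardo s p w z + gagliardo s p \<phi> z)"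
  proof (rule AE_I2)
    fix z :: "'a \<times> 'a"
    obtain x y where z: "z = (x, y)" by (cases z)
    show "norm (nonlocal_integrand s p w \<phi> z) \<le> norm (gagliardo s p w z + gagliardo s p \<phi> z)"
      using nonlocal_bound[of w x y \<phi> s] abs_nonlocal_integrand[of s w \<phi> x y] unfolding z real_norm_def by linarith
  qed
qed

end

locale comparison = bounded_open \<Omega> p for \<Omega> :: "'a::euclidean_space set" and p :: real +
  fixes s m lam \<delta> \<gamma> :: real and g0 u v :: "'a \<Rightarrow> real" and Gu Gv :: "'a \<Rightarrow> 'a"
  assumes s: "0 < s" "s < 1" and m: "0 \<le> m" "m < p - 1" and lam: "0 < lam"
    and exps: "0 < m \<Longrightarrow> 0 < \<delta> \<and> \<delta> < m \<and> \<gamma> < 1 / 2"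
    and dist: "0 < m \<Longrightarrow> integrable (lebesgue_on \<Omega>) (\<lambda>x. infdist x (frontier \<Omega>) powr (- (2 * \<gamma>)))"
    and g0: "g0 \<in> Lq \<Omega> 2" "AE x in lebesgue_on \<Omega>. 0 \<le> g0 x"
    and Wu: "W0 \<Omega> p u Gu" and Wv: "W0 \<Omega> p v Gv"
    and ub [measurable]: "u \<in> borel_measurable borel" and vb [measurable]: "v \<in> borel_measurable borel"
    and u0: "\<And>x. 0 \<le> u x" and v0: "\<And>x. 0 \<le> v x"
    and uout: "\<And>x. x \<notin> \<Omega> \<Longrightarrow> u x = 0" and vout: "\<And>x. x \<notin> \<Omega> \<Longrightarrow> v x = 0"
    and uL: "u \<in> Lq \<Omega> (2 * (m + 1))" and vL: "v \<in> Lq \<Omega> (2 * (m + 1))"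
    and vnontriv: "\<not> (AE x in lborel. v x = 0)"
    and sub: "\<And>\<phi> H C. W0 \<Omega> p \<phi> H \<Longrightarrow> \<phi> \<in> borel_measurable borel \<Longrightarrow> (\<And>x. 0 \<le> \<phi> x \<and> \<phi> x \<le> C) \<Longrightarrow> (\<And>x. x \<notin> \<Omega> \<Longrightarrow> \<phi> x = 0)
      \<Longrightarrow> energy \<Omega> p s m lam u Gu \<phi> H \<le> (LINT x|lebesgue_on \<Omega>. reaction \<Omega> m lam \<gamma> \<delta> g0 u x * \<phi> x)"
    and super: "\<And>\<phi> H C. W0 \<Omega> p \<phi> H \<Longrightarrow> \<phi> \<in> borel_measurable borel \<Longrightarrow> (\<And>x. 0 \<le> \<phi> x \<and> \<phi> x \<le> C) \<Longrightarrow> (\<And>x. x \<notin> \<Omega> \<Longrightarrow> \<phi> x = 0)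
      \<Longrightarrow> (LINT x|lebesgue_on \<Omega>. reaction \<Omega> m lam \<gamma> \<delta> g0 v x * \<phi> x) \<le> energy \<Omega> p s m lam v Gv \<phi> H"
begin

section \<open>The two sequences of test functions and their integrability\<close>

abbreviation "q \<equiv> m + 1"
abbreviation "dst x \<equiv> infdist x (frontier \<Omega>)"
abbreviation "kk n \<equiv> real (Suc n)"
abbreviation "ee n \<equiv> 1 / real (Suc n)"

text \<open>Truncation height and shift are tied to the same n, so that a single limit is
  taken.\<close>

definition "aa n x = min (u x) (kk n) + ee n"
definition "bb n x = v x + ee n"
definition "Phi n x = sub_test q (aa n x) (bb n x)"
definition "Psi n x = sup_test q (aa n x) (bb n x)"
definition "GPhi n x = (if bb n x < aa n x then (1 + (q - 1) * (bb n x / aa n x) powr q) *\<^sub>R ((if u x \<le> kk n then 1 else 0) *\<^sub>R Gu x)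
  - (q * (bb n x / aa n x) powr (q - 1)) *\<^sub>R Gv x else 0)"
definition "GPsi n x = (if bb n x < aa n x then (q * (aa n x / bb n x) powr (q - 1)) *\<^sub>R ((if u x \<le> kk n then 1 else 0) *\<^sub>R Gu x)
  - (1 + (q - 1) * (aa n x / bb n x) powr q) *\<^sub>R Gv x else 0)"

lemma q: "1 \<le> q" "q < p" using m by auto

lemma ab_pos: "0 < aa n x" "0 < bb n x"
  using u0[of x] v0[of x] by (auto simp: aa_def bb_def intro: add_nonneg_pos)

lemma aa_bounds: "aa n x \<le> kk n + ee n" "ee n \<le> aa n x" "ee n \<le> bb n x" "aa n x \<le> u x + ee n" "v x \<le> bb n x"
  using u0[of x] v0[of x] by (auto simp: aa_def bb_def)

lemma W_tests: "W0 \<Omega> p (Phi n) (GPhi n)" "W0 \<Omega> p (Psi n) (GPsi n)"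
  using W0_tests[OF Wu Wv, of "kk n" "ee n" q] u0 v0 q
  by (simp_all only: Phi_def[abs_def] Psi_def[abs_def] GPhi_def[abs_def] GPsi_def[abs_def] aa_def bb_def) simp_all

lemma tests_borel [measurable]: "Phi n \<in> borel_measurable borel" "Psi n \<in> borel_measurable borel"
  "aa n \<in> borel_measurable borel" "bb n \<in> borel_measurable borel"
proof -
  show [measurable]: "aa n \<in> borel_measurable borel" "bb n \<in> borel_measurable borel"
    unfolding aa_def[abs_def] bb_def[abs_def] by measurable
  show "Phi n \<in> borel_measurable borel" "Psi n \<in> borel_measurable borel"
    unfolding Phi_def[abs_def] Psi_def[abs_def] sub_test_def sup_test_def by measurable
qed

lemma tests_bounds:
  "0 \<le> Phi n x" "0 \<le> Psi n x" "Phi n x \<le> kk n + ee n" "Psi n x \<le> (kk n + ee n) powr q * ee n powr (1 - q)"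
proof -
  show "0 \<le> Phi n x" "0 \<le> Psi n x" unfolding Phi_def Psi_def using test_nonneg[OF ab_pos[of n x], of q] q by auto
  show "Phi n x \<le> kk n + ee n"
    unfolding Phi_def by (rule order_trans[OF sub_test_le(2)[OF q(1) ab_pos] aa_bounds(1)])
  have "sup_test q (aa n x) (bb n x) \<le> aa n x powr q * bb n x powr (1 - q)"
    using ab_pos[of n x] by (simp add: sup_test_def)
  also have "\<dots> \<le> (kk n + ee n) powr q * ee n powr (1 - q)"
    using q aa_bounds[where n = n and x = x] ab_pos[of n x] by (intro mult_mono powr_mono2 powr_mono2') auto
  finally show "Psi n x \<le> (kk n + ee n) powr q * ee n powr (1 - q)" unfolding Psi_def .
qed

lemma tests_out: "x \<notin> \<Omega> \<Longrightarrow> Phi n x = 0" "x \<notin> \<Omega> \<Longrightarrow> Psi n x = 0"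
  by (simp_all add: Phi_def Psi_def aa_def bb_def uout vout sub_test_def sup_test_def)

lemma tests_eq: 
  "Phi n x = max 0 (aa n x powr q - bb n x powr q) * aa n x powr (- m)"
  "Psi n x = max 0 (aa n x powr q - bb n x powr q) * bb n x powr (- m)"
  unfolding Phi_def Psi_def using test_eq[OF ab_pos[of n x], of q] q by simp_all

lemma meas_Om [measurable]: 
  "u \<in> borel_measurable (lebesgue_on \<Omega>)" "v \<in> borel_measurable (lebesgue_on \<Omega>)"
  "Phi n \<in> borel_measurable (lebesgue_on \<Omega>)" "Psi n \<in> borel_measurable (lebesgue_on \<Omega>)"
  "aa n \<in> borel_measurable (lebesgue_on \<Omega>)" "bb n \<in> borel_measurable (lebesgue_on \<Omega>)"
  "g0 \<in> borel_measurable (lebesgue_on \<Omega>)" "(\<lambda>x. dst x) \<in> borel_measurable (lebesgue_on \<Omega>)"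
  "Gu \<in> borel_measurable (lebesgue_on \<Omega>)" "Gv \<in> borel_measurable (lebesgue_on \<Omega>)"
proof -
  show "u \<in> borel_measurable (lebesgue_on \<Omega>)" "v \<in> borel_measurable (lebesgue_on \<Omega>)"
    "Gu \<in> borel_measurable (lebesgue_on \<Omega>)" "Gv \<in> borel_measurable (lebesgue_on \<Omega>)"
    by (rule W0_meas[OF Wu] W0_meas[OF Wv])+
  show "Phi n \<in> borel_measurable (lebesgue_on \<Omega>)" "Psi n \<in> borel_measurable (lebesgue_on \<Omega>)"
    "aa n \<in> borel_measurable (lebesgue_on \<Omega>)" "bb n \<in> borel_measurable (lebesgue_on \<Omega>)"
    by (rule borel_imp_meas[OF tests_borel(1)] borel_imp_meas[OF tests_borel(2)] 
        borel_imp_meas[OF tests_borel(3)] borel_imp_meas[OF tests_borel(4)])+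
  show "g0 \<in> borel_measurable (lebesgue_on \<Omega>)" using g0(1) by (simp add: Lq_def)
  show "(\<lambda>x. dst x) \<in> borel_measurable (lebesgue_on \<Omega>)"
    by (intro borel_imp_meas borel_measurable_continuous_onI continuous_intros)
qed

text \<open>Reaction terms are integrable as products of two L^2 functions. The powers q, m and
  \<delta> of the solutions are square integrable because their doubles do not exceed 2(m + 1); g0
  and the distance weight are the other factors.\<close>

lemma powr_integrable:
  assumes "w \<in> Lq \<Omega> (2 * (m + 1))" "\<And>x. 0 \<le> w x"
  shows "integrable (lebesgue_on \<Omega>) (\<lambda>x. w x powr (2 * m + 1))" "(\<lambda>x. w x powr q) \<in> Lq \<Omega> 2"
    "(\<lambda>x. rpow (w x) m) \<in> Lq \<Omega> 2" "0 < m \<Longrightarrow> (\<lambda>x. w x powr \<delta>) \<in> Lq \<Omega> 2"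
proof -
  have w: "\<bar>w x\<bar> = w x" for x using assms(2) by simp
  have one: "(\<lambda>x. 1::real) \<in> Lq \<Omega> 2" by (rule Lq_bounded[where C = 1]) (use fin_meas in auto)
  show "integrable (lebesgue_on \<Omega>) (\<lambda>x. w x powr (2 * m + 1))"
    using Lq_powr[OF assms(1), of "2 * m + 1" 1] m unfolding w by (simp add: Lq_def)
  show "(\<lambda>x. w x powr q) \<in> Lq \<Omega> 2" using Lq_powr[OF assms(1), of q 2] m unfolding w by simp
  show "(\<lambda>x. rpow (w x) m) \<in> Lq \<Omega> 2"
    using Lq_powr[OF assms(1), of m 2] m one unfolding w rpow_def by (cases "m = 0") simp_all
  show "(\<lambda>x. w x powr \<delta>) \<in> Lq \<Omega> 2" if "0 < m" using Lq_powr[OF assms(1), of \<delta> 2] exps[OF that] unfolding w by simp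
qed

lemma dist_Lq2: "0 < m \<Longrightarrow> (\<lambda>x. dst x powr (- \<gamma>)) \<in> Lq \<Omega> 2"
proof -
  assume "0 < m"
  have "norm (dst x powr (- \<gamma>)) powr 2 = dst x powr (- (2 * \<gamma>))" for x
    by (simp only: real_norm_def abs_of_nonneg[OF powr_ge_zero] powr_powr) (simp only: mult_minus_left mult.commute)
  moreover have "(\<lambda>x. dst x powr (- \<gamma>)) \<in> borel_measurable (lebesgue_on \<Omega>)" by measurable
  ultimately show "(\<lambda>x. dst x powr (- \<gamma>)) \<in> Lq \<Omega> 2" using dist[OF \<open>0 < m\<close>] by (simp only: Lq_def mem_Collect_eq)
qed

lemma reaction_integrable:
  assumes "w \<in> Lq \<Omega> (2 * (m + 1))" "\<And>x. 0 \<le> w x"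
  shows "integrable (lebesgue_on \<Omega>) (reaction \<Omega> m lam \<gamma> \<delta> g0 w)"
proof -
  have 1: "integrable (lebesgue_on \<Omega>) (\<lambda>x. g0 x * rpow (w x) m)"
    by (rule Lq2_mult_integrable[OF g0(1) powr_integrable(3)[OF assms]])
  have 2: "integrable (lebesgue_on \<Omega>) (\<lambda>x. lam * m * dst x powr (- \<gamma>) * w x powr \<delta>)"
  proof (cases "m = 0")
    case False
    then have "0 < m" using m by simp
    from integrable_mult_right[OF Lq2_mult_integrable[OF dist_Lq2[OF this] powr_integrable(4)[OF assms this]], of "lam * m"]
    show ?thesis by (simp only: mult.assoc)
  qed simp
  show ?thesis unfolding reaction_def[abs_def] by (rule Bochner_Integration.integrable_add[OF 1 2])
qed

lemma gagliardos: 
  "integrable (lborel \<Otimes>\<^sub>M lborel) (gagliardo s p u)" "integrable (lborel \<Otimes>\<^sub>M lborel) (gagliardo s p v)"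
  "integrable (lborel \<Otimes>\<^sub>M lborel) (gagliardo s p (Phi n))" "integrable (lborel \<Otimes>\<^sub>M lborel) (gagliardo s p (Psi n))"
  by (rule gagliardo_finite[OF s Wu ub uout], assumption, rule gagliardo_finite[OF s Wv vb vout], assumption)
    (rule gagliardo_finite[OF s W_tests(1) tests_borel(1) tests_out(1)], assumption,
     rule gagliardo_finite[OF s W_tests(2) tests_borel(2) tests_out(2)], assumption)

lemma nonlocals:
  "integrable (lborel \<Otimes>\<^sub>M lborel) (nonlocal_integrand s p u (Phi n))" 
  "integrable (lborel \<Otimes>\<^sub>M lborel) (nonlocal_integrand s p v (Psi n))"
  by (rule nonlocal_integrable[OF ub tests_borel(1) gagliardos(1,3)], rule nonlocal_integrable[OF vb tests_borel(2) gagliardos(2,4)])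

lemma locals:
  "integrable (lebesgue_on \<Omega>) (\<lambda>x. (norm (Gu x) powr (p - 2) *\<^sub>R Gu x) \<bullet> GPhi n x)"
  "integrable (lebesgue_on \<Omega>) (\<lambda>x. (norm (Gv x) powr (p - 2) *\<^sub>R Gv x) \<bullet> GPsi n x)"
  by (rule local_integrand_integrable(2)[OF W0_Lq(2)[OF Wu] W0_Lq(2)[OF W_tests(1)]],
      rule local_integrand_integrable(2)[OF W0_Lq(2)[OF Wv] W0_Lq(2)[OF W_tests(2)]])

lemma mult_tests_integrable:
  assumes "integrable (lebesgue_on \<Omega>) f"
  shows "integrable (lebesgue_on \<Omega>) (\<lambda>x. f x * Phi n x)" "integrable (lebesgue_on \<Omega>) (\<lambda>x. f x * Psi n x)"
proof -
  have "\<bar>Phi n x\<bar> \<le> kk n + ee n" "\<bar>Psi n x\<bar> \<le> (kk n + ee n) powr q * ee n powr (1 - q)" for x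
    using tests_bounds[where n = n and x = x] by simp_all
  then show "integrable (lebesgue_on \<Omega>) (\<lambda>x. f x * Phi n x)" "integrable (lebesgue_on \<Omega>) (\<lambda>x. f x * Psi n x)"
    by (auto intro!: integrable_mult_bounded[OF assms])
qed

text \<open>Subtracting the two weak inequalities leaves four differences: absorption, local
  diffusion, nonlocal diffusion and reaction.\<close>

definition "T1 n x = u x powr (2 * m + 1) * Phi n x - v x powr (2 * m + 1) * Psi n x"
definition "T2 n x = (norm (Gu x) powr (p - 2) *\<^sub>R Gu x) \<bullet> GPhi n x - (norm (Gv x) powr (p - 2) *\<^sub>R Gv x) \<bullet> GPsi n x"
definition "T3 n z = nonlocal_integrand s p u (Phi n) z - nonlocal_integrand s p v (Psi n) z"
definition "RR n x = reaction \<Omega> m lam \<gamma> \<delta> g0 u x * Phi n x - reaction \<Omega> m lam \<gamma> \<delta> g0 v x * Psi n x"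

lemma T_integrable:
  "integrable (lebesgue_on \<Omega>) (T1 n)" "integrable (lebesgue_on \<Omega>) (T2 n)" "integrable (lborel \<Otimes>\<^sub>M lborel) (T3 n)" 
  "integrable (lebesgue_on \<Omega>) (RR n)"
  unfolding T1_def[abs_def] T2_def[abs_def] T3_def[abs_def] RR_def[abs_def]
  by (intro Bochner_Integration.integrable_diff mult_tests_integrable locals nonlocals reaction_integrable powr_integrable uL vL u0 v0)+

lemma difference_inequality:
  "(LINT x|lebesgue_on \<Omega>. T1 n x) + lam * (LINT x|lebesgue_on \<Omega>. T2 n x) + lam * (LINT z|(lborel \<Otimes>\<^sub>M lborel). T3 n z)
     \<le> (LINT x|lebesgue_on \<Omega>. RR n x)"
proof -
  have 1: "energy \<Omega> p s m lam u Gu (Phi n) (GPhi n) \<le> (LINT x|lebesgue_on \<Omega>. reaction \<Omega> m lam \<gamma> \<delta> g0 u x * Phi n x)"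
    by (rule sub[OF W_tests(1) tests_borel(1), of _ "kk n + ee n"]) (use tests_bounds tests_out in auto)
  have 2: "(LINT x|lebesgue_on \<Omega>. reaction \<Omega> m lam \<gamma> \<delta> g0 v x * Psi n x) \<le> energy \<Omega> p s m lam v Gv (Psi n) (GPsi n)"
    by (rule super[OF W_tests(2) tests_borel(2), of _ "(kk n + ee n) powr q * ee n powr (1 - q)"]) (use tests_bounds tests_out in auto)
  have e1: "(LINT x|lebesgue_on \<Omega>. T1 n x) = (LINT x|lebesgue_on \<Omega>. u x powr (2 * m + 1) * Phi n x) - (LINT x|lebesgue_on \<Omega>. v x powr (2 * m + 1) * Psi n x)"
    unfolding T1_def by (intro Bochner_Integration.integral_diff mult_tests_integrable powr_integrable uL vL u0 v0)
  have e2: "(LINT x|lebesgue_on \<Omega>. T2 n x) = (LINT x|lebesgue_on \<Omega>. (norm (Gu x) powr (p - 2) *\<^sub>R Gu x) \<bullet> GPhi n x) - (LINT x|lebesgue_on \<Omega>. (norm (Gv x) powr (p - 2) *\<^sub>R Gv x) \<bullet> GPsi n x)"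
    unfolding T2_def by (rule Bochner_Integration.integral_diff[OF locals])
  have e3: "(LINT z|(lborel \<Otimes>\<^sub>M lborel). T3 n z) = (LINT z|(lborel \<Otimes>\<^sub>M lborel). nonlocal_integrand s p u (Phi n) z) - (LINT z|(lborel \<Otimes>\<^sub>M lborel). nonlocal_integrand s p v (Psi n) z)"
    unfolding T3_def by (rule Bochner_Integration.integral_diff[OF nonlocals])
  have e4: "(LINT x|lebesgue_on \<Omega>. RR n x) = (LINT x|lebesgue_on \<Omega>. reaction \<Omega> m lam \<gamma> \<delta> g0 u x * Phi n x) - (LINT x|lebesgue_on \<Omega>. reaction \<Omega> m lam \<gamma> \<delta> g0 v x * Psi n x)"
    unfolding RR_def by (intro Bochner_Integration.integral_diff mult_tests_integrable reaction_integrable uL vL u0 v0)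
  show ?thesis using 1 2 unfolding e1 e2 e3 e4 energy_def by (simp add: algebra_simps)
qed

end

section \<open>Passage to the limit\<close>

context comparison begin

lemma ee_tendsto: "ee \<longlonglongrightarrow> 0"
  using LIMSEQ_inverse_real_of_nat by (simp add: divide_inverse)

lemma kk_eventually: "eventually (\<lambda>n. t \<le> kk n) sequentially" for t :: real
proof -
  obtain N :: nat where N: "t \<le> real N" using real_arch_simple by blast
  show ?thesis
    by (rule eventually_sequentiallyI[of N]) (use N in auto)
qed

lemma aa_tendsto: "(\<lambda>n. aa n x) \<longlonglongrightarrow> u x"
proof -
  have "(\<lambda>n. u x + ee n) \<longlonglongrightarrow> u x + 0" by (intro tendsto_intros ee_tendsto)
  moreover have "eventually (\<lambda>n. u x + ee n = aa n x) sequentially"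
    using kk_eventually[of "u x"] by eventually_elim (simp add: aa_def)
  ultimately show ?thesis by (simp add: tendsto_cong)
qed

lemma bb_tendsto: "(\<lambda>n. bb n x) \<longlonglongrightarrow> v x"
proof -
  have "(\<lambda>n. v x + ee n) \<longlonglongrightarrow> v x + 0" by (intro tendsto_intros ee_tendsto)
  then show ?thesis by (simp add: bb_def)
qed

lemma inactive:
  assumes "u x \<le> v x"
  shows "Phi n x = 0" "Psi n x = 0"
proof -
  have "\<not> bb n x < aa n x" using assms by (simp add: aa_def bb_def)
  then show "Phi n x = 0" "Psi n x = 0" by (simp_all add: Phi_def Psi_def sub_test_def sup_test_def)
qed

lemma active: "bb n x < aa n x \<longleftrightarrow> v x < min (u x) (kk n)"
  by (simp add: aa_def bb_def)

lemma diff_powr_tendsto: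
  "(\<lambda>n. max 0 (aa n x powr q - bb n x powr q)) \<longlonglongrightarrow> max 0 (u x powr q - v x powr q)"
  by (intro tendsto_max tendsto_const tendsto_diff tendsto_powr2 aa_tendsto bb_tendsto) 
    (use q ab_pos in \<open>auto intro!: always_eventually less_imp_le\<close>)

lemma Phi_tendsto:
  assumes "0 < u x"
  shows "(\<lambda>n. Phi n x) \<longlonglongrightarrow> max 0 (u x powr q - v x powr q) * u x powr (- m)"
  unfolding tests_eq
  by (intro tendsto_mult diff_powr_tendsto tendsto_powr aa_tendsto tendsto_const) (use assms in auto)

lemma Psi_tendsto:
  assumes "0 < v x"
  shows "(\<lambda>n. Psi n x) \<longlonglongrightarrow> max 0 (u x powr q - v x powr q) * v x powr (- m)"
  unfolding tests_eq
  by (intro tendsto_mult diff_powr_tendsto tendsto_powr bb_tendsto tendsto_const) (use assms in auto)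

text \<open>A bound free of n. It dominates the reaction term of the sub-solution, whereas
  \<open>Psi\<close> enters with a minus sign and is dropped from upper bounds.\<close>

lemma Phi_le: "Phi n x \<le> q * u x"
proof (cases "bb n x < aa n x")
  case True
  have "Phi n x \<le> q * \<bar>aa n x - bb n x\<bar>" unfolding Phi_def by (rule sub_test_le(1)[OF q(1) ab_pos])
  also have "\<dots> \<le> q * u x" 
    using True v0[of x] q by (intro mult_left_mono) (auto simp: aa_def bb_def)
  finally show ?thesis .
next
  case False
  then show ?thesis using u0[of x] q by (simp add: Phi_def sub_test_def)
qed

text \<open>On the active set v < t = min(u, k). The claim follows because y^(2m+1) (y +
  \<epsilon>)^(-m) = y^q (y / (y + \<epsilon>))^m increases in y, and enlarging t to u in the factor
  with exponent 2m + 1 only helps.\<close>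

lemma T1_nonneg: "0 \<le> T1 n x"
proof (cases "bb n x < aa n x \<and> 0 < v x")
  case False
  then consider "\<not> bb n x < aa n x" | "v x = 0" using v0[of x] by fastforce
  then show ?thesis
  proof cases
    case 1 then show ?thesis by (simp add: T1_def Phi_def Psi_def sub_test_def sup_test_def)
  next
    case 2 then show ?thesis using m tests_bounds(1)[of n x] by (simp add: T1_def)
  qed
next
  case True
  define t where "t = min (u x) (kk n)"
  have t: "v x < t" "t \<le> u x" "0 < v x" using True active by (auto simp: t_def)
  have prof: "y powr (2 * m + 1) * (y + ee n) powr (- m) = y powr q * (y / (y + ee n)) powr m" if "0 < y" for y
  proof -
    have "(y / (y + ee n)) powr m = y powr m / (y + ee n) powr m" using that by (intro powr_divide)
    moreover have "y powr (2 * m + 1) = y powr q * y powr m" by (simp add: powr_add[symmetric])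
    ultimately show ?thesis by (simp add: powr_minus_divide)
  qed
  have "v x powr (2 * m + 1) * bb n x powr (- m) = v x powr q * (v x / (v x + ee n)) powr m"
    unfolding bb_def by (rule prof[OF t(3)])
  also have "\<dots> \<le> t powr q * (t / (t + ee n)) powr m"
  proof (intro mult_mono powr_mono2)
    show "v x / (v x + ee n) \<le> t / (t + ee n)"
      using t by (simp add: divide_simps add_pos_nonneg) (simp add: field_simps)
  qed (use t m in auto)
  also have "\<dots> = t powr (2 * m + 1) * aa n x powr (- m)"
    unfolding aa_def t_def[symmetric] by (rule prof[symmetric]) (use t in linarith)
  also have "\<dots> \<le> u x powr (2 * m + 1) * aa n x powr (- m)"
    using t m by (intro mult_right_mono powr_mono2) auto
  finally have "max 0 (aa n x powr q - bb n x powr q) * (v x powr (2 * m + 1) * bb n x powr (- m))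
    \<le> max 0 (aa n x powr q - bb n x powr q) * (u x powr (2 * m + 1) * aa n x powr (- m))"
    by (intro mult_left_mono) auto
  then show ?thesis unfolding T1_def tests_eq by (simp add: mult.left_commute)
qed

lemma T1_tendsto: "(\<lambda>n. T1 n x) \<longlonglongrightarrow> (max 0 (u x powr q - v x powr q))\<^sup>2"
proof (cases "u x \<le> v x")
  case True
  then have "u x powr q \<le> v x powr q" using u0[of x] q by (intro powr_mono2) auto
  then show ?thesis unfolding T1_def inactive[OF True] by simp
next
  case False
  then have u: "0 < u x" using v0[of x] by linarith
  let ?d = "max 0 (u x powr q - v x powr q)"
  have pw: "y powr (2 * m + 1) * y powr (- m) = y powr q" if "0 < y" for y :: real by (simp add: powr_add[symmetric])
  have "(\<lambda>n. u x powr (2 * m + 1) * Phi n x) \<longlonglongrightarrow> u x powr (2 * m + 1) * (?d * u x powr (- m))"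
    by (intro tendsto_mult tendsto_const Phi_tendsto u)
  also have "u x powr (2 * m + 1) * (?d * u x powr (- m)) = ?d * u x powr q"
    unfolding mult.left_commute[of _ ?d] pw[OF u] ..
  finally have 1: "(\<lambda>n. u x powr (2 * m + 1) * Phi n x) \<longlonglongrightarrow> ?d * u x powr q" .
  have 2: "(\<lambda>n. v x powr (2 * m + 1) * Psi n x) \<longlonglongrightarrow> ?d * v x powr q"
  \<comment> \<open>Here \<open>Psi n x\<close> may blow up, but its factor is exactly 0.\<close>
  proof (cases "v x = 0")
    case True
    then show ?thesis using m by simp
  next
    case False
    then have v: "0 < v x" using v0[of x] by linarith
    have "(\<lambda>n. v x powr (2 * m + 1) * Psi n x) \<longlonglongrightarrow> v x powr (2 * m + 1) * (?d * v x powr (- m))"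
      by (intro tendsto_mult tendsto_const Psi_tendsto v)
    also have "v x powr (2 * m + 1) * (?d * v x powr (- m)) = ?d * v x powr q"
      unfolding mult.left_commute[of _ ?d] pw[OF v] ..
    finally show ?thesis .
  qed
  have "v x powr q \<le> u x powr q" using False v0[of x] q by (intro powr_mono2) auto
  then have "?d * u x powr q - ?d * v x powr q = ?d\<^sup>2" by (simp add: max_def power2_eq_square algebra_simps)
  then show ?thesis using tendsto_diff[OF 1 2] unfolding T1_def by simp
qed

definition "err2 n x = (if kk n < u x then q * (norm (Gu x) powr (p - 1) * norm (Gv x)) else 0)"

text \<open>Where u exceeds the truncation height the truncated gradient is 0 and the pointwise
  inequality cannot be used. What remains of the sub-solution is a cross term with coefficient q
  (b/a)^(q-1), at most q on the active set; the term with the p-th power of |Gv| is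
  nonnegative.\<close>

lemma T2_ge: "- err2 n x \<le> T2 n x"
proof (cases "bb n x < aa n x")
  case False
  then show ?thesis using q by (simp add: T2_def GPhi_def GPsi_def err2_def)
next
  case True
  note ab = ab_pos[of n x]
  show ?thesis
  proof (cases "u x \<le> kk n")
    case le: True
    have "0 \<le> (norm (Gu x) powr (p - 2) *\<^sub>R Gu x) \<bullet>
               ((1 + (q - 1) * (bb n x / aa n x) powr q) *\<^sub>R Gu x - (q * (bb n x / aa n x) powr (q - 1)) *\<^sub>R Gv x)
           - (norm (Gv x) powr (p - 2) *\<^sub>R Gv x) \<bullet>
               ((q * (aa n x / bb n x) powr (q - 1)) *\<^sub>R Gu x - (1 + (q - 1) * (aa n x / bb n x) powr q) *\<^sub>R Gv x)"
      by (rule diaz_saa_pointwise) (use q ab in auto)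
    moreover have "err2 n x = 0" using le by (simp add: err2_def)
    ultimately show ?thesis unfolding T2_def GPhi_def GPsi_def using True le by (simp only: if_True scaleR_one)
  next
    case gt: False
    let ?X = "(norm (Gu x) powr (p - 2) *\<^sub>R Gu x) \<bullet> Gv x" and ?c = "(bb n x / aa n x) powr (q - 1)" 
    have c: "0 \<le> ?c" "?c \<le> 1"
    proof -
      have "?c \<le> 1 powr (q - 1)" using True ab q by (intro powr_mono2) auto
      then show "?c \<le> 1" by simp
    qed simp
    have T: "T2 n x = - (q * ?c * ?X) + (1 + (q - 1) * (aa n x / bb n x) powr q) * norm (Gv x) powr p"
      unfolding T2_def GPhi_def GPsi_def using True gt inner_powr_norm_self[of "Gv x" p]
      by (simp only: if_True if_False scaleR_zero_left scaleR_zero_right diff_0 inner_minus_right inner_scaleR_right)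
    have "q * ?c * ?X \<le> q * ?c * (norm (Gu x) powr (p - 1) * norm (Gv x))"
      using q c by (intro mult_left_mono inner_powr_norm_le(1)) auto
    also have "\<dots> \<le> q * 1 * (norm (Gu x) powr (p - 1) * norm (Gv x))"
      using q c by (intro mult_right_mono mult_left_mono) auto
    finally have "q * ?c * ?X \<le> err2 n x" using gt by (simp add: err2_def)
    moreover have "0 \<le> (1 + (q - 1) * (aa n x / bb n x) powr q) * norm (Gv x) powr p"
      using q by (intro mult_nonneg_nonneg add_nonneg_nonneg) auto
    ultimately show ?thesis unfolding T by linarith
  qed
qed

lemma err2_props:
  "integrable (lebesgue_on \<Omega>) (err2 n)" "(\<lambda>n. LINT x|lebesgue_on \<Omega>. err2 n x) \<longlonglongrightarrow> 0"
  "(LINT x|lebesgue_on \<Omega>. err2 n x) \<le> (LINT x|lebesgue_on \<Omega>. q * (norm (Gu x) powr (p - 1) * norm (Gv x)))"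
proof -
  let ?w = "\<lambda>x. q * (norm (Gu x) powr (p - 1) * norm (Gv x))"
  have w: "integrable (lebesgue_on \<Omega>) ?w"
    by (intro integrable_mult_right local_integrand_integrable(1) W0_Lq(2)[OF Wu] W0_Lq(2)[OF Wv])
  have w0: "0 \<le> ?w x" for x using q by simp
  have b: "norm (err2 n x) \<le> ?w x" for n x using w0[of x] by (simp add: err2_def)
  have m[measurable]: "err2 n \<in> borel_measurable (lebesgue_on \<Omega>)" for n unfolding err2_def[abs_def] by measurable
  show i: "integrable (lebesgue_on \<Omega>) (err2 n)" for n
    by (rule Bochner_Integration.integrable_bound[OF w m]) (use b w0 in \<open>auto intro!: AE_I2 order_trans[OF b]\<close>)
  have "(\<lambda>n. LINT x|lebesgue_on \<Omega>. err2 n x) \<longlonglongrightarrow> (LINT x|lebesgue_on \<Omega>. 0)"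
  proof (rule integral_dominated_convergence[OF _ m w])
    show "AE x in lebesgue_on \<Omega>. (\<lambda>n. err2 n x) \<longlonglongrightarrow> 0"
    proof (rule AE_I2)
      fix x
      have "eventually (\<lambda>n. err2 n x = 0) sequentially"
        using kk_eventually[of "u x"] by eventually_elim (simp add: err2_def)
      then show "(\<lambda>n. err2 n x) \<longlonglongrightarrow> 0" by (rule tendsto_eventually)
    qed
    show "AE x in lebesgue_on \<Omega>. norm (err2 n x) \<le> ?w x" for n by (rule AE_I2) (rule b)
  qed simp
  then show "(\<lambda>n. LINT x|lebesgue_on \<Omega>. err2 n x) \<longlonglongrightarrow> 0" by simp
  show "(LINT x|lebesgue_on \<Omega>. err2 n x) \<le> (LINT x|lebesgue_on \<Omega>. ?w x)"
    by (rule integral_mono[OF i w]) (use b in \<open>auto intro: order_trans[OF abs_ge_self]\<close>)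
qed

definition "err3 n = (\<lambda>(x, y). q * \<bar>u x - u y\<bar> powr (p - 1) * (\<bar>u x - u y\<bar> + \<bar>v x - v y\<bar>) 
   / norm (x - y) powr (real DIM('a) + s * p) * (if kk n < u x \<or> kk n < u y then 1 else 0))"

lemma T3_err3_nonneg: "0 \<le> T3 n z + err3 n z"
proof -
  obtain x y where z: "z = (x, y)" by (cases z)
  let ?K = "norm (x - y) powr (real DIM('a) + s * p)"
  have "0 \<le> (signed_pow (u x - u y) (p - 1) * (Phi n x - Phi n y)
            - signed_pow (v x - v y) (p - 1) * (Psi n x - Psi n y)
            + q * \<bar>u x - u y\<bar> powr (p - 1) * (\<bar>u x - u y\<bar> + \<bar>v x - v y\<bar>) * (if kk n < u x \<or> kk n < u y then 1 else 0)) / ?K"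
    unfolding Phi_def Psi_def aa_def bb_def
    by (intro divide_nonneg_nonneg truncated_nonlocal_diaz_saa q u0 v0) auto
  also have "\<dots> = T3 n z + err3 n z"
    unfolding T3_def err3_def nonlocal_integrand_def z prod.case by (simp only: add_divide_distrib diff_divide_distrib times_divide_eq_left)
  finally show ?thesis .
qed

lemma err3_props:
  "integrable (lborel \<Otimes>\<^sub>M lborel) (err3 n)" "(\<lambda>n. LINT z|(lborel \<Otimes>\<^sub>M lborel). err3 n z) \<longlonglongrightarrow> 0"
  "(LINT z|(lborel \<Otimes>\<^sub>M lborel). err3 n z) \<le> (LINT z|(lborel \<Otimes>\<^sub>M lborel). q * (3 * gagliardo s p u z + gagliardo s p v z))"
  "0 \<le> err3 n z"
proof -
  let ?M = "lborel \<Otimes>\<^sub>M lborel :: ('a \<times> 'a) measure"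
  \<comment> \<open>The factor 3 is 2 + 1: \<open>nonlocal_bound\<close> for the pair u, u gives two
    copies of the density of u, for the pair u, v one of each.\<close>
  let ?w = "\<lambda>z. q * (3 * gagliardo s p u z + gagliardo s p v z)"
  have w: "integrable ?M ?w"
    by (intro integrable_mult_right Bochner_Integration.integrable_add gagliardos)
  show nn: "0 \<le> err3 n z" for n z
    unfolding err3_def case_prod_beta using q by (intro mult_nonneg_nonneg divide_nonneg_nonneg) auto
  have b: "norm (err3 n z) \<le> ?w z" for n z
  proof -
    obtain x y where z: "z = (x, y)" by (cases z)
    let ?K = "norm (x - y) powr (real DIM('a) + s * p)"
    let ?e = "q * \<bar>u x - u y\<bar> powr (p - 1) * (\<bar>u x - u y\<bar> + \<bar>v x - v y\<bar>) / ?K"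
    have "?e = q * (\<bar>u x - u y\<bar> powr (p - 1) * \<bar>u x - u y\<bar> / ?K + \<bar>u x - u y\<bar> powr (p - 1) * \<bar>v x - v y\<bar> / ?K)"
      by (simp add: add_divide_distrib distrib_left mult.assoc)
    also have "\<dots> \<le> q * ((gagliardo s p u (x, y) + gagliardo s p u (x, y)) + (gagliardo s p u (x, y) + gagliardo s p v (x, y)))"
      using q by (intro mult_left_mono add_mono nonlocal_bound) auto
    also have "\<dots> = ?w z" by (simp add: z)
    finally have e: "?e \<le> ?w z" .
    have e0: "0 \<le> ?e" using q by (intro mult_nonneg_nonneg divide_nonneg_nonneg) auto
    have "err3 n z = ?e * (if kk n < u x \<or> kk n < u y then 1 else 0)" unfolding err3_def z prod.case ..
    also have "\<dots> \<le> ?e" using e0 by (cases "kk n < u x \<or> kk n < u y") (simp_all only: if_True if_False mult_1_right mult_zero_right order_refl)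
    finally show ?thesis using e nn[of n z] by (simp only: real_norm_def abs_of_nonneg)
  qed
  have m: "err3 n \<in> borel_measurable ?M" for n
  proof -
    have "err3 n \<in> borel_measurable (borel \<Otimes>\<^sub>M borel)" unfolding err3_def case_prod_beta by measurable
    then show ?thesis by (simp cong: measurable_cong_sets)
  qed
  show i: "integrable ?M (err3 n)" for n
    by (rule Bochner_Integration.integrable_bound[OF w m]) (rule AE_I2, rule order_trans[OF b], simp)
  have "(\<lambda>n. LINT z|?M. err3 n z) \<longlonglongrightarrow> (LINT z|?M. 0)"
  proof (rule integral_dominated_convergence[OF _ m w])
    show "AE z in ?M. (\<lambda>n. err3 n z) \<longlonglongrightarrow> 0"
    proof (rule AE_I2)
      fix z :: "'a \<times> 'a"
      obtain x y where z: "z = (x, y)" by (cases z)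
      have "eventually (\<lambda>n. err3 n z = 0) sequentially"
        using kk_eventually[of "u x"] kk_eventually[of "u y"] by eventually_elim (simp add: err3_def z)
      then show "(\<lambda>n. err3 n z) \<longlonglongrightarrow> 0" by (rule tendsto_eventually)
    qed
    show "AE z in ?M. norm (err3 n z) \<le> ?w z" for n by (rule AE_I2) (rule b)
  qed simp
  then show "(\<lambda>n. LINT z|?M. err3 n z) \<longlonglongrightarrow> 0" by simp
  show "(LINT z|?M. err3 n z) \<le> (LINT z|?M. ?w z)"
    by (rule integral_mono[OF i w]) (rule order_trans[OF abs_ge_self], rule b[unfolded real_norm_def])
qed

text \<open>A majorant of \<open>RR n x\<close> by positive parts. There is no lower bound uniform
  in n because of \<open>Psi\<close>, but the positive parts lie between 0 and an integrable
  function, so dominated convergence applies to them.\<close>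

definition "rr n x = g0 x * max 0 (rpow (u x) m * Phi n x - rpow (v x) m * Psi n x)
   + lam * m * dst x powr (- \<gamma>) * max 0 (u x powr \<delta> * Phi n x - v x powr \<delta> * Psi n x)"
definition "rdom x = q * (g0 x * u x powr q + lam * m * (dst x powr (- \<gamma>) * (1 + u x powr q)))"

lemma rdom_integrable: "integrable (lebesgue_on \<Omega>) rdom"
proof -
  have 1: "integrable (lebesgue_on \<Omega>) (\<lambda>x. g0 x * u x powr q)"
    by (rule Lq2_mult_integrable[OF g0(1) powr_integrable(2)[OF uL u0]])
  have 2: "integrable (lebesgue_on \<Omega>) (\<lambda>x. lam * m * (dst x powr (- \<gamma>) * (1 + u x powr q)))"
  proof (cases "m = 0")
    case False
    then have "0 < m" using m by simp
    have one: "(\<lambda>x. 1::real) \<in> Lq \<Omega> 2" by (rule Lq_bounded[where C = 1]) (use fin_meas in auto)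
    have "(\<lambda>x. 1 + u x powr q) \<in> Lq \<Omega> 2" by (rule Lq_add[OF one powr_integrable(2)[OF uL u0]]) simp
    then show ?thesis by (intro integrable_mult_right Lq2_mult_integrable dist_Lq2 \<open>0 < m\<close>)
  qed simp
  show ?thesis unfolding rdom_def[abs_def] by (intro integrable_mult_right Bochner_Integration.integrable_add 1 2)
qed

lemma rr_bounds:
  assumes "0 \<le> g0 x"
  shows "RR n x \<le> rr n x" "0 \<le> rr n x" "rr n x \<le> rdom x"
proof -
  let ?A = "rpow (u x) m * Phi n x - rpow (v x) m * Psi n x" and ?B = "u x powr \<delta> * Phi n x - v x powr \<delta> * Psi n x"
  let ?c = "lam * m * dst x powr (- \<gamma>)"
  have c0: "0 \<le> ?c" using lam m by simp
  have "RR n x = g0 x * ?A + ?c * ?B" by (simp add: RR_def reaction_def algebra_simps)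
  moreover have "g0 x * ?A \<le> g0 x * max 0 ?A" "?c * ?B \<le> ?c * max 0 ?B"
    using assms c0 by (auto intro!: mult_left_mono)
  ultimately show "RR n x \<le> rr n x" unfolding rr_def by linarith
  show "0 \<le> rr n x" unfolding rr_def
    by (rule add_nonneg_nonneg[OF mult_nonneg_nonneg[OF assms max.cobounded1] mult_nonneg_nonneg[OF c0 max.cobounded1]])
  have rp: "0 \<le> rpow y m" for y by (simp add: rpow_def)
  have P: "0 \<le> Phi n x" "0 \<le> Psi n x" by (rule tests_bounds)+
  have uq: "rpow (u x) m * u x \<le> u x powr q"
    using u0[of x] by (cases "u x = 0") (auto simp: rpow_def powr_add)
  have A: "max 0 ?A \<le> q * u x powr q"
  proof -
    have "rpow (u x) m * Phi n x \<le> rpow (u x) m * (q * u x)" by (intro mult_left_mono Phi_le rp)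
    also have "\<dots> \<le> q * u x powr q" using mult_left_mono[OF uq, of q] q by (simp add: mult.left_commute)
    finally have "?A \<le> q * u x powr q" using mult_nonneg_nonneg[OF rp P(2), of "v x"] by linarith
    moreover have "0 \<le> q * u x powr q" using q by simp
    ultimately show ?thesis by simp
  qed
  have B: "max 0 ?B \<le> q * (1 + u x powr q)" if m0: "0 < m"
  proof -
    have "u x powr \<delta> * Phi n x \<le> u x powr \<delta> * (q * u x)" by (intro mult_left_mono Phi_le) simp
    also have "\<dots> = q * u x powr (\<delta> + 1)"
      using u0[of x] by (cases "u x = 0") (auto simp: powr_add)
    also have "\<dots> \<le> q * (1 + u x powr q)"
    proof (rule mult_left_mono)
      show "u x powr (\<delta> + 1) \<le> 1 + u x powr q"
      proof (cases "u x \<le> 1")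
        case True
        have "u x powr (\<delta> + 1) \<le> 1 powr (\<delta> + 1)" using True u0[of x] exps[OF m0] by (intro powr_mono2) auto
        then have "u x powr (\<delta> + 1) \<le> 1" by simp
        then show ?thesis using powr_ge_zero[of "u x" q] by linarith
      next
        case False
        then have "u x powr (\<delta> + 1) \<le> u x powr q" using exps[OF m0] by (intro powr_mono) auto
        then show ?thesis by linarith
      qed
    qed (use q in simp)
    finally have "?B \<le> q * (1 + u x powr q)" using mult_nonneg_nonneg[OF powr_ge_zero P(2), of "v x" \<delta>] by linarith
    moreover have "0 \<le> q * (1 + u x powr q)" using q by (intro mult_nonneg_nonneg add_nonneg_nonneg) auto
    ultimately show ?thesis by simp
  qed
  have "?c * max 0 ?B \<le> ?c * (q * (1 + u x powr q))"
  proof (cases "m = 0")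
    case False then show ?thesis using B m c0 by (intro mult_left_mono) auto
  qed simp
  moreover have "g0 x * max 0 ?A \<le> g0 x * (q * u x powr q)" by (rule mult_left_mono[OF A assms])
  ultimately have "rr n x \<le> g0 x * (q * u x powr q) + ?c * (q * (1 + u x powr q))" unfolding rr_def by (rule add_mono[rotated])
  also have "\<dots> = rdom x" by (simp add: rdom_def algebra_simps)
  finally show "rr n x \<le> rdom x" .
qed

text \<open>For m = 0 the two tests coincide and the difference is 0. For m > 0 and v > 0 the
  difference with exponent e tends to (u^q - v^q)^+ (u^(e-m) - v^(e-m)), which is 0 for e = m and
  nonpositive for e = \<delta> < m.\<close>

lemma rr_tendsto:
  assumes "m = 0 \<or> \<not> (v x = 0 \<and> 0 < u x)"
  shows "(\<lambda>n. rr n x) \<longlonglongrightarrow> 0"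
proof -
  consider "u x \<le> v x" | "m = 0" "v x < u x" | "0 < m" "0 < v x" "v x < u x" 
    using assms v0[of x] m by fastforce
  then show ?thesis
  proof cases
    case 1
    then show ?thesis by (simp add: rr_def inactive)
  next
    case 2
    have P: "Phi n x = Psi n x" for n
      unfolding tests_eq using 2 ab_pos[of n x] by simp
    have rp: "rpow y m = 1" for y using 2(1) by (simp add: rpow_def)
    have z: "lam * m = 0" using 2(1) by simp
    have "rr n x = 0" for n unfolding rr_def rp P z by simp
    then show ?thesis by simp
  next
    case 3
    let ?d = "max 0 (u x powr q - v x powr q)"
    have u: "0 < u x" using 3 by linarith
    have lim: "(\<lambda>n. u x powr e * Phi n x - v x powr e * Psi n x) \<longlonglongrightarrow> ?d * (u x powr (e - m) - v x powr (e - m))" for e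
    proof -
      have "(\<lambda>n. u x powr e * Phi n x - v x powr e * Psi n x) \<longlonglongrightarrow> u x powr e * (?d * u x powr (- m)) - v x powr e * (?d * v x powr (- m))"
        by (intro tendsto_diff tendsto_mult tendsto_const Phi_tendsto Psi_tendsto u 3)
      also have "u x powr e * (?d * u x powr (- m)) - v x powr e * (?d * v x powr (- m)) = ?d * (u x powr (e - m) - v x powr (e - m))"
        by (simp add: powr_diff powr_minus_divide right_diff_distrib mult.commute)
      finally show ?thesis .
    qed
    have 1: "(\<lambda>n. max 0 (rpow (u x) m * Phi n x - rpow (v x) m * Psi n x)) \<longlonglongrightarrow> 0"
      using tendsto_max[OF tendsto_const[of 0] lim[of m]] 3 u by (simp add: rpow_def)
    have "u x powr (\<delta> - m) \<le> v x powr (\<delta> - m)" using exps[OF 3(1)] 3 by (intro powr_mono2') auto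
    then have "?d * (u x powr (\<delta> - m) - v x powr (\<delta> - m)) \<le> 0" by (intro mult_nonneg_nonpos) auto
    then have 2: "(\<lambda>n. max 0 (u x powr \<delta> * Phi n x - v x powr \<delta> * Psi n x)) \<longlonglongrightarrow> 0"
      using tendsto_max[OF tendsto_const[of 0] lim[of \<delta>]] by (simp add: max_absorb1)
    have "(\<lambda>n. rr n x) \<longlonglongrightarrow> g0 x * 0 + lam * m * dst x powr (- \<gamma>) * 0"
      unfolding rr_def by (intro tendsto_add tendsto_mult tendsto_const 1 2)
    then show ?thesis by simp
  qed
qed

end

section \<open>Positivity of the super-solution where the sub-solution is positive, and
  conclusion\<close>

context comparison begin

text \<open>The difference inequality is solved for the nonlocal term: absorption is nonnegative,
  the local term is at least minus an integrable error, and the reaction is at most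
  \<open>rdom\<close>. None of these bounds involves the positivity of v.\<close>

lemma nonlocal_defect_bound:
  obtains C where "\<And>n. (LINT z|(lborel \<Otimes>\<^sub>M lborel). T3 n z + err3 n z) \<le> C"
proof -
  define C where "C = ((LINT x|lebesgue_on \<Omega>. rdom x) + lam * (LINT x|lebesgue_on \<Omega>. q * (norm (Gu x) powr (p - 1) * norm (Gv x)))) / lam
    + (LINT z|(lborel \<Otimes>\<^sub>M lborel). q * (3 * gagliardo s p u z + gagliardo s p v z))"
  show thesis
  proof (rule that[of C])
    fix n
    have 1: "0 \<le> (LINT x|lebesgue_on \<Omega>. T1 n x)" by (rule Bochner_Integration.integral_nonneg) (rule T1_nonneg)
    have "(LINT x|lebesgue_on \<Omega>. - err2 n x) \<le> (LINT x|lebesgue_on \<Omega>. T2 n x)"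
      by (intro integral_mono T_integrable Bochner_Integration.integrable_minus err2_props T2_ge)
    then have 2: "- (LINT x|lebesgue_on \<Omega>. q * (norm (Gu x) powr (p - 1) * norm (Gv x))) \<le> (LINT x|lebesgue_on \<Omega>. T2 n x)"
      using err2_props(3)[of n] by simp
    have 3: "(LINT x|lebesgue_on \<Omega>. RR n x) \<le> (LINT x|lebesgue_on \<Omega>. rdom x)"
    proof (rule integral_mono_AE[OF T_integrable(4) rdom_integrable])
      show "AE x in lebesgue_on \<Omega>. RR n x \<le> rdom x"
        using g0(2) by eventually_elim (rule order_trans[OF rr_bounds(1) rr_bounds(3)])
    qed
    have "lam * (LINT z|(lborel \<Otimes>\<^sub>M lborel). T3 n z) \<le> (LINT x|lebesgue_on \<Omega>. rdom x) + lam * (LINT x|lebesgue_on \<Omega>. q * (norm (Gu x) powr (p - 1) * norm (Gv x)))"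
      using difference_inequality[of n] 1 3 mult_left_mono[OF 2, of lam] lam by simp
    then have "(LINT z|(lborel \<Otimes>\<^sub>M lborel). T3 n z) \<le> ((LINT x|lebesgue_on \<Omega>. rdom x) + lam * (LINT x|lebesgue_on \<Omega>. q * (norm (Gu x) powr (p - 1) * norm (Gv x)))) / lam"
      using lam by (simp add: pos_le_divide_eq mult.commute)
    then show "(LINT z|(lborel \<Otimes>\<^sub>M lborel). T3 n z + err3 n z) \<le> C"
      unfolding C_def using err3_props(3)[of n] Bochner_Integration.integral_add[OF T_integrable(3)[of n] err3_props(1)[of n]] by linarith
  qed
qed

text \<open>If \<open>v\<close> vanishes at \<open>x\<close> while \<open>u\<close> does not, then the test function \<open>Psi n\<close> blows up at \<open>x\<close>, and the
  nonlocal term feels this through every \<open>y\<close> with \<open>v y > 0\<close>.\<close>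

lemma nonlocal_defect_blowup:
  assumes m0: "0 < m" and x: "v x = 0" "0 < u x" and y: "0 < v y"
  shows "filterlim (\<lambda>n. T3 n (x, y) + err3 n (x, y)) at_top sequentially"
proof -
  let ?K = "norm (x - y) powr (real DIM('a) + s * p)"
  have "x \<noteq> y" using x y by auto
  then have K: "0 < ?K" by simp
  \<comment> \<open>The constants are free of n: A bounds the contribution of u, \<open>c\<close>
    times the m-th power of \<open>kk n\<close>, minus 1, bounds \<open>Psi n x\<close> from below,
    M bounds \<open>Psi n y\<close> from above, and w is |v x - v y|^(p-1).\<close>
  define A where "A = \<bar>u x - u y\<bar> powr (p - 1) * (q * (\<bar>u x - u y\<bar> + \<bar>v x - v y\<bar>))"
  define c where "c = min (u x) 1 powr q"
  define M where "M = (u y + 1) powr q * v y powr (- m)"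
  define w where "w = v y powr (p - 1)"
  have c: "0 < c" and w: "0 < w" using x y by (auto simp: c_def w_def)
  \<comment> \<open>At x the shifted super-solution is just 1/k, so its power 1 - q is k^m. The base
    min(u, 1) in c stays below every truncation because k >= 1, and the 1 absorbs the shift.\<close>
  have Px: "c * kk n powr m - 1 \<le> Psi n x" for n
  proof -
    have k1: "1 \<le> kk n" by simp
    have act: "bb n x < aa n x" unfolding active using x k1 by (simp add: min_def)
    have bb: "bb n x = ee n" using x by (simp add: bb_def)
    have "Psi n x = aa n x powr q * bb n x powr (1 - q) - bb n x" unfolding Psi_def sup_test_def using act by simp
    also have "bb n x powr (1 - q) = kk n powr m" unfolding bb by (simp add: powr_minus_divide powr_divide)
    finally have eq: "Psi n x = aa n x powr q * kk n powr m - ee n" unfolding bb .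
    have "min (u x) 1 \<le> min (u x) (kk n)" by (rule min.mono[OF order_refl k1])
    moreover have "0 \<le> ee n" by simp
    ultimately have "min (u x) 1 \<le> aa n x" unfolding aa_def by linarith
    then have "c \<le> aa n x powr q" unfolding c_def using q x by (intro powr_mono2) auto
    then have "c * kk n powr m \<le> aa n x powr q * kk n powr m" by (intro mult_right_mono) auto
    moreover have "ee n \<le> 1" by simp
    ultimately show ?thesis unfolding eq by linarith
  qed
  have Py: "Psi n y \<le> M" for n
  proof -
    have "Psi n y \<le> aa n y powr q * bb n y powr (- m)"
      unfolding tests_eq by (intro mult_right_mono) auto
    also have "\<dots> \<le> M" unfolding M_def
    proof (rule mult_mono)
      have "ee n \<le> 1" by simp
      then have "aa n y \<le> u y + 1" using aa_bounds(4)[of n y] by linarith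
      then show "aa n y powr q \<le> (u y + 1) powr q" using q ab_pos[of n y] by (intro powr_mono2) auto
      show "bb n y powr (- m) \<le> v y powr (- m)"
        by (rule powr_mono2') (use m y aa_bounds(5)[where n = n and x = y] in auto)
    qed auto
    finally show ?thesis .
  qed
  have Ph: "\<bar>Phi n x - Phi n y\<bar> \<le> q * (\<bar>u x - u y\<bar> + \<bar>v x - v y\<bar>)" for n
  proof -
    have "\<bar>Phi n x - Phi n y\<bar> \<le> q * (\<bar>aa n x - aa n y\<bar> + \<bar>bb n x - bb n y\<bar>)"
      unfolding Phi_def by (rule sub_test_lipschitz[OF q(1) ab_pos[of n x] ab_pos[of n y]])
    also have "\<dots> \<le> q * (\<bar>u x - u y\<bar> + \<bar>v x - v y\<bar>)"
      using q by (intro mult_left_mono add_mono) (auto simp: aa_def bb_def min_def)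
    finally show ?thesis .
  qed
  have lower: "(w * (c * kk n powr m - 1 - M) - A) / ?K \<le> T3 n (x, y) + err3 n (x, y)" for n
  proof -
    have "\<bar>signed_pow (u x - u y) (p - 1) * (Phi n x - Phi n y)\<bar> \<le> A"
      unfolding abs_mult abs_signed_pow A_def by (intro mult_left_mono Ph) simp
    moreover have sw: "signed_pow (v x - v y) (p - 1) = - w" using x y by (simp add: signed_pow_nonpos w_def)
    moreover have "w * (c * kk n powr m - 1 - M) \<le> w * (Psi n x - Psi n y)"
      using Px[of n] Py[of n] w by (intro mult_left_mono) auto
    ultimately have "w * (c * kk n powr m - 1 - M) - A \<le> signed_pow (u x - u y) (p - 1) * (Phi n x - Phi n y) - signed_pow (v x - v y) (p - 1) * (Psi n x - Psi n y)"
      by (simp only: mult_minus_left)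
    then have "(w * (c * kk n powr m - 1 - M) - A) / ?K \<le> (signed_pow (u x - u y) (p - 1) * (Phi n x - Phi n y) - signed_pow (v x - v y) (p - 1) * (Psi n x - Psi n y)) / ?K"
      using K by (intro divide_right_mono) auto
    also have "\<dots> = T3 n (x, y)" unfolding T3_def nonlocal_integrand_def prod.case by (simp only: diff_divide_distrib)
    finally show ?thesis using err3_props(4)[of n "(x, y)"] by linarith
  qed
  show ?thesis unfolding filterlim_at_top
  proof
    fix Z :: real
    \<comment> \<open>The value of k^m at which the lower bound reaches Z. The maximum with 0 makes
      taking the 1/m-th and then the m-th power the identity.\<close>
    define t where "t = max 0 (((Z * ?K + A) / w + 1 + M) / c)"
    have "eventually (\<lambda>n. t powr (1 / m) \<le> kk n) sequentially" by (rule kk_eventually)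
    then show "\<forall>\<^sub>F n in sequentially. Z \<le> T3 n (x, y) + err3 n (x, y)"
    proof eventually_elim
      case (elim n)
      have "(t powr (1 / m)) powr m \<le> kk n powr m" using elim m0 by (intro powr_mono2) auto
      then have "t \<le> kk n powr m" using m0 by (simp add: powr_powr t_def)
      then have "((Z * ?K + A) / w + 1 + M) / c \<le> kk n powr m" by (simp add: t_def)
      then have "(Z * ?K + A) / w \<le> c * kk n powr m - 1 - M" using c by (simp add: pos_divide_le_eq mult.commute)
      then have "Z * ?K \<le> w * (c * kk n powr m - 1 - M) - A" using w by (simp add: pos_divide_le_eq mult.commute)
      then have "Z \<le> (w * (c * kk n powr m - 1 - M) - A) / ?K" using K by (simp add: pos_le_divide_eq)
      then show ?case using lower[of n] by linarith
    qed
  qed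
qed

text \<open>The nonnegative defect blows up on the product of E = {v = 0 < u} and F = {v > 0}, while
  by Fatou its lower limit has finite integral. So the product E x F is null, and since v is
  nontrivial F is not null; hence E is.\<close>

lemma v_pos_where_u_pos:
  assumes m0: "0 < m"
  shows "AE x in lborel. \<not> (v x = 0 \<and> 0 < u x)"
proof -
  let ?M = "lborel \<Otimes>\<^sub>M lborel :: ('a \<times> 'a) measure"
  let ?P = "\<lambda>n z. T3 n z + err3 n z"
  obtain C where C: "\<And>n. (LINT z|?M. ?P n z) \<le> C" by (rule nonlocal_defect_bound) (rule that)
  have Pi: "integrable ?M (?P n)" for n by (rule Bochner_Integration.integrable_add[OF T_integrable(3) err3_props(1)])
  have m: "(\<lambda>z. ennreal (?P n z)) \<in> borel_measurable ?M" for n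
    using borel_measurable_integrable[OF Pi[of n]] by measurable
  have "(\<integral>\<^sup>+z. liminf (\<lambda>n. ennreal (?P n z)) \<partial>?M) \<le> liminf (\<lambda>n. \<integral>\<^sup>+z. ennreal (?P n z) \<partial>?M)"
    by (rule nn_integral_liminf[OF m])
  also have "\<dots> \<le> liminf (\<lambda>n::nat. ennreal C)"
  proof (rule Liminf_mono, rule always_eventually, rule allI)
    fix n
    have "(\<integral>\<^sup>+z. ennreal (?P n z) \<partial>?M) = ennreal (LINT z|?M. ?P n z)"
      by (rule nn_integral_eq_integral[OF Pi]) (rule AE_I2, rule T3_err3_nonneg)
    also have "\<dots> \<le> ennreal C" by (rule ennreal_leI[OF C])
    finally show "(\<integral>\<^sup>+z. ennreal (?P n z) \<partial>?M) \<le> ennreal C" .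
  qed
  also have "\<dots> < \<infinity>" by (simp add: Liminf_const)
  finally have fin: "(\<integral>\<^sup>+z. liminf (\<lambda>n. ennreal (?P n z)) \<partial>?M) \<noteq> \<infinity>" by simp
  have "(\<lambda>z. liminf (\<lambda>n. ennreal (?P n z))) \<in> borel_measurable ?M" by (rule borel_measurable_liminf[OF m])
  from nn_integral_PInf_AE[OF this fin]
  have ae: "AE z in ?M. liminf (\<lambda>n. ennreal (?P n z)) \<noteq> \<infinity>" .
  define E where "E = {x \<in> space borel. v x = 0 \<and> 0 < u x}"
  define F where "F = {x \<in> space borel. 0 < v x}"
  have EF: "E \<in> sets lborel" "F \<in> sets lborel" unfolding E_def F_def sets_lborel by measurable
  have "AE z in ?M. z \<notin> E \<times> F"
    using ae
  proof eventually_elim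
    case (elim z)
    show ?case
    proof
      assume "z \<in> E \<times> F"
      then obtain x y where z: "z = (x, y)" "v x = 0" "0 < u x" "0 < v y" by (auto simp: E_def F_def)
      have "((\<lambda>n. ennreal (?P n z)) \<longlongrightarrow> \<infinity>) sequentially"
        unfolding infinity_ennreal_def z(1) ennreal_tendsto_top_eq_at_top
        by (rule nonlocal_defect_blowup[OF m0 z(2-4)])
      then have "liminf (\<lambda>n. ennreal (?P n z)) = \<infinity>" by (rule lim_imp_Liminf[rotated]) simp
      then show False using elim by simp
    qed
  qed
  then have "E \<times> F \<in> null_sets ?M" using EF by (simp add: AE_iff_null_sets)
  then have "emeasure ?M (E \<times> F) = 0" by (rule null_setsD1)
  then have "emeasure lborel E * emeasure lborel F = 0"
    using lborel.emeasure_pair_measure_Times[OF EF] by simp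
  moreover have "emeasure lborel F \<noteq> 0"
  proof
    assume "emeasure lborel F = 0"
    then have "F \<in> null_sets lborel" using EF by (simp add: null_setsI)
    then have "AE x in lborel. x \<notin> F" by (rule AE_not_in)
    then have "AE x in lborel. v x = 0"
    proof eventually_elim
      case (elim x) then show ?case using v0[of x] by (simp add: F_def)
    qed
    then show False using vnontriv by simp
  qed
  ultimately have "E \<in> null_sets lborel" using EF by (simp add: null_setsI)
  then have "AE x in lborel. x \<notin> E" by (rule AE_not_in)
  then show ?thesis by eventually_elim (simp add: E_def)
qed

text \<open>The absorption integral is squeezed: it is nonnegative, bounded by \<rho> n, and Fatou's
  lemma bounds the integral of its pointwise limit by the limit 0. Strict monotonicity of the power
  q then returns from powers to u and v.\<close>

lemma comparison: "AE x in lebesgue_on \<Omega>. u x \<le> v x"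
proof -
  let ?\<Omega> = "lebesgue_on \<Omega>"
  let ?d = "\<lambda>x. (max 0 (u x powr q - v x powr q))\<^sup>2"
  have good: "AE x in ?\<Omega>. m = 0 \<or> \<not> (v x = 0 \<and> 0 < u x)"
  proof (cases "m = 0")
    case False
    then have "AE x in lebesgue. \<not> (v x = 0 \<and> 0 < u x)" using v_pos_where_u_pos m by (intro AE_completion) simp
    then have "AE x in lebesgue. x \<in> \<Omega> \<longrightarrow> (m = 0 \<or> \<not> (v x = 0 \<and> 0 < u x))" by eventually_elim simp
    then show ?thesis by (simp add: AE_restrict_space_iff)
  qed simp
  have rm: "rr n \<in> borel_measurable ?\<Omega>" for n
    unfolding rr_def[abs_def] by (measurable, rule rpow_measurable, measurable, rule rpow_measurable, measurable)
  have "(\<lambda>n. LINT x|?\<Omega>. rr n x) \<longlonglongrightarrow> (LINT x|?\<Omega>. 0)"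
  proof (rule integral_dominated_convergence[OF _ rm rdom_integrable])
    show "AE x in ?\<Omega>. (\<lambda>n. rr n x) \<longlonglongrightarrow> 0" using good by eventually_elim (rule rr_tendsto)
    show "AE x in ?\<Omega>. norm (rr n x) \<le> rdom x" for n
      using g0(2)
    proof eventually_elim
      case (elim x)
      then show ?case using rr_bounds[of x n] by simp
    qed
  qed simp
  then have rlim: "(\<lambda>n. LINT x|?\<Omega>. rr n x) \<longlonglongrightarrow> 0" by simp
  have ri: "integrable ?\<Omega> (rr n)" for n
  proof (rule Bochner_Integration.integrable_bound[OF rdom_integrable rm])
    show "AE x in ?\<Omega>. norm (rr n x) \<le> norm (rdom x)"
      using g0(2)
    proof eventually_elim
      case (elim x)
      then show ?case using rr_bounds[of x n] by simp
    qed
  qed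
  \<comment> \<open>The reaction majorant together with the two truncation errors; each summand
    tends to 0.\<close>
  define \<rho> where "\<rho> n = (LINT x|?\<Omega>. rr n x) + lam * (LINT x|?\<Omega>. err2 n x) + lam * (LINT z|(lborel \<Otimes>\<^sub>M lborel). err3 n z)" for n
  have "\<rho> \<longlonglongrightarrow> 0 + lam * 0 + lam * 0" unfolding \<rho>_def
    by (intro tendsto_add tendsto_mult tendsto_const rlim err2_props(2) err3_props(2))
  then have \<rho>: "\<rho> \<longlonglongrightarrow> 0" by simp
  have le: "(LINT x|?\<Omega>. T1 n x) \<le> \<rho> n" for n
  proof -
    have "(LINT x|?\<Omega>. - err2 n x) \<le> (LINT x|?\<Omega>. T2 n x)"
      by (intro integral_mono T_integrable Bochner_Integration.integrable_minus err2_props T2_ge)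
    then have 2: "lam * (- (LINT x|?\<Omega>. err2 n x)) \<le> lam * (LINT x|?\<Omega>. T2 n x)" using lam by (intro mult_left_mono) auto
    have "0 \<le> (LINT z|(lborel \<Otimes>\<^sub>M lborel). T3 n z + err3 n z)"
      by (rule Bochner_Integration.integral_nonneg) (rule T3_err3_nonneg)
    then have "- (LINT z|(lborel \<Otimes>\<^sub>M lborel). err3 n z) \<le> (LINT z|(lborel \<Otimes>\<^sub>M lborel). T3 n z)"
      using Bochner_Integration.integral_add[OF T_integrable(3)[of n] err3_props(1)[of n]] by linarith
    then have 3: "lam * (- (LINT z|(lborel \<Otimes>\<^sub>M lborel). err3 n z)) \<le> lam * (LINT z|(lborel \<Otimes>\<^sub>M lborel). T3 n z)" using lam by (intro mult_left_mono) auto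
    have 4: "(LINT x|?\<Omega>. RR n x) \<le> (LINT x|?\<Omega>. rr n x)"
    proof (rule integral_mono_AE[OF T_integrable(4) ri])
      show "AE x in ?\<Omega>. RR n x \<le> rr n x" using g0(2) by eventually_elim (rule rr_bounds(1))
    qed
    show ?thesis using difference_inequality[of n] 2 3 4 unfolding \<rho>_def by (simp only: mult_minus_right)
  qed
  have "(\<integral>\<^sup>+x. ennreal (?d x) \<partial>?\<Omega>) = (\<integral>\<^sup>+x. liminf (\<lambda>n. ennreal (T1 n x)) \<partial>?\<Omega>)"
  proof (rule nn_integral_cong)
    fix x
    have "(\<lambda>n. ennreal (T1 n x)) \<longlonglongrightarrow> ennreal (?d x)" by (rule tendsto_ennrealI[OF T1_tendsto])
    then show "ennreal (?d x) = liminf (\<lambda>n. ennreal (T1 n x))" by (rule lim_imp_Liminf[rotated, symmetric]) simp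
  qed
  also have "\<dots> \<le> liminf (\<lambda>n. \<integral>\<^sup>+x. ennreal (T1 n x) \<partial>?\<Omega>)"
    by (rule nn_integral_liminf) (use borel_measurable_integrable[OF T_integrable(1)] in measurable)
  also have "\<dots> \<le> liminf (\<lambda>n. ennreal (\<rho> n))"
  proof (rule Liminf_mono, rule always_eventually, rule allI)
    fix n
    have "(\<integral>\<^sup>+x. ennreal (T1 n x) \<partial>?\<Omega>) = ennreal (LINT x|?\<Omega>. T1 n x)"
      by (rule nn_integral_eq_integral[OF T_integrable(1)]) (rule AE_I2, rule T1_nonneg)
    also have "\<dots> \<le> ennreal (\<rho> n)" by (rule ennreal_leI[OF le])
    finally show "(\<integral>\<^sup>+x. ennreal (T1 n x) \<partial>?\<Omega>) \<le> ennreal (\<rho> n)" .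
  qed
  also have "\<dots> = 0"
  proof -
    have "(\<lambda>n. ennreal (\<rho> n)) \<longlonglongrightarrow> ennreal 0" by (rule tendsto_ennrealI[OF \<rho>])
    then show ?thesis using lim_imp_Liminf[of sequentially "\<lambda>n. ennreal (\<rho> n)"] by simp
  qed
  finally have "(\<integral>\<^sup>+x. ennreal (?d x) \<partial>?\<Omega>) = 0" by simp
  then have "AE x in ?\<Omega>. ennreal (?d x) = 0" by (subst (asm) nn_integral_0_iff_AE) auto
  then show ?thesis
  proof eventually_elim
    case (elim x)
    then have d: "u x powr q \<le> v x powr q" by (simp add: ennreal_eq_0_iff max_def split: if_splits)
    show ?case
    proof (rule ccontr)
      assume "\<not> u x \<le> v x"
      then have "v x powr q < u x powr q" using v0[of x] q by (intro powr_less_mono2) auto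
      then show False using d by simp
    qed
  qed
qed

end

section \<open>From the weak formulation to Borel representatives\<close>

context bounded_open begin

text \<open>The members of the Sobolev space are only Lebesgue measurable on \<Omega> and
  nonnegative almost everywhere. Cutting a Borel version off at 0 and multiplying by the indicator
  makes both signs and exterior values hold everywhere.\<close>

lemma borel_representative:
  assumes w: "w \<in> W1p_0 \<Omega> p" "nonneg_ae \<Omega> w"
  obtains w' where "w' \<in> borel_measurable borel" "\<And>x. 0 \<le> w' x" "\<And>x. x \<notin> \<Omega> \<Longrightarrow> w' x = 0" "AE x in lebesgue. w x = w' x"
proof -
  obtain G where "W0 \<Omega> p w G" and out: "\<And>x. x \<notin> \<Omega> \<Longrightarrow> w x = 0" using w(1) W1p_0_iff by blast
  then have "w \<in> borel_measurable (lebesgue_on \<Omega>)" by (intro W0_meas(1))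
  then have "(\<lambda>x. indicator \<Omega> x *\<^sub>R w x) \<in> borel_measurable lebesgue"
    by (subst (asm) borel_measurable_restrict_space_iff) auto
  from completion_ex_borel_measurable_real[OF this[unfolded real_scaleR_def]]
  obtain g where g: "g \<in> borel_measurable lborel" "AE x in lborel. indicator \<Omega> x * w x = g x" by (elim bexE)
  have [measurable]: "g \<in> borel_measurable borel" using g(1) by simp
  have [measurable]: "\<Omega> \<in> sets borel" using op by simp
  show thesis
  proof (rule that[of "\<lambda>x. indicator \<Omega> x * max 0 (g x)"])
    show "(\<lambda>x. indicator \<Omega> x * max 0 (g x)) \<in> borel_measurable borel" by measurable
    have "AE x in lebesgue. indicator \<Omega> x * w x = g x" using g(2) by (rule AE_completion)
    moreover have "AE x in lebesgue. x \<in> \<Omega> \<longrightarrow> 0 \<le> w x" using w(2) by (simp add: nonneg_ae_def AE_restrict_space_iff)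
    ultimately show "AE x in lebesgue. w x = indicator \<Omega> x * max 0 (g x)"
    proof eventually_elim
      case (elim x)
      then show ?case using out[of x] by (cases "x \<in> \<Omega>") auto
    qed
  qed auto
qed

text \<open>The completed measure on pairs differs from the product of the completed measures. The
  exceptional set is therefore first enlarged to a Borel null set, whose two cylinders are null in
  the Borel product, and completion comes last.\<close>

lemma AE_lebesgue_pair:
  assumes ae: "AE x in lebesgue. P (x::'a)"
  shows "AE z in (lebesgue :: ('a \<times> 'a) measure). P (fst z) \<and> P (snd z)"
proof -
  have "AE x in lborel. P x" using ae by (simp add: AE_completion_iff)
  then obtain N where N: "N \<in> null_sets lborel" "{x. \<not> P x} \<subseteq> N" by (auto simp: eventually_ae_filter)
  then have Nb: "N \<in> sets borel" by auto
  have ae': "AE x in lborel. x \<notin> N" using N(1) by (rule AE_not_in)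
  have "AE z in lborel \<Otimes>\<^sub>M lborel. fst z \<notin> N \<and> snd z \<notin> N"
  proof (rule lborel_pair.AE_pair_measure)
    have [measurable]: "N \<in> sets lborel" using Nb by simp
    show "{z \<in> space (lborel \<Otimes>\<^sub>M lborel). fst z \<notin> N \<and> snd z \<notin> N} \<in> sets (lborel \<Otimes>\<^sub>M lborel)" by measurable
    show "AE x in lborel. AE y in lborel. fst (x, y) \<notin> N \<and> snd (x, y) \<notin> N"
      using ae'
    proof eventually_elim
      case (elim x)
      show ?case using ae' by eventually_elim (use elim in simp)
    qed
  qed
  then have "AE z in (lborel :: ('a \<times> 'a) measure). fst z \<notin> N \<and> snd z \<notin> N" by (simp only: lborel_prod)
  then have "AE z in (lebesgue :: ('a \<times> 'a) measure). fst z \<notin> N \<and> snd z \<notin> N" by (rule AE_completion)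
  then show ?thesis by eventually_elim (use N(2) in auto)
qed

text \<open>The function w is exchanged for its Borel version while its chosen weak gradient is
  kept; the gradient of the test function may be any H, by uniqueness almost everywhere.\<close>

lemma weak_lhs_eq_energy:
  assumes W: "W0 \<Omega> p w G" and w': "w' \<in> borel_measurable borel" "AE x in lebesgue. w x = w' x"
    and \<phi>: "W0 \<Omega> p \<phi> H" "\<phi> \<in> borel_measurable borel"
  shows "weak_lhs \<Omega> p s m lam w \<phi> = energy \<Omega> p s m lam w' (weak_grad \<Omega> w) \<phi> H"
proof -
  note [measurable] = W0_meas[OF W] W0_meas[OF \<phi>(1)] borel_imp_meas[OF w'(1)] W0_meas[OF weak_grad_AE(2)[OF W]] 
    W0_meas[OF weak_grad_AE(2)[OF \<phi>(1)]]
  have ae: "AE x in lebesgue_on \<Omega>. w x = w' x" using w'(2) by (simp add: AE_restrict_space_iff) (auto elim: eventually_mono)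
  have 1: "(LINT x|lebesgue_on \<Omega>. w x powr (2 * m + 1) * \<phi> x) = (LINT x|lebesgue_on \<Omega>. w' x powr (2 * m + 1) * \<phi> x)"
  proof (rule integral_cong_AE)
    show "AE x in lebesgue_on \<Omega>. w x powr (2 * m + 1) * \<phi> x = w' x powr (2 * m + 1) * \<phi> x" using ae by eventually_elim simp
  qed measurable
  have 2: "(LINT x|lebesgue_on \<Omega>. (norm (weak_grad \<Omega> w x) powr (p - 2) *\<^sub>R weak_grad \<Omega> w x) \<bullet> weak_grad \<Omega> \<phi> x) =
    (LINT x|lebesgue_on \<Omega>. (norm (weak_grad \<Omega> w x) powr (p - 2) *\<^sub>R weak_grad \<Omega> w x) \<bullet> H x)"
  proof (rule integral_cong_AE)
    show "AE x in lebesgue_on \<Omega>. (norm (weak_grad \<Omega> w x) powr (p - 2) *\<^sub>R weak_grad \<Omega> w x) \<bullet> weak_grad \<Omega> \<phi> x = 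
      (norm (weak_grad \<Omega> w x) powr (p - 2) *\<^sub>R weak_grad \<Omega> w x) \<bullet> H x"
      using weak_grad_AE(1)[OF \<phi>(1)] by eventually_elim simp
  qed measurable
  have m': "nonlocal_integrand s p w' \<phi> \<in> borel_measurable lborel"
    using nonlocal_integrand_measurable[OF w'(1) \<phi>(2), of s p] by (simp add: borel_prod)
  then have m'': "nonlocal_integrand s p w' \<phi> \<in> borel_measurable lebesgue" by (rule measurable_completion)
  have ae2: "AE z in lebesgue. nonlocal_integrand s p w' \<phi> z = nonlocal_integrand s p w \<phi> z"
    using AE_lebesgue_pair[OF w'(2)]
  proof eventually_elim
    case (elim z)
    then show ?case by (simp add: nonlocal_integrand_def case_prod_beta)
  qed
  have 3: "(LINT z|lebesgue. nonlocal_integrand s p w \<phi> z) = (LINT z|(lborel \<Otimes>\<^sub>M lborel). nonlocal_integrand s p w' \<phi> z)"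
  proof -
    have "(LINT z|lebesgue. nonlocal_integrand s p w' \<phi> z) = (LINT z|lebesgue. nonlocal_integrand s p w \<phi> z)"
      by (rule integral_cong_AE[OF m'' borel_measurable_AE[OF m'' ae2] ae2])
    moreover have "(LINT z|lebesgue. nonlocal_integrand s p w' \<phi> z) = (LINT z|lborel. nonlocal_integrand s p w' \<phi> z)"
      by (rule integral_completion[OF m'])
    ultimately show ?thesis by (simp only: lborel_prod)
  qed
  have "weak_lhs \<Omega> p s m lam w \<phi> = (LINT x|lebesgue_on \<Omega>. w x powr (2 * m + 1) * \<phi> x)
     + lam * (LINT x|lebesgue_on \<Omega>. (norm (weak_grad \<Omega> w x) powr (p - 2) *\<^sub>R weak_grad \<Omega> w x) \<bullet> weak_grad \<Omega> \<phi> x)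
     + lam * (LINT z|lebesgue. nonlocal_integrand s p w \<phi> z)"
    unfolding weak_lhs_def nonlocal_integrand_def ..
  then show ?thesis unfolding energy_def 1 2 3 .
qed

lemma weak_rhs_eq_reaction:
  assumes w: "w \<in> borel_measurable (lebesgue_on \<Omega>)" "w' \<in> borel_measurable borel" "AE x in lebesgue. w x = w' x"
    and m: "\<phi> \<in> borel_measurable (lebesgue_on \<Omega>)" "g0 \<in> borel_measurable (lebesgue_on \<Omega>)"
  shows "weak_rhs \<Omega> m lam \<gamma> \<delta> g0 w \<phi> = (LINT x|lebesgue_on \<Omega>. reaction \<Omega> m lam \<gamma> \<delta> g0 w' x * \<phi> x)"
  unfolding weak_rhs_def reaction_def
proof (rule integral_cong_AE)
  note [measurable] = w(1) m borel_imp_meas[OF w(2)] rpow_measurable[OF w(1), of m] rpow_measurable[OF borel_imp_meas[OF w(2)], of m]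
  have [measurable]: "(\<lambda>x. infdist x (frontier \<Omega>)) \<in> borel_measurable (lebesgue_on \<Omega>)"
    by (intro borel_imp_meas borel_measurable_continuous_onI continuous_intros)
  show "(\<lambda>x. (g0 x * rpow (w x) m + lam * m * infdist x (frontier \<Omega>) powr - \<gamma> * w x powr \<delta>) * \<phi> x) \<in> borel_measurable (lebesgue_on \<Omega>)"
    "(\<lambda>x. (g0 x * rpow (w' x) m + lam * m * infdist x (frontier \<Omega>) powr - \<gamma> * w' x powr \<delta>) * \<phi> x) \<in> borel_measurable (lebesgue_on \<Omega>)"
    by measurable
  have "AE x in lebesgue_on \<Omega>. w x = w' x" using w(3) by (simp add: AE_restrict_space_iff) (auto elim: eventually_mono)
  then show "AE x in lebesgue_on \<Omega>. (g0 x * rpow (w x) m + lam * m * infdist x (frontier \<Omega>) powr - \<gamma> * w x powr \<delta>) * \<phi> x =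
    (g0 x * rpow (w' x) m + lam * m * infdist x (frontier \<Omega>) powr - \<gamma> * w' x powr \<delta>) * \<phi> x"
    by eventually_elim simp
qed

end

theorem theorem2p6:
  fixes \<Omega> :: "'a::euclidean_space set"
    and p s m lam \<delta> \<gamma> r :: real
    and g0 g_low u_sub u_sup :: "'a \<Rightarrow> real"
  assumes "bounded_smooth_domain \<Omega>"
    and "p > 1" and "0 < s" and "s < 1" and "real DIM('a) > p"
    and "0 \<le> m" and "m < p - 1" and "lam > 0"
    and "m > 0 \<Longrightarrow> 0 < \<delta> \<and> \<delta> < m \<and> \<gamma> < 1 / 2"
    and "r \<ge> 2" and "g0 \<in> Lq \<Omega> r" and "nonneg_ae \<Omega> g0"
    and "g_low \<in> Linf \<Omega>" and "nonneg_ae \<Omega> g_low" and "nontrivial \<Omega> g_low"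
    and "AE x in lebesgue_on \<Omega>. g0 x \<ge> lam * g_low x"
    and "weak_subsolution \<Omega> p s m lam \<gamma> \<delta> g0 u_sub"
    and "weak_supersolution \<Omega> p s m lam \<gamma> \<delta> g0 u_sup"
  shows "AE x in lebesgue_on \<Omega>. u_sub x \<le> u_sup x"
proof -
  interpret bounded_open \<Omega> p
    using assms(1,2) by unfold_locales (auto simp: bounded_smooth_domain_def)
  have subW: "u_sub \<in> W1p_0 \<Omega> p" "u_sub \<in> Lq \<Omega> (2 * (m + 1))" "nonneg_ae \<Omega> u_sub"
    and supW: "u_sup \<in> W1p_0 \<Omega> p" "u_sup \<in> Lq \<Omega> (2 * (m + 1))" "nonneg_ae \<Omega> u_sup" "nontrivial \<Omega> u_sup"
    using assms(17,18) by (auto simp: weak_subsolution_def weak_supersolution_def WL_def)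
  obtain u where u: "u \<in> borel_measurable borel" "\<And>x. 0 \<le> u x" "\<And>x. x \<notin> \<Omega> \<Longrightarrow> u x = 0" "AE x in lebesgue. u_sub x = u x"
    by (rule borel_representative[OF subW(1,3)]) (rule that)
  obtain v where v: "v \<in> borel_measurable borel" "\<And>x. 0 \<le> v x" "\<And>x. x \<notin> \<Omega> \<Longrightarrow> v x = 0" "AE x in lebesgue. u_sup x = v x"
    by (rule borel_representative[OF supW(1,3)]) (rule that)
  obtain Gu Gv where G: "W0 \<Omega> p u_sub Gu" "W0 \<Omega> p u_sup Gv" using subW(1) supW(1) W1p_0_iff by blast
  note Ws = weak_grad_AE(2)[OF G(1)] weak_grad_AE(2)[OF G(2)]
  have ae: "AE x in lebesgue_on \<Omega>. u_sub x = u x" "AE x in lebesgue_on \<Omega>. u_sup x = v x"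
    using u(4) v(4) by (simp_all add: AE_restrict_space_iff) (auto elim: eventually_mono)
  have g0m: "g0 \<in> borel_measurable (lebesgue_on \<Omega>)" using assms(11) by (simp add: Lq_def)
  \<comment> \<open>A bounded function on a set of finite measure lies in every Lebesgue space, so
    bounded tests are admissible in the definition of weak solutions.\<close>
  have test: "\<phi> \<in> WL \<Omega> p m \<and> nonneg_ae \<Omega> \<phi>"
    if "W0 \<Omega> p \<phi> H" "\<phi> \<in> borel_measurable borel" "\<And>x. 0 \<le> \<phi> x \<and> \<phi> x \<le> C" "\<And>x. x \<notin> \<Omega> \<Longrightarrow> \<phi> x = 0" for \<phi> H C
  proof -
    have "\<phi> \<in> W1p_0 \<Omega> p" unfolding W1p_0_iff using that(1,4) by blast
    moreover have "\<phi> \<in> Lq \<Omega> (2 * (m + 1))"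
      by (rule Lq_bounded[where C = C]) (use that(3) assms(6) borel_imp_meas[OF that(2)] fin_meas in \<open>auto intro!: AE_I2\<close>)
    ultimately show ?thesis using that(3) by (simp add: WL_def nonneg_ae_def)
  qed
  \<comment> \<open>The weak gradients of the original functions also serve the Borel
    representatives, by \<open>W0_cong_AE\<close>.\<close>
  interpret comparison \<Omega> p s m lam \<delta> \<gamma> g0 u v "weak_grad \<Omega> u_sub" "weak_grad \<Omega> u_sup"
  proof
    show "0 < m \<Longrightarrow> integrable (lebesgue_on \<Omega>) (\<lambda>x. infdist x (frontier \<Omega>) powr (- (2 * \<gamma>)))"
      by (rule integrable_dist_boundary_powr[OF assms(1)]) (use assms(9) in simp)
    show "g0 \<in> Lq \<Omega> 2" by (rule Lq_exponent_mono[OF assms(11) fin_meas]) (use assms(10) in auto)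
    show "AE x in lebesgue_on \<Omega>. 0 \<le> g0 x" using assms(12) by (simp add: nonneg_ae_def)
    show "W0 \<Omega> p u (weak_grad \<Omega> u_sub)"
      by (rule W0_cong_AE[OF Ws(1) ae(1) _ borel_imp_meas[OF u(1)] W0_meas(2)[OF Ws(1)]]) simp
    show "W0 \<Omega> p v (weak_grad \<Omega> u_sup)"
      by (rule W0_cong_AE[OF Ws(2) ae(2) _ borel_imp_meas[OF v(1)] W0_meas(2)[OF Ws(2)]]) simp
    show "u \<in> Lq \<Omega> (2 * (m + 1))" by (rule Lq_cong_AE[OF subW(2) ae(1) borel_imp_meas[OF u(1)]]) (use assms(6) in simp)
    show "v \<in> Lq \<Omega> (2 * (m + 1))" by (rule Lq_cong_AE[OF supW(2) ae(2) borel_imp_meas[OF v(1)]]) (use assms(6) in simp)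
    show "\<not> (AE x in lborel. v x = 0)"
    proof
      assume "AE x in lborel. v x = 0"
      then have "AE x in lebesgue. v x = 0" by (rule AE_completion)
      with v(4) have "AE x in lebesgue. u_sup x = 0" by eventually_elim simp
      then have "AE x in lebesgue. x \<in> \<Omega> \<longrightarrow> u_sup x = 0" by eventually_elim simp
      then show False using supW(4) by (simp add: nontrivial_def AE_restrict_space_iff)
    qed
    fix \<phi> H C
    assume \<phi>: "W0 \<Omega> p \<phi> H" "\<phi> \<in> borel_measurable borel" "\<And>x. 0 \<le> \<phi> x \<and> \<phi> x \<le> C" "\<And>x. x \<notin> \<Omega> \<Longrightarrow> \<phi> x = 0"
    note t = test[OF \<phi>] and \<phi>m = borel_imp_meas[OF \<phi>(2)]
    show "energy \<Omega> p s m lam u (weak_grad \<Omega> u_sub) \<phi> H \<le> (LINT x|lebesgue_on \<Omega>. reaction \<Omega> m lam \<gamma> \<delta> g0 u x * \<phi> x)"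
      unfolding weak_lhs_eq_energy[OF Ws(1) u(1,4) \<phi>(1,2), symmetric] weak_rhs_eq_reaction[OF W0_meas(1)[OF Ws(1)] u(1,4) \<phi>m g0m, symmetric]
      using assms(17) t by (simp add: weak_subsolution_def)
    show "(LINT x|lebesgue_on \<Omega>. reaction \<Omega> m lam \<gamma> \<delta> g0 v x * \<phi> x) \<le> energy \<Omega> p s m lam v (weak_grad \<Omega> u_sup) \<phi> H"
      unfolding weak_lhs_eq_energy[OF Ws(2) v(1,4) \<phi>(1,2), symmetric] weak_rhs_eq_reaction[OF W0_meas(1)[OF Ws(2)] v(1,4) \<phi>m g0m, symmetric]
      using assms(18) t by (simp add: weak_supersolution_def)
  qed (use assms u v in auto)
  show ?thesis using comparison ae by eventually_elim simp
qed

end
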